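(* Let $N\ge 0$ and $M\ge 1$ be integers. Let $\mathrm{A}_N^M$ be the centralizer of $\mathfrak{q}_M$ in the associative superalgebra $\mathrm{U}(\mathfrak{q}_{N+M})$. Then the elements $$C_{N+M}^{(1)},\ C_{N+M}^{(3)},\ C_{N+M}^{(5)},\ \ldots$$ together with the elements $$F_{ij|N+M}^{(1)},\ F_{ij|N+M}^{(2)},\ \ldots\qquad\text{where } |i|,|j|\le N,$$ generate the algebra $\mathrm{A}_N^M$.
   Context: All algebras are over $\mathbb{C}$; enveloping algebras are unital, and "generate" means as unital associative algebras. For an integer $K\ge 0$ let indices $i,j,k,\dots$ run through $\pm1,\dots,\pm K$; put $\bar i=0$ if $i>0$ and $\bar i=1$ if $i<0$. Let $\mathbb{C}^{K|K}$ be the $\mathbb{Z}_2$-graded vector space with basis $e_i$, $\deg e_i=\bar i$. The matrix units $E_{ij}$, with $E_{ij}e_k=\delta_{jk}e_i$ and $\deg E_{ij}=\bar i+\bar j$, form a basis of the Lie superalgebra $\mathfrak{gl}_{K|K}=\mathrm{End}(\mathbb{C}^{K|K})$ with bracket the supercommutator $[X,Y]=XY-(-1)^{\deg X\deg Y}YX$ for homogeneous $X,Y$. The queer Lie superalgebra $\mathfrak{q}_K\subset\mathfrak{gl}_{K|K}$ is the span of the elements $F_{ij}=E_{ij}+E_{-i,-j}$ (so $F_{-i,-j}=F_{ij}$); it is the fixed point subalgebra of the involution $E_{ij}\mapsto E_{-i,-j}$. In the enveloping algebra $\mathrm{U}(\mathfrak{q}_K)$ (a $\mathbb{Z}_2$-graded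 algebra) put, for $n\ge1$, $$F_{ij|K}^{(n)}=\sum_{k_1,\dots,k_{n-1}}(-1)^{\bar k_1+\dots+\bar k_{n-1}}F_{ik_1}F_{k_1k_2}\cdots F_{k_{n-2}k_{n-1}}F_{k_{n-1}j},\qquad C_K^{(n)}=\sum_k F_{kk|K}^{(n)},$$ where each summation index runs through $\pm1,\dots,\pm K$, and $F_{ij|K}^{(1)}=F_{ij}$. The Lie superalgebras $\mathfrak{q}_N$ and $\mathfrak{q}_M$ are regarded as the subalgebras of $\mathfrak{q}_{N+M}$ spanned by the $F_{ij}$ with $|i|,|j|\le N$ and with $|i|,|j|>N$ respectively. The centralizer of a subset $\mathrm C$ of a $\mathbb{Z}_2$-graded algebra $\mathrm A$ is taken in the super sense: it is the set of all $X\in\mathrm A$ with $[X,Y]=0$ for all $Y\in\mathrm C$, where $[\,,]$ is the supercommutator extended bilinearly. *)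

theory Defs
  imports Complex_Main "HOL-Algebra.QuotRing" "HOL-Algebra.Module" "HOL-Library.Poly_Mapping" "HOL-Library.Z2"
begin

section \<open>Associative superalgebras over the complex numbers\<close>

text \<open>The degrees live in the two-element field \<^typ>\<open>bit\<close>, so sums and products of degrees
  are taken modulo 2.\<close>

record 'a superalgebra = "(complex, 'a) module" +
  grade :: "bit \<Rightarrow> 'a set"

definition sgn_bit :: "bit \<Rightarrow> complex" where
  "sgn_bit p = (if p = 0 then 1 else - 1)"

text \<open>The degree-\<open>p\<close> component of \<open>X\<close>; meaningful when the algebra is the direct sum of its
  two homogeneous parts.\<close>

definition hom_part :: "('a, 'm) superalgebra_scheme \<Rightarrow> bit \<Rightarrow> 'a \<Rightarrow> 'a" where
  "hom_part A p X =
    (THE Y. \<exists>c. (\<forall>q. c q \<in> grade A q) \<and> X = c 0 \<oplus>\<^bsub>A\<^esub> c 1 \<and> Y = c p)"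

definition supercommutator :: "('a, 'm) superalgebra_scheme \<Rightarrow> 'a \<Rightarrow> 'a \<Rightarrow> 'a" where
  "supercommutator A X Y =
    (\<Oplus>\<^bsub>A\<^esub>p\<in>UNIV. \<Oplus>\<^bsub>A\<^esub>q\<in>UNIV.
       (hom_part A p X \<otimes>\<^bsub>A\<^esub> hom_part A q Y)
       \<ominus>\<^bsub>A\<^esub> (sgn_bit (p * q) \<odot>\<^bsub>A\<^esub> (hom_part A q Y \<otimes>\<^bsub>A\<^esub> hom_part A p X)))"

definition super_centralizer :: "('a, 'm) superalgebra_scheme \<Rightarrow> 'a set \<Rightarrow> 'a set" where
  "super_centralizer A C = {X \<in> carrier A. \<forall>Y\<in>C. supercommutator A X Y = \<zero>\<^bsub>A\<^esub>}"

text \<open>The unital subalgebra generated by \<open>S\<close> (it contains zero as \<open>0 \<odot> \<one>\<close>).\<close>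

inductive_set generated_subalgebra :: "('a, 'm) superalgebra_scheme \<Rightarrow> 'a set \<Rightarrow> 'a set"
  for A :: "('a, 'm) superalgebra_scheme" and S :: "'a set" where
  one: "\<one>\<^bsub>A\<^esub> \<in> generated_subalgebra A S"
| incl: "x \<in> S \<Longrightarrow> x \<in> generated_subalgebra A S"
| add: "x \<in> generated_subalgebra A S \<Longrightarrow> y \<in> generated_subalgebra A S
    \<Longrightarrow> x \<oplus>\<^bsub>A\<^esub> y \<in> generated_subalgebra A S"
| smult: "x \<in> generated_subalgebra A S \<Longrightarrow> c \<odot>\<^bsub>A\<^esub> x \<in> generated_subalgebra A S"
| mult: "x \<in> generated_subalgebra A S \<Longrightarrow> y \<in> generated_subalgebra A S
    \<Longrightarrow> x \<otimes>\<^bsub>A\<^esub> y \<in> generated_subalgebra A S"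


section \<open>Lie superalgebras and their enveloping algebras\<close>

record 'a lie_superalgebra = "'a partial_object" +
  ladd :: "'a \<Rightarrow> 'a \<Rightarrow> 'a"
  lscale :: "complex \<Rightarrow> 'a \<Rightarrow> 'a"
  lgrade :: "bit \<Rightarrow> 'a set"
  bracket :: "'a \<Rightarrow> 'a \<Rightarrow> 'a"

text \<open>A graded subspace \<open>V\<close> of \<open>A\<close> closed under the supercommutator, as a Lie superalgebra.\<close>

definition sub_lie :: "('a, 'm) superalgebra_scheme \<Rightarrow> 'a set \<Rightarrow> 'a lie_superalgebra" where
  "sub_lie A V =
    \<lparr>carrier = V, ladd = (\<lambda>x y. x \<oplus>\<^bsub>A\<^esub> y), lscale = (\<lambda>c x. c \<odot>\<^bsub>A\<^esub> x),
     lgrade = (\<lambda>p. V \<inter> grade A p), bracket = supercommutator A\<rparr>"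

text \<open>Words under concatenation, written additively so that \<^typ>\<open>'b \<Rightarrow>\<^sub>0 complex\<close> with words
  for \<^typ>\<open>'b\<close> has the convolution product, i.e. is the free associative algebra.\<close>

datatype 'a fword = Word (letters: "'a list")

instantiation fword :: (type) monoid_add
begin
definition zero_fword :: "'a fword" where "zero_fword = Word []"
definition plus_fword :: "'a fword \<Rightarrow> 'a fword \<Rightarrow> 'a fword" where
  "plus_fword v w = Word (letters v @ letters w)"
instance by standard (auto simp: zero_fword_def plus_fword_def)
end

definition free_algebra :: "'a set \<Rightarrow> ('a fword \<Rightarrow>\<^sub>0 complex) ring" where
  "free_algebra S =
    \<lparr>carrier = {f. \<forall>w\<in>Poly_Mapping.keys f. set (letters w) \<subseteq> S},
     mult = (*), one = 1, zero = 0, add = (+)\<rparr>"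

definition free_gen :: "'a \<Rightarrow> ('a fword \<Rightarrow>\<^sub>0 complex)" where
  "free_gen x = Poly_Mapping.single (Word [x]) 1"

definition free_const :: "complex \<Rightarrow> ('a fword \<Rightarrow>\<^sub>0 complex)" where
  "free_const c = Poly_Mapping.single 0 c"

text \<open>The free algebra is taken on all elements of \<open>L\<close>; the first two families of relations make
  the canonical map linear, so that the quotient by them is the tensor algebra of \<open>L\<close>.\<close>

definition env_relations ::
  "('a, 'm) lie_superalgebra_scheme \<Rightarrow> ('a fword \<Rightarrow>\<^sub>0 complex) set" where
  "env_relations L =
     {free_gen (ladd L x y) - free_gen x - free_gen y | x y. x \<in> carrier L \<and> y \<in> carrier L}
   \<union> {free_gen (lscale L c x) - free_const c * free_gen x | c x. x \<in> carrier L}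
   \<union> {free_gen x * free_gen y - free_const (sgn_bit (p * q)) * free_gen y * free_gen x
        - free_gen (bracket L x y) | x y p q. x \<in> lgrade L p \<and> y \<in> lgrade L q}"

definition env_ideal ::
  "('a, 'm) lie_superalgebra_scheme \<Rightarrow> ('a fword \<Rightarrow>\<^sub>0 complex) set" where
  "env_ideal L = genideal (free_algebra (carrier L)) (env_relations L)"

definition env_class ::
  "('a, 'm) lie_superalgebra_scheme \<Rightarrow> ('a fword \<Rightarrow>\<^sub>0 complex) \<Rightarrow> ('a fword \<Rightarrow>\<^sub>0 complex) set" where
  "env_class L f = env_ideal L +>\<^bsub>free_algebra (carrier L)\<^esub> f"

text \<open>The homogeneous parts are spanned by the products of homogeneous elements of \<open>L\<close> of the
  given total degree.\<close>

definition env_algebra ::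
  "('a, 'm) lie_superalgebra_scheme \<Rightarrow> ('a fword \<Rightarrow>\<^sub>0 complex) set superalgebra" where
  "env_algebra L =
    (let Q = free_algebra (carrier L) Quot env_ideal L in
     \<lparr>carrier = carrier Q, mult = mult Q, one = one Q, zero = zero Q, add = add Q,
      smult = (\<lambda>c X. env_class L (free_const c) \<otimes>\<^bsub>Q\<^esub> X),
      grade = (\<lambda>p. {env_class L f | f. \<forall>w\<in>Poly_Mapping.keys f.
                 \<exists>ps. list_all2 (\<lambda>x q. x \<in> lgrade L q) (letters w) ps \<and> sum_list ps = p})\<rparr>)"

definition env_incl ::
  "('a, 'm) lie_superalgebra_scheme \<Rightarrow> 'a \<Rightarrow> ('a fword \<Rightarrow>\<^sub>0 complex) set" where
  "env_incl L x = env_class L (free_gen x)"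


section \<open>The general linear and queer Lie superalgebras\<close>

definition idx :: "nat \<Rightarrow> int set" where
  "idx K = {i. i \<noteq> 0 \<and> \<bar>i\<bar> \<le> int K}"

definition par :: "int \<Rightarrow> bit" where
  "par i = (if i < 0 then 1 else 0)"

type_synonym imat = "int \<Rightarrow> int \<Rightarrow> complex"

definition gl_super :: "nat \<Rightarrow> imat superalgebra" where
  "gl_super K =
    \<lparr>carrier = {X. \<forall>i j. X i j \<noteq> 0 \<longrightarrow> i \<in> idx K \<and> j \<in> idx K},
     mult = (\<lambda>X Y i j. \<Sum>k\<in>idx K. X i k * Y k j),
     one = (\<lambda>i j. if i = j \<and> i \<in> idx K then 1 else 0),
     zero = (\<lambda>i j. 0),
     add = (\<lambda>X Y i j. X i j + Y i j),
     smult = (\<lambda>c X i j. c * X i j),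
     grade = (\<lambda>p. {X. \<forall>i j. X i j \<noteq> 0 \<longrightarrow> i \<in> idx K \<and> j \<in> idx K \<and> par i + par j = p})\<rparr>"

definition E_mat :: "int \<Rightarrow> int \<Rightarrow> imat" where
  "E_mat i j = (\<lambda>a b. if a = i \<and> b = j then 1 else 0)"

definition F_mat :: "int \<Rightarrow> int \<Rightarrow> imat" where
  "F_mat i j = (\<lambda>a b. E_mat i j a b + E_mat (- i) (- j) a b)"

definition F_span :: "int set \<Rightarrow> imat set" where
  "F_span I = {(\<lambda>a b. \<Sum>i\<in>I. \<Sum>j\<in>I. c i j * F_mat i j a b) | c. True}"

definition queer :: "nat \<Rightarrow> imat lie_superalgebra" where
  "queer K = sub_lie (gl_super K) (F_span (idx K))"


section \<open>The enveloping algebra of the queer Lie superalgebra\<close>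

definition Uq :: "nat \<Rightarrow> (imat fword \<Rightarrow>\<^sub>0 complex) set superalgebra" where
  "Uq K = env_algebra (queer K)"

definition F_elt :: "nat \<Rightarrow> int \<Rightarrow> int \<Rightarrow> (imat fword \<Rightarrow>\<^sub>0 complex) set" where
  "F_elt K i j = env_incl (queer K) (F_mat i j)"

text \<open>The product \<open>F\<^sub>i\<^sub>k\<^sub>1 F\<^sub>k\<^sub>1\<^sub>k\<^sub>2 \<dots> F\<^sub>k\<^sub>m\<^sub>j\<close> for \<open>ks = [k\<^sub>1, \<dots>, k\<^sub>m]\<close>.\<close>

fun F_path :: "nat \<Rightarrow> int \<Rightarrow> int list \<Rightarrow> int \<Rightarrow> (imat fword \<Rightarrow>\<^sub>0 complex) set" where
  "F_path K i [] j = F_elt K i j"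
| "F_path K i (k # ks) j = F_elt K i k \<otimes>\<^bsub>Uq K\<^esub> F_path K k ks j"

text \<open>Both families below are meant for \<open>n \<ge> 1\<close> only.\<close>

definition F_pow :: "nat \<Rightarrow> nat \<Rightarrow> int \<Rightarrow> int \<Rightarrow> (imat fword \<Rightarrow>\<^sub>0 complex) set" where
  "F_pow K n i j =
    (\<Oplus>\<^bsub>Uq K\<^esub>ks\<in>{ks. length ks = n - 1 \<and> set ks \<subseteq> idx K}.
       sgn_bit (sum_list (map par ks)) \<odot>\<^bsub>Uq K\<^esub> F_path K i ks j)"

definition C_elt :: "nat \<Rightarrow> nat \<Rightarrow> (imat fword \<Rightarrow>\<^sub>0 complex) set" where
  "C_elt K n = (\<Oplus>\<^bsub>Uq K\<^esub>k\<in>idx K. F_pow K n k k)"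

text \<open>The centralizer in \<open>U(q\<^sub>N\<^sub>+\<^sub>M)\<close> of \<open>q\<^sub>M\<close>, the latter being spanned by the \<open>F\<^sub>i\<^sub>j\<close> with
  \<open>\<bar>i\<bar>, \<bar>j\<bar> > N\<close>.\<close>

definition A_cent :: "nat \<Rightarrow> nat \<Rightarrow> (imat fword \<Rightarrow>\<^sub>0 complex) set set" where
  "A_cent N M = super_centralizer (Uq (N + M))
     (env_incl (queer (N + M)) ` F_span (idx (N + M) - idx N))"

end

theory Submission
  imports Defs
begin

text \<open>Write \<open>K = N + M\<close>. One inclusion is invariance theory in its simplest form: the array \<open>F\<^sub>i\<^sub>j\<close> is
  covariant under the adjoint action (\<open>covariant_F\<close>), signed matrix products of covariant arrays
  are covariant (\<open>covariant_mult\<close>), and the entries of a covariant array with both indices outside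
  the range of \<open>q\<^sub>M\<close>, as well as its trace, supercommute with \<open>q\<^sub>M\<close> (\<open>Gen_cent\<close>).

  For the other inclusion one argues by the degree filtration: if the leading term of a
  centralizing element \<open>f\<close> agrees with the leading term of a polynomial in the generators, then the
  difference centralizes \<open>q\<^sub>M\<close> as well and has lower degree (\<open>cent_Low_Gen\<close>). Three ingredients give
  the leading term.

  Symbols. Letting matrices act on functions of words in index pairs by quasi-shuffle
  multiplication is a representation of the enveloping algebra (\<open>act_commutator\<close>, \<open>rep_null\<close>).
  The symbol of \<open>f\<close> is the result of applying \<open>f\<close> to the indicator of the empty word. Its values on
  words of length \<open>n\<close> are the symmetrized coefficients of the part of degree \<open>n\<close>, and multiplying
  them out returns \<open>2\<^sup>n n! f\<close> modulo lower degree (\<open>expand_symbol\<close>). This replaces the theorem of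
  Poincare, Birkhoff and Witt. The commuting right multiplication turns the centralizer condition
  into invariance of the symbol (\<open>symbol_cent\<close>).

  Invariants. With suitable signs an invariant function on words of length \<open>n\<close> is an ordinary
  matrix on the \<open>n\<close>-th tensor power of \<open>\<complex>\<^sup>K\<^sup>|\<^sup>K\<close> that commutes with the action of \<open>q\<^sub>M\<close>
  (\<open>commutator_tmat\<close>). Such matrices are spanned by an explicit family, built from
  transpositions and from matrices commuting with \<open>q\<^sub>M\<close> on one tensor factor, namely the \<open>E\<^sub>x\<^sub>y\<close> with
  \<open>|x|, |y| \<le> N\<close>, the identity of the complementary block and the odd involution of that block
  (\<open>first_fundamental_theorem\<close>). The family consists of real matrices commuting with \<open>q\<^sub>M\<close>, its span
  contains the identity, and averaging any matrix unit over it gives an element of the algebra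
  generated by \<open>q\<^sub>M\<close> (\<open>coprod_alg_average\<close>); by positivity of the trace form these facts leave no room
  for a commuting matrix orthogonal to the family (\<open>orthogonal_commuting_zero\<close>).

  Contraction. Multiplying out a member of the family connects the \<open>n\<close> factors \<open>F\<close> into closed
  loops, with a matrix attached at every joint; since elements supercommute modulo lower degree, the
  result is up to sign and lower degree a product of such loops (\<open>contract_GenLow\<close>). By multilinearity
  the joints carry the identity, the odd involution \<open>J\<close> or an \<open>E\<^sub>x\<^sub>y\<close>. A loop through \<open>E\<^sub>x\<^sub>y\<close> is cut
  there into entries \<open>F\<^sub>i\<^sub>j\<^sup>(\<^sup>m\<^sup>)\<close> with \<open>|i|, |j| \<le> N\<close>; a loop without them is a trace of a power of
  \<open>F\<close>, possibly twisted by one \<open>J\<close>. The twisted traces vanish modulo lower degree, the untwisted ones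
  are the \<open>C\<^sup>(\<^sup>m\<^sup>)\<close>, which vanish for even \<open>m\<close> (\<open>loop_elt_GenLow\<close>).\<close>

section \<open>The free algebra as a ring of finitely supported functions\<close>

text \<open>Degrees keep the operations of the two-element field instead of being rewritten into Boolean
  connectives, so that a case distinction over the degrees decides every identity between signs.\<close>

declare add_bit_eq_xor [simp del] mult_bit_eq_and [simp del] bit_not_zero_iff [simp del] bit_not_one_iff [simp del]

lemma bit_add_self [simp]: "(p::bit) + p = 0" "p + (p + q) = q"
  by (cases p; cases q; simp)+

lemma bit_add_eq_iff: "(p::bit) + q = r \<longleftrightarrow> p = r + q"
  by (cases p; cases q; cases r; simp)

lemma sgn_bit_0 [simp]: "sgn_bit 0 = 1" and sgn_bit_1 [simp]: "sgn_bit 1 = - 1"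
  by (simp_all add: sgn_bit_def)

lemma sgn_bit_add: "sgn_bit (p + q) = sgn_bit p * sgn_bit q"
  by (cases p; cases q) simp_all

lemma sgn_bit_square [simp]: "sgn_bit p * sgn_bit p = 1" "sgn_bit p * (sgn_bit p * c) = c"
  by (cases p; simp)+

type_synonym 'a free = "'a fword \<Rightarrow>\<^sub>0 complex"

definition scl :: "complex \<Rightarrow> 'a free \<Rightarrow> 'a free" (infixr "\<bullet>" 75) where
  "c \<bullet> f = free_const c * f"

definition mon :: "'a list \<Rightarrow> 'a free" where
  "mon w = Poly_Mapping.single (Word w) 1"

lemma lookup_scl [simp]: "Poly_Mapping.lookup (c \<bullet> f) w = c * Poly_Mapping.lookup f w"
proof -
  have "c \<bullet> f = Poly_Mapping.map ((*) c) f"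
    unfolding scl_def free_const_def by (simp only: mult_map_scale_conv_mult)
  thus ?thesis by (simp add: Poly_Mapping.map.rep_eq when_def)
qed

interpretation fv: vector_space "(\<bullet>) :: complex \<Rightarrow> 'a free \<Rightarrow> 'a free"
  by unfold_locales (auto intro!: poly_mapping_eqI simp: lookup_add algebra_simps)

lemma single_eq_scl_mon: "Poly_Mapping.single (Word w) c = c \<bullet> mon w"
  by (rule poly_mapping_eqI) (simp add: mon_def lookup_single when_def)

lemma free_expand: "f = (\<Sum>w\<in>Poly_Mapping.keys f. Poly_Mapping.lookup f w \<bullet> mon (letters w))"
proof (rule poly_mapping_eqI)
  fix k
  have "(\<Sum>w\<in>Poly_Mapping.keys f. Poly_Mapping.lookup f w * (if w = k then 1 else 0))
      = (\<Sum>w\<in>Poly_Mapping.keys f. if w = k then Poly_Mapping.lookup f w else 0)"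
    by (rule sum.cong) auto
  thus "Poly_Mapping.lookup f k = Poly_Mapping.lookup (\<Sum>w\<in>Poly_Mapping.keys f. Poly_Mapping.lookup f w \<bullet> mon (letters w)) k"
    by (simp add: lookup_sum mon_def lookup_single when_def in_keys_iff)
qed

lemma free_induct [case_names zero mon add]:
  assumes "P 0" "\<And>c w. P (c \<bullet> mon w)" "\<And>f g. P f \<Longrightarrow> P g \<Longrightarrow> P (f + g)"
  shows "P f"
proof -
  have "finite A \<Longrightarrow> P (\<Sum>w\<in>A. Poly_Mapping.lookup f w \<bullet> mon (letters w))" for A
    by (induction A rule: finite_induct) (auto intro: assms)
  from this[OF finite_keys[of f]] show ?thesis
    using free_expand[of f] by simp
qed

lemma free_const_commute: "free_const c * f = f * free_const c"
  by (induction f rule: free_induct)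
    (simp_all add: free_const_def flip: single_eq_scl_mon add: mult_single algebra_simps)

lemma scl_mult_left [simp]: "(c \<bullet> f) * g = c \<bullet> (f * g)"
  by (simp add: scl_def mult.assoc)

lemma mult_scl_right [simp]: "f * (c \<bullet> g) = c \<bullet> (f * g)"
  by (metis scl_def free_const_commute mult.assoc)

lemma free_const_mult: "free_const c * f = c \<bullet> f"
  by (simp add: scl_def)

lemma free_const_eq: "free_const c = c \<bullet> 1"
  by (simp add: scl_def)

lemma mon_append: "mon (u @ v) = mon u * mon v"
  by (simp add: mon_def mult_single plus_fword_def)

lemma mon_Nil [simp]: "mon [] = 1"
  by (simp add: mon_def flip: single_one zero_fword_def)

lemma mon_Cons: "mon (x # w) = free_gen x * mon w"
  using mon_append[of "[x]" w] by (simp add: mon_def free_gen_def)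

lemma mon_single: "mon [x] = free_gen x"
  by (simp add: mon_Cons)

lemma keys_scl: "Poly_Mapping.keys (c \<bullet> f) \<subseteq> Poly_Mapping.keys f"
  by (auto simp: in_keys_iff)

lemma keys_mon [simp]: "Poly_Mapping.keys (mon w) = {Word w}"
  by (simp add: mon_def)

text \<open>Deleting the words that leave \<open>S\<close> is a ring retraction onto the free algebra on \<open>S\<close>. It moves
  all computations into one ring type, without carrier conditions.\<close>

definition restr :: "'a set \<Rightarrow> 'a free \<Rightarrow> 'a free" where
  "restr S f = Poly_Mapping.mapp (\<lambda>w c. if set (letters w) \<subseteq> S then c else 0) f"

lemma lookup_restr: "Poly_Mapping.lookup (restr S f) w = (if set (letters w) \<subseteq> S then Poly_Mapping.lookup f w else 0)"
  by (auto simp: restr_def lookup_mapp when_def in_keys_iff)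

lemma restr_add: "restr S (f + g) = restr S f + restr S g"
  by (rule poly_mapping_eqI) (simp add: lookup_restr lookup_add)

lemma restr_scl: "restr S (c \<bullet> f) = c \<bullet> restr S f"
  by (rule poly_mapping_eqI) (simp add: lookup_restr)

lemma restr_0 [simp]: "restr S 0 = 0"
  by (rule poly_mapping_eqI) (simp add: lookup_restr)

lemma restr_mon: "restr S (mon w) = (if set w \<subseteq> S then mon w else 0)"
  by (rule poly_mapping_eqI) (auto simp: lookup_restr mon_def lookup_single when_def)

lemma restr_mult: "restr S (f * g) = restr S f * restr S g"
proof (induction f rule: free_induct)
  case (mon c u)
  show ?case
  proof (induction g rule: free_induct)
    case (mon d v)
    show ?case by (simp add: restr_scl restr_mon flip: mon_append)
  qed (simp_all add: restr_add algebra_simps)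
qed (simp_all add: restr_add algebra_simps)

lemma restr_1 [simp]: "restr S 1 = 1"
  using restr_mon[of S "[]"] by simp

lemma carrier_free_algebra_iff: "f \<in> carrier (free_algebra S) \<longleftrightarrow> restr S f = f"
proof
  assume "f \<in> carrier (free_algebra S)"
  thus "restr S f = f"
    by (intro poly_mapping_eqI) (auto simp: free_algebra_def lookup_restr in_keys_iff)
next
  assume *: "restr S f = f"
  show "f \<in> carrier (free_algebra S)"
    unfolding free_algebra_def
    by (auto simp: in_keys_iff) (metis * lookup_restr subsetD)
qed

lemma restr_idem [simp]: "restr S (restr S f) = restr S f"
  by (rule poly_mapping_eqI) (simp add: lookup_restr)

lemma restr_uminus: "restr S (- f) = - restr S f"
  by (rule poly_mapping_eqI) (simp add: lookup_restr)

lemma restr_diff: "restr S (f - g) = restr S f - restr S g"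
  by (rule poly_mapping_eqI) (simp add: lookup_restr lookup_minus)

lemma free_algebra_simps:
  "mult (free_algebra S) = (*)" "one (free_algebra S) = 1" "zero (free_algebra S) = 0" "add (free_algebra S) = (+)"
  by (simp_all add: free_algebra_def)

lemma ring_free_algebra: "ring (free_algebra S)"
proof (rule ringI)
  show "abelian_group (free_algebra S)"
  proof (rule abelian_groupI)
    fix x assume "x \<in> carrier (free_algebra S)"
    thus "\<exists>y\<in>carrier (free_algebra S). y \<oplus>\<^bsub>free_algebra S\<^esub> x = \<zero>\<^bsub>free_algebra S\<^esub>"
      by (intro bexI[of _ "- x"]) (auto simp: carrier_free_algebra_iff free_algebra_simps restr_uminus)
  qed (auto simp: carrier_free_algebra_iff free_algebra_simps restr_add algebra_simps)
  show "monoid (free_algebra S)"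
    by (rule monoidI) (auto simp: carrier_free_algebra_iff free_algebra_simps restr_mult algebra_simps)
qed (auto simp: free_algebra_simps algebra_simps)


section \<open>The enveloping algebra as a quotient of the ring of all words\<close>

text \<open>The kernel of the projection from the ring of all words to the enveloping algebra. It contains
  the letters outside \<open>L\<close> as well, which the retraction deletes.\<close>

inductive_set env_null :: "('a, 'm) lie_superalgebra_scheme \<Rightarrow> 'a free set"
  for L :: "('a, 'm) lie_superalgebra_scheme" where
  rel: "r \<in> env_relations L \<Longrightarrow> a * r * b \<in> env_null L"
| gen: "x \<notin> carrier L \<Longrightarrow> a * free_gen x * b \<in> env_null L"
| zero: "0 \<in> env_null L"
| add: "f \<in> env_null L \<Longrightarrow> g \<in> env_null L \<Longrightarrow> f + g \<in> env_null L"

lemma env_null_mult_left: "f \<in> env_null L \<Longrightarrow> a * f \<in> env_null L"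
proof (induction rule: env_null.induct)
  case (rel r b c)
  thus ?case using env_null.rel[of r L "a * b" c] by (simp add: mult.assoc)
next
  case (gen x b c)
  thus ?case using env_null.gen[of x L "a * b" c] by (simp add: mult.assoc)
qed (auto simp: distrib_left intro: env_null.intros)

lemma env_null_mult_right: "f \<in> env_null L \<Longrightarrow> f * a \<in> env_null L"
proof (induction rule: env_null.induct)
  case (rel r b c)
  thus ?case using env_null.rel[of r L b "c * a"] by (simp add: mult.assoc)
next
  case (gen x b c)
  thus ?case using env_null.gen[of x L b "c * a"] by (simp add: mult.assoc)
qed (auto simp: distrib_right intro: env_null.intros)

lemma env_null_scl: "f \<in> env_null L \<Longrightarrow> c \<bullet> f \<in> env_null L"
  unfolding scl_def by (rule env_null_mult_left)

lemma env_null_uminus: "f \<in> env_null L \<Longrightarrow> - f \<in> env_null L"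
  using env_null_mult_left[of f L "- 1"] by simp

lemma env_null_diff: "f \<in> env_null L \<Longrightarrow> g \<in> env_null L \<Longrightarrow> f - g \<in> env_null L"
  using env_null.add[OF _ env_null_uminus, of f L g] by simp

lemma env_null_sum: "(\<And>i. i \<in> A \<Longrightarrow> f i \<in> env_null L) \<Longrightarrow> (\<Sum>i\<in>A. f i) \<in> env_null L"
  by (induction A rule: infinite_finite_induct) (auto intro: env_null.intros)

definition to_env :: "('a, 'm) lie_superalgebra_scheme \<Rightarrow> 'a free \<Rightarrow> 'a free set" where
  "to_env L f = env_class L (restr (carrier L) f)"

locale closed_lie_superalgebra =
  fixes L :: "('a, 'm) lie_superalgebra_scheme"
  assumes ladd_closed: "x \<in> carrier L \<Longrightarrow> y \<in> carrier L \<Longrightarrow> ladd L x y \<in> carrier L"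
    and lscale_closed: "x \<in> carrier L \<Longrightarrow> lscale L c x \<in> carrier L"
    and lgrade_carrier: "x \<in> lgrade L p \<Longrightarrow> x \<in> carrier L"
    and bracket_closed: "x \<in> lgrade L p \<Longrightarrow> y \<in> lgrade L q \<Longrightarrow> bracket L x y \<in> carrier L"
begin

abbreviation "FA \<equiv> free_algebra (carrier L)"
abbreviation "pr \<equiv> restr (carrier L)"

lemma FA_ring: "ring FA" by (rule ring_free_algebra)

lemma restr_free_gen: "x \<in> carrier L \<Longrightarrow> pr (free_gen x) = free_gen x"
  by (simp add: restr_mon flip: mon_single)

lemma restr_relation: "r \<in> env_relations L \<Longrightarrow> pr r = r"
  unfolding env_relations_def free_const_mult
  by (auto simp: restr_diff restr_mult restr_scl restr_free_gen ladd_closed lscale_closed bracket_closed lgrade_carrier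
      free_const_mult)

lemma env_relations_subset: "env_relations L \<subseteq> carrier FA"
  by (auto simp: carrier_free_algebra_iff restr_relation)

lemma ideal_env: "ideal (env_ideal L) FA"
  unfolding env_ideal_def
  by (rule ring.genideal_ideal[OF FA_ring env_relations_subset])

lemma restr_env_null: "f \<in> env_null L \<Longrightarrow> pr f \<in> env_ideal L"
proof (induction rule: env_null.induct)
  interpret I: ideal "env_ideal L" FA by (rule ideal_env)
  {
    case (rel r a b)
    have r: "r \<in> env_ideal L"
      using rel ring.genideal_self[OF FA_ring env_relations_subset] unfolding env_ideal_def by auto
    have "pr a \<in> carrier FA" "pr b \<in> carrier FA" by (simp_all add: carrier_free_algebra_iff)
    hence "pr a * r * pr b \<in> env_ideal L"
      using I.I_l_closed[OF r, of "pr a"] I.I_r_closed[of "pr a * r" "pr b"]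
      by (simp add: free_algebra_simps)
    thus ?case using rel by (simp add: restr_mult restr_relation)
  next
    case (gen x a b)
    hence "pr (free_gen x) = 0" by (simp add: restr_mon flip: mon_single)
    moreover have "0 \<in> env_ideal L"
      using additive_subgroup.zero_closed[OF ideal.axioms(1)[OF ideal_env]] by (simp add: free_algebra_simps)
    ultimately show ?case by (simp add: restr_mult)
  next
    case zero
    show ?case
      using additive_subgroup.zero_closed[OF ideal.axioms(1)[OF ideal_env]] by (simp add: free_algebra_simps)
  next
    case (add f g)
    thus ?case
      using additive_subgroup.a_closed[OF ideal.axioms(1)[OF ideal_env], of "pr f" "pr g"]
      by (simp only: restr_add free_algebra_simps)
  }
qed

lemma env_ideal_subset_null: "env_ideal L \<subseteq> env_null L"
proof -
  have "ideal (env_null L \<inter> carrier FA) FA"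
  proof (rule idealI[OF FA_ring])
    show "subgroup (env_null L \<inter> carrier FA) (add_monoid FA)"
    proof (rule group.subgroupI)
      show "group (add_monoid FA)"
        by (rule abelian_group.a_group[OF ring.is_abelian_group[OF FA_ring]])
      fix a assume a: "a \<in> env_null L \<inter> carrier FA"
      have "inv\<^bsub>add_monoid FA\<^esub> a = - a"
        using a abelian_group.minus_equality[OF ring.is_abelian_group[OF FA_ring], of "- a" a]
        by (simp add: a_inv_def carrier_free_algebra_iff restr_uminus free_algebra_simps)
      thus "inv\<^bsub>add_monoid FA\<^esub> a \<in> env_null L \<inter> carrier FA"
        using a by (auto simp: env_null_uminus carrier_free_algebra_iff restr_uminus)
    qed (auto intro: env_null.intros simp: carrier_free_algebra_iff restr_add free_algebra_simps
        intro!: exI[of _ 0])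
  qed (auto simp: carrier_free_algebra_iff free_algebra_simps restr_mult
      intro: env_null_mult_left env_null_mult_right)
  moreover have "env_relations L \<subseteq> env_null L \<inter> carrier FA"
    using env_relations_subset env_null.rel[of _ L 1 1] by auto
  ultimately show ?thesis
    unfolding env_ideal_def using ring.genideal_minimal[OF FA_ring] by blast
qed

lemma diff_restr_null: "f - pr f \<in> env_null L"
proof (induction f rule: free_induct)
  case (mon c w)
  show ?case
  proof (cases "set w \<subseteq> carrier L")
    case False
    then obtain x where x: "x \<in> set w" "x \<notin> carrier L" by auto
    then obtain u v where "w = u @ x # v" by (auto simp: in_set_conv_decomp)
    hence "mon w = mon u * free_gen x * mon v" by (simp add: mon_append mon_Cons mult.assoc)
    moreover have "c \<bullet> mon w - pr (c \<bullet> mon w) = c \<bullet> mon w"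
      using False by (simp add: restr_scl restr_mon)
    ultimately show ?thesis using x(2) by (simp only: env_null_scl env_null.gen not_False_eq_True)
  qed (simp add: restr_scl restr_mon env_null.zero)
next
  case (add f g)
  thus ?case using env_null.add by (fastforce simp: restr_add algebra_simps)
qed (simp add: env_null.zero)

lemma env_class_eq_iff:
  assumes "f \<in> carrier FA" "g \<in> carrier FA"
  shows "env_class L f = env_class L g \<longleftrightarrow> f - g \<in> env_ideal L"
proof -
  interpret I: ideal "env_ideal L" FA by (rule ideal_env)
  have m: "f \<ominus>\<^bsub>FA\<^esub> g = f - g"
    using abelian_group.minus_equality[OF ring.is_abelian_group[OF FA_ring], of "- g" g] assms
    by (simp add: a_minus_def carrier_free_algebra_iff restr_uminus free_algebra_simps)
  show ?thesis
    using ring.quotient_eq_iff_same_a_r_cos[OF FA_ring ideal_env assms]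
    unfolding env_class_def m by simp
qed

text \<open>The carrier-based quotient of the definition is the quotient of the whole ring by \<open>env_null\<close>:
  the retraction maps \<open>env_null\<close> into the generated ideal and changes an element only by words that
  contain a letter outside \<open>L\<close>.\<close>

lemma to_env_eq_iff: "to_env L f = to_env L g \<longleftrightarrow> f - g \<in> env_null L"
proof -
  have "to_env L f = to_env L g \<longleftrightarrow> pr (f - g) \<in> env_ideal L"
    unfolding to_env_def by (subst env_class_eq_iff) (simp_all add: carrier_free_algebra_iff restr_diff)
  also have "\<dots> \<longleftrightarrow> f - g \<in> env_null L"
  proof
    assume "pr (f - g) \<in> env_ideal L"
    thus "f - g \<in> env_null L"
      using env_null.add[OF diff_restr_null[of "f - g"]] env_ideal_subset_null by force
  qed (rule restr_env_null)
  finally show ?thesis .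
qed

abbreviation "UA \<equiv> env_algebra L"

lemma env_algebra_sel:
  "carrier UA = carrier (FA Quot env_ideal L)" "mult UA = mult (FA Quot env_ideal L)"
  "one UA = one (FA Quot env_ideal L)" "zero UA = zero (FA Quot env_ideal L)" "add UA = add (FA Quot env_ideal L)"
  by (simp_all add: env_algebra_def Let_def)

lemma carrier_UA: "carrier UA = range (to_env L)"
proof -
  have "carrier UA = env_class L ` carrier FA"
    unfolding env_algebra_sel by (auto simp: FactRing_def A_RCOSETS_def' env_class_def)
  also have "carrier FA = range pr"
    by (auto simp: image_iff carrier_free_algebra_iff) metis
  finally show ?thesis by (simp add: image_image to_env_def)
qed

lemma to_env_hom:
  "to_env L f \<otimes>\<^bsub>UA\<^esub> to_env L g = to_env L (f * g)"
  "to_env L f \<oplus>\<^bsub>UA\<^esub> to_env L g = to_env L (f + g)"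
  "\<one>\<^bsub>UA\<^esub> = to_env L 1" "\<zero>\<^bsub>UA\<^esub> = to_env L 0"
proof -
  interpret I: ideal "env_ideal L" FA by (rule ideal_env)
  interpret h: ring_hom_ring FA "FA Quot env_ideal L" "(+>\<^bsub>FA\<^esub>) (env_ideal L)"
    by (rule I.rcos_ring_hom_ring)
  have c: "pr f \<in> carrier FA" "pr g \<in> carrier FA" by (simp_all add: carrier_free_algebra_iff)
  show "to_env L f \<otimes>\<^bsub>UA\<^esub> to_env L g = to_env L (f * g)"
    using h.hom_mult[OF c] by (simp add: env_algebra_sel to_env_def env_class_def restr_mult free_algebra_simps)
  show "to_env L f \<oplus>\<^bsub>UA\<^esub> to_env L g = to_env L (f + g)"
    using h.hom_add[OF c] by (simp add: env_algebra_sel to_env_def env_class_def restr_add free_algebra_simps)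
  show "\<one>\<^bsub>UA\<^esub> = to_env L 1"
    using h.hom_one by (simp add: env_algebra_sel to_env_def env_class_def free_algebra_simps)
  show "\<zero>\<^bsub>UA\<^esub> = to_env L 0"
    using h.hom_zero by (simp add: env_algebra_sel to_env_def env_class_def free_algebra_simps)
qed

lemma to_env_smult: "c \<odot>\<^bsub>UA\<^esub> to_env L f = to_env L (c \<bullet> f)"
proof -
  have "c \<odot>\<^bsub>UA\<^esub> to_env L f = env_class L (free_const c) \<otimes>\<^bsub>UA\<^esub> to_env L f"
    by (simp add: env_algebra_def Let_def)
  also have "env_class L (free_const c) = to_env L (free_const c)"
    by (simp add: to_env_def free_const_eq restr_scl)
  finally show ?thesis by (simp add: to_env_hom scl_def)
qed

lemma ring_UA: "ring UA"
proof (rule ringI)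
  show "abelian_group UA"
  proof (rule abelian_groupI)
    fix x assume "x \<in> carrier UA"
    then obtain f where x: "x = to_env L f" by (auto simp: carrier_UA)
    show "\<exists>y\<in>carrier UA. y \<oplus>\<^bsub>UA\<^esub> x = \<zero>\<^bsub>UA\<^esub>"
      by (rule bexI[of _ "to_env L (- f)"]) (auto simp: x to_env_hom carrier_UA)
  qed (auto simp: to_env_hom carrier_UA algebra_simps)
  show "monoid UA"
    by (rule monoidI) (auto simp: to_env_hom carrier_UA algebra_simps)
qed (auto simp: to_env_hom carrier_UA algebra_simps)

lemma to_env_minus: "to_env L f \<ominus>\<^bsub>UA\<^esub> to_env L g = to_env L (f - g)"
proof -
  interpret U: ring UA by (rule ring_UA)
  have "\<ominus>\<^bsub>UA\<^esub> to_env L g = to_env L (- g)"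
    by (rule U.minus_equality) (auto simp: to_env_hom carrier_UA)
  thus ?thesis by (simp add: a_minus_def to_env_hom)
qed

lemma to_env_finsum: "finite A \<Longrightarrow> (\<Oplus>\<^bsub>UA\<^esub>i\<in>A. to_env L (f i)) = to_env L (\<Sum>i\<in>A. f i)"
proof (induction A rule: finite_induct)
  interpret U: ring UA by (rule ring_UA)
  { case empty show ?case by (simp add: to_env_hom) }
  { case (insert x A)
    thus ?case by (subst U.finsum_insert) (auto simp: to_env_hom carrier_UA) }
qed

lemma env_incl_eq: "x \<in> carrier L \<Longrightarrow> env_incl L x = to_env L (free_gen x)"
  by (simp add: env_incl_def to_env_def restr_free_gen)

end

section \<open>The queer Lie superalgebra\<close>

lemma finite_idx [simp]: "finite (idx K)"
proof -
  have "idx K \<subseteq> {- int K..int K}" by (auto simp: idx_def)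
  thus ?thesis by (rule finite_subset) simp
qed

lemma idx_uminus [simp]: "- i \<in> idx K \<longleftrightarrow> i \<in> idx K"
  by (auto simp: idx_def)

lemma par_uminus_idx [simp]: "i \<in> idx K \<Longrightarrow> par (- i) = par i + 1"
  by (auto simp: par_def idx_def)

lemma sum_idx_uminus: "(\<And>i. - i \<in> I \<longleftrightarrow> i \<in> I) \<Longrightarrow> (\<Sum>k\<in>I. f (- k)) = (\<Sum>k\<in>(I::int set). f k)"
  by (rule sum.reindex_bij_witness[of _ uminus uminus]) auto

lemma UNIV_bit: "(UNIV :: bit set) = {0, 1}"
  using bit.exhaust by auto

lemma (in abelian_monoid) finsum_bit:
  assumes "f 0 \<in> carrier G" "f (1::bit) \<in> carrier G"
  shows "(\<Oplus>p\<in>UNIV. f p) = f 0 \<oplus> f 1"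
  unfolding UNIV_bit using assms by (subst finsum_insert) (auto simp: Pi_def)

lemma F_mat_in_F_span:
  assumes "finite I" "i \<in> I" "j \<in> I" shows "F_mat i j \<in> F_span I"
proof -
  have "F_mat i j a b = (\<Sum>k\<in>I. \<Sum>l\<in>I. (if k = i \<and> l = j then 1 else 0) * F_mat k l a b)" for a b
  proof -
    have "(\<Sum>k\<in>I. \<Sum>l\<in>I. (if k = i \<and> l = j then 1 else 0) * F_mat k l a b)
        = (\<Sum>k\<in>I. if k = i then (\<Sum>l\<in>I. if l = j then F_mat k l a b else 0) else 0)"
      by (intro sum.cong refl) (auto intro!: sum.cong)
    thus ?thesis using assms by simp
  qed
  thus ?thesis unfolding F_span_def by (auto simp: fun_eq_iff)
qed

text \<open>The factor \<open>1/2\<close> compensates for \<open>F\<^sub>i\<^sub>j = F\<^sub>-\<^sub>i\<^sub>,\<^sub>-\<^sub>j\<close>: every basis element occurs twice in the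
  sum.\<close>

lemma F_span_expand:
  assumes I: "finite I" "\<And>i. - i \<in> I \<longleftrightarrow> i \<in> I"
    and x: "\<And>i j. x i j \<noteq> 0 \<Longrightarrow> i \<in> I \<and> j \<in> I" "\<And>i j. x (- i) (- j) = x i j"
  shows "x a b = (\<Sum>i\<in>I. \<Sum>j\<in>I. (x i j / 2) * F_mat i j a b)"
proof -
  have *: "(\<Sum>i\<in>I. \<Sum>j\<in>I. (x i j / 2) * E_mat i j a b) = x a b / 2" for a b
  proof -
    have "(\<Sum>i\<in>I. \<Sum>j\<in>I. (x i j / 2) * E_mat i j a b)
        = (\<Sum>i\<in>I. if i = a then (\<Sum>j\<in>I. if j = b then x i j / 2 else 0) else 0)"
      unfolding E_mat_def by (intro sum.cong refl) (auto intro!: sum.cong)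
    also have "\<dots> = x a b / 2" using I(1) x(1)[of a b] by auto
    finally show ?thesis .
  qed
  have "(\<Sum>i\<in>I. \<Sum>j\<in>I. (x i j / 2) * E_mat (- i) (- j) a b) = (\<Sum>i\<in>I. \<Sum>j\<in>I. (x i j / 2) * E_mat i j (- a) (- b))"
    unfolding E_mat_def by (intro sum.cong refl) (auto simp: minus_equation_iff)
  hence "(\<Sum>i\<in>I. \<Sum>j\<in>I. (x i j / 2) * F_mat i j a b) = x a b / 2 + x (- a) (- b) / 2"
    unfolding F_mat_def distrib_left sum.distrib by (simp only: *)
  thus ?thesis by (simp add: x(2))
qed

lemma F_mat_uminus [simp]: "F_mat (- i) (- j) = F_mat i j"
  by (simp add: F_mat_def fun_eq_iff)

text \<open>The queer Lie superalgebra is the fixed point subalgebra of the involution that negates both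
  indices. This form makes closure under products immediate.\<close>

lemma F_span_iff:
  assumes I: "finite I" "\<And>i. - i \<in> I \<longleftrightarrow> i \<in> I"
  shows "x \<in> F_span I \<longleftrightarrow> (\<forall>i j. x i j \<noteq> 0 \<longrightarrow> i \<in> I \<and> j \<in> I) \<and> (\<forall>i j. x (- i) (- j) = x i j)"
proof
  assume "x \<in> F_span I"
  then obtain c where x: "x = (\<lambda>a b. \<Sum>i\<in>I. \<Sum>j\<in>I. c i j * F_mat i j a b)"
    by (auto simp: F_span_def)
  have s: "F_mat i j (- a) (- b) = F_mat i j a b" for i j a b
    by (auto simp: F_mat_def E_mat_def minus_equation_iff)
  have "F_mat i j a b = 0" if "\<not> (a \<in> I \<and> b \<in> I)" "i \<in> I" "j \<in> I" for i j a b
    using that I(2) by (auto simp: F_mat_def E_mat_def)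
  hence "x a b = 0" if "\<not> (a \<in> I \<and> b \<in> I)" for a b
    using that unfolding x by (intro sum.neutral ballI) auto
  thus "(\<forall>i j. x i j \<noteq> 0 \<longrightarrow> i \<in> I \<and> j \<in> I) \<and> (\<forall>i j. x (- i) (- j) = x i j)"
    unfolding x s by blast
next
  assume "(\<forall>i j. x i j \<noteq> 0 \<longrightarrow> i \<in> I \<and> j \<in> I) \<and> (\<forall>i j. x (- i) (- j) = x i j)"
  hence e: "x = (\<lambda>a b. \<Sum>i\<in>I. \<Sum>j\<in>I. (x i j / 2) * F_mat i j a b)"
    using F_span_expand[OF I, of x] by blast
  have "(\<lambda>a b. \<Sum>i\<in>I. \<Sum>j\<in>I. (x i j / 2) * F_mat i j a b) \<in> F_span I"
    unfolding F_span_def by (intro CollectI exI[of _ "\<lambda>i j. x i j / 2"] conjI refl TrueI)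
  thus "x \<in> F_span I" by (rule ssubst[where P = "\<lambda>z. z \<in> F_span I", OF e])
qed

lemmas F_span_idx_iff = F_span_iff[OF finite_idx idx_uminus]

lemma gl_super_sel:
  "carrier (gl_super K) = {X. \<forall>i j. X i j \<noteq> 0 \<longrightarrow> i \<in> idx K \<and> j \<in> idx K}"
  "mult (gl_super K) = (\<lambda>X Y i j. \<Sum>k\<in>idx K. X i k * Y k j)"
  "zero (gl_super K) = (\<lambda>i j. 0)"
  "add (gl_super K) = (\<lambda>X Y i j. X i j + Y i j)"
  "smult (gl_super K) = (\<lambda>c X i j. c * X i j)"
  "grade (gl_super K) = (\<lambda>p. {X. \<forall>i j. X i j \<noteq> 0 \<longrightarrow> i \<in> idx K \<and> j \<in> idx K \<and> par i + par j = p})"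
  by (simp_all add: gl_super_def)

lemma abelian_group_gl_super: "abelian_group (gl_super K)"
proof (rule abelian_groupI)
  fix X assume "X \<in> carrier (gl_super K)"
  thus "\<exists>Y\<in>carrier (gl_super K). Y \<oplus>\<^bsub>gl_super K\<^esub> X = \<zero>\<^bsub>gl_super K\<^esub>"
    by (intro bexI[of _ "\<lambda>i j. - X i j"]) (auto simp: gl_super_sel)
next
  fix X Y assume "X \<in> carrier (gl_super K)" "Y \<in> carrier (gl_super K)"
  thus "X \<oplus>\<^bsub>gl_super K\<^esub> Y \<in> carrier (gl_super K)"
    unfolding gl_super_sel by (auto) (metis add.right_neutral add_0)+
qed (auto simp: gl_super_sel algebra_simps)

lemma gl_super_minus:
  assumes "X \<in> carrier (gl_super K)" "Y \<in> carrier (gl_super K)"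
  shows "X \<ominus>\<^bsub>gl_super K\<^esub> Y = (\<lambda>i j. X i j - Y i j)"
proof -
  have "\<ominus>\<^bsub>gl_super K\<^esub> Y = (\<lambda>i j. - Y i j)"
    by (rule abelian_group.minus_equality[OF abelian_group_gl_super]) (use assms in \<open>auto simp: gl_super_sel\<close>)
  thus ?thesis by (simp add: a_minus_def gl_super_sel)
qed

lemma hom_part_gl_super:
  assumes "X \<in> carrier (gl_super K)"
  shows "hom_part (gl_super K) p X = (\<lambda>i j. if par i + par j = p then X i j else 0)"
  unfolding hom_part_def
proof (rule the_equality)
  let ?c = "\<lambda>p i j. if par i + par j = p then X i j else 0"
  show "\<exists>c. (\<forall>q. c q \<in> grade (gl_super K) q) \<and> X = c 0 \<oplus>\<^bsub>gl_super K\<^esub> c 1 \<and> ?c p = c p"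
    using assms by (intro exI[of _ ?c]) (auto simp: gl_super_sel fun_eq_iff, metis bit.exhaust)
next
  fix Y assume "\<exists>c. (\<forall>q. c q \<in> grade (gl_super K) q) \<and> X = c 0 \<oplus>\<^bsub>gl_super K\<^esub> c 1 \<and> Y = c p"
  then obtain c where c: "\<And>q. c q \<in> grade (gl_super K) q" "X = (\<lambda>i j. c 0 i j + c 1 i j)" "Y = c p"
    by (auto simp: gl_super_sel)
  have z: "c q i j = 0" if "par i + par j \<noteq> q" for q i j
    using c(1)[of q] that by (auto simp: gl_super_sel)
  show "Y = (\<lambda>i j. if par i + par j = p then X i j else 0)"
  proof (intro ext)
    fix i j
    show "Y i j = (if par i + par j = p then X i j else 0)"
      unfolding c(2,3) using z[of i j 0] z[of i j 1] z[of i j p]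
      by (cases "par i + par j"; cases p) auto
  qed
qed

lemma mult_gl_super_closed:
  "X \<in> carrier (gl_super K) \<Longrightarrow> Y \<in> carrier (gl_super K) \<Longrightarrow> X \<otimes>\<^bsub>gl_super K\<^esub> Y \<in> carrier (gl_super K)"
proof -
  assume a: "X \<in> carrier (gl_super K)" "Y \<in> carrier (gl_super K)"
  have "(\<Sum>k\<in>idx K. X i k * Y k j) = 0" if "\<not> (i \<in> idx K \<and> j \<in> idx K)" for i j
    using a that by (intro sum.neutral ballI) (auto simp: gl_super_sel)
  thus ?thesis unfolding gl_super_sel by blast
qed

lemma supercommutator_gl_super:
  assumes X: "X \<in> grade (gl_super K) p" and Y: "Y \<in> grade (gl_super K) q"
  shows "supercommutator (gl_super K) X Y =
    (\<lambda>i j. (\<Sum>k\<in>idx K. X i k * Y k j) - sgn_bit (p * q) * (\<Sum>k\<in>idx K. Y i k * X k j))"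
proof -
  let ?G = "gl_super K"
  interpret abelian_group ?G by (rule abelian_group_gl_super)
  have XY: "X \<in> carrier ?G" "Y \<in> carrier ?G" using X Y by (auto simp: gl_super_sel)
  have hX: "hom_part ?G r X = (if r = p then X else (\<lambda>i j. 0))" for r
    unfolding hom_part_gl_super[OF XY(1)] using X by (auto simp: gl_super_sel fun_eq_iff)
  have hY: "hom_part ?G r Y = (if r = q then Y else (\<lambda>i j. 0))" for r
    unfolding hom_part_gl_super[OF XY(2)] using Y by (auto simp: gl_super_sel fun_eq_iff)
  define t where "t = (\<lambda>r s. if r = p \<and> s = q then
    (\<lambda>i j. (\<Sum>k\<in>idx K. X i k * Y k j) - sgn_bit (p * q) * (\<Sum>k\<in>idx K. Y i k * X k j)) else (\<lambda>i j. 0))"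
  have z: "(\<lambda>i j. 0) \<in> carrier ?G" by (simp add: gl_super_sel)
  have c1: "X \<otimes>\<^bsub>?G\<^esub> Y \<in> carrier ?G" "Y \<otimes>\<^bsub>?G\<^esub> X \<in> carrier ?G" by (auto intro: mult_gl_super_closed XY)
  hence c2: "sgn_bit (p * q) \<odot>\<^bsub>?G\<^esub> (Y \<otimes>\<^bsub>?G\<^esub> X) \<in> carrier ?G" by (auto simp: gl_super_sel(1,5))
  have tc: "t r s \<in> carrier ?G" for r s
    using minus_closed[OF c1(1) c2] z unfolding t_def gl_super_minus[OF c1(1) c2]
    by (simp add: gl_super_sel(2,5))
  have t: "(hom_part ?G r X \<otimes>\<^bsub>?G\<^esub> hom_part ?G s Y)
       \<ominus>\<^bsub>?G\<^esub> (sgn_bit (r * s) \<odot>\<^bsub>?G\<^esub> (hom_part ?G s Y \<otimes>\<^bsub>?G\<^esub> hom_part ?G r X)) = t r s" for r s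
  proof (cases "r = p \<and> s = q")
    case True
    thus ?thesis using gl_super_minus[OF c1(1) c2] by (simp add: hX hY t_def gl_super_sel(2,5))
  next
    case False
    hence "hom_part ?G r X \<otimes>\<^bsub>?G\<^esub> hom_part ?G s Y = (\<lambda>i j. 0)"
      "hom_part ?G s Y \<otimes>\<^bsub>?G\<^esub> hom_part ?G r X = (\<lambda>i j. 0)"
      by (auto simp: hX hY gl_super_sel)
    thus ?thesis using False gl_super_minus[OF z z] by (auto simp: t_def gl_super_sel(5))
  qed
  have "supercommutator ?G X Y = (\<Oplus>\<^bsub>?G\<^esub>r\<in>UNIV. \<Oplus>\<^bsub>?G\<^esub>s\<in>UNIV. t r s)"
    unfolding supercommutator_def t ..
  also have "\<dots> = (\<Oplus>\<^bsub>?G\<^esub>r\<in>UNIV. t r 0 \<oplus>\<^bsub>?G\<^esub> t r 1)"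
    by (subst finsum_bit[OF tc tc]) (rule refl)
  also have "\<dots> = (t 0 0 \<oplus>\<^bsub>?G\<^esub> t 0 1) \<oplus>\<^bsub>?G\<^esub> (t 1 0 \<oplus>\<^bsub>?G\<^esub> t 1 1)"
    by (rule finsum_bit) (auto intro: a_closed tc)
  also have "\<dots> = t p q"
    by (cases p; cases q) (auto simp: t_def gl_super_sel fun_eq_iff)
  finally show ?thesis by (simp add: t_def)
qed

lemma queer_sel:
  "carrier (queer K) = F_span (idx K)" "ladd (queer K) x y = (\<lambda>i j. x i j + y i j)"
  "lscale (queer K) c x = (\<lambda>i j. c * x i j)"
  "lgrade (queer K) p = F_span (idx K) \<inter> grade (gl_super K) p"
  by (simp_all add: queer_def sub_lie_def gl_super_sel)

lemma bracket_queer: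
  assumes "x \<in> lgrade (queer K) p" "y \<in> lgrade (queer K) q"
  shows "bracket (queer K) x y =
    (\<lambda>i j. (\<Sum>k\<in>idx K. x i k * y k j) - sgn_bit (p * q) * (\<Sum>k\<in>idx K. y i k * x k j))"
  using supercommutator_gl_super[of x K p y q] assms by (simp add: queer_def sub_lie_def)

lemma F_span_mult:
  assumes "x \<in> F_span (idx K)" "y \<in> F_span (idx K)"
  shows "(\<lambda>i j. \<Sum>k\<in>idx K. x i k * y k j) \<in> F_span (idx K)"
proof -
  have x: "\<And>i j. x i j \<noteq> 0 \<Longrightarrow> i \<in> idx K \<and> j \<in> idx K" "\<And>i j. x (- i) (- j) = x i j"
    and y: "\<And>i j. y i j \<noteq> 0 \<Longrightarrow> i \<in> idx K \<and> j \<in> idx K" "\<And>i j. y (- i) (- j) = y i j"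
    using assms by (auto simp: F_span_idx_iff)
  have "(\<Sum>k\<in>idx K. x i k * y k j) = 0" if "\<not> (i \<in> idx K \<and> j \<in> idx K)" for i j
    using that x(1) y(1) by (intro sum.neutral ballI) auto
  moreover have "(\<Sum>k\<in>idx K. x (- i) k * y k (- j)) = (\<Sum>k\<in>idx K. x i k * y k j)" for i j
    using sum_idx_uminus[of "idx K" "\<lambda>k. x (- i) k * y k (- j)"] by (simp add: x y)
  ultimately show ?thesis unfolding F_span_idx_iff by blast
qed

lemma F_span_add: "x \<in> F_span (idx K) \<Longrightarrow> y \<in> F_span (idx K) \<Longrightarrow> (\<lambda>i j. x i j + y i j) \<in> F_span (idx K)"
  unfolding F_span_idx_iff by (simp, metis add_0)

lemma F_span_scale: "x \<in> F_span (idx K) \<Longrightarrow> (\<lambda>i j. c * x i j) \<in> F_span (idx K)"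
  unfolding F_span_idx_iff by auto

lemma F_span_sum:
  assumes "\<And>a. a \<in> A \<Longrightarrow> x a \<in> F_span (idx K)"
  shows "(\<lambda>i j. \<Sum>a\<in>A. c a * x a i j) \<in> F_span (idx K)"
  using assms
proof (induction A rule: infinite_finite_induct)
  case (insert a A)
  have "(\<lambda>i j. c a * x a i j + (\<Sum>a\<in>A. c a * x a i j)) \<in> F_span (idx K)"
    by (intro F_span_add F_span_scale insert) (auto intro: insert)
  thus ?case using insert by simp
qed (auto simp: F_span_idx_iff)

lemma closed_queer: "closed_lie_superalgebra (queer K)"
proof
  fix x y p q assume *: "x \<in> lgrade (queer K) p" "y \<in> lgrade (queer K) q"
  hence xy: "x \<in> F_span (idx K)" "y \<in> F_span (idx K)" by (auto simp: queer_sel)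
  show "bracket (queer K) x y \<in> carrier (queer K)"
    using F_span_add[OF F_span_mult[OF xy] F_span_scale[OF F_span_mult[OF xy(2,1)]], of "- sgn_bit (p * q)"]
    unfolding bracket_queer[OF *] queer_sel by simp
qed (auto simp: queer_sel F_span_add F_span_scale)

definition sign_mat :: "imat \<Rightarrow> imat" where
  "sign_mat x = (\<lambda>i j. sgn_bit (par i + par j) * x i j)"

lemma sign_mat_sign_mat [simp]: "sign_mat (sign_mat x) = x"
  by (simp add: sign_mat_def)

lemma sign_mat_F_span [simp]: "sign_mat x \<in> F_span (idx K) \<longleftrightarrow> x \<in> F_span (idx K)"
proof -
  have "sign_mat x \<in> F_span (idx K)" if "x \<in> F_span (idx K)" for x
  proof -
    have x: "x i j \<noteq> 0 \<Longrightarrow> i \<in> idx K \<and> j \<in> idx K" "x (- i) (- j) = x i j" for i j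
      using that by (auto simp: F_span_idx_iff)
    have "sgn_bit (par (- i) + par (- j)) * x i j = sgn_bit (par i + par j) * x i j" for i j
    proof (cases "x i j = 0")
      case False
      hence "i \<in> idx K" "j \<in> idx K" using x(1) by auto
      thus ?thesis by (simp add: sgn_bit_add)
    qed simp
    thus ?thesis using x by (auto simp: F_span_idx_iff sign_mat_def)
  qed
  from this[of x] this[of "sign_mat x"] show ?thesis by auto
qed

lemma sign_mat_homogeneous: "x \<in> lgrade (queer K) p \<Longrightarrow> sign_mat x = (\<lambda>i j. sgn_bit p * x i j)"
  by (auto simp: queer_sel gl_super_sel sign_mat_def fun_eq_iff)

text \<open>The parity automorphism acts by \<open>(-1)\<^sup>p\<close> in degree \<open>p\<close>. It allows supercommutators with a
  homogeneous element to be written without splitting the other factor into homogeneous parts.\<close>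

definition pi_aut :: "imat free \<Rightarrow> imat free" where
  "pi_aut f = Poly_Mapping.map_key (\<lambda>w. Word (map sign_mat (letters w))) f"

lemma inj_word_sign_mat: "inj (\<lambda>w. Word (map sign_mat (letters w)))"
  by (rule inj_on_inverseI[of _ "\<lambda>w. Word (map sign_mat (letters w))"]) (simp add: o_def)

lemma pi_add: "pi_aut (f + g) = pi_aut f + pi_aut g"
  unfolding pi_aut_def by (rule map_key_plus[OF inj_word_sign_mat])

lemma pi_scl: "pi_aut (c \<bullet> f) = c \<bullet> pi_aut f"
  unfolding pi_aut_def by (rule poly_mapping_eqI) (simp add: map_key.rep_eq inj_word_sign_mat)

lemma pi_mon: "pi_aut (mon w) = mon (map sign_mat w)"
  using map_key_single[OF inj_word_sign_mat, of "Word (map sign_mat w)" 1]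
  by (simp add: pi_aut_def mon_def o_def)

lemma pi_0 [simp]: "pi_aut 0 = 0"
  by (simp add: pi_aut_def inj_word_sign_mat)

lemma pi_uminus: "pi_aut (- f) = - pi_aut f"
  using pi_scl[of "-1" f] by simp

lemma pi_diff: "pi_aut (f - g) = pi_aut f - pi_aut g"
  using pi_add[of f "- g"] by (simp add: pi_uminus)

lemma pi_mult: "pi_aut (f * g) = pi_aut f * pi_aut g"
proof (induction f rule: free_induct)
  case (mon c u)
  have "pi_aut (mon u * g) = pi_aut (mon u) * pi_aut g"
    by (induction g rule: free_induct)
      (simp_all add: pi_add pi_scl pi_mon distrib_left flip: mon_append)
  thus ?case by (simp add: pi_scl)
qed (simp_all add: pi_add algebra_simps)

lemma pi_pi [simp]: "pi_aut (pi_aut f) = f"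
  by (induction f rule: free_induct) (simp_all add: pi_add pi_scl pi_mon o_def)

lemma pi_free_gen: "pi_aut (free_gen x) = free_gen (sign_mat x)"
  using pi_mon[of "[x]"] by (simp add: mon_single)

lemma pi_sum: "pi_aut (\<Sum>i\<in>A. f i) = (\<Sum>i\<in>A. pi_aut (f i))"
  by (induction A rule: infinite_finite_induct) (simp_all add: pi_add)

lemma pi_1 [simp]: "pi_aut 1 = 1"
  using pi_mon[of "[]"] by simp

text \<open>The \<open>q\<close>-th power of the parity automorphism.\<close>

definition pip :: "bit \<Rightarrow> imat free \<Rightarrow> imat free" where
  "pip q f = (if q = 0 then f else pi_aut f)"

lemma pi_relation:
  assumes "r \<in> env_relations (queer K)" shows "pi_aut r \<in> env_relations (queer K)"
proof -
  let ?L = "queer K"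
  consider (a) x y where "r = free_gen (ladd ?L x y) - free_gen x - free_gen y" "x \<in> carrier ?L" "y \<in> carrier ?L"
    | (b) c x where "r = free_gen (lscale ?L c x) - free_const c * free_gen x" "x \<in> carrier ?L"
    | (c) x y p q where "r = free_gen x * free_gen y - free_const (sgn_bit (p * q)) * free_gen y * free_gen x
        - free_gen (bracket ?L x y)" "x \<in> lgrade ?L p" "y \<in> lgrade ?L q"
    using assms unfolding env_relations_def by blast
  thus ?thesis
  proof cases
    case a
    have "sign_mat (ladd ?L x y) = ladd ?L (sign_mat x) (sign_mat y)"
      by (simp add: queer_sel sign_mat_def fun_eq_iff algebra_simps)
    hence "pi_aut r = free_gen (ladd ?L (sign_mat x) (sign_mat y)) - free_gen (sign_mat x) - free_gen (sign_mat y)"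
      by (simp add: a pi_diff pi_free_gen)
    moreover have "sign_mat x \<in> carrier ?L" "sign_mat y \<in> carrier ?L" using a by (simp_all add: queer_sel)
    ultimately show ?thesis unfolding env_relations_def by blast
  next
    case b
    have "sign_mat (lscale ?L c x) = lscale ?L c (sign_mat x)"
      by (simp add: queer_sel sign_mat_def fun_eq_iff algebra_simps)
    hence "pi_aut r = free_gen (lscale ?L c (sign_mat x)) - free_const c * free_gen (sign_mat x)"
      by (simp add: b pi_diff pi_free_gen free_const_mult pi_scl)
    moreover have "sign_mat x \<in> carrier ?L" using b by (simp_all add: queer_sel)
    ultimately show ?thesis unfolding env_relations_def by blast
  next
    case c
    have g: "sign_mat x \<in> lgrade ?L p" "sign_mat y \<in> lgrade ?L q"
      using c by (auto simp: queer_sel gl_super_sel) (auto simp: sign_mat_def)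
    have "sign_mat (bracket ?L x y) = bracket ?L (sign_mat x) (sign_mat y)"
    proof (intro ext)
      fix i j
      have xz: "x i j \<noteq> 0 \<Longrightarrow> par i + par j = p" and yz: "y i j \<noteq> 0 \<Longrightarrow> par i + par j = q" for i j
        using c by (auto simp: queer_sel gl_super_sel)
      have sx: "sgn_bit p * x i j = sgn_bit (par i) * sgn_bit (par j) * x i j"
        and symbol: "sgn_bit q * y i j = sgn_bit (par i) * sgn_bit (par j) * y i j" for i j
        using xz[of i j] yz[of i j] by (auto simp flip: sgn_bit_add)
      have *: "sgn_bit (par i + par j) * (x i k * y k j) = sgn_bit p * x i k * (sgn_bit q * y k j)"
        "sgn_bit (par i + par j) * (y i k * x k j) = sgn_bit q * y i k * (sgn_bit p * x k j)" for k
        by (simp_all add: sx symbol sgn_bit_add mult_ac)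
      show "sign_mat (bracket ?L x y) i j = bracket ?L (sign_mat x) (sign_mat y) i j"
        unfolding bracket_queer[OF c(2,3)] bracket_queer[OF g]
        unfolding sign_mat_homogeneous[OF c(2)] sign_mat_homogeneous[OF c(3)]
        by (simp add: sign_mat_def right_diff_distrib sum_distrib_left mult.left_commute[of "sgn_bit (par i + par j)" "sgn_bit (p * q)"] *)
    qed
    hence "pi_aut r = free_gen (sign_mat x) * free_gen (sign_mat y) - free_const (sgn_bit (p * q)) * free_gen (sign_mat y) * free_gen (sign_mat x)
        - free_gen (bracket ?L (sign_mat x) (sign_mat y))"
      by (simp add: c pi_diff pi_free_gen free_const_mult pi_scl pi_mult mult.assoc)
    thus ?thesis using g unfolding env_relations_def by blast
  qed
qed

lemma pi_null: "f \<in> env_null (queer K) \<Longrightarrow> pi_aut f \<in> env_null (queer K)"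
proof (induction rule: env_null.induct)
  case (gen x a b)
  thus ?case using env_null.gen[of "sign_mat x" "queer K"] by (simp add: pi_mult pi_free_gen queer_sel)
qed (auto simp: pi_mult pi_add intro: env_null.intros pi_relation)

section \<open>Grading and supercommutators in the enveloping algebra\<close>

locale queer_env =
  fixes K :: nat
begin

sublocale closed_lie_superalgebra "queer K" by (rule closed_queer)

abbreviation "nl \<equiv> env_null (queer K)"
abbreviation "cls \<equiv> to_env (queer K)"
abbreviation "U \<equiv> Uq K"

definition eqv :: "imat free \<Rightarrow> imat free \<Rightarrow> bool" (infix "\<doteq>" 50) where
  "f \<doteq> g \<longleftrightarrow> f - g \<in> nl"

lemma eqv_refl [simp, intro]: "f \<doteq> f"
  by (simp add: eqv_def env_null.zero)

lemma eqv_sym: "f \<doteq> g \<Longrightarrow> g \<doteq> f"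
  using env_null_uminus[of "f - g"] by (simp add: eqv_def)

lemma eqv_trans [trans]: "f \<doteq> g \<Longrightarrow> g \<doteq> h \<Longrightarrow> f \<doteq> h"
  using env_null.add[of "f - g" "queer K" "g - h"] by (simp add: eqv_def)

lemma eq_eqv_trans [trans]: "f = g \<Longrightarrow> g \<doteq> h \<Longrightarrow> f \<doteq> h"
  by simp

lemma eqv_eq_trans [trans]: "f \<doteq> g \<Longrightarrow> g = h \<Longrightarrow> f \<doteq> h"
  by simp

lemma eqv_add: "f \<doteq> f' \<Longrightarrow> g \<doteq> g' \<Longrightarrow> f + g \<doteq> f' + g'"
  using env_null.add[of "f - f'" "queer K" "g - g'"] by (simp add: eqv_def algebra_simps)

lemma eqv_diff: "f \<doteq> f' \<Longrightarrow> g \<doteq> g' \<Longrightarrow> f - g \<doteq> f' - g'"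
  using env_null_diff[of "f - f'" "queer K" "g - g'"] by (simp add: eqv_def algebra_simps)

lemma eqv_scl: "f \<doteq> f' \<Longrightarrow> c \<bullet> f \<doteq> c \<bullet> f'"
  using env_null_scl[of "f - f'" "queer K" c] by (simp add: eqv_def fv.scale_right_diff_distrib)

lemma eqv_mult: "f \<doteq> f' \<Longrightarrow> g \<doteq> g' \<Longrightarrow> f * g \<doteq> f' * g'"
  using env_null.add[OF env_null_mult_right[of "f - f'" "queer K" g] env_null_mult_left[of "g - g'" "queer K" f']]
  by (simp add: eqv_def algebra_simps)

lemma eqv_sum: "(\<And>i. i \<in> A \<Longrightarrow> f i \<doteq> g i) \<Longrightarrow> (\<Sum>i\<in>A. f i) \<doteq> (\<Sum>i\<in>A. g i)"
  using env_null_sum[of A "\<lambda>i. f i - g i" "queer K"] by (simp add: eqv_def sum_subtractf)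

lemma eqv_pi: "f \<doteq> g \<Longrightarrow> pi_aut f \<doteq> pi_aut g"
  using pi_null[of "f - g" K] by (simp add: eqv_def pi_diff)

lemma eqv_0: "f \<doteq> 0 \<longleftrightarrow> f \<in> nl"
  by (simp add: eqv_def)

lemma cls_eq_iff: "cls f = cls g \<longleftrightarrow> f \<doteq> g"
  by (simp add: to_env_eq_iff eqv_def)

lemma gen_add: "x \<in> F_span (idx K) \<Longrightarrow> y \<in> F_span (idx K) \<Longrightarrow>
    free_gen (\<lambda>i j. x i j + y i j) \<doteq> free_gen x + free_gen y"
proof -
  assume "x \<in> F_span (idx K)" "y \<in> F_span (idx K)"
  hence "free_gen (ladd (queer K) x y) - free_gen x - free_gen y \<in> env_relations (queer K)"
    unfolding env_relations_def queer_sel(1)[symmetric] by blast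
  from env_null.rel[OF this, of 1 1] show ?thesis
    by (simp add: eqv_def queer_sel algebra_simps)
qed

lemma gen_scale: "x \<in> F_span (idx K) \<Longrightarrow> free_gen (\<lambda>i j. c * x i j) \<doteq> c \<bullet> free_gen x"
proof -
  assume "x \<in> F_span (idx K)"
  hence "free_gen (lscale (queer K) c x) - free_const c * free_gen x \<in> env_relations (queer K)"
    unfolding env_relations_def queer_sel(1)[symmetric] by blast
  from env_null.rel[OF this, of 1 1] show ?thesis
    by (simp add: eqv_def queer_sel free_const_mult)
qed

lemma gen_comm:
  assumes "x \<in> lgrade (queer K) p" "y \<in> lgrade (queer K) r"
  shows "free_gen x * free_gen y - sgn_bit (p * r) \<bullet> (free_gen y * free_gen x) \<doteq>
    free_gen (\<lambda>i j. (\<Sum>k\<in>idx K. x i k * y k j) - sgn_bit (p * r) * (\<Sum>k\<in>idx K. y i k * x k j))"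
proof -
  have "free_gen x * free_gen y - free_const (sgn_bit (p * r)) * free_gen y * free_gen x
        - free_gen (bracket (queer K) x y) \<in> env_relations (queer K)"
    using assms unfolding env_relations_def by blast
  from env_null.rel[OF this, of 1 1] show ?thesis
    by (simp add: eqv_def bracket_queer[OF assms] free_const_mult mult.assoc)
qed

lemma gen_zero: "free_gen (\<lambda>i j. 0) \<doteq> 0"
  using gen_scale[of "\<lambda>i j. 0" 0] by (simp add: F_span_idx_iff)

lemma gen_sum:
  assumes "\<And>a. a \<in> A \<Longrightarrow> x a \<in> F_span (idx K)"
  shows "free_gen (\<lambda>i j. \<Sum>a\<in>A. c a * x a i j) \<doteq> (\<Sum>a\<in>A. c a \<bullet> free_gen (x a))"
  using assms
proof (induction A rule: infinite_finite_induct)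
  case (insert a A)
  have "free_gen (\<lambda>i j. c a * x a i j + (\<Sum>a\<in>A. c a * x a i j))
      \<doteq> free_gen (\<lambda>i j. c a * x a i j) + free_gen (\<lambda>i j. (\<Sum>a\<in>A. c a * x a i j))"
    by (intro gen_add F_span_scale F_span_sum) (auto intro: insert)
  also have "\<dots> \<doteq> c a \<bullet> free_gen (x a) + (\<Sum>a\<in>A. c a \<bullet> free_gen (x a))"
    by (intro eqv_add gen_scale insert) (auto intro: insert)
  finally show ?case using insert by simp
qed (auto simp: gen_zero)

definition F :: "int \<Rightarrow> int \<Rightarrow> imat free" where
  "F i j = free_gen (F_mat i j)"

lemma F_uminus [simp]: "F (- i) (- j) = F i j"
  by (simp add: F_def)

lemma F_mat_span [simp]: "i \<in> idx K \<Longrightarrow> j \<in> idx K \<Longrightarrow> F_mat i j \<in> F_span (idx K)"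
  by (rule F_mat_in_F_span) auto

lemma F_mat_lgrade: "i \<in> idx K \<Longrightarrow> j \<in> idx K \<Longrightarrow> F_mat i j \<in> lgrade (queer K) (par i + par j)"
  by (auto simp: queer_sel gl_super_sel) (auto simp: F_mat_def E_mat_def add_ac split: if_splits)

lemma gen_expand:
  assumes "x \<in> F_span (idx K)"
  shows "free_gen x \<doteq> (\<Sum>i\<in>idx K. \<Sum>j\<in>idx K. (x i j / 2) \<bullet> F i j)"
proof -
  let ?A = "idx K \<times> idx K"
  have xs: "\<And>i j. x i j \<noteq> 0 \<Longrightarrow> i \<in> idx K \<and> j \<in> idx K" "\<And>i j. x (- i) (- j) = x i j"
    using assms by (auto simp: F_span_idx_iff)
  have "x a b = (\<Sum>s\<in>?A. (x (fst s) (snd s) / 2) * F_mat (fst s) (snd s) a b)" for a b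
  proof -
    have "x a b = (\<Sum>i\<in>idx K. \<Sum>j\<in>idx K. (x i j / 2) * F_mat i j a b)"
      by (rule F_span_expand) (use xs in auto)
    also have "\<dots> = (\<Sum>s\<in>?A. (x (fst s) (snd s) / 2) * F_mat (fst s) (snd s) a b)"
      unfolding sum.cartesian_product by (rule sum.cong) auto
    finally show ?thesis .
  qed
  hence e: "free_gen x = free_gen (\<lambda>a b. \<Sum>s\<in>?A. (x (fst s) (snd s) / 2) * F_mat (fst s) (snd s) a b)"
    by (intro arg_cong[where f = free_gen] ext)
  note e
  also have "\<dots> \<doteq> (\<Sum>s\<in>?A. (x (fst s) (snd s) / 2) \<bullet> free_gen (F_mat (fst s) (snd s)))"
    by (rule gen_sum) auto
  also have "(\<Sum>s\<in>?A. (x (fst s) (snd s) / 2) \<bullet> free_gen (F_mat (fst s) (snd s)))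
      = (\<Sum>i\<in>idx K. \<Sum>j\<in>idx K. (x i j / 2) \<bullet> F i j)"
    unfolding sum.cartesian_product by (rule sum.cong) (auto simp: F_def)
  finally show ?thesis .
qed

definition homg :: "bit \<Rightarrow> imat free \<Rightarrow> bool" where
  "homg p f \<longleftrightarrow> (\<forall>w\<in>Poly_Mapping.keys f.
     \<exists>ps. list_all2 (\<lambda>x q. x \<in> lgrade (queer K) q) (letters w) ps \<and> sum_list ps = p)"

lemma homg_add: "homg p f \<Longrightarrow> homg p g \<Longrightarrow> homg p (f + g)"
  using keys_add[of f g] unfolding homg_def by blast

lemma homg_scl: "homg p f \<Longrightarrow> homg p (c \<bullet> f)"
  using keys_scl[of c f] unfolding homg_def by blast

lemma homg_0: "homg p 0"
  by (simp add: homg_def)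

lemma homg_mult:
  assumes "homg p f" "homg r g" shows "homg (p + r) (f * g)"
  unfolding homg_def
proof
  fix w assume "w \<in> Poly_Mapping.keys (f * g)"
  then obtain a b where w: "w = a + b" "a \<in> Poly_Mapping.keys f" "b \<in> Poly_Mapping.keys g"
    using keys_mult[of f g] by blast
  then obtain ps rs where "list_all2 (\<lambda>x q. x \<in> lgrade (queer K) q) (letters a) ps" "sum_list ps = p"
    "list_all2 (\<lambda>x q. x \<in> lgrade (queer K) q) (letters b) rs" "sum_list rs = r"
    using assms unfolding homg_def by blast
  thus "\<exists>ps. list_all2 (\<lambda>x q. x \<in> lgrade (queer K) q) (letters w) ps \<and> sum_list ps = p + r"
    by (intro exI[of _ "ps @ rs"]) (simp add: w plus_fword_def list_all2_appendI)
qed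

lemma homg_gen: "x \<in> lgrade (queer K) p \<Longrightarrow> homg p (free_gen x)"
  unfolding homg_def mon_single[symmetric] by (auto intro!: exI[of _ "[p]"])

lemma homg_1: "homg 0 1"
  unfolding homg_def by (auto simp: zero_fword_def)

lemma homg_pi:
  assumes "homg p f" shows "pi_aut f \<doteq> sgn_bit p \<bullet> f"
proof -
  have w: "pi_aut (mon w) \<doteq> sgn_bit (sum_list ps) \<bullet> mon w"
    if "list_all2 (\<lambda>x q. x \<in> lgrade (queer K) q) w ps" for w ps
    using that
  proof (induction rule: list_all2_induct)
    case (Cons x w p ps)
    have "pi_aut (mon (x # w)) = free_gen (sign_mat x) * pi_aut (mon w)"
      by (simp add: mon_Cons pi_mult pi_free_gen)
    also have "\<dots> \<doteq> (sgn_bit p \<bullet> free_gen x) * (sgn_bit (sum_list ps) \<bullet> mon w)"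
      using Cons gen_scale[of x "sgn_bit p"]
      by (intro eqv_mult) (auto simp: sign_mat_homogeneous queer_sel)
    finally show ?case by (simp add: mon_Cons sgn_bit_add mult.commute)
  qed simp
  have "pi_aut f = (\<Sum>w\<in>Poly_Mapping.keys f. Poly_Mapping.lookup f w \<bullet> pi_aut (mon (letters w)))"
    by (subst free_expand) (simp add: pi_sum pi_scl)
  also have "\<dots> \<doteq> (\<Sum>w\<in>Poly_Mapping.keys f. Poly_Mapping.lookup f w \<bullet> sgn_bit p \<bullet> mon (letters w))"
    using assms w by (intro eqv_sum eqv_scl) (auto simp: homg_def)
  also have "\<dots> = sgn_bit p \<bullet> (\<Sum>w\<in>Poly_Mapping.keys f. Poly_Mapping.lookup f w \<bullet> mon (letters w))"
    by (simp add: fv.scale_sum_right mult.commute)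
  finally show ?thesis by (simp flip: free_expand)
qed

lemma homg_F: "i \<in> idx K \<Longrightarrow> j \<in> idx K \<Longrightarrow> homg (par i + par j) (F i j)"
  unfolding F_def by (rule homg_gen) (rule F_mat_lgrade)

lemma pi_F: "i \<in> idx K \<Longrightarrow> j \<in> idx K \<Longrightarrow> pi_aut (F i j) \<doteq> sgn_bit (par i + par j) \<bullet> F i j"
  by (rule homg_pi) (rule homg_F)

definition decomp :: "imat free \<Rightarrow> bool" where
  "decomp f \<longleftrightarrow> (\<exists>f0 f1. homg 0 f0 \<and> homg 1 f1 \<and> f \<doteq> f0 + f1)"

lemma decomp_homg: "homg p f \<Longrightarrow> decomp f"
  unfolding decomp_def by (cases p) (use homg_0[of 0] homg_0[of 1] in \<open>(metis add_0 add.right_neutral eqv_refl)+\<close>)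

lemma decomp_add: "decomp f \<Longrightarrow> decomp g \<Longrightarrow> decomp (f + g)"
  unfolding decomp_def
proof clarify
  fix f0 f1 g0 g1 assume *: "homg 0 f0" "homg 1 f1" "f \<doteq> f0 + f1" "homg 0 g0" "homg 1 g1" "g \<doteq> g0 + g1"
  show "\<exists>h0 h1. homg 0 h0 \<and> homg 1 h1 \<and> f + g \<doteq> h0 + h1"
    using homg_add[OF *(1,4)] homg_add[OF *(2,5)] eqv_add[OF *(3,6)]
    by (intro exI[of _ "f0 + g0"] exI[of _ "f1 + g1"]) (simp add: add_ac)
qed

lemma decomp_eqv: "f \<doteq> g \<Longrightarrow> decomp g \<Longrightarrow> decomp f"
  unfolding decomp_def by (meson eqv_trans)

lemma decomp_mult: "decomp f \<Longrightarrow> decomp g \<Longrightarrow> decomp (f * g)"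
proof -
  assume "decomp f" "decomp g"
  then obtain f0 f1 g0 g1 where *: "homg 0 f0" "homg 1 f1" "f \<doteq> f0 + f1" "homg 0 g0" "homg 1 g1" "g \<doteq> g0 + g1"
    unfolding decomp_def by blast
  have "decomp (f0 * g0 + f0 * g1 + (f1 * g0 + f1 * g1))"
    by (intro decomp_add) (rule decomp_homg[OF homg_mult], rule *, rule *)+
  moreover have "f * g \<doteq> f0 * g0 + f0 * g1 + (f1 * g0 + f1 * g1)"
    using eqv_mult[OF *(3,6)] by (simp add: algebra_simps)
  ultimately show ?thesis by (rule decomp_eqv[rotated])
qed

lemma decomp_sum: "(\<And>i. i \<in> A \<Longrightarrow> decomp (f i)) \<Longrightarrow> decomp (\<Sum>i\<in>A. f i)"
  by (induction A rule: infinite_finite_induct) (auto intro: decomp_add decomp_homg homg_0)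

lemma decomp_gen: "decomp (free_gen x)"
proof (cases "x \<in> F_span (idx K)")
  case True
  show ?thesis
    by (rule decomp_eqv[OF gen_expand[OF True]])
      (intro decomp_sum decomp_homg, rule homg_scl, rule homg_F)
next
  case False
  hence "free_gen x \<doteq> 0"
    using env_null.gen[of x "queer K" 1 1] by (simp add: queer_sel eqv_0)
  thus ?thesis by (rule decomp_eqv) (rule decomp_homg, rule homg_0)
qed

text \<open>Letters in the queer Lie superalgebra are combinations of the homogeneous \<open>F\<^sub>i\<^sub>j\<close>, and all other
  letters are zero.\<close>

lemma decomp_all: "decomp f"
proof (induction f rule: free_induct)
  case (mon c w)
  have "decomp (mon w)"
    by (induction w) (auto simp: mon_Cons intro: decomp_homg[OF homg_1] decomp_mult decomp_gen)
  hence "decomp ((c \<bullet> 1) * mon w)" by (rule decomp_mult[OF decomp_homg[OF homg_scl[OF homg_1]]])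
  thus ?case by simp
qed (auto intro: decomp_add decomp_homg homg_0)

text \<open>The homogeneous parts are the eigencomponents of the parity automorphism.\<close>

definition hom_proj :: "bit \<Rightarrow> imat free \<Rightarrow> imat free" where
  "hom_proj p f = (1/2) \<bullet> (f + sgn_bit p \<bullet> pi_aut f)"

text \<open>A homogeneous element is an eigenvector of the parity automorphism modulo the relations. Hence
  the two homogeneous parts of an element are determined by it, and the direct sum decomposition
  follows without knowing a basis of the enveloping algebra.\<close>

lemma hom_proj_unique:
  assumes "homg 0 f0" "homg 1 f1" "f \<doteq> f0 + f1"
  shows "hom_proj 0 f \<doteq> f0" "hom_proj 1 f \<doteq> f1"
proof -
  have "pi_aut f \<doteq> pi_aut f0 + pi_aut f1" using eqv_pi[OF assms(3)] by (simp add: pi_add)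
  also have "\<dots> \<doteq> f0 - f1" using eqv_add[OF homg_pi[OF assms(1)] homg_pi[OF assms(2)]] by simp
  finally have *: "pi_aut f \<doteq> f0 - f1" .
  have t: "(1/2) \<bullet> (g + g) = g" for g :: "imat free"
    using fv.scale_left_distrib[of "1/2" "1/2" g] by (simp add: fv.scale_right_distrib)
  show "hom_proj 0 f \<doteq> f0"
    using eqv_scl[OF eqv_add[OF assms(3) *], of "1/2"] by (simp add: hom_proj_def t)
  show "hom_proj 1 f \<doteq> f1"
    using eqv_scl[OF eqv_diff[OF assms(3) *], of "1/2"] by (simp add: hom_proj_def t)
qed

lemma eqv_hom_proj: "f \<doteq> g \<Longrightarrow> hom_proj p f \<doteq> hom_proj p g"
  unfolding hom_proj_def by (intro eqv_scl eqv_add eqv_pi)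

lemma hom_proj_homg:
  assumes "homg p f" shows "hom_proj r f \<doteq> (if r = p then f else 0)"
proof -
  have c: "s = 0 \<or> s = 1" for s :: bit by (metis bit.exhaust)
  show ?thesis
  proof (cases "p = 0")
    case True
    hence h: "homg 0 f" using assms by simp
    have "hom_proj 0 f \<doteq> f" "hom_proj 1 f \<doteq> 0"
      by (rule hom_proj_unique[OF h homg_0], simp)+
    thus ?thesis using True c[of r] by metis
  next
    case False
    hence p: "p = 1" and h: "homg 1 f" using assms c[of p] by auto
    have "hom_proj 0 f \<doteq> 0" "hom_proj 1 f \<doteq> f"
      by (rule hom_proj_unique[OF homg_0 h], simp)+
    thus ?thesis using p c[of r] by metis
  qed
qed

lemma grade_U: "grade U p = {cls f | f. homg p f}"
proof -
  have w: "set w \<subseteq> carrier (queer K)" if "list_all2 (\<lambda>x q. x \<in> lgrade (queer K) q) w ps" for w ps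
    using that by (induction rule: list_all2_induct) (simp_all add: lgrade_carrier)
  have "restr (carrier (queer K)) f = f" if h: "homg p f" for f
  proof -
    have "set (letters v) \<subseteq> carrier (queer K)" if "v \<in> Poly_Mapping.keys f" for v
      using h w that unfolding homg_def by blast
    thus ?thesis
      unfolding carrier_free_algebra_iff[symmetric] by (simp add: free_algebra_def)
  qed
  hence e: "cls f = env_class (queer K) f" if "homg p f" for f
    using that by (simp add: to_env_def)
  have "grade U p = {env_class (queer K) f | f. homg p f}"
    by (simp add: Uq_def env_algebra_def Let_def homg_def)
  also have "\<dots> = {cls f | f. homg p f}"
    by (rule Collect_cong) (metis e)
  finally show ?thesis .
qed

lemmas U_hom = to_env_hom[folded Uq_def] and U_smult = to_env_smult[folded Uq_def]
  and U_minus = to_env_minus[folded Uq_def] and U_finsum = to_env_finsum[folded Uq_def]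
  and U_ring = ring_UA[folded Uq_def] and U_carrier = carrier_UA[folded Uq_def]

lemma hom_part_U: "hom_part U p (cls f) = cls (hom_proj p f)"
  unfolding hom_part_def
proof (rule the_equality)
  obtain f0 f1 where f: "homg 0 f0" "homg 1 f1" "f \<doteq> f0 + f1"
    using decomp_all[of f] unfolding decomp_def by blast
  let ?c = "\<lambda>p. cls (if p = 0 then f0 else f1)"
  show "\<exists>c. (\<forall>r. c r \<in> grade U r) \<and> cls f = c 0 \<oplus>\<^bsub>U\<^esub> c 1 \<and> cls (hom_proj p f) = c p"
  proof (intro exI[of _ ?c] conjI allI)
    fix r show "?c r \<in> grade U r" using f by (cases r) (auto simp: grade_U)
    show "cls (hom_proj p f) = ?c p" using hom_proj_unique[OF f] by (cases p) (auto simp: cls_eq_iff)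
  qed (simp add: U_hom cls_eq_iff f)
next
  fix Y assume "\<exists>c. (\<forall>r. c r \<in> grade U r) \<and> cls f = c 0 \<oplus>\<^bsub>U\<^esub> c 1 \<and> Y = c p"
  then obtain c where c: "\<And>r. c r \<in> grade U r" "cls f = c 0 \<oplus>\<^bsub>U\<^esub> c 1" "Y = c p" by blast
  obtain f0 f1 where f: "homg 0 f0" "c 0 = cls f0" "homg 1 f1" "c 1 = cls f1"
    using c(1)[of 0] c(1)[of 1] by (auto simp: grade_U)
  have "f \<doteq> f0 + f1" using c(2) by (simp add: f U_hom cls_eq_iff)
  from hom_proj_unique[OF f(1,3) this] show "Y = cls (hom_proj p f)"
    by (cases p) (auto simp: c f cls_eq_iff intro: eqv_sym)
qed

definition scomm :: "imat free \<Rightarrow> imat free \<Rightarrow> imat free" where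
  "scomm f g = (\<Sum>p\<in>UNIV. \<Sum>r\<in>UNIV. hom_proj p f * hom_proj r g - sgn_bit (p * r) \<bullet> (hom_proj r g * hom_proj p f))"

lemma supercommutator_U: "supercommutator U (cls f) (cls g) = cls (scomm f g)"
proof -
  have "finite (UNIV :: bit set)" by (simp add: UNIV_bit)
  thus ?thesis
    unfolding supercommutator_def scomm_def hom_part_U U_hom U_smult U_minus
    by (simp only: U_finsum)
qed

lemma eqv_scomm: "g \<doteq> g' \<Longrightarrow> scomm f g \<doteq> scomm f g'"
  unfolding scomm_def by (intro eqv_sum eqv_diff eqv_mult eqv_scl eqv_hom_proj eqv_refl)

lemma hom_proj_add: "hom_proj p (f + g) = hom_proj p f + hom_proj p g"
  unfolding hom_proj_def by (simp add: pi_add fv.scale_right_distrib algebra_simps)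

lemma hom_proj_scl: "hom_proj p (c \<bullet> f) = c \<bullet> hom_proj p f"
  unfolding hom_proj_def by (simp add: pi_scl fv.scale_right_distrib mult.commute)

lemma scomm_add: "scomm f (g + h) = scomm f g + scomm f h"
proof -
  have "scomm f (g + h) = (\<Sum>p\<in>UNIV. \<Sum>r\<in>UNIV. (hom_proj p f * hom_proj r g - sgn_bit (p * r) \<bullet> (hom_proj r g * hom_proj p f))
      + (hom_proj p f * hom_proj r h - sgn_bit (p * r) \<bullet> (hom_proj r h * hom_proj p f)))"
    unfolding scomm_def
    by (intro sum.cong refl) (simp add: hom_proj_add distrib_left distrib_right fv.scale_right_distrib)
  thus ?thesis by (simp only: sum.distrib scomm_def)
qed

lemma scomm_scl: "scomm f (c \<bullet> g) = c \<bullet> scomm f g"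
proof -
  have "scomm f (c \<bullet> g) = (\<Sum>p\<in>UNIV. \<Sum>r\<in>UNIV. c \<bullet> (hom_proj p f * hom_proj r g - sgn_bit (p * r) \<bullet> (hom_proj r g * hom_proj p f)))"
    unfolding scomm_def
    by (intro sum.cong refl) (simp add: hom_proj_scl fv.scale_right_diff_distrib mult.commute)
  thus ?thesis by (simp only: fv.scale_sum_right scomm_def)
qed

lemma scomm_0: "scomm f 0 = 0"
  using scomm_scl[of f 0 0] by simp

lemma scomm_sum: "scomm f (\<Sum>i\<in>A. g i) = (\<Sum>i\<in>A. scomm f (g i))"
  by (induction A rule: infinite_finite_induct) (simp_all add: scomm_add scomm_0)

lemma scomm_homg:
  assumes "homg r g" shows "scomm f g \<doteq> f * g - g * pip r f"
proof -
  have t: "(1/2) \<bullet> g + (1/2) \<bullet> g = g" for g :: "imat free"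
    using fv.scale_left_distrib[of "1/2" "1/2" g] by simp
  have f: "hom_proj 0 f + hom_proj 1 f = f" "hom_proj 0 f - hom_proj 1 f = pi_aut f"
    by (simp_all add: hom_proj_def fv.scale_right_distrib fv.scale_right_diff_distrib t)
  have "scomm f g \<doteq> (\<Sum>p\<in>UNIV. \<Sum>s\<in>UNIV. hom_proj p f * (if s = r then g else 0)
      - sgn_bit (p * s) \<bullet> ((if s = r then g else 0) * hom_proj p f))"
    unfolding scomm_def by (intro eqv_sum eqv_diff eqv_mult eqv_scl hom_proj_homg[OF assms] eqv_refl)
  also have "\<dots> = (hom_proj 0 f + hom_proj 1 f) * g - g * (if r = 0 then hom_proj 0 f + hom_proj 1 f else hom_proj 0 f - hom_proj 1 f)"
    by (cases r) (simp_all add: UNIV_bit algebra_simps)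
  finally show ?thesis by (cases "r = 0") (simp_all add: f pip_def)
qed

text \<open>The condition \<open>f F\<^sub>a\<^sub>b = F\<^sub>a\<^sub>b \<pi>\<^sup>r f\<close>, with \<open>r\<close> the degree of \<open>F\<^sub>a\<^sub>b\<close> and \<open>\<pi>\<close> the parity automorphism,
  says that the supercommutator of \<open>f\<close> with \<open>F\<^sub>a\<^sub>b\<close> vanishes.\<close>

definition cent :: "int set \<Rightarrow> imat free set" where
  "cent I = {f. \<forall>a\<in>I. \<forall>b\<in>I. f * F a b \<doteq> F a b * pip (par a + par b) f}"

lemma super_centralizer_U:
  assumes I: "I \<subseteq> idx K" "\<And>i. - i \<in> I \<longleftrightarrow> i \<in> I"
  shows "super_centralizer U (env_incl (queer K) ` F_span I) = cls ` cent I"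
proof -
  have fin: "finite I" using I(1) finite_idx finite_subset by blast
  have sub: "F_span I \<subseteq> F_span (idx K)"
    using I unfolding F_span_idx_iff subset_iff F_span_iff[OF fin I(2)] by blast
  have "cls f \<in> super_centralizer U (env_incl (queer K) ` F_span I) \<longleftrightarrow> f \<in> cent I" for f
  proof -
    have "cls f \<in> super_centralizer U (env_incl (queer K) ` F_span I)
        \<longleftrightarrow> (\<forall>y\<in>F_span I. scomm f (free_gen y) \<doteq> 0)"
      using sub by (auto simp: super_centralizer_def U_carrier env_incl_eq queer_sel subset_iff
          supercommutator_U U_hom cls_eq_iff)
    also have "\<dots> \<longleftrightarrow> (\<forall>a\<in>I. \<forall>b\<in>I. scomm f (F a b) \<doteq> 0)"
    proof
      assume "\<forall>y\<in>F_span I. scomm f (free_gen y) \<doteq> 0"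
      thus "\<forall>a\<in>I. \<forall>b\<in>I. scomm f (F a b) \<doteq> 0"
        using F_mat_in_F_span[OF fin] by (auto simp: F_def)
    next
      assume *: "\<forall>a\<in>I. \<forall>b\<in>I. scomm f (F a b) \<doteq> 0"
      show "\<forall>y\<in>F_span I. scomm f (free_gen y) \<doteq> 0"
      proof
        fix y assume y: "y \<in> F_span I"
        have "scomm f (free_gen y) \<doteq> scomm f (\<Sum>i\<in>idx K. \<Sum>j\<in>idx K. (y i j / 2) \<bullet> F i j)"
          using y sub by (intro eqv_scomm gen_expand) auto
        also have "\<dots> = (\<Sum>i\<in>idx K. \<Sum>j\<in>idx K. (y i j / 2) \<bullet> scomm f (F i j))"
          by (simp add: scomm_sum scomm_scl)
        also have "\<dots> \<doteq> (\<Sum>i\<in>idx K. \<Sum>j\<in>idx K. 0)"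
        proof (intro eqv_sum)
          fix i j
          show "(y i j / 2) \<bullet> scomm f (F i j) \<doteq> 0"
          proof (cases "y i j = 0")
            case False
            hence "i \<in> I" "j \<in> I" using y by (auto simp: F_span_iff[OF fin I(2)])
            thus ?thesis using eqv_scl[of "scomm f (F i j)" 0] * by auto
          qed simp
        qed
        finally show "scomm f (free_gen y) \<doteq> 0" by simp
      qed
    qed
    also have "\<dots> \<longleftrightarrow> f \<in> cent I"
    proof -
      have "scomm f (F a b) \<doteq> 0 \<longleftrightarrow> f * F a b \<doteq> F a b * pip (par a + par b) f" if "a \<in> I" "b \<in> I" for a b
      proof -
        have h: "scomm f (F a b) \<doteq> f * F a b - F a b * pip (par a + par b) f"
          using that I by (intro scomm_homg homg_F) auto
        have "scomm f (F a b) \<doteq> 0 \<longleftrightarrow> f * F a b - F a b * pip (par a + par b) f \<doteq> 0"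
          using h by (meson eqv_sym eqv_trans)
        thus ?thesis by (simp add: eqv_def)
      qed
      thus ?thesis by (simp add: cent_def)
    qed
    finally show ?thesis .
  qed
  moreover have "super_centralizer U (env_incl (queer K) ` F_span I) \<subseteq> range cls"
    by (auto simp: super_centralizer_def U_carrier)
  ultimately show ?thesis by blast
qed

end

section \<open>The generators and their invariance\<close>

definition ilists :: "nat \<Rightarrow> nat \<Rightarrow> int list set" where
  "ilists K n = {xs. length xs = n \<and> set xs \<subseteq> idx K}"

lemma finite_ilists [simp]: "finite (ilists K n)"
  using finite_lists_length_eq[OF finite_idx, of K n] by (simp add: ilists_def conj_commute)

lemma ilists_0 [simp]: "ilists K 0 = {[]}"
  by (auto simp: ilists_def)

lemma ilists_Suc: "ilists K (Suc n) = (\<lambda>(x, xs). x # xs) ` (idx K \<times> ilists K n)"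
  by (auto simp: ilists_def image_iff length_Suc_conv)

lemma Cons_in_ilists [simp]: "x # xs \<in> ilists K n \<longleftrightarrow> (\<exists>m. n = Suc m \<and> x \<in> idx K \<and> xs \<in> ilists K m)"
  by (cases n) (auto simp: ilists_def)

lemma sum_ilists_Suc: "(\<Sum>xs\<in>ilists K (Suc n). f xs) = (\<Sum>x\<in>idx K. \<Sum>xs\<in>ilists K n. f (x # xs))"
proof -
  have "inj_on (\<lambda>(x, xs). x # xs) (idx K \<times> ilists K n)"
    by (auto simp: inj_on_def)
  thus ?thesis
    unfolding ilists_Suc by (subst sum.reindex) (auto simp: sum.cartesian_product split_beta intro!: sum.cong)
qed

context queer_env
begin

text \<open>The superscript is shifted by one: \<open>fp n i j\<close> is \<open>F\<^sub>i\<^sub>j\<close> with superscript \<open>n + 1\<close>.\<close>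

fun fp :: "nat \<Rightarrow> int \<Rightarrow> int \<Rightarrow> imat free" where
  "fp 0 i j = F i j"
| "fp (Suc n) i j = (\<Sum>k\<in>idx K. sgn_bit (par k) \<bullet> (F i k * fp n k j))"

lemma homg_sum: "(\<And>i. i \<in> A \<Longrightarrow> homg p (f i)) \<Longrightarrow> homg p (\<Sum>i\<in>A. f i)"
  by (induction A rule: infinite_finite_induct) (auto intro: homg_add homg_0)

lemma homg_fp: "i \<in> idx K \<Longrightarrow> j \<in> idx K \<Longrightarrow> homg (par i + par j) (fp n i j)"
proof (induction n arbitrary: i)
  case (Suc n)
  have "homg (par i + par j) (F i k * fp n k j)" if "k \<in> idx K" for k
    using homg_mult[OF homg_F[OF Suc.prems(1) that] Suc.IH[OF that Suc.prems(2)]]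
    by (simp add: add.assoc)
  thus ?case by (auto intro!: homg_sum homg_scl)
qed (simp add: homg_F)

text \<open>The adjoint action transforms the entries of \<open>G\<close> as it transforms the generators, linearly in
  each of the two indices.\<close>

definition covariant :: "(int \<Rightarrow> int \<Rightarrow> imat free) \<Rightarrow> bool" where
  "covariant G \<longleftrightarrow> (\<forall>a\<in>idx K. \<forall>b\<in>idx K. \<forall>i\<in>idx K. \<forall>j\<in>idx K.
     F a b * G i j - sgn_bit ((par a + par b) * (par i + par j)) \<bullet> (G i j * F a b) \<doteq>
     (\<Sum>k\<in>idx K. F_mat a b k i \<bullet> G k j)
       - sgn_bit ((par a + par b) * (par i + par j)) \<bullet> (\<Sum>k\<in>idx K. F_mat a b j k \<bullet> G i k))"

lemma F_mat_nonzero_par: "a \<in> idx K \<Longrightarrow> b \<in> idx K \<Longrightarrow> F_mat a b i j \<noteq> 0 \<Longrightarrow> par i + par j = par a + par b"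
  using F_mat_lgrade[of a b] by (auto simp: queer_sel gl_super_sel)

text \<open>Both sides are the matrix product of \<open>F\<^sub>a\<^sub>b\<close> and \<open>F\<^sub>i\<^sub>j\<close>; on the right it is expanded in the
  spanning elements. This brings the defining bracket into covariant form.\<close>

lemma F_mat_product_left:
  assumes "a \<in> idx K" "i \<in> idx K" "j \<in> idx K"
  shows "(\<Sum>k\<in>idx K. F_mat a b u k * F_mat i j k v) = (\<Sum>k\<in>idx K. F_mat a b k i * F_mat k j u v)"
proof (cases "u \<in> idx K")
  case True
  have s: "F_mat a b (- u) i = F_mat a b u (- i)" for u i
    by (auto simp: F_mat_def E_mat_def minus_equation_iff)
  have "(\<Sum>k\<in>idx K. F_mat a b u k * F_mat i j k v)
      = (\<Sum>k\<in>idx K. (if k = i then F_mat a b u k * (if v = j then 1 else 0) else 0)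
          + (if k = - i then F_mat a b u k * (if v = - j then 1 else 0) else 0))"
    by (intro sum.cong refl) (auto simp: F_mat_def[of i j] E_mat_def)
  also have "\<dots> = F_mat a b u i * (if v = j then 1 else 0) + F_mat a b u (- i) * (if v = - j then 1 else 0)"
    using assms by (simp add: sum.distrib)
  also have "\<dots> = (\<Sum>k\<in>idx K. (if k = u then F_mat a b k i * (if v = j then 1 else 0) else 0)
          + (if k = - u then F_mat a b k i * (if v = - j then 1 else 0) else 0))"
    using True by (simp add: sum.distrib s)
  also have "\<dots> = (\<Sum>k\<in>idx K. F_mat a b k i * F_mat k j u v)"
    by (intro sum.cong refl) (auto simp: F_mat_def[of _ j] E_mat_def)
  finally show ?thesis .
next
  case False
  have "F_mat k j u v = 0" "F_mat a b u k = 0" if "k \<in> idx K" for k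
    using that False assms(1) by (auto simp: F_mat_def E_mat_def)
  thus ?thesis by simp
qed

lemma F_mat_transpose: "F_mat a b i j = F_mat b a j i"
  by (auto simp: F_mat_def E_mat_def)

lemma F_mat_product_right:
  assumes "b \<in> idx K" "i \<in> idx K" "j \<in> idx K"
  shows "(\<Sum>k\<in>idx K. F_mat i j u k * F_mat a b k v) = (\<Sum>k\<in>idx K. F_mat a b j k * F_mat i k u v)"
  using F_mat_product_left[OF assms(1,3,2), of a v u]
  by (simp add: F_mat_transpose[of b a] F_mat_transpose[of j i] F_mat_transpose[of _ i] mult.commute)

lemma gen_diff:
  assumes "x \<in> F_span (idx K)" "y \<in> F_span (idx K)"
  shows "free_gen (\<lambda>i j. x i j - c * y i j) \<doteq> free_gen x - c \<bullet> free_gen y"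
proof -
  have "free_gen (\<lambda>i j. x i j + (- c) * y i j) \<doteq> free_gen x + free_gen (\<lambda>i j. (- c) * y i j)"
    by (intro gen_add F_span_scale assms)
  also have "\<dots> \<doteq> free_gen x + (- c) \<bullet> free_gen y"
    by (intro eqv_add gen_scale assms eqv_refl)
  finally show ?thesis by simp
qed

lemma covariant_F: "covariant F"
  unfolding covariant_def
proof (intro ballI)
  fix a b i j assume *: "a \<in> idx K" "b \<in> idx K" "i \<in> idx K" "j \<in> idx K"
  let ?s = "sgn_bit ((par a + par b) * (par i + par j))"
  let ?x = "\<lambda>u v. \<Sum>k\<in>idx K. F_mat a b k i * F_mat k j u v"
  let ?y = "\<lambda>u v. \<Sum>k\<in>idx K. F_mat a b j k * F_mat i k u v"
  have "F a b * F i j - ?s \<bullet> (F i j * F a b) \<doteq> free_gen (\<lambda>u v. ?x u v - ?s * ?y u v)"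
    using gen_comm[OF F_mat_lgrade[OF *(1,2)] F_mat_lgrade[OF *(3,4)]]
    unfolding F_mat_product_left[OF *(1,3,4)] F_mat_product_right[OF *(2,3,4)] F_def .
  also have "\<dots> \<doteq> free_gen ?x - ?s \<bullet> free_gen ?y"
    by (intro gen_diff F_span_sum) (auto simp: *)
  also have "\<dots> \<doteq> (\<Sum>k\<in>idx K. F_mat a b k i \<bullet> F k j) - ?s \<bullet> (\<Sum>k\<in>idx K. F_mat a b j k \<bullet> F i k)"
    unfolding F_def by (intro eqv_diff eqv_scl gen_sum) (auto simp: *)
  finally show "F a b * F i j - ?s \<bullet> (F i j * F a b) \<doteq>
    (\<Sum>k\<in>idx K. F_mat a b k i \<bullet> F k j) - ?s \<bullet> (\<Sum>k\<in>idx K. F_mat a b j k \<bullet> F i k)" .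
qed

text \<open>By the Leibniz rule the supercommutator acts on both factors. The two contributions at the
  summation index cancel, because the sign \<open>(-1)\<^sup>k\<close> in the product compensates for moving \<open>F\<^sub>a\<^sub>b\<close>
  past the first factor.\<close>

lemma covariant_mult:
  assumes "covariant G" "covariant H"
  shows "covariant (\<lambda>i j. \<Sum>k\<in>idx K. sgn_bit (par k) \<bullet> (G i k * H k j))"
  unfolding covariant_def
proof (intro ballI)
  fix a b i j assume *: "a \<in> idx K" "b \<in> idx K" "i \<in> idx K" "j \<in> idx K"
  define y where "y = F a b"
  define m where "m = F_mat a b"
  define s where "s = (\<lambda>i j. sgn_bit ((par a + par b) * (par i + par j)))"
  let ?GH = "\<lambda>i j. \<Sum>k\<in>idx K. sgn_bit (par k) \<bullet> (G i k * H k j)"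
  let ?I = "idx K"
  have ss: "s i k * s k j = s i j" for i j k
    unfolding s_def by (cases "par a + par b"; cases "par i"; cases "par j"; cases "par k") simp_all
  have m: "sgn_bit (par k) * s i k * m k l = sgn_bit (par l) * s i l * m k l" for k l
  proof (cases "m k l = 0")
    case False
    hence "par k + par l = par a + par b" unfolding m_def by (rule F_mat_nonzero_par[OF *(1,2)])
    thus ?thesis unfolding s_def
      by (cases "par a + par b"; cases "par i"; cases "par l"; cases "par k") simp_all
  qed simp
  have G: "y * G i k - s i k \<bullet> (G i k * y) \<doteq> (\<Sum>l\<in>?I. m l i \<bullet> G l k) - s i k \<bullet> (\<Sum>l\<in>?I. m k l \<bullet> G i l)"
    and H: "y * H k j - s k j \<bullet> (H k j * y) \<doteq> (\<Sum>l\<in>?I. m l k \<bullet> H l j) - s k j \<bullet> (\<Sum>l\<in>?I. m j l \<bullet> H k l)"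
    if "k \<in> idx K" for k
    using assms * that unfolding covariant_def y_def s_def m_def by auto
  have "y * ?GH i j - s i j \<bullet> (?GH i j * y)
     = (\<Sum>k\<in>?I. sgn_bit (par k) \<bullet> ((y * G i k - s i k \<bullet> (G i k * y)) * H k j
          + s i k \<bullet> (G i k * (y * H k j - s k j \<bullet> (H k j * y)))))"
    unfolding sum_distrib_left sum_distrib_right fv.scale_sum_right sum_subtractf[symmetric]
    by (intro sum.cong refl)
      (simp add: left_diff_distrib right_diff_distrib fv.scale_right_diff_distrib fv.scale_right_distrib
        mult.assoc ss mult.left_commute[of _ "sgn_bit _"] mult.commute[of _ "sgn_bit _"])
  also have "\<dots> \<doteq> (\<Sum>k\<in>?I. sgn_bit (par k) \<bullet> (((\<Sum>l\<in>?I. m l i \<bullet> G l k) - s i k \<bullet> (\<Sum>l\<in>?I. m k l \<bullet> G i l)) * H k j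
          + s i k \<bullet> (G i k * ((\<Sum>l\<in>?I. m l k \<bullet> H l j) - s k j \<bullet> (\<Sum>l\<in>?I. m j l \<bullet> H k l)))))"
    by (rule eqv_sum, rule eqv_scl, rule eqv_add, rule eqv_mult, erule G, rule eqv_refl,
        rule eqv_scl, rule eqv_mult, rule eqv_refl, erule H)
  also have "\<dots> = (\<Sum>k\<in>?I. \<Sum>l\<in>?I. (sgn_bit (par k) * m l i) \<bullet> (G l k * H k j))
      - (\<Sum>k\<in>?I. \<Sum>l\<in>?I. (sgn_bit (par k) * s i k * m k l) \<bullet> (G i l * H k j))
      + (\<Sum>k\<in>?I. \<Sum>l\<in>?I. (sgn_bit (par k) * s i k * m l k) \<bullet> (G i k * H l j))
      - (\<Sum>k\<in>?I. \<Sum>l\<in>?I. (sgn_bit (par k) * (s i k * s k j) * m j l) \<bullet> (G i k * H k l))"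
  proof -
    have ex: "c \<bullet> ((A - r \<bullet> B) * h + r \<bullet> (g * (C - t \<bullet> D)))
        = c \<bullet> (A * h) - (c * r) \<bullet> (B * h) + (c * r) \<bullet> (g * C) - (c * (r * t)) \<bullet> (g * D)"
      for c r t and A B C D g h :: "imat free"
      by (simp add: left_diff_distrib right_diff_distrib fv.scale_right_diff_distrib fv.scale_right_distrib)
    show ?thesis
      unfolding ex
      by (simp only: sum_subtractf sum.distrib sum_distrib_left sum_distrib_right fv.scale_sum_right
          fv.scale_scale scl_mult_left mult_scl_right mult.assoc)
  qed
  also have "(\<Sum>k\<in>?I. \<Sum>l\<in>?I. (sgn_bit (par k) * s i k * m l k) \<bullet> (G i k * H l j))
      = (\<Sum>k\<in>?I. \<Sum>l\<in>?I. (sgn_bit (par k) * s i k * m k l) \<bullet> (G i l * H k j))"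
    by (subst sum.swap) (intro sum.cong refl arg_cong2[where f = scl] m[symmetric])
  also have "(\<Sum>k\<in>?I. \<Sum>l\<in>?I. (sgn_bit (par k) * m l i) \<bullet> (G l k * H k j)) = (\<Sum>l\<in>?I. m l i \<bullet> ?GH l j)"
    unfolding fv.scale_sum_right by (subst sum.swap) (simp add: mult.commute)
  also have "(\<Sum>k\<in>?I. \<Sum>l\<in>?I. (sgn_bit (par k) * (s i k * s k j) * m j l) \<bullet> (G i k * H k l))
      = s i j \<bullet> (\<Sum>l\<in>?I. m j l \<bullet> ?GH i l)"
    unfolding fv.scale_sum_right ss by (subst sum.swap) (simp add: mult_ac)
  finally show "F a b * ?GH i j - sgn_bit ((par a + par b) * (par i + par j)) \<bullet> (?GH i j * F a b) \<doteq>
     (\<Sum>k\<in>?I. F_mat a b k i \<bullet> ?GH k j)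
       - sgn_bit ((par a + par b) * (par i + par j)) \<bullet> (\<Sum>k\<in>?I. F_mat a b j k \<bullet> ?GH i k)"
    unfolding y_def m_def s_def by simp
qed

lemma covariant_fp: "covariant (fp n)"
proof (induction n)
  case 0
  have "fp 0 = F" by (intro ext) simp
  thus ?case by (simp only: covariant_F)
next
  case (Suc n)
  have "fp (Suc n) = (\<lambda>i j. \<Sum>k\<in>idx K. sgn_bit (par k) \<bullet> (F i k * fp n k j))" by (intro ext) simp
  thus ?case using covariant_mult[OF covariant_F Suc] by (simp only:)
qed

lemma cent_mult: "f \<in> cent I \<Longrightarrow> g \<in> cent I \<Longrightarrow> f * g \<in> cent I"
  unfolding cent_def
proof (intro CollectI ballI)
  fix a b assume *: "f \<in> {f. \<forall>a\<in>I. \<forall>b\<in>I. f * F a b \<doteq> F a b * pip (par a + par b) f}"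
    "g \<in> {f. \<forall>a\<in>I. \<forall>b\<in>I. f * F a b \<doteq> F a b * pip (par a + par b) f}" "a \<in> I" "b \<in> I"
  let ?p = "pip (par a + par b)"
  have "f * g * F a b = f * (g * F a b)" by (simp add: mult.assoc)
  also have "\<dots> \<doteq> f * (F a b * ?p g)" using * by (intro eqv_mult[OF eqv_refl]) auto
  also have "\<dots> = f * F a b * ?p g" by (simp add: mult.assoc)
  also have "\<dots> \<doteq> F a b * ?p f * ?p g" using * by (intro eqv_mult[OF _ eqv_refl]) auto
  also have "\<dots> = F a b * ?p (f * g)" by (simp add: pip_def pi_mult mult.assoc)
  finally show "f * g * F a b \<doteq> F a b * ?p (f * g)" .
qed

lemma cent_add: "f \<in> cent I \<Longrightarrow> g \<in> cent I \<Longrightarrow> f + g \<in> cent I"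
  unfolding cent_def
proof (intro CollectI ballI)
  fix a b assume *: "f \<in> {f. \<forall>a\<in>I. \<forall>b\<in>I. f * F a b \<doteq> F a b * pip (par a + par b) f}"
    "g \<in> {f. \<forall>a\<in>I. \<forall>b\<in>I. f * F a b \<doteq> F a b * pip (par a + par b) f}" "a \<in> I" "b \<in> I"
  hence "f * F a b + g * F a b \<doteq> F a b * pip (par a + par b) f + F a b * pip (par a + par b) g"
    by (intro eqv_add) auto
  thus "(f + g) * F a b \<doteq> F a b * pip (par a + par b) (f + g)"
    by (simp add: pip_def pi_add distrib_left distrib_right split: if_splits)
qed

lemma cent_scl: "f \<in> cent I \<Longrightarrow> c \<bullet> f \<in> cent I"
  unfolding cent_def
proof (intro CollectI ballI)
  fix a b assume "f \<in> {f. \<forall>a\<in>I. \<forall>b\<in>I. f * F a b \<doteq> F a b * pip (par a + par b) f}" "a \<in> I" "b \<in> I"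
  hence "c \<bullet> (f * F a b) \<doteq> c \<bullet> (F a b * pip (par a + par b) f)" by (intro eqv_scl) auto
  thus "c \<bullet> f * F a b \<doteq> F a b * pip (par a + par b) (c \<bullet> f)"
    by (simp add: pip_def pi_scl split: if_splits)
qed

lemma cent_eqv: "f \<in> cent I \<Longrightarrow> f \<doteq> g \<Longrightarrow> g \<in> cent I"
  unfolding cent_def
proof (intro CollectI ballI)
  fix a b assume *: "f \<in> {f. \<forall>a\<in>I. \<forall>b\<in>I. f * F a b \<doteq> F a b * pip (par a + par b) f}" "f \<doteq> g" "a \<in> I" "b \<in> I"
  have "g * F a b \<doteq> f * F a b" using *(2) by (intro eqv_mult eqv_refl) (rule eqv_sym)
  also have "\<dots> \<doteq> F a b * pip (par a + par b) f" using * by auto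
  also have "\<dots> \<doteq> F a b * pip (par a + par b) g"
    using *(2) by (intro eqv_mult eqv_refl) (auto simp: pip_def eqv_pi)
  finally show "g * F a b \<doteq> F a b * pip (par a + par b) g" .
qed

lemma cent_1: "1 \<in> cent I"
  by (simp add: cent_def pip_def)

lemma cent_homg:
  assumes "homg p f" "I \<subseteq> idx K"
    and "\<And>a b. a \<in> I \<Longrightarrow> b \<in> I \<Longrightarrow> F a b * f - sgn_bit ((par a + par b) * p) \<bullet> (f * F a b) \<doteq> 0"
  shows "f \<in> cent I"
  unfolding cent_def
proof (intro CollectI ballI)
  fix a b assume ab: "a \<in> I" "b \<in> I"
  let ?s = "sgn_bit ((par a + par b) * p)"
  have "f * F a b = ?s \<bullet> (?s \<bullet> (f * F a b))" by simp
  also have "\<dots> \<doteq> ?s \<bullet> (F a b * f)"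
  proof -
    have "F a b * f \<doteq> ?s \<bullet> (f * F a b)" using assms(3)[OF ab] by (simp add: eqv_def)
    thus ?thesis by (intro eqv_scl) (rule eqv_sym)
  qed
  also have "\<dots> = F a b * (?s \<bullet> f)" by simp
  also have "\<dots> \<doteq> F a b * pip (par a + par b) f"
  proof (intro eqv_mult eqv_refl)
    have "par a + par b = 0 \<or> par a + par b = 1" by (metis bit.exhaust)
    thus "?s \<bullet> f \<doteq> pip (par a + par b) f"
      using eqv_sym[OF homg_pi[OF assms(1)]] by (auto simp: pip_def)
  qed
  finally show "f * F a b \<doteq> F a b * pip (par a + par b) f" .
qed

text \<open>For \<open>|a|, |b| > N\<close> all coefficients on the right-hand side of the covariance relation vanish.\<close>

lemma fp_cent:
  assumes "i \<in> idx N" "j \<in> idx N" "N \<le> K"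
  shows "fp n i j \<in> cent (idx K - idx N)"
proof (rule cent_homg)
  have ij: "i \<in> idx K" "j \<in> idx K" using assms by (auto simp: idx_def)
  show "homg (par i + par j) (fp n i j)" by (rule homg_fp[OF ij])
  fix a b assume ab: "a \<in> idx K - idx N" "b \<in> idx K - idx N"
  have z: "F_mat a b k i = 0" "F_mat a b j k = 0" for k
    using ab assms by (auto simp: F_mat_def E_mat_def)
  show "F a b * fp n i j - sgn_bit ((par a + par b) * (par i + par j)) \<bullet> (fp n i j * F a b) \<doteq> 0"
    using covariant_fp[of n, unfolded covariant_def, rule_format, of a b i j] ab ij by (simp add: z)
qed auto

text \<open>In the trace the two sums of the covariance relation coincide.\<close>

lemma trace_fp_cent: "I \<subseteq> idx K \<Longrightarrow> (\<Sum>k\<in>idx K. fp n k k) \<in> cent I"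
proof (rule cent_homg[where p = 0])
  show "homg 0 (\<Sum>k\<in>idx K. fp n k k)"
    using homg_fp[of _ _ n] by (intro homg_sum) (metis bit_add_self(1))
  fix a b assume "I \<subseteq> idx K" "a \<in> I" "b \<in> I"
  hence ab: "a \<in> idx K" "b \<in> idx K" by auto
  have "(\<Sum>k\<in>idx K. F a b * fp n k k - fp n k k * F a b)
      \<doteq> (\<Sum>k\<in>idx K. (\<Sum>l\<in>idx K. F_mat a b l k \<bullet> fp n l k) - (\<Sum>l\<in>idx K. F_mat a b k l \<bullet> fp n k l))"
  proof (rule eqv_sum)
    fix k assume "k \<in> idx K"
    thus "F a b * fp n k k - fp n k k * F a b
        \<doteq> (\<Sum>l\<in>idx K. F_mat a b l k \<bullet> fp n l k) - (\<Sum>l\<in>idx K. F_mat a b k l \<bullet> fp n k l)"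
      using covariant_fp[of n] ab unfolding covariant_def by force
  qed
  also have "\<dots> = 0"
    unfolding sum_subtractf by (subst sum.swap) simp
  finally show "F a b * (\<Sum>k\<in>idx K. fp n k k) - sgn_bit ((par a + par b) * 0) \<bullet> ((\<Sum>k\<in>idx K. fp n k k) * F a b) \<doteq> 0"
    by (simp add: sum_distrib_left sum_distrib_right sum_subtractf)
qed

text \<open>The preimage in the ring of words of the subalgebra in question. By the shift of the
  superscript, even \<open>n\<close> gives the traces with odd superscript.\<close>

inductive_set Gen :: "nat \<Rightarrow> imat free set" for N where
  null: "f \<in> nl \<Longrightarrow> f \<in> Gen N"
| one: "1 \<in> Gen N"
| tr: "even n \<Longrightarrow> (\<Sum>k\<in>idx K. fp n k k) \<in> Gen N"
| fp: "i \<in> idx N \<Longrightarrow> j \<in> idx N \<Longrightarrow> fp n i j \<in> Gen N"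
| add: "f \<in> Gen N \<Longrightarrow> g \<in> Gen N \<Longrightarrow> f + g \<in> Gen N"
| scl: "f \<in> Gen N \<Longrightarrow> c \<bullet> f \<in> Gen N"
| mult: "f \<in> Gen N \<Longrightarrow> g \<in> Gen N \<Longrightarrow> f * g \<in> Gen N"

lemma Gen_cent:
  assumes "f \<in> Gen N" "N \<le> K" shows "f \<in> cent (idx K - idx N)"
  using assms(1)
proof (induction rule: Gen.induct)
  case (null f)
  have "0 \<in> cent (idx K - idx N)" using cent_scl[OF cent_1, of 0] by simp
  thus ?case by (rule cent_eqv) (use null env_null_uminus in \<open>auto simp: eqv_def\<close>)
qed (auto intro: cent_1 trace_fp_cent fp_cent assms(2) cent_add cent_scl cent_mult)

fun fpath :: "int \<Rightarrow> int list \<Rightarrow> int \<Rightarrow> imat free" where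
  "fpath i [] j = F i j"
| "fpath i (k # ks) j = F i k * fpath k ks j"

lemma F_elt_eq: "i \<in> idx K \<Longrightarrow> j \<in> idx K \<Longrightarrow> F_elt K i j = cls (F i j)"
  unfolding F_elt_def F_def by (rule env_incl_eq) (simp add: queer_sel)

lemma F_path_eq: "i \<in> idx K \<Longrightarrow> j \<in> idx K \<Longrightarrow> set ks \<subseteq> idx K \<Longrightarrow> F_path K i ks j = cls (fpath i ks j)"
  by (induction ks arbitrary: i) (simp_all add: F_elt_eq U_hom)

lemma fp_eq_sum: "fp n i j = (\<Sum>ks\<in>ilists K n. sgn_bit (sum_list (map par ks)) \<bullet> fpath i ks j)"
  by (induction n arbitrary: i)
    (simp_all add: sum_ilists_Suc sum_distrib_left fv.scale_sum_right sgn_bit_add)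

lemma F_pow_eq:
  assumes "i \<in> idx K" "j \<in> idx K" "n \<ge> 1"
  shows "F_pow K n i j = cls (fp (n - 1) i j)"
proof -
  have "F_pow K n i j = (\<Oplus>\<^bsub>U\<^esub>ks\<in>ilists K (n - 1). cls (sgn_bit (sum_list (map par ks)) \<bullet> fpath i ks j))"
    unfolding F_pow_def ilists_def[symmetric]
  proof (rule abelian_monoid.finsum_cong'[OF abelian_group.axioms(1)[OF ring.is_abelian_group[OF U_ring]]])
    fix ks assume "ks \<in> ilists K (n - 1)"
    thus "sgn_bit (sum_list (map par ks)) \<odot>\<^bsub>U\<^esub> F_path K i ks j = cls (sgn_bit (sum_list (map par ks)) \<bullet> fpath i ks j)"
      using assms by (simp add: F_path_eq ilists_def U_smult)
  qed (auto simp: U_carrier)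
  also have "\<dots> = cls (fp (n - 1) i j)"
    by (simp add: U_finsum fp_eq_sum)
  finally show ?thesis .
qed

lemma C_elt_eq:
  assumes "n \<ge> 1" shows "C_elt K n = cls (\<Sum>k\<in>idx K. fp (n - 1) k k)"
proof -
  have "C_elt K n = (\<Oplus>\<^bsub>U\<^esub>k\<in>idx K. cls (fp (n - 1) k k))"
    unfolding C_elt_def
  proof (rule abelian_monoid.finsum_cong'[OF abelian_group.axioms(1)[OF ring.is_abelian_group[OF U_ring]]])
    fix k assume "k \<in> idx K"
    thus "F_pow K n k k = cls (fp (n - 1) k k)" by (intro F_pow_eq assms)
  qed (auto simp: U_carrier)
  thus ?thesis by (simp add: U_finsum)
qed

lemma generated_eq:
  assumes "N \<le> K"
  shows "generated_subalgebra U ({C_elt K n | n. odd n}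
      \<union> {F_pow K n i j | n i j. n \<ge> 1 \<and> i \<in> idx N \<and> j \<in> idx N}) = cls ` Gen N"
    (is "generated_subalgebra U ?S = _")
proof -
  have sub: "i \<in> idx K" if "i \<in> idx N" for i using assms that by (auto simp: idx_def)
  have "X \<in> cls ` Gen N" if "X \<in> generated_subalgebra U ?S" for X
    using that
  proof (induction rule: generated_subalgebra.induct)
    case (incl X)
    then consider n where "odd n" "X = C_elt K n"
      | n i j where "n \<ge> 1" "i \<in> idx N" "j \<in> idx N" "X = F_pow K n i j" by blast
    thus ?case
    proof cases
      case 1
      hence "n \<ge> 1" "even (n - 1)" by (auto simp: odd_pos Suc_leI)
      thus ?thesis using 1 Gen.tr[of "n - 1" N] by (simp only: C_elt_eq imageI)
    next
      case 2
      thus ?thesis by (auto simp: F_pow_eq sub intro: Gen.fp)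
    qed
  qed (auto simp: U_hom U_smult intro: Gen.intros)
  moreover have "cls f \<in> generated_subalgebra U ?S" if "f \<in> Gen N" for f
    using that
  proof (induction rule: Gen.induct)
    case (null f)
    hence "cls f = 0 \<odot>\<^bsub>U\<^esub> \<one>\<^bsub>U\<^esub>" by (simp add: U_hom U_smult cls_eq_iff eqv_0)
    thus ?case by (auto intro: generated_subalgebra.intros)
  next
    case one
    thus ?case unfolding U_hom(3)[symmetric] by (rule generated_subalgebra.one)
  next
    case (tr n)
    hence "cls (\<Sum>k\<in>idx K. fp n k k) \<in> ?S"
      using C_elt_eq[of "Suc n"] by (intro UnI1 CollectI exI[of _ "Suc n"]) simp
    thus ?case by (rule generated_subalgebra.incl)
  next
    case (fp i j n)
    hence "cls (fp n i j) \<in> ?S"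
      using F_pow_eq[of i j "Suc n"]
      by (intro UnI2 CollectI exI[of _ "Suc n"] exI[of _ i] exI[of _ j]) (simp add: sub)
    thus ?case by (rule generated_subalgebra.incl)
  qed (auto simp: U_hom[symmetric] U_smult[symmetric] intro: generated_subalgebra.intros)
  ultimately show ?thesis by blast
qed

lemma A_cent_eq:
  assumes "K = N + M"
  shows "A_cent N M = cls ` cent (idx K - idx N)"
  unfolding A_cent_def assms[symmetric]
  by (rule super_centralizer_U) auto

end

section \<open>The filtration by degree\<close>

context queer_env
begin

fun Fw :: "(int \<times> int) list \<Rightarrow> imat free" where
  "Fw [] = 1"
| "Fw ((i, j) # w) = F i j * Fw w"

lemma Fw_append: "Fw (v @ w) = Fw v * Fw w"
  by (induction v rule: Fw.induct) (simp_all add: mult.assoc)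

definition valid :: "(int \<times> int) list \<Rightarrow> bool" where
  "valid w \<longleftrightarrow> set w \<subseteq> idx K \<times> idx K"

definition parw :: "(int \<times> int) list \<Rightarrow> bit" where
  "parw w = sum_list (map (\<lambda>(i, j). par i + par j) w)"

lemma valid_simps [simp]: "valid []" "valid ((i, j) # w) \<longleftrightarrow> i \<in> idx K \<and> j \<in> idx K \<and> valid w"
  "valid (v @ w) \<longleftrightarrow> valid v \<and> valid w"
  by (auto simp: valid_def)

lemma parw_simps [simp]: "parw [] = 0" "parw ((i, j) # w) = par i + par j + parw w"
  "parw (v @ w) = parw v + parw w"
  by (auto simp: parw_def)

text \<open>The span, modulo the relations, of the products \<open>Fw w\<close> over the words selected by \<open>P\<close>. The two
  instances used below bound the length strictly: \<open>Low n\<close> contains the elements of degree less than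
  \<open>n\<close>, so that \<open>Low 0\<close> is zero in the enveloping algebra, and \<open>HW n p\<close> restricts to words of
  parity \<open>p\<close>.\<close>

inductive_set Filt :: "((int \<times> int) list \<Rightarrow> bool) \<Rightarrow> imat free set" for P where
  null: "f \<in> nl \<Longrightarrow> f \<in> Filt P"
| word: "P w \<Longrightarrow> Fw w \<in> Filt P"
| add: "f \<in> Filt P \<Longrightarrow> g \<in> Filt P \<Longrightarrow> f + g \<in> Filt P"
| scl: "f \<in> Filt P \<Longrightarrow> c \<bullet> f \<in> Filt P"

lemma Filt_mono: "(\<And>w. P w \<Longrightarrow> Q w) \<Longrightarrow> f \<in> Filt P \<Longrightarrow> f \<in> Filt Q"
  by (rotate_tac 1, induction rule: Filt.induct) (auto intro: Filt.intros)

lemma Filt_0: "0 \<in> Filt P"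
  by (rule Filt.null) (rule env_null.zero)

lemma Filt_uminus: "f \<in> Filt P \<Longrightarrow> - f \<in> Filt P"
  using Filt.scl[of f P "-1"] by simp

lemma Filt_diff: "f \<in> Filt P \<Longrightarrow> g \<in> Filt P \<Longrightarrow> f - g \<in> Filt P"
  using Filt.add[OF _ Filt_uminus, of f P g] by simp

lemma Filt_sum: "(\<And>i. i \<in> A \<Longrightarrow> f i \<in> Filt P) \<Longrightarrow> (\<Sum>i\<in>A. f i) \<in> Filt P"
  by (induction A rule: infinite_finite_induct) (auto intro: Filt.add Filt_0)

lemma Filt_eqv: "f \<doteq> g \<Longrightarrow> g \<in> Filt P \<Longrightarrow> f \<in> Filt P"
  using Filt.add[OF Filt.null[of "f - g" P], of g] by (simp add: eqv_def)

lemma Filt_mult: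
  assumes "\<And>v w. P v \<Longrightarrow> Q w \<Longrightarrow> R (v @ w)" "f \<in> Filt P" "g \<in> Filt Q"
  shows "f * g \<in> Filt R"
  using assms(2)
proof (induction rule: Filt.induct)
  case (word v)
  from assms(3) show ?case
  proof (induction rule: Filt.induct)
    case (word w)
    thus ?case using assms(1)[of v w] \<open>P v\<close> by (simp add: Filt.word flip: Fw_append)
  qed (auto simp: distrib_left intro: Filt.intros env_null_mult_left)
qed (auto simp: distrib_right intro: Filt.intros env_null_mult_right)

abbreviation HW :: "nat \<Rightarrow> bit \<Rightarrow> imat free set" where
  "HW n p \<equiv> Filt (\<lambda>w. length w < n \<and> valid w \<and> parw w = p)"

abbreviation Low :: "nat \<Rightarrow> imat free set" where
  "Low n \<equiv> Filt (\<lambda>w. length w < n \<and> valid w)"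

lemma HW_Low: "f \<in> HW n p \<Longrightarrow> f \<in> Low n"
  by (erule Filt_mono[rotated]) auto

lemma Low_mono: "f \<in> Low n \<Longrightarrow> n \<le> m \<Longrightarrow> f \<in> Low m"
  by (erule Filt_mono[rotated]) auto

lemma F_HW: "i \<in> idx K \<Longrightarrow> j \<in> idx K \<Longrightarrow> n \<ge> 2 \<Longrightarrow> F i j \<in> HW n (par i + par j)"
  using Filt.word[of "\<lambda>w. length w < n \<and> valid w \<and> parw w = par i + par j" "[(i, j)]"] by simp

lemma HW_mult: "f \<in> HW (Suc n) p \<Longrightarrow> g \<in> HW (Suc m) r \<Longrightarrow> f * g \<in> HW (Suc (n + m)) (p + r)"
  by (rule Filt_mult) auto

lemma Low_mult_left: "f \<in> Low n \<Longrightarrow> g \<in> Low (Suc m) \<Longrightarrow> f * g \<in> Low (n + m)"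
  by (rule Filt_mult) auto

lemma Low_mult_right: "f \<in> Low (Suc n) \<Longrightarrow> g \<in> Low m \<Longrightarrow> f * g \<in> Low (n + m)"
  by (rule Filt_mult) auto

lemma Low_1: "n > 0 \<Longrightarrow> 1 \<in> Low n"
  using Filt.word[of "\<lambda>w. length w < n \<and> valid w" "[]"] by simp

lemma F_Low: "i \<in> idx K \<Longrightarrow> j \<in> idx K \<Longrightarrow> n \<ge> 2 \<Longrightarrow> F i j \<in> Low n"
  by (rule HW_Low) (rule F_HW)

text \<open>By covariance a supercommutator of two generators is linear in the generators.\<close>

lemma swap_FF:
  assumes "i \<in> idx K" "j \<in> idx K" "k \<in> idx K" "l \<in> idx K"
  shows "F i j * F k l - sgn_bit ((par i + par j) * (par k + par l)) \<bullet> (F k l * F i j) \<in> Low 2"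
proof -
  have "F i j * F k l - sgn_bit ((par i + par j) * (par k + par l)) \<bullet> (F k l * F i j) \<doteq>
    (\<Sum>u\<in>idx K. F_mat i j u k \<bullet> F u l)
       - sgn_bit ((par i + par j) * (par k + par l)) \<bullet> (\<Sum>u\<in>idx K. F_mat i j l u \<bullet> F k u)"
    using covariant_F assms unfolding covariant_def by blast
  thus ?thesis
    by (rule Filt_eqv) (intro Filt_diff Filt.scl Filt_sum F_Low; simp add: assms)
qed

lemma swap_F_Fw:
  assumes "i \<in> idx K" "j \<in> idx K" "valid w"
  shows "F i j * Fw w - sgn_bit ((par i + par j) * parw w) \<bullet> (Fw w * F i j) \<in> Low (Suc (length w))"
  using assms(3)
proof (induction w)
  case Nil
  show ?case by (simp add: Filt_0)
next
  case (Cons kl w)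
  obtain k l where kl: "kl = (k, l)" by (cases kl)
  let ?p = "par i + par j" and ?r = "par k + par l"
  have *: "k \<in> idx K" "l \<in> idx K" "valid w" using Cons.prems by (auto simp: kl)
  have "F i j * Fw (kl # w) - sgn_bit (?p * parw (kl # w)) \<bullet> (Fw (kl # w) * F i j)
      = (F i j * F k l - sgn_bit (?p * ?r) \<bullet> (F k l * F i j)) * Fw w
        + sgn_bit (?p * ?r) \<bullet> (F k l * (F i j * Fw w - sgn_bit (?p * parw w) \<bullet> (Fw w * F i j)))"
    by (simp add: kl algebra_simps fv.scale_right_diff_distrib sgn_bit_add distrib_left)
  also have "\<dots> \<in> Low (2 + length w)"
  proof (intro Filt.add Filt.scl)
    have "Fw w \<in> Low (Suc (length w))" by (rule Filt.word) (simp add: *)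
    from Low_mult_left[OF swap_FF this] show "(F i j * F k l - sgn_bit (?p * ?r) \<bullet> (F k l * F i j)) * Fw w \<in> Low (2 + length w)"
      using * assms by simp
    have "F k l * (F i j * Fw w - sgn_bit (?p * parw w) \<bullet> (Fw w * F i j)) \<in> Low (1 + Suc (length w))"
      by (rule Low_mult_right[OF _ Cons.IH[OF *(3)]]) (simp add: F_Low *)
    thus "F k l * (F i j * Fw w - sgn_bit (?p * parw w) \<bullet> (Fw w * F i j)) \<in> Low (2 + length w)" by simp
  qed
  finally show ?case by simp
qed

lemma swap_Fw_Fw:
  assumes "valid v" "valid w"
  shows "Fw v * Fw w - sgn_bit (parw v * parw w) \<bullet> (Fw w * Fw v) \<in> Low (length v + length w)"
  using assms(1)
proof (induction v)
  case Nil
  show ?case by (simp add: Filt_0)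
next
  case (Cons ij v)
  obtain i j where ij: "ij = (i, j)" by (cases ij)
  let ?p = "par i + par j"
  have *: "i \<in> idx K" "j \<in> idx K" "valid v" using Cons.prems by (auto simp: ij)
  have "Fw (ij # v) * Fw w - sgn_bit (parw (ij # v) * parw w) \<bullet> (Fw w * Fw (ij # v))
      = F i j * (Fw v * Fw w - sgn_bit (parw v * parw w) \<bullet> (Fw w * Fw v))
        + sgn_bit (parw v * parw w) \<bullet> ((F i j * Fw w - sgn_bit (?p * parw w) \<bullet> (Fw w * F i j)) * Fw v)"
    by (simp add: ij algebra_simps fv.scale_right_diff_distrib sgn_bit_add distrib_left)
  also have "\<dots> \<in> Low (Suc (length v + length w))"
  proof (intro Filt.add Filt.scl)
    have v: "Fw v \<in> Low (Suc (length v))" by (rule Filt.word) (simp add: *)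
    have "F i j \<in> Low (Suc 1)" by (simp add: F_Low *)
    from Low_mult_right[OF this Cons.IH[OF *(3)]]
    show "F i j * (Fw v * Fw w - sgn_bit (parw v * parw w) \<bullet> (Fw w * Fw v)) \<in> Low (Suc (length v + length w))"
      by simp
    show "(F i j * Fw w - sgn_bit (?p * parw w) \<bullet> (Fw w * F i j)) * Fw v \<in> Low (Suc (length v + length w))"
      using Low_mult_left[OF swap_F_Fw[OF *(1,2) assms(2)] v] by (simp add: add.commute)
  qed
  finally show ?case by simp
qed

text \<open>The associated graded algebra is supercommutative. Here \<open>f\<close> and \<open>g\<close> have degrees at most \<open>n\<close> and
  \<open>m\<close>, and the error has degree less than \<open>n + m\<close>.\<close>

lemma swap_HW:
  assumes "f \<in> HW (Suc n) p" "g \<in> HW (Suc m) r"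
  shows "f * g - sgn_bit (p * r) \<bullet> (g * f) \<in> Low (n + m)"
  using assms(1)
proof (induction rule: Filt.induct)
  case (null f)
  thus ?case by (intro Filt.null env_null_diff env_null_scl) (auto intro: env_null_mult_left env_null_mult_right)
next
  case (word v)
  from assms(2) show ?case
  proof (induction rule: Filt.induct)
    case (null g)
    thus ?case by (intro Filt.null env_null_diff env_null_scl) (auto intro: env_null_mult_left env_null_mult_right)
  next
    case (word w)
    thus ?case using swap_Fw_Fw[of v w] \<open>length v < Suc n \<and> valid v \<and> parw v = p\<close>
      by (auto elim!: Low_mono)
  next
    case (add g h)
    from Filt.add[OF add.IH] show ?case
      by (simp add: distrib_left distrib_right fv.scale_right_distrib add_diff_add)
  next
    case (scl g c)
    from Filt.scl[OF scl.IH, of c] show ?case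
      by (simp add: fv.scale_right_diff_distrib mult.commute)
  qed
next
  case (add f h)
  from Filt.add[OF add.IH] show ?case
    by (simp add: distrib_left distrib_right fv.scale_right_distrib add_diff_add)
next
  case (scl f c)
  from Filt.scl[OF scl.IH, of c] show ?case
    by (simp add: fv.scale_right_diff_distrib mult.commute)
qed

lemma gen_Low: "free_gen x \<in> Low 2"
proof (cases "x \<in> F_span (idx K)")
  case True
  show ?thesis
    by (rule Filt_eqv[OF gen_expand[OF True]]) (intro Filt_sum Filt.scl F_Low; simp)
next
  case False
  hence "free_gen x \<in> nl"
    using env_null.gen[of x "queer K" 1 1] by (simp add: queer_sel)
  thus ?thesis by (rule Filt.null)
qed

lemma mon_Low: "mon w \<in> Low (Suc (length w))"
proof (induction w)
  case (Cons x w)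
  have "free_gen x \<in> Low (Suc 1)" using gen_Low by (simp add: numeral_2_eq_2)
  from Low_mult_right[OF this Cons] show ?case by (simp add: mon_Cons)
qed (use Low_1[of 1] in simp)

lemma Low_exhaustive: "\<exists>n. f \<in> Low n"
proof (induction f rule: free_induct)
  case (add f g)
  then obtain n m where "f \<in> Low n" "g \<in> Low m" by blast
  hence "f \<in> Low (max n m)" "g \<in> Low (max n m)" by (auto elim: Low_mono)
  thus ?case by (blast intro: Filt.add)
qed (auto intro: Filt_0 Filt.scl mon_Low)

end

section \<open>The quasi-shuffle action and the symbol\<close>

definition homog_mat :: "bit \<Rightarrow> imat \<Rightarrow> bool" where
  "homog_mat p x \<longleftrightarrow> (\<forall>i j. x i j \<noteq> 0 \<longrightarrow> par i + par j = p)"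

text \<open>The sign for moving \<open>x\<close> past a letter of degree \<open>p\<close>, taken entrywise so that \<open>x\<close> need not be
  homogeneous.\<close>

definition twist :: "bit \<Rightarrow> imat \<Rightarrow> imat" where
  "twist p x = (\<lambda>i j. sgn_bit (p * (par i + par j)) * x i j)"

lemma twist_homog_mat: "homog_mat p x \<Longrightarrow> twist r x = (\<lambda>i j. sgn_bit (r * p) * x i j)"
  by (auto simp: homog_mat_def twist_def fun_eq_iff)

type_synonym coeffs = "(int \<times> int) list \<Rightarrow> complex"

context queer_env
begin

text \<open>Read \<open>\<phi>\<close> as a formal sum of words in the matrix units with coefficients \<open>\<phi> w\<close>. Then \<open>act x\<close> is
  left quasi-shuffle multiplication by \<open>x\<close>: the letter \<open>x\<close> is inserted at the current position, or
  passes the current letter with a sign, or is merged with it by matrix multiplication from the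
  left.\<close>

fun act :: "imat \<Rightarrow> coeffs \<Rightarrow> coeffs" where
  "act x \<phi> [] = 0"
| "act x \<phi> ((i, j) # w) = x i j * \<phi> w + act (twist (par i + par j) x) (\<lambda>u. \<phi> ((i, j) # u)) w
     + (\<Sum>k\<in>idx K. x i k * \<phi> ((k, j) # w))"

lemma act_add: "act x (\<lambda>u. \<phi> u + \<psi> u) w = act x \<phi> w + act x \<psi> w"
proof (induction w arbitrary: \<phi> \<psi> x)
  case (Cons a w)
  obtain i j where a: "a = (i, j)" by (cases a)
  show ?case by (simp add: a Cons algebra_simps sum.distrib)
qed simp

lemma act_scale: "act x (\<lambda>u. c * \<phi> u) w = c * act x \<phi> w"
  by (induction x \<phi> w rule: act.induct) (simp_all add: algebra_simps sum_distrib_left)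

lemma act_zero [simp]: "act x (\<lambda>u. 0) w = 0"
  using act_scale[of x 0 "\<lambda>u. 0" w] by simp

lemma act_sum: "act x (\<lambda>u. \<Sum>k\<in>A. \<phi> k u) w = (\<Sum>k\<in>A. act x (\<phi> k) w)"
  by (induction A rule: infinite_finite_induct) (simp_all add: act_add)

lemma act_add_left: "act (\<lambda>i j. x i j + y i j) \<phi> w = act x \<phi> w + act y \<phi> w"
proof (induction w arbitrary: \<phi> x y)
  case (Cons a w)
  obtain i j where a: "a = (i, j)" by (cases a)
  have "twist p (\<lambda>i j. x i j + y i j) = (\<lambda>i j. twist p x i j + twist p y i j)" for p
    by (simp add: twist_def algebra_simps)
  thus ?case using Cons by (simp add: a algebra_simps sum.distrib)
qed simp

lemma act_scale_left: "act (\<lambda>i j. c * x i j) \<phi> w = c * act x \<phi> w"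
proof (induction w arbitrary: \<phi> x)
  case (Cons a w)
  obtain i j where a: "a = (i, j)" by (cases a)
  have "twist p (\<lambda>i j. c * x i j) = (\<lambda>i j. c * twist p x i j)" for p
    by (simp add: twist_def algebra_simps)
  thus ?case using Cons by (simp add: a algebra_simps sum_distrib_left)
qed simp

lemma act_Cons_homog_mat:
  assumes "homog_mat p x"
  shows "act x \<phi> ((i, j) # w) = x i j * \<phi> w + sgn_bit ((par i + par j) * p) * act x (\<lambda>u. \<phi> ((i, j) # u)) w
     + (\<Sum>k\<in>idx K. x i k * \<phi> ((k, j) # w))"
  by (simp add: twist_homog_mat[OF assms] act_scale_left)

text \<open>The terms are ordered by what happens to \<open>x\<close> and \<open>y\<close> at the first letter of the word: inserted,
  passing it, or merged with it.\<close>

lemma act_act_Cons: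
  assumes x: "homog_mat p x" and y: "homog_mat r y"
  shows "act x (act y \<phi>) ((i, j) # w) = x i j * act y \<phi> w
    + sgn_bit ((par i + par j) * p) * (y i j * act x \<phi> w)
    + sgn_bit ((par i + par j) * (p + r)) * act x (act y (\<lambda>u. \<phi> ((i, j) # u))) w
    + sgn_bit ((par i + par j) * p) * (\<Sum>k\<in>idx K. y i k * act x (\<lambda>u. \<phi> ((k, j) # u)) w)
    + (\<Sum>k\<in>idx K. x i k * y k j) * \<phi> w
    + sgn_bit (p * r) * (sgn_bit ((par i + par j) * r) * (\<Sum>k\<in>idx K. x i k * act y (\<lambda>u. \<phi> ((k, j) # u)) w))
    + (\<Sum>k\<in>idx K. \<Sum>l\<in>idx K. x i k * y k l * \<phi> ((l, j) # w))"
proof -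
  let ?a = "par i + par j"
  have e: "(\<lambda>u. act y \<phi> ((i, j) # u)) = (\<lambda>u. (y i j * \<phi> u + sgn_bit (?a * r) * act y (\<lambda>u. \<phi> ((i, j) # u)) u)
      + (\<Sum>k\<in>idx K. y i k * \<phi> ((k, j) # u)))"
    by (intro ext) (rule act_Cons_homog_mat[OF y])
  \<comment> \<open>merging \<open>x\<close> first changes the degree of the letter that \<open>y\<close> passes\<close>
  have s: "x i k * sgn_bit ((par k + par j) * r) = sgn_bit (p * r) * sgn_bit (?a * r) * x i k" for k
  proof (cases "x i k = 0")
    case False
    hence "par i + par k = p" using x by (auto simp: homog_mat_def)
    thus ?thesis by (cases "par i"; cases "par j"; cases "par k"; cases r) auto
  qed simp
  have t: "(\<Sum>k\<in>idx K. x i k * act y \<phi> ((k, j) # w)) = (\<Sum>k\<in>idx K. x i k * y k j) * \<phi> w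
    + sgn_bit (p * r) * (sgn_bit (?a * r) * (\<Sum>k\<in>idx K. x i k * act y (\<lambda>u. \<phi> ((k, j) # u)) w))
    + (\<Sum>k\<in>idx K. \<Sum>l\<in>idx K. x i k * y k l * \<phi> ((l, j) # w))"
    unfolding act_Cons_homog_mat[OF y] distrib_left sum.distrib sum_distrib_left sum_distrib_right
    by (simp only: mult.assoc[symmetric] s)
  have "act x (act y \<phi>) ((i, j) # w) = x i j * act y \<phi> w + sgn_bit (?a * p) *
      (y i j * act x \<phi> w + sgn_bit (?a * r) * act x (act y (\<lambda>u. \<phi> ((i, j) # u))) w
        + (\<Sum>k\<in>idx K. y i k * act x (\<lambda>u. \<phi> ((k, j) # u)) w))
      + (\<Sum>k\<in>idx K. x i k * act y \<phi> ((k, j) # w))"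
    by (subst act_Cons_homog_mat[OF x]) (simp only: e act_add act_scale act_sum)
  thus ?thesis unfolding t by (simp add: distrib_left sgn_bit_add)
qed

text \<open>Insertions and mergings at different positions supercommute. Only two kinds of terms are left:
  \<open>x\<close> merged into the letter \<open>y\<close>, or \<open>y\<close> into \<open>x\<close>, and both mergings into the same letter. They
  form the action of the supercommutator of the matrices, so the action is a representation of the
  Lie superalgebra.\<close>

lemma act_commutator:
  assumes x: "homog_mat p x" and y: "homog_mat r y"
  shows "act x (act y \<phi>) w - sgn_bit (p * r) * act y (act x \<phi>) w =
    act (\<lambda>i j. (\<Sum>k\<in>idx K. x i k * y k j) - sgn_bit (p * r) * (\<Sum>k\<in>idx K. y i k * x k j)) \<phi> w"
    (is "_ = act ?z \<phi> w")
proof (induction w arbitrary: \<phi>)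
  case (Cons a w)
  obtain i j where a: "a = (i, j)" by (cases a)
  have z: "homog_mat (p + r) ?z"
    unfolding homog_mat_def
  proof (intro allI impI)
    fix i j assume "?z i j \<noteq> 0"
    hence "(\<Sum>k\<in>idx K. x i k * y k j) \<noteq> 0 \<or> (\<Sum>k\<in>idx K. y i k * x k j) \<noteq> 0" by auto
    then obtain k where "x i k * y k j \<noteq> 0 \<or> y i k * x k j \<noteq> 0"
      by (metis (no_types, lifting) sum.neutral)
    hence "(par i + par k = p \<and> par k + par j = r) \<or> (par i + par k = r \<and> par k + par j = p)"
      using x y unfolding homog_mat_def by auto
    thus "par i + par j = p + r"
      by (cases "par i"; cases "par j"; cases "par k") auto
  qed
  let ?a = "par i + par j"
  have d: "(\<Sum>k\<in>idx K. ?z i k * \<phi> ((k, j) # w)) = (\<Sum>k\<in>idx K. \<Sum>l\<in>idx K. x i k * y k l * \<phi> ((l, j) # w))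
      - sgn_bit (p * r) * (\<Sum>k\<in>idx K. \<Sum>l\<in>idx K. y i k * x k l * \<phi> ((l, j) # w))"
    unfolding left_diff_distrib sum_subtractf sum_distrib_right sum_distrib_left
    by (subst sum.swap, subst (2) sum.swap) (simp add: mult.assoc)
  have cx: "sgn_bit (p * r) * (sgn_bit (?a * r) * (x i j * C)) = x i j * C" for C
  proof (cases "x i j = 0")
    case False
    hence "?a = p" using x by (auto simp: homog_mat_def)
    thus ?thesis by simp
  qed simp
  have cy: "sgn_bit (p * r) * (y i j * C) = sgn_bit (?a * p) * (y i j * C)" for C
  proof (cases "y i j = 0")
    case False
    hence "?a = r" using y by (auto simp: homog_mat_def)
    thus ?thesis by (simp add: mult.commute[of r p])
  qed simp
  have "act x (act y \<phi>) (a # w) - sgn_bit (p * r) * act y (act x \<phi>) (a # w) - act ?z \<phi> (a # w) =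
      x i j * act y \<phi> w + sgn_bit (?a * p) * (y i j * act x \<phi> w)
      - sgn_bit (p * r) * (y i j * act x \<phi> w) - sgn_bit (p * r) * (sgn_bit (?a * r) * (x i j * act y \<phi> w))"
    unfolding a act_act_Cons[OF x y] act_act_Cons[OF y x] act_Cons_homog_mat[OF z] Cons[symmetric] d
      add.commute[of r p] mult.commute[of r p]
    by (simp add: distrib_left distrib_right left_diff_distrib right_diff_distrib mult.left_commute[of "sgn_bit (p * r)" "sgn_bit (?a * (p + r))"]
        mult.assoc del: distrib_left_numeral)
  thus ?case by (simp add: cx cy)
qed simp

end

context queer_env
begin

text \<open>The mirror image of \<open>act\<close>: the letter \<open>y\<close> of degree \<open>r\<close> arrives from the right and is merged by
  matrix multiplication from the right. The signs are chosen so that \<open>ract\<close> describes right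
  multiplication after a twist by the parity automorphism, see \<open>symbol_right_mult\<close>.\<close>

fun ract :: "bit \<Rightarrow> imat \<Rightarrow> coeffs \<Rightarrow> coeffs" where
  "ract r y \<phi> [] = 0"
| "ract r y \<phi> ((i, j) # w) = y i j * \<phi> w + sgn_bit ((par i + par j) * r) * ract r y (\<lambda>u. \<phi> ((i, j) # u)) w
     + (\<Sum>k\<in>idx K. sgn_bit (r * (par i + par k)) * y k j * \<phi> ((i, k) # w))"

lemma ract_add: "ract r x (\<lambda>u. \<phi> u + \<psi> u) w = ract r x \<phi> w + ract r x \<psi> w"
proof (induction w arbitrary: \<phi> \<psi>)
  case (Cons a w)
  obtain i j where a: "a = (i, j)" by (cases a)
  show ?case by (simp add: a Cons distrib_left distrib_right sum.distrib)
qed simp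

lemma ract_scale: "ract r x (\<lambda>u. c * \<phi> u) w = c * ract r x \<phi> w"
proof (induction w arbitrary: \<phi>)
  case (Cons a w)
  obtain i j where a: "a = (i, j)" by (cases a)
  show ?case by (simp add: a Cons distrib_left distrib_right sum_distrib_left mult_ac)
qed simp

lemma ract_zero [simp]: "ract r x (\<lambda>u. 0) w = 0"
  using ract_scale[of r x 0 "\<lambda>u. 0" w] by simp

lemma ract_sum: "ract r x (\<lambda>u. \<Sum>k\<in>A. \<phi> k u) w = (\<Sum>k\<in>A. ract r x (\<phi> k) w)"
  by (induction A rule: infinite_finite_induct) (simp_all add: ract_add)

text \<open>Left and right multiplication in the associative quasi-shuffle algebra commute up to the sign
  rule.\<close>

lemma ract_act:
  assumes x: "homog_mat p x" and y: "homog_mat r y"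
  shows "ract r y (act x \<phi>) w = sgn_bit (p * r) * act x (ract r y \<phi>) w"
proof (induction w arbitrary: \<phi>)
  case (Cons a w)
  obtain i j where a: "a = (i, j)" by (cases a)
  let ?a = "par i + par j"
  let ?s = "sgn_bit (p * r)"
  let ?X = "\<Sum>k\<in>idx K. x i k * ract r y (\<lambda>u. \<phi> ((k, j) # u)) w"
  let ?Y = "\<Sum>k\<in>idx K. sgn_bit (r * (par i + par k)) * y k j * act x (\<lambda>u. \<phi> ((i, k) # u)) w"
  let ?Z = "\<Sum>k\<in>idx K. sgn_bit (r * (par i + par k)) * y k j * x i k * \<phi> w"
  let ?W = "\<Sum>k\<in>idx K. \<Sum>l\<in>idx K. sgn_bit (r * (par i + par k)) * y k j * (x i l * \<phi> ((l, k) # w))"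
  have ea: "(\<lambda>u. act x \<phi> ((i, j) # u)) = (\<lambda>u. (x i j * \<phi> u + sgn_bit (?a * p) * act x (\<lambda>u. \<phi> ((i, j) # u)) u)
      + (\<Sum>k\<in>idx K. x i k * \<phi> ((k, j) # u)))"
    by (intro ext) (rule act_Cons_homog_mat[OF x])
  have er: "(\<lambda>u. ract r y \<phi> ((i, j) # u)) = (\<lambda>u. (y i j * \<phi> u + sgn_bit (?a * r) * ract r y (\<lambda>u. \<phi> ((i, j) # u)) u)
      + (\<Sum>k\<in>idx K. (sgn_bit (r * (par i + par k)) * y k j) * \<phi> ((i, k) # u)))"
    by (intro ext) simp
  have ca: "?s * (sgn_bit (?a * p) * (y i j * C)) = y i j * C" for C
  proof (cases "y i j = 0")
    case False
    hence "?a = r" using y by (auto simp: homog_mat_def)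
    thus ?thesis by (simp add: mult.commute[of r p])
  qed simp
  have cx: "?s * (x i j * C) = sgn_bit (?a * r) * (x i j * C)" for C
  proof (cases "x i j = 0")
    case False
    hence "?a = p" using x by (auto simp: homog_mat_def)
    thus ?thesis by simp
  qed simp
  have s1: "sgn_bit (r * (par i + par k)) * y k j * (sgn_bit ((par i + par k) * p) * C)
      = ?s * (sgn_bit (?a * p) * (sgn_bit (r * (par i + par k)) * y k j * C))" for k C
  proof (cases "y k j = 0")
    case False
    hence "par k + par j = r" using y by (auto simp: homog_mat_def)
    hence r: "r = par k + par j" by simp
    show ?thesis unfolding r by (cases "par i"; cases "par j"; cases "par k"; cases p) auto
  qed simp
  have s2: "?s * (x i k * (sgn_bit ((par k + par j) * r) * C)) = sgn_bit (?a * r) * (x i k * C)"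
    and s3: "?s * (x i k * (sgn_bit (r * (par k + par l)) * C)) = sgn_bit (r * (par i + par l)) * (x i k * C)" for k l C
  proof -
    have "par i + par k = p" if "x i k \<noteq> 0" using x that by (auto simp: homog_mat_def)
    thus "?s * (x i k * (sgn_bit ((par k + par j) * r) * C)) = sgn_bit (?a * r) * (x i k * C)"
      by (cases "x i k = 0"; cases "par i"; cases "par j"; cases "par k"; cases r) auto
    have "par i + par k = p" if "x i k \<noteq> 0" using x that by (auto simp: homog_mat_def)
    thus "?s * (x i k * (sgn_bit (r * (par k + par l)) * C)) = sgn_bit (r * (par i + par l)) * (x i k * C)"
      by (cases "x i k = 0"; cases "par i"; cases "par l"; cases "par k"; cases r) auto
  qed
  have "(\<Sum>k\<in>idx K. sgn_bit (r * (par i + par k)) * y k j * act x \<phi> ((i, k) # w))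
      = ?Z + ?s * (sgn_bit (?a * p) * ?Y) + ?W"
    unfolding act_Cons_homog_mat[OF x] distrib_left[where 'a = complex] sum.distrib s1 sum_distrib_left by (simp only: mult.assoc)
  hence L: "ract r y (act x \<phi>) ((i, j) # w) = y i j * act x \<phi> w
      + sgn_bit (?a * r) * (x i j * ract r y \<phi> w
        + sgn_bit (?a * p) * ract r y (act x (\<lambda>u. \<phi> ((i, j) # u))) w + ?X)
      + (?Z + ?s * (sgn_bit (?a * p) * ?Y) + ?W)"
    by (subst ract.simps(2)) (simp only: ea ract_add ract_scale ract_sum)
  have "?s * (\<Sum>k\<in>idx K. x i k * ract r y \<phi> ((k, j) # w))
      = ?s * (\<Sum>k\<in>idx K. x i k * y k j) * \<phi> w + sgn_bit (?a * r) * ?X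
        + (\<Sum>k\<in>idx K. \<Sum>l\<in>idx K. sgn_bit (r * (par i + par l)) * (x i k * (y l j * \<phi> ((k, l) # w))))"
    unfolding ract.simps distrib_left[where 'a = complex] sum.distrib sum_distrib_left sum_distrib_right
    by (simp only: mult.assoc s2 s3)
  also have "(\<Sum>k\<in>idx K. \<Sum>l\<in>idx K. sgn_bit (r * (par i + par l)) * (x i k * (y l j * \<phi> ((k, l) # w)))) = ?W"
    by (subst sum.swap) (simp add: mult_ac)
  also have "?s * (\<Sum>k\<in>idx K. x i k * y k j) * \<phi> w = ?Z"
    unfolding sum_distrib_left sum_distrib_right
  proof (intro sum.cong refl)
    fix k
    have "par i + par k = p" if "x i k \<noteq> 0" using x that by (auto simp: homog_mat_def)
    thus "?s * (x i k * y k j) * \<phi> w = sgn_bit (r * (par i + par k)) * y k j * x i k * \<phi> w"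
      by (cases "x i k = 0") (auto simp: mult_ac)
  qed
  finally have R3: "?s * (\<Sum>k\<in>idx K. x i k * ract r y \<phi> ((k, j) # w)) = ?Z + sgn_bit (?a * r) * ?X + ?W" .
  have "act x (ract r y \<phi>) ((i, j) # w) = x i j * ract r y \<phi> w
      + sgn_bit (?a * p) * (y i j * act x \<phi> w + sgn_bit (?a * r) * act x (ract r y (\<lambda>u. \<phi> ((i, j) # u))) w + ?Y)
      + (\<Sum>k\<in>idx K. x i k * ract r y \<phi> ((k, j) # w))"
    by (subst act_Cons_homog_mat[OF x]) (simp only: er act_add act_scale act_sum)
  hence "?s * act x (ract r y \<phi>) ((i, j) # w) = sgn_bit (?a * r) * (x i j * ract r y \<phi> w)
      + (y i j * act x \<phi> w + sgn_bit (?a * r) * (sgn_bit (?a * p) * (?s * act x (ract r y (\<lambda>u. \<phi> ((i, j) # u))) w))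
      + ?s * (sgn_bit (?a * p) * ?Y)) + (?Z + sgn_bit (?a * r) * ?X + ?W)"
    by (simp only: distrib_left[where 'a = complex] ca cx R3) (simp only: mult_ac)
  also have "\<dots> = ract r y (act x \<phi>) ((i, j) # w)"
    unfolding L Cons[symmetric] by (simp add: distrib_left)
  finally show ?case unfolding a by simp
qed simp

text \<open>Letters outside the Lie superalgebra are zero in the enveloping algebra and hence act by zero.\<close>

fun repw :: "imat list \<Rightarrow> coeffs \<Rightarrow> coeffs" where
  "repw [] \<phi> = \<phi>"
| "repw (x # ws) \<phi> = (if x \<in> F_span (idx K) then act x (repw ws \<phi>) else (\<lambda>_. 0))"

lemma repw_append: "repw (u @ v) \<phi> = repw u (repw v \<phi>)"
  by (induction u) simp_all

lemma repw_add: "repw u (\<lambda>v. \<phi> v + \<psi> v) = (\<lambda>v. repw u \<phi> v + repw u \<psi> v)"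
  by (induction u) (auto simp: act_add)

lemma repw_scale: "repw u (\<lambda>v. c * \<phi> v) = (\<lambda>v. c * repw u \<phi> v)"
  by (induction u) (auto simp: act_scale)

lemma repw_0: "repw u (\<lambda>v. 0) = (\<lambda>v. 0)"
  using repw_scale[of u 0 "\<lambda>v. 0"] by simp

definition rep :: "imat free \<Rightarrow> coeffs \<Rightarrow> coeffs" where
  "rep f \<phi> v = (\<Sum>w\<in>Poly_Mapping.keys f. Poly_Mapping.lookup f w * repw (letters w) \<phi> v)"

lemma rep_superset:
  "finite A \<Longrightarrow> Poly_Mapping.keys f \<subseteq> A \<Longrightarrow> rep f \<phi> v = (\<Sum>w\<in>A. Poly_Mapping.lookup f w * repw (letters w) \<phi> v)"
  unfolding rep_def by (rule sum.mono_neutral_left) (auto simp: in_keys_iff)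

lemma rep_add: "rep (f + g) \<phi> v = rep f \<phi> v + rep g \<phi> v"
proof -
  let ?A = "Poly_Mapping.keys f \<union> Poly_Mapping.keys g"
  have "finite ?A" "Poly_Mapping.keys (f + g) \<subseteq> ?A" using keys_add[of f g] by auto
  thus ?thesis
    using rep_superset[of ?A "f + g"] rep_superset[of ?A f] rep_superset[of ?A g]
    by (simp add: lookup_add algebra_simps sum.distrib)
qed

lemma rep_scl: "rep (c \<bullet> f) \<phi> v = c * rep f \<phi> v"
  using rep_superset[OF finite_keys keys_scl, of c f \<phi> v]
  by (simp add: rep_def sum_distrib_left mult.assoc)

lemma rep_mon: "rep (mon w) \<phi> v = repw w \<phi> v"
  by (simp add: rep_def) (simp add: mon_def)

lemma rep_0: "rep 0 \<phi> v = 0"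
  by (simp add: rep_def)

lemma rep_diff: "rep (f - g) \<phi> v = rep f \<phi> v - rep g \<phi> v"
  using rep_add[of f "- g" \<phi> v] rep_scl[of "-1" g \<phi> v] by simp

lemma rep_zero_right: "rep f (\<lambda>v. 0) v = 0"
  by (simp add: rep_def repw_0)

lemma rep_mult: "rep (f * g) \<phi> v = rep f (rep g \<phi>) v"
proof (induction f arbitrary: v rule: free_induct)
  case (mon c u)
  have "rep (mon u * g) \<phi> = repw u (rep g \<phi>)"
  proof (induction g rule: free_induct)
    case zero
    have "rep 0 \<phi> = (\<lambda>v. 0)" by (intro ext) (rule rep_0)
    thus ?case by (simp add: repw_0)
  next
    case (mon d w)
    have 1: "rep (d \<bullet> mon w) \<phi> = (\<lambda>v. d * repw w \<phi> v)"
      by (intro ext) (simp add: rep_scl rep_mon)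
    show ?case unfolding 1 repw_scale
      by (intro ext) (simp add: rep_scl rep_mon repw_append flip: mon_append)
  next
    case (add f g)
    have 1: "rep (f + g) \<phi> = (\<lambda>v. rep f \<phi> v + rep g \<phi> v)"
      by (intro ext) (rule rep_add)
    show ?case unfolding 1 repw_add add[symmetric]
      by (intro ext) (simp add: distrib_left rep_add)
  qed
  thus ?case by (simp add: rep_scl rep_mon)
qed (simp_all add: rep_0 rep_add distrib_right)

lemma rep_gen: "rep (free_gen x) \<phi> v = (if x \<in> F_span (idx K) then act x \<phi> v else 0)"
  using rep_mon[of "[x]"] by (simp add: mon_single)

lemma rep_gen_fun: "x \<in> F_span (idx K) \<Longrightarrow> rep (free_gen x) \<phi> = act x \<phi>"
  by (intro ext) (simp add: rep_gen)

lemma rep_relation: "r \<in> env_relations (queer K) \<Longrightarrow> rep r \<phi> v = 0"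
proof -
  let ?L = "queer K"
  assume "r \<in> env_relations (queer K)"
  then consider (a) x y where "r = free_gen (ladd ?L x y) - free_gen x - free_gen y" "x \<in> carrier ?L" "y \<in> carrier ?L"
    | (b) c x where "r = free_gen (lscale ?L c x) - free_const c * free_gen x" "x \<in> carrier ?L"
    | (c) x y p s where "r = free_gen x * free_gen y - free_const (sgn_bit (p * s)) * free_gen y * free_gen x
        - free_gen (bracket ?L x y)" "x \<in> lgrade ?L p" "y \<in> lgrade ?L s"
    unfolding env_relations_def by blast
  thus ?thesis
  proof cases
    case a
    thus ?thesis using ladd_closed[of x y]
      by (simp add: rep_diff rep_gen queer_sel act_add_left)
  next
    case b
    thus ?thesis using lscale_closed[of x c]
      by (simp add: rep_diff rep_gen queer_sel act_scale_left free_const_mult rep_scl)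
  next
    case c
    hence xy: "x \<in> F_span (idx K)" "y \<in> F_span (idx K)" "homog_mat p x" "homog_mat s y"
      by (auto simp: queer_sel gl_super_sel homog_mat_def)
    have "rep r \<phi> v = act x (act y \<phi>) v - sgn_bit (p * s) * act y (act x \<phi>) v - act (bracket ?L x y) \<phi> v"
      using bracket_closed[OF c(2,3)]
      by (simp add: c(1) rep_diff rep_gen free_const_mult rep_scl rep_mult mult.assoc rep_gen_fun xy queer_sel)
    thus ?thesis unfolding bracket_queer[OF c(2,3)] act_commutator[OF xy(3,4)] by simp
  qed
qed

text \<open>The action factors through the enveloping algebra.\<close>

lemma rep_null: "f \<in> nl \<Longrightarrow> rep f \<phi> v = 0"
proof (induction arbitrary: \<phi> v rule: env_null.induct)
  case (rel r a b)
  have "rep r (rep b \<phi>) = (\<lambda>v. 0)" by (intro ext) (rule rep_relation[OF rel])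
  thus ?case by (simp add: mult.assoc rep_mult[of a] rep_mult[of r, abs_def] rep_zero_right)
next
  case (gen x a b)
  have "rep (free_gen x * b) \<phi> = (\<lambda>v. 0)"
    using gen by (intro ext) (simp add: rep_mult rep_gen queer_sel)
  thus ?case by (simp add: mult.assoc rep_mult[of a] rep_zero_right)
qed (simp_all add: rep_0 rep_add)

definition eps :: coeffs where
  "eps w = (if w = [] then 1 else 0)"

text \<open>The image of \<open>f\<close> in the quasi-shuffle algebra; \<open>eps\<close> is its unit, the empty word.\<close>

definition symbol :: "imat free \<Rightarrow> coeffs" where
  "symbol f = rep f eps"

lemma symbol_simps: "symbol (f + g) = (\<lambda>w. symbol f w + symbol g w)" "symbol (c \<bullet> f) = (\<lambda>w. c * symbol f w)"
  "symbol 1 = eps" "f \<in> nl \<Longrightarrow> symbol f = (\<lambda>w. 0)"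
  unfolding symbol_def using rep_mon[of "[]"] by (auto simp: rep_add rep_scl rep_null)

lemma symbol_eqv: "f \<doteq> g \<Longrightarrow> symbol f = symbol g"
  using symbol_simps(1)[of g "f - g"] by (simp add: eqv_def symbol_simps(4))

lemma symbol_F_mult: "a \<in> idx K \<Longrightarrow> b \<in> idx K \<Longrightarrow> symbol (F a b * f) = act (F_mat a b) (symbol f)"
  unfolding symbol_def by (intro ext) (simp add: rep_mult F_def rep_gen)

lemma homog_mat_F_mat: "a \<in> idx K \<Longrightarrow> b \<in> idx K \<Longrightarrow> homog_mat (par a + par b) (F_mat a b)"
  unfolding homog_mat_def using F_mat_nonzero_par by blast

lemma act_vanish: "(\<And>w. length w \<ge> n \<Longrightarrow> \<phi> w = 0) \<Longrightarrow> length w \<ge> Suc n \<Longrightarrow> act x \<phi> w = 0"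
proof (induction w arbitrary: n \<phi> x)
  case (Cons a w)
  obtain i j where a: "a = (i, j)" by (cases a)
  have z: "\<phi> w = 0" "\<phi> ((k, j) # w) = 0" for k using Cons.prems by (auto intro!: Cons.prems(1))
  show ?case
  proof (cases "length w \<ge> Suc (n - 1)")
    case True
    have "act (twist (par i + par j) x) (\<lambda>u. \<phi> ((i, j) # u)) w = 0"
      by (rule Cons.IH[of "n - 1"]) (use True in \<open>auto intro!: Cons.prems(1)\<close>)
    thus ?thesis by (simp add: a z)
  next
    case False
    hence "w = []" using Cons.prems(2) by (cases n; cases w) auto
    thus ?thesis using z by (simp add: a)
  qed
qed simp

lemma symbol_Fw_vanish: "valid w \<Longrightarrow> length v > length w \<Longrightarrow> symbol (Fw w) v = 0"
proof (induction w arbitrary: v)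
  case Nil
  thus ?case by (auto simp: symbol_simps eps_def)
next
  case (Cons a w)
  obtain i j where a: "a = (i, j)" by (cases a)
  have "act (F_mat i j) (symbol (Fw w)) v = 0"
    by (rule act_vanish[of "Suc (length w)"]) (use Cons in \<open>auto simp: a\<close>)
  thus ?case using Cons.prems by (simp add: a symbol_F_mult)
qed

text \<open>A product of \<open>n\<close> letters involves no words longer than \<open>n\<close>. Together with \<open>expand_symbol\<close> this
  says that the words of length \<open>n\<close> carry exactly the leading term of an element of degree \<open>n\<close>.\<close>

lemma symbol_vanish: "f \<in> Low n \<Longrightarrow> length v \<ge> n \<Longrightarrow> symbol f v = 0"
  by (induction rule: Filt.induct) (auto simp: symbol_simps symbol_Fw_vanish)

text \<open>The generator \<open>F\<^sub>i\<^sub>j\<close> is substituted for each letter \<open>E\<^sub>i\<^sub>j\<close>, on words of length \<open>n\<close>.\<close>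

definition expand :: "nat \<Rightarrow> coeffs \<Rightarrow> imat free" where
  "expand n \<phi> = (\<Sum>xs\<in>ilists K n. \<Sum>ys\<in>ilists K n. \<phi> (zip xs ys) \<bullet> Fw (zip xs ys))"

lemma expand_0: "expand 0 \<phi> = \<phi> [] \<bullet> 1"
  by (simp add: expand_def)

lemma expand_Suc: "expand (Suc n) \<phi> = (\<Sum>x\<in>idx K. \<Sum>y\<in>idx K. F x y * expand n (\<lambda>w. \<phi> ((x, y) # w)))"
  unfolding expand_def sum_ilists_Suc
  by (subst (2) sum.swap) (simp add: sum_distrib_left)

lemma expand_cong: "(\<And>w. length w = n \<Longrightarrow> \<phi> w = \<psi> w) \<Longrightarrow> expand n \<phi> = expand n \<psi>"
  unfolding expand_def by (intro sum.cong refl) (auto simp: ilists_def)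

lemma expand_add: "expand n (\<lambda>w. \<phi> w + \<psi> w) = expand n \<phi> + expand n \<psi>"
  by (simp add: expand_def fv.scale_left_distrib sum.distrib)

lemma expand_scale: "expand n (\<lambda>w. c * \<phi> w) = c \<bullet> expand n \<phi>"
  by (simp add: expand_def fv.scale_sum_right)

lemma expand_zero: "expand n (\<lambda>w. 0) = 0"
  by (simp add: expand_def)

lemma valid_zip: "xs \<in> ilists K n \<Longrightarrow> ys \<in> ilists K n \<Longrightarrow> valid (zip xs ys)"
  by (auto simp: ilists_def valid_def dest: set_zip_leftD set_zip_rightD)

lemma expand_Low: "expand n \<phi> \<in> Low (Suc n)"
  unfolding expand_def by (intro Filt_sum Filt.scl Filt.word) (auto simp: valid_zip, simp add: ilists_def)

text \<open>The letter \<open>F\<^sub>a\<^sub>b = E\<^sub>a\<^sub>b + E\<^sub>-\<^sub>a\<^sub>,\<^sub>-\<^sub>b\<close> turns into \<open>2 F\<^sub>a\<^sub>b\<close>.\<close>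

lemma sum_F_mat_F:
  assumes "a \<in> idx K" "b \<in> idx K"
  shows "(\<Sum>x\<in>idx K. \<Sum>y\<in>idx K. F_mat a b x y \<bullet> F x y) = 2 \<bullet> F a b"
proof -
  have "a \<noteq> 0" using assms by (auto simp: idx_def)
  have "(\<Sum>x\<in>idx K. \<Sum>y\<in>idx K. F_mat a b x y \<bullet> F x y)
      = (\<Sum>x\<in>idx K. \<Sum>y\<in>idx K. (if x = a then if y = b then F x y else 0 else 0)
          + (if x = - a then if y = - b then F x y else 0 else 0))"
    using \<open>a \<noteq> 0\<close> by (intro sum.cong refl) (auto simp: F_mat_def E_mat_def)
  also have "\<dots> = (\<Sum>x\<in>idx K. if x = a then \<Sum>y\<in>idx K. if y = b then F x y else 0 else 0)
      + (\<Sum>x\<in>idx K. if x = - a then \<Sum>y\<in>idx K. if y = - b then F x y else 0 else 0)"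
    unfolding sum.distrib by (intro arg_cong2[where f = "(+)"] sum.cong refl) auto
  also have "\<dots> = F a b + F a b" using assms by simp
  finally show ?thesis
    using fv.scale_left_distrib[of 1 1 "F a b"] by (simp only: one_add_one fv.scale_one)
qed

text \<open>As \<open>\<phi>\<close> has no words of length \<open>n + 1\<close>, those in \<open>act x \<phi>\<close> arise only by insertion of \<open>x\<close>
  into words of length \<open>n\<close>. Each of the \<open>n + 1\<close> positions contributes \<open>2 F\<^sub>a\<^sub>b\<close>, which may be moved to the
  front modulo lower degree.\<close>

lemma expand_act:
  assumes ab: "a \<in> idx K" "b \<in> idx K" and "\<And>w. length w = Suc n \<Longrightarrow> \<phi> w = 0"
  shows "expand (Suc n) (act (F_mat a b) \<phi>) - (2 * of_nat (Suc n)) \<bullet> (F a b * expand n \<phi>) \<in> Low (Suc n)"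
  using assms(3)
proof (induction n arbitrary: \<phi>)
  case (0 \<phi>)
  let ?x = "F_mat a b"
  have "act ?x \<phi> [(i, j)] = ?x i j * \<phi> []" for i j
    using 0 by simp
  hence "expand 1 (act ?x \<phi>) = (\<Sum>x\<in>idx K. \<Sum>y\<in>idx K. \<phi> [] \<bullet> (F_mat a b x y \<bullet> F x y))"
    by (simp add: expand_Suc expand_0 mult.commute)
  also have "\<dots> = \<phi> [] \<bullet> 2 \<bullet> F a b"
    unfolding sum_F_mat_F[OF ab, symmetric] fv.scale_sum_right ..
  finally show ?case by (simp add: expand_0 Filt_0 mult.commute)
next
  case (Suc n \<phi>)
  let ?x = "F_mat a b" and ?p = "par a + par b" and ?c = "2 * of_nat (Suc n) :: complex"
  note h = homog_mat_F_mat[OF ab]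
  have "expand (Suc n) (\<lambda>w. act ?x \<phi> ((i, j) # w))
      = ?x i j \<bullet> expand (Suc n) \<phi> + sgn_bit ((par i + par j) * ?p) \<bullet> expand (Suc n) (act ?x (\<lambda>u. \<phi> ((i, j) # u)))" for i j
    unfolding expand_add[symmetric] expand_scale[symmetric]
    by (rule expand_cong) (simp add: act_Cons_homog_mat[OF h] Suc.prems del: act.simps)
  hence L: "expand (Suc (Suc n)) (act ?x \<phi>) = (\<Sum>i\<in>idx K. \<Sum>j\<in>idx K. ?x i j \<bullet> F i j) * expand (Suc n) \<phi>
      + (\<Sum>i\<in>idx K. \<Sum>j\<in>idx K. sgn_bit ((par i + par j) * ?p) \<bullet> (F i j * expand (Suc n) (act ?x (\<lambda>u. \<phi> ((i, j) # u)))))"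
    by (subst expand_Suc) (simp add: distrib_left sum.distrib sum_distrib_right)
  have R: "?c \<bullet> (F a b * expand (Suc n) \<phi>) = (\<Sum>i\<in>idx K. \<Sum>j\<in>idx K. ?c \<bullet> (F a b * F i j * expand n (\<lambda>w. \<phi> ((i, j) # w))))"
    by (subst expand_Suc) (simp add: sum_distrib_left fv.scale_sum_right mult.assoc)
  have "(\<Sum>i\<in>idx K. \<Sum>j\<in>idx K. sgn_bit ((par i + par j) * ?p) \<bullet> (F i j * expand (Suc n) (act ?x (\<lambda>u. \<phi> ((i, j) # u)))))
      - ?c \<bullet> (F a b * expand (Suc n) \<phi>)
      = (\<Sum>i\<in>idx K. \<Sum>j\<in>idx K. sgn_bit ((par i + par j) * ?p) \<bullet> (F i j *
          (expand (Suc n) (act ?x (\<lambda>u. \<phi> ((i, j) # u))) - ?c \<bullet> (F a b * expand n (\<lambda>u. \<phi> ((i, j) # u))))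
          + ?c \<bullet> ((F i j * F a b - sgn_bit ((par i + par j) * ?p) \<bullet> (F a b * F i j)) * expand n (\<lambda>u. \<phi> ((i, j) # u)))))"
    unfolding R sum_subtractf[symmetric]
    by (intro sum.cong refl)
      (simp add: right_diff_distrib left_diff_distrib fv.scale_right_diff_distrib fv.scale_right_distrib mult.assoc mult.left_commute)
  also have "\<dots> \<in> Low (Suc (Suc n))"
  proof (intro Filt_sum Filt.scl Filt.add)
    fix i j assume ij: "i \<in> idx K" "j \<in> idx K"
    have F: "F i j \<in> Low (Suc 1)" using ij by (simp add: F_Low)
    have "expand (Suc n) (act ?x (\<lambda>u. \<phi> ((i, j) # u))) - ?c \<bullet> (F a b * expand n (\<lambda>u. \<phi> ((i, j) # u))) \<in> Low (Suc n)"
      by (rule Suc.IH) (simp add: Suc.prems)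
    from Low_mult_right[OF F this]
    show "F i j * (expand (Suc n) (act ?x (\<lambda>u. \<phi> ((i, j) # u))) - ?c \<bullet> (F a b * expand n (\<lambda>u. \<phi> ((i, j) # u)))) \<in> Low (Suc (Suc n))"
      by simp
    show "(F i j * F a b - sgn_bit ((par i + par j) * ?p) \<bullet> (F a b * F i j)) * expand n (\<lambda>u. \<phi> ((i, j) # u)) \<in> Low (Suc (Suc n))"
      using Low_mult_left[OF swap_FF[OF ij ab] expand_Low] by simp
  qed
  finally have *: "(\<Sum>i\<in>idx K. \<Sum>j\<in>idx K. sgn_bit ((par i + par j) * ?p) \<bullet> (F i j * expand (Suc n) (act ?x (\<lambda>u. \<phi> ((i, j) # u)))))
      - ?c \<bullet> (F a b * expand (Suc n) \<phi>) \<in> Low (Suc (Suc n))" .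
  have "expand (Suc (Suc n)) (act ?x \<phi>) - (2 * of_nat (Suc (Suc n))) \<bullet> (F a b * expand (Suc n) \<phi>)
      = (\<Sum>i\<in>idx K. \<Sum>j\<in>idx K. sgn_bit ((par i + par j) * ?p) \<bullet> (F i j * expand (Suc n) (act ?x (\<lambda>u. \<phi> ((i, j) # u)))))
      - ?c \<bullet> (F a b * expand (Suc n) \<phi>)"
  proof -
    have e: "2 * of_nat (Suc (Suc n)) = 2 + ?c" by (simp add: distrib_left)
    show ?thesis
      unfolding L sum_F_mat_F[OF ab] e fv.scale_left_distrib scl_mult_left by (rule add_diff_cancel_left)
  qed
  with * show ?case by simp
qed

lemma expand_symbol_word:
  assumes "valid w" shows "expand (length w) (symbol (Fw w)) - (2 ^ length w * fact (length w)) \<bullet> Fw w \<in> Low (length w)"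
  using assms
proof (induction w)
  case Nil
  thus ?case by (simp add: expand_0 symbol_simps eps_def Filt_0)
next
  case (Cons ab w)
  obtain a b where ab: "ab = (a, b)" by (cases ab)
  have *: "a \<in> idx K" "b \<in> idx K" "valid w" using Cons.prems by (auto simp: ab)
  let ?n = "length w" let ?c = "2 * of_nat (Suc ?n) :: complex"
  have "expand (Suc ?n) (symbol (Fw (ab # w))) - (2 ^ Suc ?n * fact (Suc ?n)) \<bullet> Fw (ab # w)
     = (expand (Suc ?n) (act (F_mat a b) (symbol (Fw w))) - ?c \<bullet> (F a b * expand ?n (symbol (Fw w))))
       + ?c \<bullet> (F a b * (expand ?n (symbol (Fw w)) - (2 ^ ?n * fact ?n) \<bullet> Fw w))"
    by (simp add: ab symbol_F_mult * right_diff_distrib fv.scale_right_diff_distrib mult_ac del: of_nat_Suc)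
  also have "\<dots> \<in> Low (Suc ?n)"
  proof (intro Filt.add Filt.scl)
    show "expand (Suc ?n) (act (F_mat a b) (symbol (Fw w))) - ?c \<bullet> (F a b * expand ?n (symbol (Fw w))) \<in> Low (Suc ?n)"
      by (rule expand_act) (auto simp: * symbol_Fw_vanish)
    have F: "F a b \<in> Low (Suc 1)" using * by (simp add: F_Low)
    from Low_mult_right[OF F Cons.IH[OF *(3)]]
    show "F a b * (expand ?n (symbol (Fw w)) - (2 ^ ?n * fact ?n) \<bullet> Fw w) \<in> Low (Suc ?n)" by simp
  qed
  finally show ?case by simp
qed

text \<open>The symbol determines an element modulo lower degree. The constant collects a factor \<open>2 k\<close> for
  the \<open>k\<close>-th letter.\<close>

lemma expand_symbol: "f \<in> Low (Suc n) \<Longrightarrow> expand n (symbol f) - (2 ^ n * fact n) \<bullet> f \<in> Low n"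
proof (induction rule: Filt.induct)
  case (null f)
  thus ?case by (simp add: symbol_simps expand_zero Filt_uminus Filt.scl Filt.null)
next
  case (word w)
  show ?case
  proof (cases "length w = n")
    case True
    thus ?thesis using word expand_symbol_word[of w] by auto
  next
    case False
    hence "Fw w \<in> Low n" using word by (intro Filt.word) auto
    moreover from this have "expand n (symbol (Fw w)) = expand n (\<lambda>w. 0)"
      by (intro expand_cong) (simp add: symbol_vanish)
    ultimately show ?thesis by (simp add: expand_zero Filt_uminus Filt.scl)
  qed
next
  case (add f g)
  from Filt.add[OF add.IH] show ?case
    by (simp add: symbol_simps expand_add fv.scale_right_distrib add_diff_add)
next
  case (scl f c)
  from Filt.scl[OF scl.IH, of c] show ?case
    by (simp add: symbol_simps expand_scale fv.scale_right_diff_distrib mult.commute)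
qed

lemma act_ract_eps: "act y eps w = ract r y eps w"
proof (cases w)
  case (Cons a v)
  obtain i j where a: "a = (i, j)" by (cases a)
  have e: "(\<lambda>u. eps ((i, j) # u)) = (\<lambda>u. 0)" by (simp add: eps_def)
  show ?thesis unfolding Cons a act.simps ract.simps e by (simp add: eps_def)
qed simp

lemma pip_simps: "pip r (f + g) = pip r f + pip r g" "pip r (c \<bullet> f) = c \<bullet> pip r f" "pip r (f * g) = pip r f * pip r g"
  "pip r 1 = 1" "pip r (pip r f) = f" "f \<in> nl \<Longrightarrow> pip r f \<in> nl"
  by (simp_all add: pip_def pi_add pi_scl pi_mult pi_null)

lemma pip_F: "i \<in> idx K \<Longrightarrow> j \<in> idx K \<Longrightarrow> pip r (F i j) \<doteq> sgn_bit ((par i + par j) * r) \<bullet> F i j"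
  by (cases r) (simp_all add: pip_def pi_F)

lemma symbol_right_mult:
  assumes ab: "a \<in> idx K" "b \<in> idx K"
  shows "symbol (pip (par a + par b) f * F a b) = ract (par a + par b) (F_mat a b) (symbol f)"
proof -
  let ?r = "par a + par b" and ?y = "F_mat a b"
  have w: "symbol (pip ?r (Fw w) * F a b) = ract ?r ?y (symbol (Fw w))" if "valid w" for w
    using that
  proof (induction w)
    case Nil
    show ?case using symbol_F_mult[OF ab, of 1] by (simp add: pip_simps symbol_simps act_ract_eps[where r = ?r] fun_eq_iff)
  next
    case (Cons ij w)
    obtain i j where ij: "ij = (i, j)" by (cases ij)
    have *: "i \<in> idx K" "j \<in> idx K" "valid w" using Cons.prems by (auto simp: ij)
    let ?s = "sgn_bit ((par i + par j) * ?r)"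
    have "pip ?r (Fw (ij # w)) * F a b \<doteq> (?s \<bullet> F i j) * (pip ?r (Fw w) * F a b)"
      unfolding ij Fw.simps pip_simps mult.assoc by (intro eqv_mult pip_F eqv_refl *)
    hence "symbol (pip ?r (Fw (ij # w)) * F a b) = symbol ((?s \<bullet> F i j) * (pip ?r (Fw w) * F a b))"
      by (rule symbol_eqv)
    also have "\<dots> = (\<lambda>v. ?s * act (F_mat i j) (ract ?r ?y (symbol (Fw w))) v)"
      by (simp add: symbol_simps(2) symbol_F_mult[OF *(1,2)] Cons.IH[OF *(3)])
    also have "\<dots> = ract ?r ?y (act (F_mat i j) (symbol (Fw w)))"
      by (intro ext) (simp add: ract_act[OF homog_mat_F_mat[OF *(1,2)] homog_mat_F_mat[OF ab]])
    finally show ?case by (simp add: ij symbol_F_mult *)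
  qed
  obtain n where "f \<in> Low n" using Low_exhaustive by blast
  thus ?thesis
  proof (induction rule: Filt.induct)
    case (null f)
    thus ?case by (simp add: symbol_simps pip_simps env_null_mult_right fun_eq_iff)
  qed (simp_all add: w pip_simps distrib_right symbol_simps ract_add[abs_def] ract_scale[abs_def] fun_eq_iff ract_add ract_scale)
qed

text \<open>The relation \<open>f F = F \<pi>\<^sup>r f\<close> is applied to \<open>\<pi>\<^sup>r f\<close>, so that the right multiplication appears
  in the form treated by \<open>symbol_right_mult\<close>.\<close>

lemma symbol_cent:
  assumes "f \<in> cent I" "I \<subseteq> idx K" "a \<in> I" "b \<in> I"
  shows "act (F_mat a b) (symbol f) = ract (par a + par b) (F_mat a b) (symbol f)"
proof -
  let ?r = "par a + par b"
  have ab: "a \<in> idx K" "b \<in> idx K" using assms by auto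
  have "f * F a b \<doteq> F a b * pip ?r f" using assms by (auto simp: cent_def)
  hence "pip ?r (f * F a b) \<doteq> pip ?r (F a b * pip ?r f)"
    by (auto simp: pip_def eqv_pi)
  hence "pip ?r f * pip ?r (F a b) \<doteq> pip ?r (F a b) * f" by (simp add: pip_simps)
  moreover have s: "pip ?r (F a b) \<doteq> sgn_bit (?r * ?r) \<bullet> F a b" by (rule pip_F[OF ab])
  ultimately have m: "pip ?r f * pip ?r (F a b) \<doteq> pip ?r (F a b) * f" by simp
  let ?s = "sgn_bit (?r * ?r)"
  have "pip ?r f * F a b = ?s \<bullet> (pip ?r f * (?s \<bullet> F a b))" by simp
  also have "\<dots> \<doteq> ?s \<bullet> (pip ?r f * pip ?r (F a b))"
    by (intro eqv_scl eqv_mult eqv_refl eqv_sym[OF s])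
  also have "\<dots> \<doteq> ?s \<bullet> (pip ?r (F a b) * f)" by (intro eqv_scl m)
  also have "\<dots> \<doteq> ?s \<bullet> ((?s \<bullet> F a b) * f)"
    by (intro eqv_scl eqv_mult eqv_refl s)
  also have "\<dots> = F a b * f" by simp
  finally have "pip ?r f * F a b \<doteq> F a b * f" .
  from symbol_eqv[OF this] show ?thesis by (simp add: symbol_right_mult ab symbol_F_mult)
qed

end

section \<open>Matrices on tensor powers\<close>

type_synonym lmat = "int list \<Rightarrow> int list \<Rightarrow> complex"

definition parl :: "int list \<Rightarrow> bit" where
  "parl xs = sum_list (map par xs)"

lemma parl_simps [simp]: "parl [] = 0" "parl (x # xs) = par x + parl xs"
  by (simp_all add: parl_def)

fun tens :: "imat \<Rightarrow> lmat \<Rightarrow> lmat" where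
  "tens a A (x # xs) (y # ys) = a x y * A xs ys"
| "tens a A xs ys = 0"

text \<open>The sign of the identification of the tensor power of \<open>End V\<close> with \<open>End\<close> of the tensor power
  of \<open>V\<close>: it moves the \<open>m\<close>-th tensor factor, of degree \<open>x + y\<close>, past the column indices from the
  \<open>m\<close>-th one on.\<close>

fun pair_sign :: "int list \<Rightarrow> int list \<Rightarrow> complex" where
  "pair_sign (x # xs) (y # ys) = sgn_bit ((par x + par y) * (par y + parl ys)) * pair_sign xs ys"
| "pair_sign xs ys = 1"

text \<open>The exchange of the entries at positions \<open>k\<close> and \<open>k + 1\<close>; \<open>ssg\<close> is the sign rule for it.\<close>

fun swp :: "nat \<Rightarrow> 'a list \<Rightarrow> 'a list" where
  "swp 0 (x # y # xs) = y # x # xs"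
| "swp (Suc k) (x # xs) = x # swp k xs"
| "swp k xs = xs"

fun ssg :: "nat \<Rightarrow> int list \<Rightarrow> complex" where
  "ssg 0 (x # y # xs) = sgn_bit (par x * par y)"
| "ssg (Suc k) (x # xs) = ssg k xs"
| "ssg k xs = 1"

lemma swp_swp [simp]: "swp k (swp k xs) = xs"
  by (induction k xs rule: swp.induct) auto

lemma ssg_swp [simp]: "ssg k (swp k xs) = ssg k xs"
  by (induction k xs rule: swp.induct) (auto simp: mult.commute)

lemma ssg_square [simp]: "ssg k xs * ssg k xs = 1" "ssg k xs * (ssg k xs * c) = c"
proof -
  show *: "ssg k xs * ssg k xs = 1" by (induction k xs rule: ssg.induct) auto
  show "ssg k xs * (ssg k xs * c) = c" by (simp add: * flip: mult.assoc)
qed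

lemma length_swp [simp]: "length (swp k xs) = length xs"
  by (induction k xs rule: swp.induct) auto

lemma set_swp [simp]: "set (swp k xs) = set xs"
  by (induction k xs rule: swp.induct) auto

lemma swp_ilists [simp]: "swp k xs \<in> ilists K d \<longleftrightarrow> xs \<in> ilists K d"
  by (simp add: ilists_def)

lemma parl_swp [simp]: "parl (swp k xs) = parl xs"
  by (induction k xs rule: swp.induct) (auto simp: add_ac)

lemma sum_swp: "(\<Sum>xs\<in>ilists K d. f (swp k xs)) = (\<Sum>xs\<in>ilists K d. f xs)"
  by (rule sum.reindex_bij_witness[of _ "swp k" "swp k"]) auto

definition conj_swp :: "nat \<Rightarrow> lmat \<Rightarrow> lmat" where
  "conj_swp k A xs ys = ssg k xs * ssg k ys * A (swp k xs) (swp k ys)"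

definition left_swp :: "nat \<Rightarrow> lmat \<Rightarrow> lmat" where
  "left_swp k A xs ys = ssg k xs * A (swp k xs) ys"

text \<open>Multiplication from the left by the signed transposition of the tensor factors \<open>0\<close> and \<open>m\<close>,
  through the recursion \<open>(0 m+1) = s\<^sub>m (0 m) s\<^sub>m\<close> with \<open>s\<^sub>m\<close> adjacent. The functions \<open>conj_transp\<close> and
  \<open>vec_transp\<close> are conjugation by it and its action on vectors.\<close>

fun left_transp :: "nat \<Rightarrow> lmat \<Rightarrow> lmat" where
  "left_transp 0 A = A"
| "left_transp (Suc 0) A = left_swp 0 A"
| "left_transp (Suc (Suc m)) A = conj_swp (Suc m) (left_transp (Suc m) (conj_swp (Suc m) A))"

fun conj_transp :: "nat \<Rightarrow> lmat \<Rightarrow> lmat" where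
  "conj_transp 0 A = A"
| "conj_transp (Suc 0) A = conj_swp 0 A"
| "conj_transp (Suc (Suc m)) A = conj_swp (Suc m) (conj_transp (Suc m) (conj_swp (Suc m) A))"

fun vec_transp :: "nat \<Rightarrow> (int list \<Rightarrow> complex) \<Rightarrow> int list \<Rightarrow> complex" where
  "vec_transp 0 f = f"
| "vec_transp (Suc 0) f = (\<lambda>xs. ssg 0 xs * f (swp 0 xs))"
| "vec_transp (Suc (Suc m)) f = (\<lambda>xs. ssg (Suc m) xs * vec_transp (Suc m) (\<lambda>xs. ssg (Suc m) xs * f (swp (Suc m) xs)) (swp (Suc m) xs))"

lemma vec_transp_scale: "vec_transp m (\<lambda>xs. c * f xs) = (\<lambda>xs. c * vec_transp m f xs)"
proof (induction m f rule: vec_transp.induct)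
  case (3 m f)
  have "(\<lambda>xs. ssg (Suc m) xs * (c * f (swp (Suc m) xs))) = (\<lambda>xs. c * (ssg (Suc m) xs * f (swp (Suc m) xs)))"
    by (simp add: mult_ac)
  thus ?case using 3 by (simp add: mult_ac)
qed (auto simp: mult_ac)

lemma left_transp_eq_vec_transp: "left_transp m A xs ys = vec_transp m (\<lambda>zs. A zs ys) xs"
proof (induction m A arbitrary: xs ys rule: left_transp.induct)
  case (3 m A)
  have "(\<lambda>zs. conj_swp (Suc m) A zs (swp (Suc m) ys))
      = (\<lambda>zs. ssg (Suc m) ys * (ssg (Suc m) zs * A (swp (Suc m) zs) ys))"
    by (simp add: conj_swp_def mult_ac)
  hence "vec_transp (Suc m) (\<lambda>zs. conj_swp (Suc m) A zs (swp (Suc m) ys))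
      = (\<lambda>xs. ssg (Suc m) ys * vec_transp (Suc m) (\<lambda>zs. ssg (Suc m) zs * A (swp (Suc m) zs) ys) xs)"
    by (simp only: vec_transp_scale)
  thus ?case by (simp add: conj_swp_def[of "Suc m" "left_transp (Suc m) _"] 3 mult_ac)
qed (auto simp: left_swp_def)

lemma conj_swp_product: "conj_swp k (\<lambda>xs ys. f xs * g ys) = (\<lambda>xs ys. (ssg k xs * f (swp k xs)) * (ssg k ys * g (swp k ys)))"
  by (intro ext) (simp add: conj_swp_def mult_ac)

lemma conj_transp_product: "conj_transp m (\<lambda>xs ys. f xs * g ys) xs ys = vec_transp m f xs * vec_transp m g ys"
proof (induction m arbitrary: f g xs ys)
  case (Suc m)
  show ?case
  proof (cases m)
    case (Suc l)
    show ?thesis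
      unfolding Suc conj_transp.simps vec_transp.simps conj_swp_product
      unfolding conj_swp_def Suc.IH[unfolded Suc] by (simp only: mult_ac)
  qed (simp add: conj_swp_product)
qed simp

lemma conj_swp_add: "conj_swp k (\<lambda>xs ys. A xs ys + B xs ys) = (\<lambda>xs ys. conj_swp k A xs ys + conj_swp k B xs ys)"
  by (intro ext) (simp add: conj_swp_def algebra_simps)

lemma conj_swp_scale: "conj_swp k (\<lambda>xs ys. c * A xs ys) = (\<lambda>xs ys. c * conj_swp k A xs ys)"
  by (intro ext) (simp add: conj_swp_def algebra_simps)

lemma conj_transp_add: "conj_transp m (\<lambda>xs ys. A xs ys + B xs ys) = (\<lambda>xs ys. conj_transp m A xs ys + conj_transp m B xs ys)"
  by (induction m A arbitrary: B rule: conj_transp.induct) (simp_all add: conj_swp_add)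

lemma conj_transp_scale: "conj_transp m (\<lambda>xs ys. c * A xs ys) = (\<lambda>xs ys. c * conj_transp m A xs ys)"
  by (induction m A rule: conj_transp.induct) (simp_all add: conj_swp_scale)

lemma conj_transp_zero: "conj_transp m (\<lambda>xs ys. 0) = (\<lambda>xs ys. 0)"
  using conj_transp_scale[of m 0 "\<lambda>xs ys. 0"] by simp

lemma conj_transp_sum_list: "conj_transp m (\<lambda>xs ys. \<Sum>i\<leftarrow>I. A i xs ys) = (\<lambda>xs ys. \<Sum>i\<leftarrow>I. conj_transp m (A i) xs ys)"
  by (induction I) (simp_all add: conj_transp_zero conj_transp_add)

lemma conj_swp_conj_swp [simp]: "conj_swp k (conj_swp k A) = A"
  by (intro ext) (simp add: conj_swp_def mult_ac)

lemma conj_swp_tens: "conj_swp (Suc k) (tens a A) = tens a (conj_swp k A)"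
proof (intro ext)
  fix xs ys show "conj_swp (Suc k) (tens a A) xs ys = tens a (conj_swp k A) xs ys"
    by (cases xs; cases ys) (simp_all add: conj_swp_def)
qed

lemma tens_scale: "tens (\<lambda>i j. c * a i j) A = (\<lambda>xs ys. c * tens a A xs ys)"
proof (intro ext)
  fix xs ys show "tens (\<lambda>i j. c * a i j) A xs ys = c * tens a A xs ys"
    by (cases xs; cases ys) simp_all
qed

lemma tens_scale_right: "tens a (\<lambda>xs ys. c * A xs ys) = (\<lambda>xs ys. c * tens a A xs ys)"
proof (intro ext)
  fix xs ys show "tens a (\<lambda>xs ys. c * A xs ys) xs ys = c * tens a A xs ys"
    by (cases xs; cases ys) simp_all
qed

lemma tens_add: "tens (\<lambda>i j. a i j + b i j) A = (\<lambda>xs ys. tens a A xs ys + tens b A xs ys)"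
proof (intro ext)
  fix xs ys show "tens (\<lambda>i j. a i j + b i j) A xs ys = tens a A xs ys + tens b A xs ys"
    by (cases xs; cases ys) (simp_all add: algebra_simps)
qed

lemma tens_add_right: "tens a (\<lambda>xs ys. A xs ys + B xs ys) = (\<lambda>xs ys. tens a A xs ys + tens a B xs ys)"
proof (intro ext)
  fix xs ys show "tens a (\<lambda>xs ys. A xs ys + B xs ys) xs ys = tens a A xs ys + tens a B xs ys"
    by (cases xs; cases ys) (simp_all add: algebra_simps)
qed

lemma tens_zero: "tens (\<lambda>i j. 0) A = (\<lambda>xs ys. 0)" "tens a (\<lambda>xs ys. 0) = (\<lambda>xs ys. 0)"
  using tens_scale[of 0 a A] tens_scale_right[of a 0 A] by simp_all

text \<open>Multiplication from the right by the \<open>b\<close>-th power of the parity operator on the tensor power.\<close>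

definition parity_right :: "bit \<Rightarrow> lmat \<Rightarrow> lmat" where
  "parity_right b A xs ys = A xs ys * sgn_bit (b * parl ys)"

context queer_env
begin

definition mm :: "nat \<Rightarrow> lmat \<Rightarrow> lmat \<Rightarrow> lmat" where
  "mm d A B xs ys = (\<Sum>zs\<in>ilists K d. A xs zs * B zs ys)"

definition m1 :: "imat \<Rightarrow> imat \<Rightarrow> imat" where
  "m1 a b i j = (\<Sum>k\<in>idx K. a i k * b k j)"

definition one :: "nat \<Rightarrow> lmat" where
  "one d xs ys = (if xs = ys \<and> xs \<in> ilists K d then 1 else 0)"

text \<open>The \<open>q\<close>-th power of the parity operator on \<open>\<complex>\<^sup>K\<^sup>|\<^sup>K\<close>; for \<open>q = 0\<close> it is the identity.\<close>

definition pm :: "bit \<Rightarrow> imat" where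
  "pm q i j = (if i = j \<and> i \<in> idx K then sgn_bit (q * par i) else 0)"

definition supp :: "nat \<Rightarrow> lmat \<Rightarrow> bool" where
  "supp d A \<longleftrightarrow> (\<forall>xs ys. A xs ys \<noteq> 0 \<longrightarrow> xs \<in> ilists K d \<and> ys \<in> ilists K d)"

definition supp1 :: "imat \<Rightarrow> bool" where
  "supp1 a \<longleftrightarrow> (\<forall>i j. a i j \<noteq> 0 \<longrightarrow> i \<in> idx K \<and> j \<in> idx K)"

lemma mm_assoc: "mm d (mm d A B) C = mm d A (mm d B C)"
  by (intro ext) (simp add: mm_def sum_distrib_left sum_distrib_right mult.assoc, rule sum.swap)

lemma mm_add_left: "mm d (\<lambda>xs ys. A xs ys + B xs ys) C = (\<lambda>xs ys. mm d A C xs ys + mm d B C xs ys)"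
  by (intro ext) (simp add: mm_def distrib_right sum.distrib)

lemma mm_add_right: "mm d A (\<lambda>xs ys. B xs ys + C xs ys) = (\<lambda>xs ys. mm d A B xs ys + mm d A C xs ys)"
  by (intro ext) (simp add: mm_def distrib_left sum.distrib)

lemma mm_scale_left: "mm d (\<lambda>xs ys. c * A xs ys) B = (\<lambda>xs ys. c * mm d A B xs ys)"
  by (intro ext) (simp add: mm_def sum_distrib_left mult.assoc)

lemma mm_scale_right: "mm d A (\<lambda>xs ys. c * B xs ys) = (\<lambda>xs ys. c * mm d A B xs ys)"
  by (intro ext) (simp add: mm_def sum_distrib_left mult_ac)

lemma mm_zero: "mm d (\<lambda>xs ys. 0) B = (\<lambda>xs ys. 0)" "mm d A (\<lambda>xs ys. 0) = (\<lambda>xs ys. 0)"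
  by (simp_all add: mm_def fun_eq_iff)

lemma mm_sum_right: "mm d A (\<lambda>xs ys. \<Sum>i\<in>I. B i xs ys) = (\<lambda>xs ys. \<Sum>i\<in>I. mm d A (B i) xs ys)"
  by (induction I rule: infinite_finite_induct) (simp_all add: mm_zero mm_add_right)

lemma mm_one_left: "supp d A \<Longrightarrow> mm d (one d) A = A"
proof (intro ext)
  fix xs ys assume "supp d A"
  have "mm d (one d) A xs ys = (\<Sum>zs\<in>ilists K d. if zs = xs then A xs ys else 0)"
    unfolding mm_def one_def by (rule sum.cong) auto
  thus "mm d (one d) A xs ys = A xs ys" using \<open>supp d A\<close> by (auto simp: supp_def)
qed

lemma mm_one_right: "supp d A \<Longrightarrow> mm d A (one d) = A"
proof (intro ext)
  fix xs ys assume "supp d A"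
  have "mm d A (one d) xs ys = (\<Sum>zs\<in>ilists K d. if zs = ys then A xs ys else 0)"
    unfolding mm_def one_def by (rule sum.cong) auto
  thus "mm d A (one d) xs ys = A xs ys" using \<open>supp d A\<close> by (auto simp: supp_def)
qed

lemma mm_tens: "mm (Suc d) (tens a A) (tens b B) = tens (m1 a b) (mm d A B)"
proof (intro ext)
  fix xs ys
  show "mm (Suc d) (tens a A) (tens b B) xs ys = tens (m1 a b) (mm d A B) xs ys"
  proof (cases xs; cases ys)
    fix x xs' y ys' assume "xs = x # xs'" "ys = y # ys'"
    thus ?thesis
      by (simp add: mm_def m1_def sum_ilists_Suc sum_product mult_ac)
  qed (simp_all add: mm_def)
qed

lemma supp_tens: "supp1 a \<Longrightarrow> supp d A \<Longrightarrow> supp (Suc d) (tens a A)"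
  unfolding supp_def
proof (intro allI impI)
  fix xs ys assume *: "supp1 a" "\<forall>xs ys. A xs ys \<noteq> 0 \<longrightarrow> xs \<in> ilists K d \<and> ys \<in> ilists K d" "tens a A xs ys \<noteq> 0"
  obtain x xs' y ys' where e: "xs = x # xs'" "ys = y # ys'" using *(3) by (cases xs; cases ys) auto
  show "xs \<in> ilists K (Suc d) \<and> ys \<in> ilists K (Suc d)"
    using * unfolding e supp1_def by auto
qed

lemma supp_one: "supp d (one d)"
  by (auto simp: supp_def one_def)

lemma supp1_pm: "supp1 (pm q)"
  by (auto simp: supp1_def pm_def)

lemma one_Suc: "one (Suc d) = tens (pm 0) (one d)"
proof (intro ext)
  fix xs ys show "one (Suc d) xs ys = tens (pm 0) (one d) xs ys"
    by (cases xs; cases ys) (auto simp: one_def pm_def ilists_def)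
qed

lemma m1_pm_right: "supp1 a \<Longrightarrow> m1 a (pm q) = (\<lambda>i j. a i j * sgn_bit (q * par j))"
proof (intro ext)
  fix i j assume a: "supp1 a"
  have "m1 a (pm q) i j = (\<Sum>k\<in>idx K. if k = j then a i j * sgn_bit (q * par j) else 0)"
    unfolding m1_def pm_def by (rule sum.cong) auto
  thus "m1 a (pm q) i j = a i j * sgn_bit (q * par j)" using a by (auto simp: supp1_def)
qed

lemma m1_pm_left: "supp1 a \<Longrightarrow> m1 (pm q) a = (\<lambda>i j. sgn_bit (q * par i) * a i j)"
proof (intro ext)
  fix i j assume a: "supp1 a"
  have "m1 (pm q) a i j = (\<Sum>k\<in>idx K. if k = i then sgn_bit (q * par i) * a i j else 0)"
    unfolding m1_def pm_def by (rule sum.cong) auto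
  thus "m1 (pm q) a i j = sgn_bit (q * par i) * a i j" using a by (auto simp: supp1_def)
qed

lemma conj_swp_mm: "conj_swp k (mm d A B) = mm d (conj_swp k A) (conj_swp k B)"
proof (intro ext)
  fix xs ys
  have "conj_swp k (mm d A B) xs ys = (\<Sum>zs\<in>ilists K d. ssg k xs * ssg k ys * (A (swp k xs) (swp k zs) * B (swp k zs) (swp k ys)))"
    unfolding conj_swp_def mm_def sum_distrib_left
    by (rule sum_swp[symmetric])
  thus "conj_swp k (mm d A B) xs ys = mm d (conj_swp k A) (conj_swp k B) xs ys"
    unfolding mm_def by (simp add: conj_swp_def mult_ac)
qed

lemma conj_transp_mm: "conj_transp m (mm d A B) = mm d (conj_transp m A) (conj_transp m B)"
  by (induction m A arbitrary: B rule: conj_transp.induct) (simp_all add: conj_swp_mm)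

lemma conj_swp_one: "conj_swp k (one d) = one d"
proof (intro ext)
  fix xs ys :: "int list"
  have "swp k xs = swp k ys \<longleftrightarrow> xs = ys" by (metis swp_swp)
  thus "conj_swp k (one d) xs ys = one d xs ys" by (auto simp: conj_swp_def one_def)
qed

text \<open>Exchanging two homogeneous factors creates a sign at a row of one and at a column of the other,
  which are parity operators on the new factors.\<close>

lemma conj_swp_tens_tens:
  assumes "homog_mat p a" "homog_mat r b"
  shows "conj_swp 0 (tens a (tens b A)) = tens (\<lambda>i j. sgn_bit (p * par i) * b i j) (tens (\<lambda>i j. a i j * sgn_bit (r * par j)) A)"
proof (intro ext)
  fix xs ys :: "int list"
  have *: "sgn_bit (par x * par x') * (sgn_bit (par y * par y') * (a x' y' * b x y))
     = sgn_bit (p * par x) * (sgn_bit (r * par y') * (a x' y' * b x y))" for x x' y y'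
  proof (cases "a x' y' = 0 \<or> b x y = 0")
    case False
    hence "p = par x' + par y'" "r = par x + par y" using assms by (auto simp: homog_mat_def)
    thus ?thesis by (cases "par x"; cases "par y"; cases "par x'"; cases "par y'") simp_all
  qed auto
  consider (1) x x' zs y y' ws where "xs = x # x' # zs" "ys = y # y' # ws"
    | (2) "length xs < 2" | (3) "length ys < 2"
    by (cases xs; cases ys; cases "tl xs"; cases "tl ys") auto
  thus "conj_swp 0 (tens a (tens b A)) xs ys
     = tens (\<lambda>i j. sgn_bit (p * par i) * b i j) (tens (\<lambda>i j. a i j * sgn_bit (r * par j)) A) xs ys"
  proof cases
    case 1
    thus ?thesis using *[of x x' y y'] by (simp add: conj_swp_def mult_ac)
  next
    case 2
    thus ?thesis by (cases xs; cases ys; cases "tl xs"; cases "tl ys") (auto simp: conj_swp_def)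
  next
    case 3
    thus ?thesis by (cases xs; cases ys; cases "tl xs"; cases "tl ys") (auto simp: conj_swp_def)
  qed
qed

lemma homog_mat_pm: "homog_mat 0 (pm q)"
  by (auto simp: homog_mat_def pm_def)

text \<open>The action of an element \<open>y\<close> of degree \<open>r\<close> on the \<open>d\<close>-th tensor power, written with ordinary
  matrices: the parity operator on the factors to the left accounts for the sign rule.\<close>

fun coprod :: "nat \<Rightarrow> bit \<Rightarrow> imat \<Rightarrow> lmat" where
  "coprod 0 r y = (\<lambda>xs ys. 0)"
| "coprod (Suc d) r y = (\<lambda>xs ys. tens y (one d) xs ys + tens (pm r) (coprod d r y) xs ys)"

text \<open>The summand of \<open>coprod\<close> in which \<open>y\<close> sits at the tensor factor \<open>m\<close>.\<close>

fun at_factor :: "nat \<Rightarrow> nat \<Rightarrow> bit \<Rightarrow> imat \<Rightarrow> lmat" where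
  "at_factor 0 m r y = (\<lambda>xs ys. 0)"
| "at_factor (Suc d) 0 r y = tens y (one d)"
| "at_factor (Suc d) (Suc m) r y = tens (pm r) (at_factor d m r y)"

lemma sum_at_factor: "(\<lambda>xs ys. \<Sum>m<d. at_factor d m r y xs ys) = coprod d r y"
proof (induction d)
  case (Suc d)
  have "tens (pm r) (\<lambda>xs ys. \<Sum>m<n. A m xs ys) = (\<lambda>xs ys. \<Sum>m<n. tens (pm r) (A m) xs ys)" for n :: nat and A
    by (induction n) (simp_all add: tens_zero tens_add_right)
  from this[of "\<lambda>m. at_factor d m r y" d] show ?case
    by (simp add: sum.lessThan_Suc_shift Suc del: sum.lessThan_Suc)
qed simp

lemma supp_coprod: "supp1 y \<Longrightarrow> supp d (coprod d r y)"
proof (induction d)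
  case (Suc d)
  have "supp (Suc d) (tens y (one d))" "supp (Suc d) (tens (pm r) (coprod d r y))"
    by (intro supp_tens supp_one supp1_pm Suc)+
  thus ?case unfolding supp_def by simp (metis add.right_neutral)
qed (simp add: supp_def)

lemma conj_swp_at_factor:
  assumes "homog_mat r y" "supp1 y" "Suc m < d"
  shows "conj_swp m (at_factor d m r y) = at_factor d (Suc m) r y"
  using assms(3)
proof (induction m arbitrary: d)
  case 0
  then obtain e where d: "d = Suc (Suc e)" by (cases d; cases "d - 1") auto
  have "conj_swp 0 (tens y (tens (pm 0) (one e))) = tens (\<lambda>i j. sgn_bit (r * par i) * pm 0 i j) (tens (\<lambda>i j. y i j * sgn_bit (0 * par j)) (one e))"
    by (rule conj_swp_tens_tens[OF assms(1) homog_mat_pm])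
  also have "(\<lambda>i j. sgn_bit (r * par i) * pm 0 i j) = pm r" by (auto simp: pm_def fun_eq_iff)
  finally show ?case by (simp add: d one_Suc)
next
  case (Suc m)
  then obtain e where "d = Suc e" by (cases d) auto
  thus ?case using Suc by (simp add: conj_swp_tens)
qed

lemma conj_swp_at_factor_0: "0 < k \<Longrightarrow> conj_swp k (at_factor d 0 r y) = at_factor d 0 r y"
proof (cases d)
  case 0 thus ?thesis by (simp add: conj_swp_def fun_eq_iff)
next
  case (Suc e)
  assume "0 < k"
  then obtain l where "k = Suc l" by (cases k) auto
  thus ?thesis by (simp add: Suc conj_swp_tens conj_swp_one)
qed

lemma conj_transp_at_factor:
  assumes "homog_mat r y" "supp1 y" "m < d"
  shows "conj_transp m (at_factor d 0 r y) = at_factor d m r y"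
  using assms(3)
proof (induction m)
  case (Suc m)
  show ?case
  proof (cases m)
    case 0
    thus ?thesis using conj_swp_at_factor[OF assms(1,2), of 0 d] Suc by simp
  next
    case (Suc l)
    thus ?thesis using conj_swp_at_factor[OF assms(1,2), of m d] Suc.IH Suc.prems by (simp add: conj_swp_at_factor_0)
  qed
qed simp

lemma conj_swp_coprod:
  assumes "homog_mat r y" "supp1 y" "Suc k < d"
  shows "conj_swp k (coprod d r y) = coprod d r y"
  using assms(3)
proof (induction k arbitrary: d)
  case 0
  then obtain e where d: "d = Suc (Suc e)" by (cases d; cases "d - 1") auto
  have D: "coprod d r y = (\<lambda>xs ys. at_factor d 0 r y xs ys + (at_factor d 1 r y xs ys + tens (pm r) (tens (pm r) (coprod e r y)) xs ys))"
    by (simp add: d tens_add_right)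
  have 1: "conj_swp 0 (at_factor d 0 r y) = at_factor d 1 r y" using conj_swp_at_factor[OF assms(1,2), of 0 d] by (simp add: d)
  hence 2: "conj_swp 0 (at_factor d 1 r y) = at_factor d 0 r y" by (metis conj_swp_conj_swp)
  have 3: "conj_swp 0 (tens (pm r) (tens (pm r) (coprod e r y))) = tens (pm r) (tens (pm r) (coprod e r y))"
    using conj_swp_tens_tens[OF homog_mat_pm homog_mat_pm, of r r "coprod e r y"] by simp
  show ?case unfolding D conj_swp_add 1 2 3 by (simp add: fun_eq_iff)
next
  case (Suc k)
  then obtain e where "d = Suc e" by (cases d) auto
  thus ?case using Suc by (simp add: conj_swp_tens conj_swp_add conj_swp_one)
qed

lemma conj_transp_fixed:
  assumes "\<And>k. Suc k < d \<Longrightarrow> conj_swp k A = A" "m < d"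
  shows "conj_transp m A = A"
  using assms(2)
proof (induction m)
  case (Suc m)
  thus ?case using assms(1) by (cases m) auto
qed simp

end

context queer_env
begin

definition tmat :: "coeffs \<Rightarrow> lmat" where
  "tmat \<phi> xs ys = pair_sign xs ys * \<phi> (zip xs ys)"

lemma coprod_par:
  assumes "homog_mat r y" "coprod d r y xs ys \<noteq> 0"
  shows "parl xs = parl ys + r"
  using assms(2)
proof (induction d arbitrary: xs ys)
  case (Suc d)
  obtain x xs' z zs where e: "xs = x # xs'" "ys = z # zs" using Suc.prems by (cases xs; cases ys) auto
  show ?case
  proof (cases "y x z * one d xs' zs = 0")
    case False
    hence "y x z \<noteq> 0" "xs' = zs" by (auto simp: one_def split: if_splits)
    hence "par x + par z = r" "xs' = zs" using assms(1) by (auto simp: homog_mat_def)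
    hence "par x = par z + r" by (metis bit_add_eq_iff add.commute)
    thus ?thesis using \<open>xs' = zs\<close> by (simp add: e add_ac)
  next
    case True
    hence "pm r x z \<noteq> 0" "coprod d r y xs' zs \<noteq> 0" using Suc.prems by (auto simp: e)
    thus ?thesis using Suc.IH[of xs' zs] by (auto simp: e pm_def add_ac split: if_splits)
  qed
qed simp

lemma mm_coprod_left:
  assumes "xs \<in> ilists K d" "x \<in> idx K"
  shows "mm (Suc d) (coprod (Suc d) r y) T (x # xs) zs
    = (\<Sum>k\<in>idx K. y x k * T (k # xs) zs) + sgn_bit (r * par x) * mm d (coprod d r y) (\<lambda>us. T (x # us)) xs zs"
proof -
  have 1: "(\<Sum>us\<in>ilists K d. one d xs us * c us) = c xs" for c
  proof -
    have "(\<Sum>us\<in>ilists K d. one d xs us * c us) = (\<Sum>us\<in>ilists K d. if us = xs then c us else 0)"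
      unfolding one_def by (rule sum.cong) auto
    thus ?thesis using assms by simp
  qed
  have 2: "(\<Sum>k\<in>idx K. \<Sum>us\<in>ilists K d. pm r x k * c k us) = (\<Sum>us\<in>ilists K d. sgn_bit (r * par x) * c x us)" for c
  proof -
    have "(\<Sum>k\<in>idx K. \<Sum>us\<in>ilists K d. pm r x k * c k us)
       = (\<Sum>k\<in>idx K. if k = x then (\<Sum>us\<in>ilists K d. sgn_bit (r * par x) * c x us) else 0)"
      unfolding pm_def using assms by (intro sum.cong refl) auto
    thus ?thesis using assms by simp
  qed
  show ?thesis
    unfolding mm_def sum_ilists_Suc
    using 1 2[of "\<lambda>k us. coprod d r y xs us * T (k # us) zs"]
    by (simp add: distrib_right sum.distrib mult.assoc sum_distrib_left[symmetric])
qed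

lemma mm_coprod_right:
  assumes "zs \<in> ilists K d" "z \<in> idx K"
  shows "mm (Suc d) T (coprod (Suc d) r y) xs (z # zs)
    = (\<Sum>k\<in>idx K. T xs (k # zs) * y k z) + sgn_bit (r * par z) * mm d (\<lambda>xs us. T xs (z # us)) (coprod d r y) xs zs"
proof -
  have 1: "(\<Sum>us\<in>ilists K d. c us * one d us zs) = c zs" for c
  proof -
    have "(\<Sum>us\<in>ilists K d. c us * one d us zs) = (\<Sum>us\<in>ilists K d. if us = zs then c us else 0)"
      unfolding one_def by (rule sum.cong) auto
    thus ?thesis using assms by simp
  qed
  have 2: "(\<Sum>k\<in>idx K. \<Sum>us\<in>ilists K d. pm r k z * c k us) = (\<Sum>us\<in>ilists K d. sgn_bit (r * par z) * c z us)" for c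
  proof -
    have "(\<Sum>k\<in>idx K. \<Sum>us\<in>ilists K d. pm r k z * c k us)
       = (\<Sum>k\<in>idx K. if k = z then (\<Sum>us\<in>ilists K d. sgn_bit (r * par z) * c z us) else 0)"
      unfolding pm_def using assms by (intro sum.cong refl) auto
    thus ?thesis using assms by simp
  qed
  have "mm (Suc d) T (coprod (Suc d) r y) xs (z # zs) = (\<Sum>k\<in>idx K. \<Sum>us\<in>ilists K d. (T xs (k # us) * y k z) * one d us zs)
     + (\<Sum>k\<in>idx K. \<Sum>us\<in>ilists K d. pm r k z * (T xs (k # us) * coprod d r y us zs))"
    unfolding mm_def sum_ilists_Suc by (simp add: distrib_left sum.distrib mult_ac)
  thus ?thesis
    unfolding 1 2[of "\<lambda>k us. T xs (k # us) * coprod d r y us zs"]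
    by (simp add: mm_def sum_distrib_left mult_ac)
qed

text \<open>The difference of left and right quasi-shuffle multiplication has no insertion terms, and its
  merging terms are matrix multiplications on single tensor factors. The signs \<open>pair_sign\<close> turn it
  into an ordinary commutator.\<close>

lemma commutator_tmat:
  assumes y: "homog_mat r y" and "xs \<in> ilists K d" "zs \<in> ilists K d"
  shows "mm d (coprod d r y) (tmat \<phi>) xs zs - mm d (tmat \<phi>) (coprod d r y) xs zs
    = sgn_bit (r * parl zs) * pair_sign xs zs * (act y \<phi> (zip xs zs) - ract r y \<phi> (zip xs zs))"
  using assms(2,3)
proof (induction d arbitrary: xs zs \<phi>)
  case 0
  thus ?case by (simp add: mm_def)
next
  case (Suc d)
  obtain x xs' z zs' where e: "xs = x # xs'" "zs = z # zs'" "x \<in> idx K" "xs' \<in> ilists K d" "z \<in> idx K" "zs' \<in> ilists K d"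
    using Suc.prems unfolding ilists_Suc by auto
  define \<psi> where "\<psi> = (\<lambda>k l u. \<phi> ((k, l) # u))"
  define w where "w = zip xs' zs'"
  define q where "q = parl zs'"
  define S where "S = pair_sign xs' zs'"
  define s where "s = sgn_bit ((par x + par z) * (par z + q))"
  have T: "tmat \<phi> (k # us) (l # vs) = sgn_bit ((par k + par l) * (par l + parl vs)) * tmat (\<psi> k l) us vs" for k l us vs
    by (simp add: tmat_def \<psi>_def)
  \<comment> \<open>\<open>A\<close> and \<open>B\<close> treat the action on the later tensor factors, \<open>C\<close> and \<open>D\<close> the one on the first factor; in all four the sign of the first factor is separated from those of the rest\<close>
  have A: "mm d (coprod d r y) (\<lambda>us. tmat \<phi> (x # us)) xs' zs = s * mm d (coprod d r y) (tmat (\<psi> x z)) xs' zs'"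
    unfolding mm_def sum_distrib_left e(2) T s_def q_def by (rule sum.cong) auto
  have B: "sgn_bit (r * par z) * mm d (\<lambda>xs us. tmat \<phi> xs (z # us)) (coprod d r y) xs zs'
      = sgn_bit (r * par x) * (s * mm d (tmat (\<psi> x z)) (coprod d r y) xs' zs')"
    unfolding mm_def sum_distrib_left e(1) T
  proof (rule sum.cong[OF refl])
    fix us
    have "sgn_bit (r * par z) * sgn_bit ((par x + par z) * (par z + parl us)) * coprod d r y us zs'
        = sgn_bit (r * par x) * s * coprod d r y us zs'"
    proof (cases "coprod d r y us zs' = 0")
      case False
      hence "parl us = q + r" unfolding q_def by (rule coprod_par[OF y])
      thus ?thesis unfolding s_def by (cases "par x"; cases "par z"; cases q; cases r) simp_all
    qed simp
    thus "sgn_bit (r * par z) * (sgn_bit ((par x + par z) * (par z + parl us)) * tmat (\<psi> x z) xs' us * coprod d r y us zs')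
        = sgn_bit (r * par x) * (s * (tmat (\<psi> x z) xs' us * coprod d r y us zs'))"
      by (simp add: mult_ac)
  qed
  have C: "(\<Sum>k\<in>idx K. y x k * tmat \<phi> (k # xs') zs) = sgn_bit (r * (par z + q)) * s * S * (\<Sum>k\<in>idx K. y x k * \<psi> k z w)"
    unfolding sum_distrib_left e(2) T
  proof (rule sum.cong[OF refl])
    fix k
    have "sgn_bit ((par k + par z) * (par z + q)) * y x k = sgn_bit (r * (par z + q)) * s * y x k"
    proof (cases "y x k = 0")
      case False
      hence "r = par x + par k" using y by (auto simp: homog_mat_def)
      thus ?thesis unfolding s_def by (cases "par x"; cases "par z"; cases q; cases "par k") simp_all
    qed simp
    hence "(sgn_bit ((par k + par z) * (par z + q)) * y x k) * (S * \<psi> k z w)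
        = (sgn_bit (r * (par z + q)) * s * y x k) * (S * \<psi> k z w)" by (simp only:)
    thus "y x k * (sgn_bit ((par k + par z) * (par z + parl zs')) * tmat (\<psi> k z) xs' zs')
        = sgn_bit (r * (par z + q)) * s * S * (y x k * \<psi> k z w)"
      unfolding tmat_def q_def[symmetric] S_def[symmetric] w_def[symmetric] by (simp only: mult_ac)
  qed
  have D: "(\<Sum>k\<in>idx K. tmat \<phi> xs (k # zs') * y k z)
      = sgn_bit (r * (par z + q)) * s * S * (\<Sum>k\<in>idx K. sgn_bit (r * (par x + par k)) * y k z * \<psi> x k w)"
    unfolding sum_distrib_left e(1) T
  proof (rule sum.cong[OF refl])
    fix k
    have "sgn_bit ((par x + par k) * (par k + q)) * y k z = sgn_bit (r * (par z + q)) * s * (sgn_bit (r * (par x + par k)) * y k z)"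
    proof (cases "y k z = 0")
      case False
      hence "r = par k + par z" using y by (auto simp: homog_mat_def)
      thus ?thesis unfolding s_def by (cases "par x"; cases "par z"; cases q; cases "par k") simp_all
    qed simp
    hence "(sgn_bit ((par x + par k) * (par k + q)) * y k z) * (S * \<psi> x k w)
        = (sgn_bit (r * (par z + q)) * s * (sgn_bit (r * (par x + par k)) * y k z)) * (S * \<psi> x k w)" by (simp only:)
    thus "sgn_bit ((par x + par k) * (par k + parl zs')) * tmat (\<psi> x k) xs' zs' * y k z
        = sgn_bit (r * (par z + q)) * s * S * (sgn_bit (r * (par x + par k)) * y k z * \<psi> x k w)"
      unfolding tmat_def q_def[symmetric] S_def[symmetric] w_def[symmetric] by (simp only: mult_ac)
  qed
  have IH: "mm d (coprod d r y) (tmat (\<psi> x z)) xs' zs' - mm d (tmat (\<psi> x z)) (coprod d r y) xs' zs'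
      = sgn_bit (r * q) * S * (act y (\<psi> x z) w - ract r y (\<psi> x z) w)"
    using Suc.IH[OF e(4,6), of "\<psi> x z"] by (simp add: q_def S_def w_def)
  have "mm (Suc d) (coprod (Suc d) r y) (tmat \<phi>) xs zs - mm (Suc d) (tmat \<phi>) (coprod (Suc d) r y) xs zs
     = (\<Sum>k\<in>idx K. y x k * tmat \<phi> (k # xs') zs) - (\<Sum>k\<in>idx K. tmat \<phi> xs (k # zs') * y k z)
       + sgn_bit (r * par x) * s * (mm d (coprod d r y) (tmat (\<psi> x z)) xs' zs' - mm d (tmat (\<psi> x z)) (coprod d r y) xs' zs')"
    using mm_coprod_left[OF e(4,3), of r y "tmat \<phi>" zs] mm_coprod_right[OF e(6,5), of "tmat \<phi>" r y xs] A B
    by (simp add: e(1,2)[symmetric] right_diff_distrib)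
  also have "\<dots> = sgn_bit (r * (par z + q)) * s * S * ((\<Sum>k\<in>idx K. y x k * \<psi> k z w)
        - (\<Sum>k\<in>idx K. sgn_bit (r * (par x + par k)) * y k z * \<psi> x k w))
      + sgn_bit (r * par x) * s * (sgn_bit (r * q) * S * (act y (\<psi> x z) w - ract r y (\<psi> x z) w))"
    unfolding C D IH by (simp add: right_diff_distrib)
  also have "sgn_bit (r * par x) * s * (sgn_bit (r * q) * S * (act y (\<psi> x z) w - ract r y (\<psi> x z) w))
      = sgn_bit (r * (par z + q)) * s * S * (sgn_bit ((par x + par z) * r) * (act y (\<psi> x z) w - ract r y (\<psi> x z) w))"
    by (cases r; cases "par x"; cases "par z"; cases q) (simp_all add: algebra_simps)
  also have "sgn_bit (r * (par z + q)) * s * S * ((\<Sum>k\<in>idx K. y x k * \<psi> k z w)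
        - (\<Sum>k\<in>idx K. sgn_bit (r * (par x + par k)) * y k z * \<psi> x k w))
      + sgn_bit (r * (par z + q)) * s * S * (sgn_bit ((par x + par z) * r) * (act y (\<psi> x z) w - ract r y (\<psi> x z) w))
      = sgn_bit (r * (par z + q)) * s * S * (act y \<phi> ((x, z) # w) - ract r y \<phi> ((x, z) # w))"
    unfolding act_Cons_homog_mat[OF y] ract.simps \<psi>_def by (simp add: algebra_simps)
  finally show ?case
    by (simp add: e(1,2) s_def S_def q_def w_def mult_ac)
qed

end

section \<open>Orthogonal projections in finite dimension\<close>

inductive_set lspan :: "('i \<Rightarrow> complex) list \<Rightarrow> ('i \<Rightarrow> complex) set" for us where
  zero: "(\<lambda>i. 0) \<in> lspan us"
| step: "u \<in> set us \<Longrightarrow> f \<in> lspan us \<Longrightarrow> (\<lambda>i. c * u i + f i) \<in> lspan us"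

lemma lspan_add: "f \<in> lspan us \<Longrightarrow> g \<in> lspan us \<Longrightarrow> (\<lambda>i. f i + g i) \<in> lspan us"
proof (induction rule: lspan.induct)
  case (step u f c)
  have "(\<lambda>i. c * u i + (f i + g i)) \<in> lspan us"
    by (rule lspan.step) (use step in auto)
  thus ?case by (simp add: add.assoc)
qed simp

lemma lspan_scale: "f \<in> lspan us \<Longrightarrow> (\<lambda>i. d * f i) \<in> lspan us"
proof (induction rule: lspan.induct)
  case (step u f c)
  have "(\<lambda>i. (d * c) * u i + d * f i) \<in> lspan us"
    by (rule lspan.step) (use step in auto)
  thus ?case by (simp add: algebra_simps)
qed (simp add: lspan.zero)

lemma lspan_mono: "f \<in> lspan us \<Longrightarrow> set us \<subseteq> set vs \<Longrightarrow> f \<in> lspan vs"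
  by (induction rule: lspan.induct) (auto intro: lspan.intros)

lemma mult_cnj_self: "z * cnj z = (complex_of_real (cmod z))\<^sup>2"
  using complex_norm_square[of z] by simp

text \<open>The Gram-Schmidt step with respect to the Hermitian form of \<open>A\<close>. A list that is linearly
  dependent on \<open>A\<close> is permitted: if the new vector has no component orthogonal to the others on
  \<open>A\<close>, the coefficient is zero.\<close>

lemma orthogonal_projection:
  fixes T :: "'i \<Rightarrow> complex"
  assumes A: "finite A"
  shows "\<exists>f\<in>lspan us. \<forall>u\<in>set us. (\<Sum>i\<in>A. (T i - f i) * cnj (u i)) = 0"
proof (induction us arbitrary: T)
  case Nil
  show ?case by (auto intro: lspan.zero)
next
  case (Cons u us)
  define ip where "ip = (\<lambda>f g :: 'i \<Rightarrow> complex. \<Sum>i\<in>A. f i * cnj (g i))"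
  have ip_add: "ip f (\<lambda>i. g i + h i) = ip f g + ip f h"
    and ip_diff: "ip (\<lambda>i. f i - c * h i) g = ip f g - c * ip h g"
    and ip_scale: "ip f (\<lambda>i. c * g i) = cnj c * ip f g" for f g h c
    by (simp_all add: ip_def algebra_simps sum.distrib sum_subtractf sum_distrib_left)
  obtain f g where f: "f \<in> lspan us" "\<And>v. v \<in> set us \<Longrightarrow> ip (\<lambda>i. T i - f i) v = 0"
    and g: "g \<in> lspan us" "\<And>v. v \<in> set us \<Longrightarrow> ip (\<lambda>i. u i - g i) v = 0"
    using Cons[of T] Cons[of u] unfolding ip_def by blast
  define t where "t = (\<lambda>i. T i - f i)"
  define h where "h = (\<lambda>i. u i - g i)"
  \<comment> \<open>if \<open>h\<close> vanishes on \<open>A\<close>, any coefficient works, since \<open>t\<close> is then orthogonal to it\<close>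
  define c where "c = (if ip h h = 0 then 0 else ip t h / ip h h)"
  have perp: "ip k v = 0" if "v \<in> lspan us" "\<And>v. v \<in> set us \<Longrightarrow> ip k v = 0" for k v
    using that(1)
  proof (induction rule: lspan.induct)
    case zero thus ?case by (simp add: ip_def)
  qed (simp add: ip_add ip_scale that(2))
  have hh: "ip t h = 0" if "ip h h = 0"
  proof -
    have "ip h h = of_real (\<Sum>i\<in>A. (cmod (h i))\<^sup>2)"
      unfolding ip_def by (simp add: mult_cnj_self)
    hence "complex_of_real (\<Sum>i\<in>A. (cmod (h i))\<^sup>2) = 0" using that by (simp only:)
    hence "(\<Sum>i\<in>A. (cmod (h i))\<^sup>2) = 0" by (simp only: of_real_eq_0_iff)
    hence "\<forall>i\<in>A. h i = 0" using A by (simp add: sum_nonneg_eq_0_iff)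
    thus ?thesis by (simp add: ip_def)
  qed
  define k where "k = (\<lambda>i. f i + (c * u i + (- c) * g i))"
  have k: "k \<in> lspan (u # us)" unfolding k_def
    by (intro lspan_add lspan.step lspan_scale) (auto intro: lspan_mono[OF f(1)] lspan_mono[OF g(1)])
  have Tk: "(\<lambda>i. T i - k i) = (\<lambda>i. t i - c * h i)"
    by (auto simp: k_def t_def h_def algebra_simps)
  have us: "ip (\<lambda>i. t i - c * h i) v = 0" if "v \<in> set us" for v
    unfolding ip_diff using f(2)[OF that] g(2)[OF that] by (simp add: t_def h_def)
  have "ip (\<lambda>i. t i - c * h i) h = 0"
    unfolding ip_diff using hh by (auto simp: c_def)
  moreover have "ip (\<lambda>i. t i - c * h i) g = 0" by (rule perp[OF g(1) us])
  moreover have "u = (\<lambda>i. h i + g i)" by (simp add: h_def)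
  ultimately have "ip (\<lambda>i. t i - c * h i) u = 0" by (metis ip_add add_0)
  hence "\<forall>v\<in>set (u # us). ip (\<lambda>i. T i - k i) v = 0" unfolding Tk using us by simp
  thus ?case using k unfolding ip_def by blast
qed

text \<open>A double commutant theorem by positivity. If \<open>T\<close> commutes with the averages
  \<open>\<Sum>\<^sub>u u Z u\<^sup>T\<close> of all matrix units \<open>Z\<close> and is orthogonal to the real matrices \<open>u\<close>, then the linear
  functional \<open>\<langle>T u, T\<rangle>\<close> vanishes on each \<open>u\<close>, because the sum of its squared absolute values does.
  As the identity is a combination of the \<open>u\<close>, also \<open>\<langle>T, T\<rangle> = 0\<close>.\<close>

lemma orthogonal_commuting_zero:
  fixes T :: "'j \<Rightarrow> 'j \<Rightarrow> complex" and us :: "('j \<Rightarrow> 'j \<Rightarrow> complex) list"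
  assumes A: "finite A"
    and real: "\<And>u a b. u \<in> set us \<Longrightarrow> cnj (u a b) = u a b"
    and orth: "\<And>u. u \<in> set us \<Longrightarrow> (\<Sum>a\<in>A. \<Sum>b\<in>A. T a b * u a b) = 0"
    and comm: "\<And>p q a c. p \<in> A \<Longrightarrow> q \<in> A \<Longrightarrow> a \<in> A \<Longrightarrow> c \<in> A \<Longrightarrow>
       (\<Sum>w\<in>A. T a w * (\<Sum>u\<leftarrow>us. u w p * u c q)) = (\<Sum>w\<in>A. (\<Sum>u\<leftarrow>us. u a p * u w q) * T w c)"
    and one: "e \<in> lspan (map (\<lambda>u (a, b). u a b) us)" "\<And>a b. a \<in> A \<Longrightarrow> b \<in> A \<Longrightarrow> e (a, b) = (if a = b then 1 else 0)"
    and ab: "a \<in> A" "b \<in> A"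
  shows "T a b = 0"
proof -
  \<comment> \<open>the pairing \<open>\<langle>T u, T\<rangle>\<close>; by the hypothesis on averages it may be replaced by \<open>\<langle>u, T\<rangle>\<close> times entries of \<open>T\<close>\<close>
  define \<tau> where "\<tau> = (\<lambda>u. \<Sum>a\<in>A. \<Sum>p\<in>A. cnj (T a p) * (\<Sum>w\<in>A. T a w * u w p))"
  have orth': "(\<Sum>a\<in>A. \<Sum>p\<in>A. cnj (T a p) * u a p) = 0" if "u \<in> set us" for u
    using arg_cong[OF orth[OF that], of cnj] by (simp add: real[OF that])
  have sw: "(\<Sum>i\<in>B. \<Sum>u\<leftarrow>vs. h i u) = (\<Sum>u\<leftarrow>vs. \<Sum>i\<in>B. h i u)" for h :: "'j \<Rightarrow> ('j \<Rightarrow> 'j \<Rightarrow> complex) \<Rightarrow> complex" and B vs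
    by (induction vs) (simp_all add: sum.distrib)
  have 1: "(\<Sum>u\<leftarrow>us. \<tau> u * u c q) = 0" if "c \<in> A" "q \<in> A" for c q
  proof -
    have "(\<Sum>u\<leftarrow>us. \<tau> u * u c q) = (\<Sum>a\<in>A. \<Sum>p\<in>A. cnj (T a p) * (\<Sum>w\<in>A. T a w * (\<Sum>u\<leftarrow>us. u w p * u c q)))"
      by (simp add: \<tau>_def sum_distrib_left sum_distrib_right sum_list_const_mult[symmetric] sw mult_ac)
    also have "\<dots> = (\<Sum>a\<in>A. \<Sum>p\<in>A. cnj (T a p) * (\<Sum>w\<in>A. (\<Sum>u\<leftarrow>us. u a p * u w q) * T w c))"
      using comm that by (intro sum.cong refl) simp
    also have "\<dots> = (\<Sum>u\<leftarrow>us. (\<Sum>a\<in>A. \<Sum>p\<in>A. cnj (T a p) * u a p) * (\<Sum>w\<in>A. u w q * T w c))"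
      by (simp add: sum_distrib_left sum_distrib_right sum_list_const_mult[symmetric] sum_list_mult_const[symmetric] sw mult_ac)
    also have "\<dots> = (\<Sum>u\<leftarrow>us. 0)" using orth' by (intro arg_cong[where f = sum_list] map_cong) auto
    finally show ?thesis by simp
  qed
  have cnj\<tau>: "cnj (\<tau> u) = (\<Sum>r\<in>A. \<Sum>p\<in>A. (\<Sum>a\<in>A. T a p * cnj (T a r)) * u r p)" if "u \<in> set us" for u
  proof -
    have "cnj (\<tau> u) = (\<Sum>a\<in>A. \<Sum>p\<in>A. \<Sum>r\<in>A. T a p * cnj (T a r) * u r p)"
      by (simp add: \<tau>_def real[OF that] sum_distrib_left mult_ac)
    also have "\<dots> = (\<Sum>a\<in>A. \<Sum>r\<in>A. \<Sum>p\<in>A. T a p * cnj (T a r) * u r p)"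
      by (intro sum.cong refl sum.swap)
    also have "\<dots> = (\<Sum>r\<in>A. \<Sum>a\<in>A. \<Sum>p\<in>A. T a p * cnj (T a r) * u r p)" by (rule sum.swap)
    also have "\<dots> = (\<Sum>r\<in>A. \<Sum>p\<in>A. \<Sum>a\<in>A. T a p * cnj (T a r) * u r p)"
      by (intro sum.cong refl sum.swap)
    finally show ?thesis by (simp add: sum_distrib_right)
  qed
  have "(\<Sum>u\<leftarrow>us. \<tau> u * cnj (\<tau> u)) = (\<Sum>u\<leftarrow>us. \<tau> u * (\<Sum>r\<in>A. \<Sum>p\<in>A. (\<Sum>a\<in>A. T a p * cnj (T a r)) * u r p))"
    using cnj\<tau> by (intro arg_cong[where f = sum_list] map_cong) auto
  also have "\<dots> = (\<Sum>u\<leftarrow>us. \<Sum>r\<in>A. \<Sum>p\<in>A. (\<Sum>a\<in>A. T a p * cnj (T a r)) * (\<tau> u * u r p))"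
    by (simp add: sum_distrib_left mult_ac)
  also have "\<dots> = (\<Sum>r\<in>A. \<Sum>p\<in>A. (\<Sum>a\<in>A. T a p * cnj (T a r)) * (\<Sum>u\<leftarrow>us. \<tau> u * u r p))"
    by (simp only: sw[symmetric] sum_list_const_mult)
  also have "\<dots> = 0" by (simp add: 1)
  finally have "(\<Sum>u\<leftarrow>us. \<tau> u * cnj (\<tau> u)) = 0" .
  moreover have "(\<Sum>u\<leftarrow>us. \<tau> u * cnj (\<tau> u)) = of_real (\<Sum>u\<leftarrow>us. (cmod (\<tau> u))\<^sup>2)"
    by (induction us) (simp_all add: mult_cnj_self)
  ultimately have "(\<Sum>u\<leftarrow>us. (cmod (\<tau> u))\<^sup>2) = 0" by simp
  hence \<tau>0: "\<tau> u = 0" if "u \<in> set us" for u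
    using that by (subst (asm) sum_list_nonneg_eq_0_iff) auto
  have "(\<Sum>a\<in>A. \<Sum>p\<in>A. cnj (T a p) * (\<Sum>w\<in>A. T a w * f (w, p))) = 0"
    if "f \<in> lspan (map (\<lambda>u (a, b). u a b) us)" for f
    using that
  proof (induction rule: lspan.induct)
    case (step u f c)
    then obtain v where v: "v \<in> set us" "u = (\<lambda>(a, b). v a b)" by auto
    have "(\<Sum>a\<in>A. \<Sum>p\<in>A. cnj (T a p) * (\<Sum>w\<in>A. T a w * (c * u (w, p) + f (w, p))))
      = c * \<tau> v + (\<Sum>a\<in>A. \<Sum>p\<in>A. cnj (T a p) * (\<Sum>w\<in>A. T a w * f (w, p)))"
      by (simp add: \<tau>_def v(2) distrib_left sum.distrib sum_distrib_left mult_ac)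
    thus ?case using step.IH \<tau>0[OF v(1)] by simp
  qed simp
  from this[OF one(1)] have "(\<Sum>a\<in>A. \<Sum>p\<in>A. cnj (T a p) * (\<Sum>w\<in>A. T a w * (if w = p then 1 else 0))) = 0"
    by (simp add: one(2) cong: sum.cong)
  hence "(\<Sum>a\<in>A. \<Sum>p\<in>A. cnj (T a p) * T a p) = 0"
    using A by (simp add: if_distrib[of "\<lambda>x. _ * x"] cong: if_cong)
  hence "of_real (\<Sum>a\<in>A. \<Sum>p\<in>A. (cmod (T a p))\<^sup>2) = (0::complex)"
    by (simp add: mult_cnj_self mult.commute[of "cnj _"])
  hence "(\<Sum>a\<in>A. \<Sum>p\<in>A. (cmod (T a p))\<^sup>2) = 0" by (simp only: of_real_eq_0_iff)
  hence "\<forall>a\<in>A. (\<Sum>p\<in>A. (cmod (T a p))\<^sup>2) = 0"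
    using A by (subst (asm) sum_nonneg_eq_0_iff) (auto intro: sum_nonneg)
  thus ?thesis using A ab by (auto simp: sum_nonneg_eq_0_iff)
qed

section \<open>The first fundamental theorem for the smaller queer Lie superalgebra\<close>

locale queer_pair = queer_env K for K +
  fixes N :: nat
  assumes NK: "N \<le> K"
begin

definition idM :: "int set" where
  "idM = idx K - idx N"

lemma idM: "finite idM" "- i \<in> idM \<longleftrightarrow> i \<in> idM" "idM \<subseteq> idx K" "i \<in> idM \<Longrightarrow> i \<in> idx K" "idx N \<subseteq> idx K"
  using NK by (auto simp: idM_def idx_def intro: finite_subset[OF _ finite_idx])

lemma F_span_idM_iff: "z \<in> F_span idM \<longleftrightarrow> (\<forall>i j. z i j \<noteq> 0 \<longrightarrow> i \<in> idM \<and> j \<in> idM) \<and> (\<forall>i j. z (- i) (- j) = z i j)"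
  by (rule F_span_iff[OF idM(1,2)])

definition oneM :: imat where
  "oneM i j = (if i = j \<and> i \<in> idM then 1 else 0)"

definition JM :: imat where
  "JM i j = (if i = - j \<and> i \<in> idM then 1 else 0)"

text \<open>A basis of the matrices that commute with \<open>q\<^sub>M\<close>, taken as ordinary matrices, each with its degree:
  the \<open>E\<^sub>x\<^sub>y\<close> of the block of \<open>q\<^sub>N\<close>, and the identity and the odd involution of the block of \<open>q\<^sub>M\<close>.
  Lists keep sums over the basis and over the family below in one format.\<close>

definition cent_basis :: "(imat \<times> bit) list" where
  "cent_basis = concat (map (\<lambda>x. map (\<lambda>y. (E_mat x y, par x + par y)) (sorted_list_of_set (idx N))) (sorted_list_of_set (idx N)))
     @ [(oneM, 0), (JM, 1)]"

lemma set_cent_basis: "set cent_basis = {(E_mat x y, par x + par y) | x y. x \<in> idx N \<and> y \<in> idx N} \<union> {(oneM, 0), (JM, 1)}"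
  by (auto simp: cent_basis_def)

lemma cent_basis_cases [consumes 1, case_names E one J]:
  assumes "b \<in> set cent_basis"
  obtains x y where "b = (E_mat x y, par x + par y)" "x \<in> idx N" "y \<in> idx N" | "b = (oneM, 0)" | "b = (JM, 1)"
  using assms unfolding set_cent_basis by blast

lemma cent_basis_homog_mat: "b \<in> set cent_basis \<Longrightarrow> homog_mat (snd b) (fst b)"
  by (cases b rule: cent_basis_cases) (auto simp: homog_mat_def E_mat_def oneM_def JM_def dest!: idM(4))

lemma cent_basis_supp:
  assumes "b \<in> set cent_basis" shows "supp1 (fst b)"
  using assms
proof (cases b rule: cent_basis_cases)
  case (E x y)
  thus ?thesis using idM(5) by (auto simp: supp1_def E_mat_def)
next
  case one
  have "supp1 oneM" unfolding supp1_def oneM_def using idM(4) by simp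
  thus ?thesis using one by simp
next
  case J
  have "supp1 JM" unfolding supp1_def JM_def using idM(2,4) by auto
  thus ?thesis using J by simp
qed

lemma cent_basis_real: "b \<in> set cent_basis \<Longrightarrow> cnj (fst b i j) = fst b i j"
  by (cases b rule: cent_basis_cases) (auto simp: E_mat_def oneM_def JM_def)

text \<open>Homogeneous elements of the span of the identity and \<open>q\<^sub>M\<close>, which is closed under matrix
  multiplication.\<close>

definition unit_qM :: "bit \<Rightarrow> imat \<Rightarrow> bool" where
  "unit_qM p y \<longleftrightarrow> (\<exists>c z. y = (\<lambda>i j. c * pm 0 i j + z i j) \<and> z \<in> F_span idM \<and> homog_mat p z \<and> (c = 0 \<or> p = 0))"

lemma unit_qM_homog_mat: "unit_qM p y \<Longrightarrow> homog_mat p y"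
proof -
  assume "unit_qM p y"
  then obtain c z where y: "y = (\<lambda>i j. c * pm 0 i j + z i j)" "homog_mat p z" "c = 0 \<or> p = 0"
    unfolding unit_qM_def by blast
  show ?thesis
    unfolding homog_mat_def
  proof (intro allI impI)
    fix i j assume "y i j \<noteq> 0"
    hence "(c \<noteq> 0 \<and> pm 0 i j \<noteq> 0) \<or> z i j \<noteq> 0" by (auto simp: y(1))
    thus "par i + par j = p" using y(2,3) homog_mat_pm[of 0] unfolding homog_mat_def by blast
  qed
qed

lemma unit_qM_supp: "unit_qM p y \<Longrightarrow> supp1 y"
  using supp1_pm[of 0] idM(4) unfolding unit_qM_def supp1_def F_span_idM_iff
  by (metis add.right_neutral mult_zero_right)

lemma supp1_F_span_idM: "z \<in> F_span idM \<Longrightarrow> supp1 z"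
  using idM(4) by (auto simp: supp1_def F_span_idM_iff)

lemma F_span_idM_m1:
  assumes "z \<in> F_span idM" "z' \<in> F_span idM" shows "m1 z z' \<in> F_span idM"
proof -
  have z: "\<And>i j. z i j \<noteq> 0 \<Longrightarrow> i \<in> idM \<and> j \<in> idM" "\<And>i j. z (- i) (- j) = z i j"
    and z': "\<And>i j. z' i j \<noteq> 0 \<Longrightarrow> i \<in> idM \<and> j \<in> idM" "\<And>i j. z' (- i) (- j) = z' i j"
    using assms by (auto simp: F_span_idM_iff)
  have "m1 z z' i j = 0" if "\<not> (i \<in> idM \<and> j \<in> idM)" for i j
    unfolding m1_def using that z(1) z'(1) by (intro sum.neutral ballI) auto
  moreover have "m1 z z' (- i) (- j) = m1 z z' i j" for i j
    unfolding m1_def using sum_idx_uminus[of "idx K" "\<lambda>k. z (- i) k * z' k (- j)"] by (simp add: z z')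
  ultimately show ?thesis unfolding F_span_idM_iff by blast
qed

lemma F_span_idM_lin:
  assumes "z \<in> F_span idM" "z' \<in> F_span idM" shows "(\<lambda>i j. c * z i j + c' * z' i j) \<in> F_span idM"
proof -
  have "z i j = 0 \<and> z' i j = 0" if "\<not> (i \<in> idM \<and> j \<in> idM)" for i j
    using assms that unfolding F_span_idM_iff by blast
  hence "\<forall>i j. c * z i j + c' * z' i j \<noteq> 0 \<longrightarrow> i \<in> idM \<and> j \<in> idM"
    by (metis add.right_neutral mult_zero_right)
  thus ?thesis using assms unfolding F_span_idM_iff by simp
qed

lemma homog_mat_m1: "homog_mat p a \<Longrightarrow> homog_mat q b \<Longrightarrow> homog_mat (p + q) (m1 a b)"
  unfolding homog_mat_def
proof (intro allI impI)
  fix i j assume *: "\<forall>i j. a i j \<noteq> 0 \<longrightarrow> par i + par j = p" "\<forall>i j. b i j \<noteq> 0 \<longrightarrow> par i + par j = q" "m1 a b i j \<noteq> 0"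
  from *(3) obtain k where "a i k * b k j \<noteq> 0"
    unfolding m1_def by (metis (no_types, lifting) sum.neutral)
  hence "par i + par k = p" "par k + par j = q" using * by auto
  thus "par i + par j = p + q" by (cases "par i"; cases "par j"; cases "par k") auto
qed

lemma homog_mat_lin: "homog_mat p a \<Longrightarrow> homog_mat p b \<Longrightarrow> homog_mat p (\<lambda>i j. c * a i j + c' * b i j)"
  unfolding homog_mat_def by (metis add.right_neutral mult_zero_right)

lemma unit_qM_m1:
  assumes "unit_qM p y" "unit_qM q y'" shows "unit_qM (p + q) (m1 y y')"
proof -
  obtain c z where y: "y = (\<lambda>i j. c * pm 0 i j + z i j)" "z \<in> F_span idM" "homog_mat p z" "c = 0 \<or> p = 0"
    using assms(1) unfolding unit_qM_def by blast
  obtain c' z' where y': "y' = (\<lambda>i j. c' * pm 0 i j + z' i j)" "z' \<in> F_span idM" "homog_mat q z'" "c' = 0 \<or> q = 0"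
    using assms(2) unfolding unit_qM_def by blast
  have s: "supp1 z" "supp1 z'" using y y' by (auto simp: supp1_F_span_idM)
  have "m1 y y' = (\<lambda>i j. c * c' * m1 (pm 0) (pm 0) i j + (c * m1 (pm 0) z' i j + c' * m1 z (pm 0) i j + m1 z z' i j))"
    by (simp add: y(1) y'(1) m1_def algebra_simps sum.distrib sum_distrib_left fun_eq_iff)
  also have "\<dots> = (\<lambda>i j. c * c' * pm 0 i j + (c * z' i j + c' * z i j + m1 z z' i j))"
    using m1_pm_left[OF s(2)] m1_pm_right[OF s(1)] m1_pm_left[OF supp1_pm[of 0]] by (simp add: fun_eq_iff)
  finally have e: "m1 y y' = (\<lambda>i j. c * c' * pm 0 i j + (c * z' i j + c' * z i j + m1 z z' i j))" .
  have 1: "(\<lambda>i j. c * z' i j + c' * z i j + m1 z z' i j) \<in> F_span idM"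
    using F_span_idM_lin[OF F_span_idM_lin[OF y'(2) y(2)] F_span_idM_m1[OF y(2) y'(2)], of 1 c c' 1] by simp
  have "homog_mat (p + q) (\<lambda>i j. c * z' i j)" "homog_mat (p + q) (\<lambda>i j. c' * z i j)"
    using y(3,4) y'(3,4) by (auto simp: homog_mat_def)
  hence 2: "homog_mat (p + q) (\<lambda>i j. c * z' i j + c' * z i j + m1 z z' i j)"
    using homog_mat_lin[OF homog_mat_lin homog_mat_m1[OF y(3) y'(3)], of "\<lambda>i j. c * z' i j" "\<lambda>i j. c' * z i j" 1 1 1 1] by simp
  show ?thesis
    unfolding unit_qM_def e by (intro exI[of _ "c * c'"] exI[of _ "\<lambda>i j. c * z' i j + c' * z i j + m1 z z' i j"] conjI refl 1 2)
      (use y(4) y'(4) in auto)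
qed

lemma unit_qM_commute:
  assumes "unit_qM p y" "b \<in> set cent_basis" shows "m1 y (fst b) = m1 (fst b) y"
proof -
  obtain c z where y: "y = (\<lambda>i j. c * pm 0 i j + z i j)" "z \<in> F_span idM"
    using assms(1) unfolding unit_qM_def by blast
  have z: "z i j = 0" if "i \<notin> idM \<or> j \<notin> idM" for i j
    using y(2) that unfolding F_span_idM_iff by blast
  have zK: "z i j = 0" if "i \<notin> idx K \<or> j \<notin> idx K" for i j
    using z that idM(4) by blast
  have z': "z (- i) (- j) = z i j" for i j using y(2) unfolding F_span_idM_iff by blast
  have "m1 z (fst b) = m1 (fst b) z"
    using assms(2)
  proof (cases b rule: cent_basis_cases)
    case (E u v)
    have "m1 z (fst b) i j = 0" "m1 (fst b) z i j = 0" for i j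
      unfolding m1_def using E z by (auto intro!: sum.neutral simp: E_mat_def idM_def)
    thus ?thesis by (simp add: fun_eq_iff)
  next
    case one
    have "m1 z oneM i j = (\<Sum>k\<in>idx K. if k = j then z i j else 0)" for i j
      unfolding m1_def oneM_def by (rule sum.cong) (auto simp: z)
    moreover have "m1 oneM z i j = (\<Sum>k\<in>idx K. if k = i then z i j else 0)" for i j
      unfolding m1_def oneM_def by (rule sum.cong) (auto simp: z)
    ultimately show ?thesis using one by (simp add: fun_eq_iff zK)
  next
    case J
    have "m1 z JM i j = (\<Sum>k\<in>idx K. if k = - j then z i (- j) else 0)" for i j
      unfolding m1_def JM_def by (rule sum.cong) (auto simp: z idM(2))
    moreover have "m1 JM z i j = (\<Sum>k\<in>idx K. if k = - i then z (- i) j else 0)" for i j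
      unfolding m1_def JM_def by (rule sum.cong) (auto simp: z idM(2))
    moreover have "z i (- j) = z (- i) j" for i j using z'[of i "- j"] by simp
    ultimately show ?thesis using J by (simp add: fun_eq_iff zK)
  qed
  moreover have "m1 (pm 0) (fst b) = m1 (fst b) (pm 0)"
    using m1_pm_left[OF cent_basis_supp[OF assms(2)], of 0] m1_pm_right[OF cent_basis_supp[OF assms(2)], of 0] by simp
  ultimately have "m1 z (fst b) i j = m1 (fst b) z i j" "m1 (pm 0) (fst b) i j = m1 (fst b) (pm 0) i j" for i j
    by simp_all
  thus ?thesis
    by (intro ext) (simp add: y(1) m1_def distrib_left distrib_right sum.distrib mult.left_commute[of _ c]
        mult.assoc flip: sum_distrib_left)
qed

text \<open>The spanning set for the matrices commuting with \<open>q\<^sub>M\<close> on the \<open>d\<close>-th tensor power. The member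
  with parameters \<open>m\<close>, \<open>b\<close>, \<open>u\<close> places \<open>b\<close> at the first factor and \<open>u\<close>, with the parity operators
  demanded by the sign rule, at the others, and then transposes the factors \<open>0\<close> and \<open>m\<close>. All
  permutations arise in this way.\<close>

fun family :: "nat \<Rightarrow> lmat list" where
  "family 0 = [one 0]"
| "family (Suc d) = concat (map (\<lambda>m. concat (map (\<lambda>b. map (\<lambda>u. left_transp m (tens (fst b) (parity_right (snd b) u))) (family d)) cent_basis)) [0..<Suc d])"

text \<open>The algebra generated by the action of \<open>unit_qM\<close> on the \<open>d\<close>-th tensor power, with its grading.\<close>

inductive coprod_alg :: "nat \<Rightarrow> bit \<Rightarrow> lmat \<Rightarrow> bool" for d where
  one: "coprod_alg d 0 (one d)"
| mul: "unit_qM p y \<Longrightarrow> coprod_alg d q A \<Longrightarrow> coprod_alg d (p + q) (mm d (coprod d p y) A)"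
| add: "coprod_alg d q A \<Longrightarrow> coprod_alg d q B \<Longrightarrow> coprod_alg d q (\<lambda>xs ys. A xs ys + B xs ys)"
| scale: "coprod_alg d q A \<Longrightarrow> coprod_alg d q (\<lambda>xs ys. c * A xs ys)"
| zero: "coprod_alg d q (\<lambda>xs ys. 0)"

text \<open>The left module over \<open>coprod_alg\<close> generated by the operators that act on the first tensor
  factor only.\<close>

inductive first_leg_alg :: "nat \<Rightarrow> bit \<Rightarrow> lmat \<Rightarrow> bool" for d where
  base: "coprod_alg (Suc d) r A \<Longrightarrow> unit_qM s Y \<Longrightarrow> first_leg_alg d (r + s) (mm (Suc d) A (at_factor (Suc d) 0 s Y))"
| add: "first_leg_alg d q A \<Longrightarrow> first_leg_alg d q B \<Longrightarrow> first_leg_alg d q (\<lambda>xs ys. A xs ys + B xs ys)"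
| scale: "first_leg_alg d q A \<Longrightarrow> first_leg_alg d q (\<lambda>xs ys. c * A xs ys)"
| zero: "first_leg_alg d q (\<lambda>xs ys. 0)"

lemma coprod_alg_supp: "coprod_alg d q A \<Longrightarrow> supp d A"
proof (induction rule: coprod_alg.induct)
  case (mul p y q A)
  show ?case
    unfolding supp_def
  proof (intro allI impI)
    fix xs ys assume "mm d (coprod d p y) A xs ys \<noteq> 0"
    then obtain zs where "coprod d p y xs zs * A zs ys \<noteq> 0"
      unfolding mm_def by (metis (no_types, lifting) sum.neutral)
    thus "xs \<in> ilists K d \<and> ys \<in> ilists K d"
      using mul.IH supp_coprod[OF unit_qM_supp[OF mul.hyps(1)]] unfolding supp_def by auto
  qed
next
  case (add q A B)
  thus ?case unfolding supp_def by (metis add.right_neutral)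
qed (auto simp: supp_def supp_one[unfolded supp_def])

lemma coprod_alg_mult_right: "coprod_alg d q A \<Longrightarrow> unit_qM p y \<Longrightarrow> coprod_alg d (q + p) (mm d A (coprod d p y))"
proof (induction rule: coprod_alg.induct)
  case one
  have "coprod_alg d (p + 0) (mm d (coprod d p y) (one d))" by (rule coprod_alg.mul[OF one coprod_alg.one])
  thus ?case using supp_coprod[OF unit_qM_supp[OF one], of d p] by (simp add: mm_one_left mm_one_right)
next
  case (mul p' y' q A)
  have "coprod_alg d (p' + (q + p)) (mm d (coprod d p' y') (mm d A (coprod d p y)))"
    by (rule coprod_alg.mul) (use mul in auto)
  thus ?case by (simp add: mm_assoc add.assoc)
qed (auto simp: mm_add_left mm_scale_left mm_zero intro: coprod_alg.intros)

lemma coprod_alg_fixed: "coprod_alg d q A \<Longrightarrow> Suc k < d \<Longrightarrow> conj_swp k A = A"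
proof (induction rule: coprod_alg.induct)
  case (mul p y q A)
  thus ?case by (simp add: conj_swp_mm conj_swp_coprod unit_qM_homog_mat unit_qM_supp)
next
  case zero
  show ?case by (simp add: conj_swp_def fun_eq_iff)
qed (simp_all add: conj_swp_one conj_swp_add conj_swp_scale)

lemma first_leg_alg_mult_left: "first_leg_alg d q B \<Longrightarrow> unit_qM p y \<Longrightarrow> first_leg_alg d (p + q) (mm (Suc d) (coprod (Suc d) p y) B)"
proof (induction rule: first_leg_alg.induct)
  case (base r A s Y)
  have "first_leg_alg d ((p + r) + s) (mm (Suc d) (mm (Suc d) (coprod (Suc d) p y) A) (at_factor (Suc d) 0 s Y))"
    by (rule first_leg_alg.base[OF coprod_alg.mul]) (use base in auto)
  thus ?case by (simp only: mm_assoc add.assoc)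
qed (auto simp only: mm_add_right mm_scale_right mm_zero intro: first_leg_alg.intros)

text \<open>The operator \<open>Y P\<^sup>r \<otimes> A\<close> with \<open>A\<close> in the algebra of \<open>d\<close> factors is expressed through the algebra
  of \<open>d + 1\<close> factors, by induction on \<open>A\<close>: one generator of \<open>A\<close> acting on the last \<open>d\<close> factors is
  its action on all factors minus its action on the first one. The former supercommutes past \<open>Y\<close> up
  to a term in which \<open>Y\<close> is replaced by the matrix product of the generator and \<open>Y\<close>, which is
  again in \<open>unit_qM\<close>.\<close>

lemma first_leg_alg_lift: "coprod_alg d r A \<Longrightarrow> unit_qM p Y \<Longrightarrow> first_leg_alg d (p + r) (mm (Suc d) (tens Y (one d)) (tens (pm r) A))"
proof (induction arbitrary: p Y rule: coprod_alg.induct)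
  case (one p Y)
  have "first_leg_alg d (0 + p) (mm (Suc d) (one (Suc d)) (at_factor (Suc d) 0 p Y))"
    by (rule first_leg_alg.base[OF coprod_alg.one one])
  thus ?case
    using supp_tens[OF unit_qM_supp[OF one] supp_one, of d] by (simp add: mm_one_left mm_one_right flip: one_Suc)
next
  case (mul p' y q A)
  let ?m = "mm (Suc d)" and ?s = "sgn_bit (p * p')"
  let ?D = "coprod (Suc d) p' y" and ?L = "tens (pm p') (coprod d p' y)" and ?Z = "tens (pm q) A" and ?Y = "tens Y (one d)"
  note sD = supp_coprod[OF unit_qM_supp[OF mul.hyps(1)], of d p']
  have pp: "m1 (pm p') (pm q) = pm (p' + q)"
    using m1_pm_left[OF supp1_pm, of p' q] by (auto simp: pm_def fun_eq_iff distrib_right sgn_bit_add)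
  have 1: "tens (pm (p' + q)) (mm d (coprod d p' y) A) = ?m ?L ?Z"
    by (simp add: mm_tens pp)
  have 2: "m1 Y (pm p') = (\<lambda>i j. ?s * m1 (pm p') Y i j)"
  proof (intro ext)
    fix i j
    show "m1 Y (pm p') i j = ?s * m1 (pm p') Y i j"
      unfolding m1_pm_right[OF unit_qM_supp[OF mul.prems]] m1_pm_left[OF unit_qM_supp[OF mul.prems]]
    proof (cases "Y i j = 0")
      case False
      hence "p = par i + par j" using unit_qM_homog_mat[OF mul.prems] by (auto simp: homog_mat_def)
      thus "Y i j * sgn_bit (p' * par j) = ?s * (sgn_bit (p' * par i) * Y i j)"
        by (cases p'; cases "par i"; cases "par j") auto
    qed simp
  qed
  have 3: "?m ?Y ?L = (\<lambda>xs ys. ?s * ?m ?L ?Y xs ys)"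
    by (simp add: mm_tens 2 tens_scale mm_one_left[OF sD] mm_one_right[OF sD])
  \<comment> \<open>the action on the last factors as the action on all factors minus the action on the first one\<close>
  have L: "?L = (\<lambda>xs ys. ?D xs ys + (- 1) * tens y (one d) xs ys)" by simp
  have 4: "?m ?L ?Y = (\<lambda>xs ys. ?m ?D ?Y xs ys + (- 1) * tens (m1 y Y) (one d) xs ys)"
    unfolding L mm_add_left mm_scale_left mm_tens mm_one_left[OF supp_one] ..
  have 5: "?m ?Y (tens (pm (p' + q)) (mm d (coprod d p' y) A))
      = (\<lambda>xs ys. ?s * (?m ?D (?m ?Y ?Z) xs ys + (- 1) * ?m (tens (m1 y Y) (one d)) ?Z xs ys))"
    unfolding 1 mm_assoc[symmetric] 3 mm_scale_left 4 mm_add_left ..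
  have 6: "p + (p' + q) = p' + (p + q)" "p + (p' + q) = p' + p + q" by (simp_all add: add_ac)
  have "first_leg_alg d (p + (p' + q)) (?m ?D (?m ?Y ?Z))"
    unfolding 6(1) by (rule first_leg_alg_mult_left[OF mul.IH[OF mul.prems] mul.hyps(1)])
  moreover have "first_leg_alg d (p + (p' + q)) (?m (tens (m1 y Y) (one d)) ?Z)"
    unfolding 6(2) by (rule mul.IH[OF unit_qM_m1[OF mul.hyps(1) mul.prems]])
  ultimately show ?case unfolding 5 by (intro first_leg_alg.scale first_leg_alg.add)
next
  case (add q A B)
  thus ?case by (simp add: tens_add_right mm_add_right first_leg_alg.add)
next
  case (scale q A c)
  thus ?case by (simp add: tens_scale_right mm_scale_right first_leg_alg.scale)
next
  case (zero q)
  show ?case by (simp add: tens_zero mm_zero first_leg_alg.zero)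
qed

text \<open>Elements of \<open>coprod_alg\<close> are fixed by permutations of the tensor factors, so summing over all
  positions of the first leg turns it into \<open>coprod\<close>.\<close>

lemma first_leg_alg_sum: "first_leg_alg d q B \<Longrightarrow> coprod_alg (Suc d) q (\<lambda>xs ys. \<Sum>m<Suc d. conj_transp m B xs ys)"
proof (induction rule: first_leg_alg.induct)
  case (base r A s Y)
  have "conj_transp m (mm (Suc d) A (at_factor (Suc d) 0 s Y)) = mm (Suc d) A (at_factor (Suc d) m s Y)" if "m < Suc d" for m
    unfolding conj_transp_mm conj_transp_at_factor[OF unit_qM_homog_mat[OF base(2)] unit_qM_supp[OF base(2)] that]
    using conj_transp_fixed[of "Suc d" A m] coprod_alg_fixed[OF base(1)] that by simp
  hence "(\<lambda>xs ys. \<Sum>m<Suc d. conj_transp m (mm (Suc d) A (at_factor (Suc d) 0 s Y)) xs ys)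
     = (\<lambda>xs ys. \<Sum>m<Suc d. mm (Suc d) A (at_factor (Suc d) m s Y) xs ys)"
    by (intro ext sum.cong) auto
  also have "\<dots> = mm (Suc d) A (coprod (Suc d) s Y)"
    unfolding mm_sum_right[symmetric] sum_at_factor ..
  finally show ?case using coprod_alg_mult_right[OF base] by (simp only:)
next
  case (add q A B)
  thus ?case using coprod_alg.add[OF add.IH] by (simp only: conj_transp_add sum.distrib)
next
  case (scale q A c)
  thus ?case using coprod_alg.scale[OF scale.IH, of c] by (simp only: conj_transp_scale sum_distrib_left)
next
  case (zero q)
  show ?case by (simp only: conj_transp_zero) (simp add: coprod_alg.zero)
qed

text \<open>The entry \<open>xs, ys\<close> of \<open>\<Sum>\<^sub>u u Z u\<^sup>T\<close> for the matrix unit \<open>Z\<close> at \<open>p, q\<close>.\<close>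

definition average :: "nat \<Rightarrow> int list \<Rightarrow> int list \<Rightarrow> lmat" where
  "average d p q xs ys = (\<Sum>u\<leftarrow>family d. u xs p * u ys q)"

text \<open>The case of a single tensor factor, see \<open>cent_basis_sum\<close>: averaging the matrix unit at \<open>x, y\<close>
  over \<open>cent_basis\<close>.\<close>

definition averaged_unit :: "int \<Rightarrow> int \<Rightarrow> imat" where
  "averaged_unit x y = (if x \<in> idM \<and> y \<in> idM then F_mat x y
     else if x \<in> idx N \<and> x = y then (\<lambda>i j. 1 * pm 0 i j + (- 1) * oneM i j) else (\<lambda>i j. 0))"

lemma oneM_F_span: "oneM \<in> F_span idM"
  unfolding F_span_idM_iff oneM_def by (auto simp: idM(2))

lemma unit_qM_averaged_unit: "x \<in> idx K \<Longrightarrow> y \<in> idx K \<Longrightarrow> unit_qM (par x + par y) (averaged_unit x y)"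
proof -
  assume xy: "x \<in> idx K" "y \<in> idx K"
  have z: "(\<lambda>i j. 0) \<in> F_span idM" by (simp add: F_span_idM_iff)
  consider (1) "x \<in> idM \<and> y \<in> idM" | (2) "\<not> (x \<in> idM \<and> y \<in> idM)" "x \<in> idx N \<and> x = y"
    | (3) "\<not> (x \<in> idM \<and> y \<in> idM)" "\<not> (x \<in> idx N \<and> x = y)" by blast
  thus ?thesis
  proof cases
    case 1
    thus ?thesis unfolding unit_qM_def using homog_mat_F_mat[OF xy] F_mat_in_F_span[OF idM(1)]
      by (intro exI[of _ 0] exI[of _ "F_mat x y"]) (auto simp: averaged_unit_def)
  next
    case 2
    have "homog_mat 0 (\<lambda>i j. (- 1) * oneM i j)" by (auto simp: homog_mat_def oneM_def)
    moreover have "(\<lambda>i j. (- 1) * oneM i j) \<in> F_span idM"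
      using F_span_idM_lin[OF oneM_F_span z, of "-1" 0] by simp
    ultimately show ?thesis unfolding unit_qM_def using 2
      by (intro exI[of _ 1] exI[of _ "\<lambda>i j. (- 1) * oneM i j"]) (auto simp: averaged_unit_def)
  next
    case 3
    thus ?thesis unfolding unit_qM_def using z
      by (intro exI[of _ 0] exI[of _ "\<lambda>i j. 0"]) (auto simp: averaged_unit_def homog_mat_def)
  qed
qed

lemma sum_list_concat_map: "(\<Sum>x\<leftarrow>concat xss. f x) = (\<Sum>xs\<leftarrow>xss. \<Sum>x\<leftarrow>xs. (f x :: complex))"
  by (induction xss) simp_all

text \<open>Averaging over the basis of the commutant lands in the span of the identity and \<open>q\<^sub>M\<close>. For
  \<open>x, y\<close> in the block of \<open>q\<^sub>M\<close> the identity and the odd involution contribute the two matrix units of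
  \<open>F\<^sub>x\<^sub>y\<close>; for \<open>x = y\<close> in the other block the \<open>E\<^sub>u\<^sub>x\<close> contribute its identity. The signs stem from the
  parity operators on the remaining tensor factors.\<close>

lemma cent_basis_sum:
  assumes "x \<in> idx K" "y \<in> idx K"
  shows "(\<Sum>b\<leftarrow>cent_basis. sgn_bit (snd b * z) * (fst b i x * fst b j y)) = sgn_bit (par y * z) * (averaged_unit x y i j * sgn_bit (z * par j))"
proof -
  let ?N = "idx N"
  have sl: "(\<Sum>x\<leftarrow>sorted_list_of_set ?N. f x) = (\<Sum>x\<in>?N. f x)" for f :: "int \<Rightarrow> complex"
    by (simp add: sum_list_distinct_conv_sum_set)
  have "(\<Sum>b\<leftarrow>cent_basis. sgn_bit (snd b * z) * (fst b i x * fst b j y))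
      = (\<Sum>u\<in>?N. \<Sum>v\<in>?N. sgn_bit ((par u + par v) * z) * (E_mat u v i x * E_mat u v j y))
        + (oneM i x * oneM j y + sgn_bit z * (JM i x * JM j y))"
    by (simp add: cent_basis_def sum_list_concat_map o_def sl)
  also have "(\<Sum>u\<in>?N. \<Sum>v\<in>?N. sgn_bit ((par u + par v) * z) * (E_mat u v i x * E_mat u v j y))
      = (\<Sum>u\<in>?N. \<Sum>v\<in>?N. if u = i then if v = x then (if i = j \<and> x = y then sgn_bit ((par i + par x) * z) else 0) else 0 else 0)"
    unfolding E_mat_def by (intro sum.cong refl) auto
  also have "\<dots> = (\<Sum>u\<in>?N. if u = i then (\<Sum>v\<in>?N. if v = x then (if i = j \<and> x = y then sgn_bit ((par i + par x) * z) else 0) else 0) else 0)"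
    by (intro sum.cong refl) simp
  also have "\<dots> = (if i \<in> ?N \<and> x \<in> ?N \<and> i = j \<and> x = y then sgn_bit ((par i + par x) * z) else 0)"
    by auto
  also have "\<dots> + (oneM i x * oneM j y + sgn_bit z * (JM i x * JM j y)) = sgn_bit (par y * z) * (averaged_unit x y i j * sgn_bit (z * par j))"
  proof -
    consider (1) "x \<in> idM" "y \<in> idM" | (2) "x \<in> ?N" "y = x" | (3) "x \<in> ?N" "y \<noteq> x" | (4) "x \<in> idM" "y \<in> ?N"
      using assms by (auto simp: idM_def)
    thus ?thesis
    proof cases
      case 1
      hence "x \<notin> ?N" "y \<in> idx K" "y \<noteq> 0" by (auto simp: idM_def idx_def)
      thus ?thesis using 1
        by (cases z; cases "par y") (auto simp: averaged_unit_def F_mat_def E_mat_def oneM_def JM_def idM(2))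
    next
      case 2
      hence x: "x \<notin> idM" by (auto simp: idM_def)
      hence o: "oneM i x = 0" "JM i x = 0" by (auto simp: oneM_def JM_def idM(2))
      have "i \<in> idx N \<longleftrightarrow> i \<in> idx K \<and> i \<notin> idM" using idM(5) by (auto simp: idM_def)
      hence Y: "averaged_unit x x i j = (if i = j \<and> i \<in> ?N then 1 else 0)"
        using 2 x idM(4)[of i] by (auto simp: averaged_unit_def pm_def oneM_def)
      have "sgn_bit ((par i + par x) * z) = sgn_bit (par x * z) * sgn_bit (z * par i)"
        by (cases z; cases "par i"; cases "par x") simp_all
      thus ?thesis using 2 by (auto simp: o Y)
    next
      case 3
      hence "x \<notin> idM" by (auto simp: idM_def)
      thus ?thesis using 3 by (auto simp: averaged_unit_def oneM_def JM_def idM(2))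
    next
      case 4
      hence "y \<notin> idM" "x \<notin> ?N" by (auto simp: idM_def)
      thus ?thesis using 4 by (auto simp: averaged_unit_def oneM_def JM_def idM(2))
    qed
  qed
  finally show ?thesis .
qed

text \<open>Conjugation by the transposition \<open>(0 m)\<close> is applied to the average over the parameters \<open>b\<close> and
  \<open>u\<close>; the latter is a tensor product of averages, covered by \<open>first_leg_alg_lift\<close> and the induction
  hypothesis. The sum over \<open>m\<close> is then \<open>first_leg_alg_sum\<close>.\<close>

lemma coprod_alg_average: "p \<in> ilists K d \<Longrightarrow> q \<in> ilists K d \<Longrightarrow> coprod_alg d (parl p + parl q) (average d p q)"
proof (induction d arbitrary: p q)
  case 0
  have "average 0 [] [] = one 0" by (auto simp: average_def one_def fun_eq_iff)
  thus ?case using 0 coprod_alg.one[of 0] by simp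
next
  case (Suc d)
  obtain x p' y q' where e: "p = x # p'" "q = y # q'" "x \<in> idx K" "p' \<in> ilists K d" "y \<in> idx K" "q' \<in> ilists K d"
    using Suc.prems unfolding ilists_Suc by auto
  define z where "z = parl p' + parl q'"
  let ?B = "\<lambda>b u. tens (fst b) (parity_right (snd b) u)"
  \<comment> \<open>the average of a matrix unit over \<open>b\<close> and \<open>u\<close>, before transposing factors\<close>
  have P: "(\<lambda>xs ys. \<Sum>b\<leftarrow>cent_basis. \<Sum>u\<leftarrow>family d. ?B b u xs p * ?B b u ys q)
      = (\<lambda>xs ys. sgn_bit (par y * z) * tens (m1 (averaged_unit x y) (pm z)) (average d p' q') xs ys)"
  proof (intro ext)
    fix xs ys
    show "(\<Sum>b\<leftarrow>cent_basis. \<Sum>u\<leftarrow>family d. ?B b u xs p * ?B b u ys q)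
       = sgn_bit (par y * z) * tens (m1 (averaged_unit x y) (pm z)) (average d p' q') xs ys"
    proof (cases xs; cases ys)
      fix i xs' j ys' assume l: "xs = i # xs'" "ys = j # ys'"
      have "(\<Sum>b\<leftarrow>cent_basis. \<Sum>u\<leftarrow>family d. ?B b u xs p * ?B b u ys q)
          = (\<Sum>b\<leftarrow>cent_basis. \<Sum>u\<leftarrow>family d. sgn_bit (snd b * z) * (fst b i x * fst b j y) * (u xs' p' * u ys' q'))"
        by (simp add: l e parity_right_def z_def distrib_left sgn_bit_add mult_ac)
      also have "\<dots> = (\<Sum>b\<leftarrow>cent_basis. sgn_bit (snd b * z) * (fst b i x * fst b j y)) * average d p' q' xs' ys'"
        by (simp add: average_def sum_list_const_mult sum_list_mult_const)
      finally show ?thesis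
        unfolding cent_basis_sum[OF e(3,5)] l m1_pm_right[OF unit_qM_supp[OF unit_qM_averaged_unit[OF e(3,5)]]] by (simp add: mult_ac)
    qed (simp_all add: sum_list_0)
  qed
  have "average (Suc d) p q xs ys = (\<Sum>m<Suc d. conj_transp m (\<lambda>xs ys. \<Sum>b\<leftarrow>cent_basis. \<Sum>u\<leftarrow>family d. ?B b u xs p * ?B b u ys q) xs ys)" for xs ys
  proof -
    have "average (Suc d) p q xs ys = (\<Sum>m\<leftarrow>[0..<Suc d]. \<Sum>b\<leftarrow>cent_basis. \<Sum>u\<leftarrow>family d. left_transp m (?B b u) xs p * left_transp m (?B b u) ys q)"
      by (simp add: average_def sum_list_concat_map o_def del: upt_Suc)
    also have "\<dots> = (\<Sum>m<Suc d. \<Sum>b\<leftarrow>cent_basis. \<Sum>u\<leftarrow>family d. left_transp m (?B b u) xs p * left_transp m (?B b u) ys q)"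
      by (simp add: sum_list_distinct_conv_sum_set atLeast0LessThan del: upt_Suc sum.lessThan_Suc)
    finally show ?thesis by (simp only: conj_transp_sum_list left_transp_eq_vec_transp conj_transp_product)
  qed
  hence R: "average (Suc d) p q = (\<lambda>xs ys. \<Sum>m<Suc d. conj_transp m (\<lambda>xs ys. sgn_bit (par y * z) * tens (m1 (averaged_unit x y) (pm z)) (average d p' q') xs ys) xs ys)"
    unfolding P by (intro ext)
  have IH: "coprod_alg d z (average d p' q')" unfolding z_def by (rule Suc.IH[OF e(4,6)])
  have "first_leg_alg d (par x + par y + z) (mm (Suc d) (tens (averaged_unit x y) (one d)) (tens (pm z) (average d p' q')))"
    by (rule first_leg_alg_lift[OF IH unit_qM_averaged_unit[OF e(3,5)]])
  hence "first_leg_alg d (par x + par y + z) (tens (m1 (averaged_unit x y) (pm z)) (average d p' q'))"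
    by (simp add: mm_tens mm_one_left[OF coprod_alg_supp[OF IH]])
  from first_leg_alg_sum[OF first_leg_alg.scale[OF this, of "sgn_bit (par y * z)"]] show ?case
    unfolding R by (simp add: e z_def add_ac)
qed

lemma left_swp_mm: "left_swp k (mm d A B) = mm d (left_swp k A) B"
  by (intro ext) (simp add: left_swp_def mm_def sum_distrib_left mult.assoc)

lemma mm_left_swp: "mm d A (left_swp k B) = mm d (\<lambda>xs zs. ssg k zs * A xs (swp k zs)) B"
proof (intro ext)
  fix xs ys
  show "mm d A (left_swp k B) xs ys = mm d (\<lambda>xs zs. ssg k zs * A xs (swp k zs)) B xs ys"
    using sum_swp[of "\<lambda>zs. A xs zs * (ssg k zs * B (swp k zs) ys)" k]
    unfolding mm_def left_swp_def by (simp add: mult_ac)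
qed

text \<open>Transpositions commute with operators fixed by all permutations of the tensor factors.\<close>

lemma mm_left_transp:
  assumes D: "\<And>k. Suc k < d \<Longrightarrow> conj_swp k D = D" and "m < d"
  shows "mm d D (left_transp m B) = left_transp m (mm d D B)" "mm d (left_transp m B) D = left_transp m (mm d B D)"
  using assms(2)
proof (induction m arbitrary: B)
  case (Suc m)
  {
    case 1
    show ?case
    proof (cases m)
      case 0
      have "(\<lambda>xs zs. ssg 0 zs * D xs (swp 0 zs)) = left_swp 0 D"
      proof (intro ext)
        fix xs zs
        have "conj_swp 0 D xs (swp 0 zs) = D xs (swp 0 zs)" using D[of 0] 1 0 by simp
        hence e: "D xs (swp 0 zs) = ssg 0 xs * (ssg 0 zs * D (swp 0 xs) zs)" by (simp add: conj_swp_def mult.assoc)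
        show "ssg 0 zs * D xs (swp 0 zs) = left_swp 0 D xs zs"
          unfolding e left_swp_def by (simp add: mult.left_commute[of "ssg 0 zs" "ssg 0 xs"])
      qed
      thus ?thesis by (simp add: 0 mm_left_swp left_swp_mm)
    next
      case (Suc l)
      have c: "conj_swp m D = D" using D[of m] 1 by simp
      have "mm d D (conj_swp m (left_transp m (conj_swp m B))) = conj_swp m (mm d (conj_swp m D) (left_transp m (conj_swp m B)))"
        by (simp add: conj_swp_mm)
      also have "\<dots> = conj_swp m (left_transp m (mm d (conj_swp m D) (conj_swp m B)))" unfolding c using Suc.IH(1)[of "conj_swp m B"] 1 by simp
      also have "\<dots> = conj_swp m (left_transp m (conj_swp m (mm d D B)))" by (simp add: conj_swp_mm)
      finally show ?thesis by (simp add: Suc)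
    qed
  next
    case 2
    show ?case
    proof (cases m)
      case (Suc l)
      have c: "conj_swp m D = D" using D[of m] 2 by simp
      have "mm d (conj_swp m (left_transp m (conj_swp m B))) D = conj_swp m (mm d (left_transp m (conj_swp m B)) (conj_swp m D))"
        by (simp add: conj_swp_mm)
      also have "\<dots> = conj_swp m (left_transp m (mm d (conj_swp m B) (conj_swp m D)))" unfolding c using Suc.IH(2)[of "conj_swp m B"] 2 by simp
      also have "\<dots> = conj_swp m (left_transp m (conj_swp m (mm d B D)))" by (simp add: conj_swp_mm)
      finally show ?thesis by (simp add: Suc)
    qed (simp add: left_swp_mm)
  }
qed simp_all

lemma conj_swp_supp: "supp d A \<Longrightarrow> supp d (conj_swp k A)"
  unfolding supp_def conj_swp_def by (metis mult_zero_right swp_ilists)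

lemma left_swp_supp: "supp d A \<Longrightarrow> supp d (left_swp k A)"
  unfolding supp_def left_swp_def by (metis mult_zero_right swp_ilists)

lemma left_transp_supp: "supp d A \<Longrightarrow> supp d (left_transp m A)"
  by (induction m A rule: left_transp.induct) (simp_all add: conj_swp_supp left_swp_supp)

lemma parity_right_supp: "supp d A \<Longrightarrow> supp d (parity_right b A)"
  unfolding supp_def parity_right_def by auto

lemma family_memI:
  "m < Suc d \<Longrightarrow> b \<in> set cent_basis \<Longrightarrow> u \<in> set (family d) \<Longrightarrow> left_transp m (tens (fst b) (parity_right (snd b) u)) \<in> set (family (Suc d))"
  by (auto simp del: upt_Suc intro!: bexI[of _ m] bexI[of _ b])

lemma family_supp: "u \<in> set (family d) \<Longrightarrow> supp d u"
  by (induction d arbitrary: u) (auto simp: supp_one intro!: left_transp_supp supp_tens parity_right_supp cent_basis_supp simp del: upt_Suc)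

lemma family_real: "u \<in> set (family d) \<Longrightarrow> cnj (u xs ys) = u xs ys"
proof (induction d arbitrary: u xs ys)
  case (Suc d)
  then obtain m b v where u: "u = left_transp m (tens (fst b) (parity_right (snd b) v))" "b \<in> set cent_basis" "v \<in> set (family d)"
    by (auto simp del: upt_Suc)
  have s: "cnj (sgn_bit p) = sgn_bit p" for p by (cases p) simp_all
  have t: "cnj (tens (fst b) (parity_right (snd b) v) zs ws) = tens (fst b) (parity_right (snd b) v) zs ws" for zs ws
    by (cases zs; cases ws) (simp_all add: parity_right_def Suc.IH[OF u(3)] cent_basis_real[OF u(2)] s)
  have ss: "cnj (ssg k zs) = ssg k zs" for k zs
    by (induction k zs rule: ssg.induct) (simp_all add: s)
  have "cnj (left_transp m A zs ws) = left_transp m A zs ws" if "\<And>zs ws. cnj (A zs ws) = A zs ws" for A zs ws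
    using that
  proof (induction m A arbitrary: zs ws rule: left_transp.induct)
    case (3 m A)
    have "cnj (conj_swp (Suc m) A zs ws) = conj_swp (Suc m) A zs ws" for zs ws by (simp add: conj_swp_def ss 3)
    from 3(1)[OF this] show ?case by (simp add: conj_swp_def[of _ "left_transp _ _"] ss)
  qed (simp_all add: left_swp_def ss)
  thus ?case using t by (simp add: u(1))
qed (simp add: one_def)

lemma family_commute: "u \<in> set (family d) \<Longrightarrow> unit_qM p y \<Longrightarrow> mm d (coprod d p y) u = mm d u (coprod d p y)"
proof (induction d arbitrary: u)
  case 0
  thus ?case by (simp add: mm_zero)
next
  case (Suc d)
  then obtain m b v where u: "u = left_transp m (tens (fst b) (parity_right (snd b) v))" "m < Suc d" "b \<in> set cent_basis" "v \<in> set (family d)"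
    by (auto simp del: upt_Suc)
  let ?D = "coprod (Suc d) p y" and ?r = "parity_right (snd b)" and ?s = "sgn_bit (p * snd b)"
  note y = unit_qM_homog_mat[OF Suc.prems(2)] unit_qM_supp[OF Suc.prems(2)]
  note b = cent_basis_homog_mat[OF u(3)] cent_basis_supp[OF u(3)]
  note v = parity_right_supp[OF family_supp[OF u(4)]]
  have 1: "m1 (pm p) (fst b) = (\<lambda>i j. ?s * m1 (fst b) (pm p) i j)"
  proof (intro ext)
    fix i j
    show "m1 (pm p) (fst b) i j = ?s * m1 (fst b) (pm p) i j"
      unfolding m1_pm_left[OF b(2)] m1_pm_right[OF b(2)]
    proof (cases "fst b i j = 0")
      case False
      hence "snd b = par i + par j" using b(1) by (auto simp: homog_mat_def)
      thus "sgn_bit (p * par i) * fst b i j = ?s * (fst b i j * sgn_bit (p * par j))"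
        by (cases p; cases "par i"; cases "par j") auto
    qed simp
  qed
  have "mm d (coprod d p y) (?r v) = ?r (mm d (coprod d p y) v)"
    by (simp add: parity_right_def mm_def fun_eq_iff sum_distrib_right mult.assoc)
  hence 2: "mm d (coprod d p y) (?r v) = ?r (mm d v (coprod d p y))"
    unfolding Suc.IH[OF u(4) Suc.prems(2)] .
  have 3: "mm d (?r v) (coprod d p y) = (\<lambda>xs ys. ?s * ?r (mm d v (coprod d p y)) xs ys)"
  proof (intro ext)
    fix xs ys
    have "sgn_bit (snd b * parl zs) * coprod d p y zs ys = ?s * (sgn_bit (snd b * parl ys) * coprod d p y zs ys)" for zs
    proof (cases "coprod d p y zs ys = 0")
      case False
      hence "parl zs = parl ys + p" by (rule coprod_par[OF y(1)])
      thus ?thesis by (cases p; cases "snd b"; cases "parl ys") auto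
    qed simp
    hence "v xs zs * (sgn_bit (snd b * parl zs) * coprod d p y zs ys) = ?s * (v xs zs * coprod d p y zs ys * sgn_bit (snd b * parl ys))" for zs
      by (simp add: mult_ac)
    thus "mm d (?r v) (coprod d p y) xs ys = ?s * ?r (mm d v (coprod d p y)) xs ys"
      unfolding mm_def parity_right_def sum_distrib_left sum_distrib_right mult.assoc by (intro sum.cong refl) (simp add: mult_ac)
  qed
  have "mm (Suc d) ?D (tens (fst b) (?r v)) = mm (Suc d) (tens (fst b) (?r v)) ?D"
    unfolding coprod.simps mm_add_left mm_add_right mm_tens mm_one_left[OF v] mm_one_right[OF v] 1 2 3
      tens_scale tens_scale_right unit_qM_commute[OF Suc.prems(2) u(3)] ..
  moreover have "mm (Suc d) ?D (left_transp m B) = left_transp m (mm (Suc d) ?D B)" "mm (Suc d) (left_transp m B) ?D = left_transp m (mm (Suc d) B ?D)" for B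
    by (rule mm_left_transp[OF _ u(2)], erule conj_swp_coprod[OF y])+
  ultimately show ?case unfolding u(1) by (simp only:)
qed

definition commutes :: "nat \<Rightarrow> lmat \<Rightarrow> lmat \<Rightarrow> bool" where
  "commutes d T A \<longleftrightarrow> mm d T A = mm d A T"

lemma commutes_coprod_alg:
  assumes "supp d T" "\<And>p y. unit_qM p y \<Longrightarrow> commutes d T (coprod d p y)" "coprod_alg d q A"
  shows "commutes d T A"
  using assms(3)
proof (induction rule: coprod_alg.induct)
  case one
  show ?case using assms(1) by (simp add: commutes_def mm_one_left mm_one_right)
next
  case (mul p y q A)
  have 1: "mm d T (coprod d p y) = mm d (coprod d p y) T" using assms(2)[OF mul(1)] by (simp add: commutes_def)
  have "mm d T (mm d (coprod d p y) A) = mm d (mm d T (coprod d p y)) A" by (simp only: mm_assoc)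
  also have "\<dots> = mm d (coprod d p y) (mm d T A)" unfolding 1 by (simp only: mm_assoc)
  also have "\<dots> = mm d (mm d (coprod d p y) A) T" using mul.IH by (simp add: commutes_def mm_assoc)
  finally show ?case by (simp add: commutes_def)
qed (simp_all add: commutes_def mm_add_left mm_add_right mm_scale_left mm_scale_right mm_zero)

lemma coprod_lin: "coprod d p (\<lambda>i j. x i j + c * y i j) = (\<lambda>xs ys. coprod d p x xs ys + c * coprod d p y xs ys)"
proof (induction d)
  case (Suc d)
  show ?case unfolding coprod.simps Suc tens_add tens_scale tens_add_right tens_scale_right
    by (simp add: fun_eq_iff algebra_simps)
qed simp

lemma coprod_zero: "coprod d p (\<lambda>i j. 0) = (\<lambda>xs ys. 0)"
  by (induction d) (simp_all add: tens_zero)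

lemma coprod_id: "coprod d 0 (pm 0) = (\<lambda>xs ys. of_nat d * one d xs ys)"
proof (induction d)
  case (Suc d)
  show ?case unfolding coprod.simps Suc tens_scale_right one_Suc
    by (simp add: fun_eq_iff algebra_simps)
qed simp

text \<open>The identity acts on the tensor power by the scalar \<open>d\<close>.\<close>

lemma commutes_unit_qM:
  assumes T: "supp d T" and F: "\<And>a b. a \<in> idM \<Longrightarrow> b \<in> idM \<Longrightarrow> commutes d T (coprod d (par a + par b) (F_mat a b))"
    and "unit_qM p y"
  shows "commutes d T (coprod d p y)"
proof -
  obtain c z where y: "y = (\<lambda>i j. c * pm 0 i j + z i j)" "z \<in> F_span idM" "homog_mat p z" "c = 0 \<or> p = 0"
    using assms(3) unfolding unit_qM_def by blast
  have lin: "commutes d T (\<lambda>xs ys. A xs ys + k * B xs ys)" if "commutes d T A" "commutes d T B" for A B k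
    using that by (simp add: commutes_def mm_add_left mm_add_right mm_scale_left mm_scale_right)
  have z0: "commutes d T (\<lambda>xs ys. 0)" by (simp add: commutes_def mm_zero)
  have sum: "commutes d T (coprod d p (\<lambda>i j. \<Sum>s\<in>S. k s * x s i j))"
    if "\<And>s. s \<in> S \<Longrightarrow> k s = 0 \<or> commutes d T (coprod d p (x s))" "finite S" for S and k :: "int \<times> int \<Rightarrow> complex" and x
    using that(2,1)
  proof (induction S rule: finite_induct)
    case empty
    show ?case using z0 by (simp add: coprod_zero)
  next
    case (insert s S)
    have "commutes d T (\<lambda>xs ys. coprod d p (\<lambda>i j. \<Sum>s\<in>S. k s * x s i j) xs ys + k s * coprod d p (x s) xs ys)"
    proof (cases "k s = 0")
      case True
      thus ?thesis using insert by simp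
    next
      case False
      hence "commutes d T (coprod d p (x s))" using insert.prems[of s] by simp
      moreover have "commutes d T (coprod d p (\<lambda>i j. \<Sum>s\<in>S. k s * x s i j))"
        by (rule insert.IH) (rule insert.prems, simp)
      ultimately show ?thesis by (intro lin)
    qed
    moreover have "(\<lambda>i j. \<Sum>s\<in>insert s S. k s * x s i j) = (\<lambda>i j. (\<Sum>s\<in>S. k s * x s i j) + k s * x s i j)"
      using insert.hyps by (simp add: add.commute)
    ultimately show ?case by (simp only: coprod_lin)
  qed
  have "commutes d T (coprod d p z)"
  proof -
    have zi: "\<And>i j. z i j \<noteq> 0 \<Longrightarrow> i \<in> idM \<and> j \<in> idM" "\<And>i j. z (- i) (- j) = z i j"
      using y(2) by (auto simp: F_span_idM_iff)
    have e: "z = (\<lambda>i j. \<Sum>s\<in>idM \<times> idM. (z (fst s) (snd s) / 2) * F_mat (fst s) (snd s) i j)"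
    proof (intro ext)
      fix i j
      have "z i j = (\<Sum>a\<in>idM. \<Sum>b\<in>idM. (z a b / 2) * F_mat a b i j)"
        by (rule F_span_expand) (use zi idM in auto)
      also have "\<dots> = (\<Sum>s\<in>idM \<times> idM. (z (fst s) (snd s) / 2) * F_mat (fst s) (snd s) i j)"
        unfolding sum.cartesian_product by (rule sum.cong) auto
      finally show "z i j = (\<Sum>s\<in>idM \<times> idM. (z (fst s) (snd s) / 2) * F_mat (fst s) (snd s) i j)" .
    qed
    have "commutes d T (coprod d p (\<lambda>i j. \<Sum>s\<in>idM \<times> idM. (z (fst s) (snd s) / 2) * F_mat (fst s) (snd s) i j))"
    proof (rule sum)
      fix s assume "s \<in> idM \<times> idM"
      thus "z (fst s) (snd s) / 2 = 0 \<or> commutes d T (coprod d p (F_mat (fst s) (snd s)))"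
        using F[of "fst s" "snd s"] y(3) by (cases "z (fst s) (snd s) = 0") (auto simp: homog_mat_def)
    qed (simp add: idM)
    thus ?thesis by (subst e)
  qed
  moreover have "commutes d T (coprod d 0 (pm 0))"
    using T by (simp add: commutes_def coprod_id mm_scale_left mm_scale_right mm_one_left mm_one_right)
  ultimately have "commutes d T (\<lambda>xs ys. coprod d p z xs ys + c * coprod d p (pm 0) xs ys)"
    using y(4) lin[of "coprod d p z" "coprod d p (pm 0)" c] by auto
  thus ?thesis by (simp add: y(1) coprod_lin[symmetric] add.commute)
qed

text \<open>The identity of \<open>\<complex>\<^sup>K\<^sup>|\<^sup>K\<close> is the sum of the \<open>E\<^sub>x\<^sub>x\<close> and of the identity of the block of \<open>q\<^sub>M\<close>,
  and the members with \<open>m = 0\<close> are tensor products.\<close>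

lemma one_in_lspan_family: "\<exists>e\<in>lspan (map (\<lambda>u (a, b). u a b) (family d)). \<forall>a b. e (a, b) = one d a b"
proof (induction d)
  case 0
  have "(\<lambda>i. 1 * (\<lambda>(a, b). one 0 a b) i + 0) \<in> lspan (map (\<lambda>u (a, b). u a b) (family 0))"
    by (rule lspan.step[OF _ lspan.zero]) simp
  thus ?case by (rule bexI[rotated]) simp
next
  case (Suc d)
  let ?u = "\<lambda>u. (\<lambda>(a, b). (u :: lmat) a b)"
  obtain e where e: "e \<in> lspan (map ?u (family d))" "\<And>a b. e (a, b) = one d a b" using Suc by blast
  have t: "?u (tens (fst b) (\<lambda>xs ys. f (xs, ys))) \<in> lspan (map ?u (family (Suc d)))"
    if "b \<in> set cent_basis" "snd b = 0" "f \<in> lspan (map ?u (family d))" for b f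
    using that(3)
  proof (induction rule: lspan.induct)
    case zero
    have "?u (tens (fst b) (\<lambda>xs ys. 0)) = (\<lambda>i. 0)" by (simp add: tens_zero fun_eq_iff)
    thus ?case by (simp only: lspan.zero)
  next
    case (step v f c)
    then obtain u where u: "u \<in> set (family d)" "v = ?u u" by auto
    have "parity_right (snd b) u = u" by (simp add: parity_right_def that(2) fun_eq_iff)
    hence "tens (fst b) u = left_transp 0 (tens (fst b) (parity_right (snd b) u))" by simp
    also have "\<dots> \<in> set (family (Suc d))"
      using that(1) u(1) by (intro family_memI) auto
    finally have "tens (fst b) u \<in> set (family (Suc d))" .
    hence "?u (tens (fst b) u) \<in> set (map ?u (family (Suc d)))" by (simp only: set_map imageI)
    from lspan.step[OF this step.IH, of c]
    have "(\<lambda>i. c * ?u (tens (fst b) u) i + ?u (tens (fst b) (\<lambda>xs ys. f (xs, ys))) i) \<in> lspan (map ?u (family (Suc d)))" .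
    also have "(\<lambda>i. c * ?u (tens (fst b) u) i + ?u (tens (fst b) (\<lambda>xs ys. f (xs, ys))) i)
        = ?u (tens (fst b) (\<lambda>xs ys. c * v (xs, ys) + f (xs, ys)))"
      by (simp add: u(2) tens_add_right tens_scale_right fun_eq_iff)
    finally show ?case .
  qed
  have E: "one (Suc d) = (\<lambda>xs ys. (\<Sum>x\<in>idx N. tens (E_mat x x) (one d) xs ys) + tens oneM (one d) xs ys)"
  proof -
    have "pm 0 = (\<lambda>i j. (\<Sum>x\<in>idx N. E_mat x x i j) + oneM i j)"
    proof (intro ext)
      fix i j
      have "(\<Sum>x\<in>idx N. E_mat x x i j) = (\<Sum>x\<in>idx N. if x = i then (if i = j then 1 else 0) else 0)"
        by (intro sum.cong refl) (auto simp: E_mat_def)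
      also have "\<dots> = (if i \<in> idx N then (if i = j then 1 else 0) else 0)" by simp
      finally show "pm 0 i j = (\<Sum>x\<in>idx N. E_mat x x i j) + oneM i j"
        using idM(5) by (auto simp: pm_def oneM_def idM_def)
    qed
    moreover have "tens (\<lambda>i j. \<Sum>x\<in>X. a x i j) A = (\<lambda>xs ys. \<Sum>x\<in>X. tens (a x) A xs ys)" for X :: "int set" and a A
      by (induction X rule: infinite_finite_induct) (simp_all add: tens_zero tens_add)
    ultimately show ?thesis by (simp add: one_Suc tens_add)
  qed
  have ee: "tens a (\<lambda>xs ys. e (xs, ys)) = tens a (one d)" for a by (simp add: e(2))
  have x: "?u (tens (E_mat x x) (one d)) \<in> lspan (map ?u (family (Suc d)))" if "x \<in> idx N" for x
    using t[of "(E_mat x x, 0)" e] e(1) that by (simp add: set_cent_basis ee) (metis bit_add_self(1))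
  have s: "(\<lambda>i. \<Sum>x\<in>X. ?u (tens (E_mat x x) (one d)) i) \<in> lspan (map ?u (family (Suc d)))" if "X \<subseteq> idx N" "finite X" for X
    using that(2,1)
  proof (induction X rule: finite_induct)
    case (insert x X)
    have "(\<lambda>i. ?u (tens (E_mat x x) (one d)) i + (\<Sum>x\<in>X. ?u (tens (E_mat x x) (one d)) i)) \<in> lspan (map ?u (family (Suc d)))"
      by (intro lspan_add x insert.IH) (use insert in auto)
    thus ?case using insert by simp
  qed (simp add: lspan.zero)
  have "?u (tens oneM (one d)) \<in> lspan (map ?u (family (Suc d)))"
    using t[of "(oneM, 0)" e] e(1) by (simp add: set_cent_basis ee)
  from lspan_add[OF s[of "idx N"] this]
  have "(\<lambda>i. (\<Sum>x\<in>idx N. ?u (tens (E_mat x x) (one d)) i) + ?u (tens oneM (one d)) i) \<in> lspan (map ?u (family (Suc d)))" by simp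
  thus ?case by (rule bexI[rotated]) (simp add: E)
qed

text \<open>The matrix of an invariant function commutes with \<open>q\<^sub>M\<close>; its component orthogonal to the family
  still does, as the family itself commutes with \<open>q\<^sub>M\<close>. That component vanishes by the double
  commutant argument.\<close>

lemma first_fundamental_theorem:
  assumes ad: "\<And>a b w. a \<in> idM \<Longrightarrow> b \<in> idM \<Longrightarrow> act (F_mat a b) \<phi> w = ract (par a + par b) (F_mat a b) \<phi> w"
  shows "\<exists>f\<in>lspan (map (\<lambda>u (a, b). u a b) (family d)). \<forall>xs\<in>ilists K d. \<forall>ys\<in>ilists K d. tmat \<phi> xs ys = f (xs, ys)"
proof -
  let ?O = "ilists K d"
  let ?u = "\<lambda>u. (\<lambda>(a, b). (u :: lmat) a b)"
  define T where "T = (\<lambda>xs ys. if xs \<in> ?O \<and> ys \<in> ?O then tmat \<phi> xs ys else 0)"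
  have T: "supp d T" by (simp add: supp_def T_def)
  have TF: "commutes d T (coprod d (par a + par b) (F_mat a b))" if "a \<in> idM" "b \<in> idM" for a b
    unfolding commutes_def
  proof (intro ext)
    fix xs ys
    let ?D = "coprod d (par a + par b) (F_mat a b)"
    have D: "supp d ?D" using that idM(4) by (intro supp_coprod) (auto simp: supp1_def F_mat_def E_mat_def split: if_splits)
    have h: "homog_mat (par a + par b) (F_mat a b)" using that idM(4) by (intro homog_mat_F_mat) auto
    show "mm d T ?D xs ys = mm d ?D T xs ys"
    proof (cases "xs \<in> ?O \<and> ys \<in> ?O")
      case True
      hence xy: "xs \<in> ?O" "ys \<in> ?O" by auto
      have "mm d T ?D xs ys = mm d (tmat \<phi>) ?D xs ys" "mm d ?D T xs ys = mm d ?D (tmat \<phi>) xs ys"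
        unfolding mm_def T_def using True by (auto intro!: sum.cong)
      thus ?thesis using commutator_tmat[OF h xy, of \<phi>] ad[OF that] by simp
    next
      case False
      have "D' zs ws = 0" if "supp d D'" "\<not> (zs \<in> ?O \<and> ws \<in> ?O)" for D' zs ws
        using that unfolding supp_def by blast
      note z = this[OF D] this[OF T]
      show ?thesis unfolding mm_def using False z by (cases "xs \<in> ?O") simp_all
    qed
  qed
  obtain f where f: "f \<in> lspan (map ?u (family d))"
    "\<And>u. u \<in> set (family d) \<Longrightarrow> (\<Sum>i\<in>?O \<times> ?O. (?u T i - f i) * cnj (?u u i)) = 0"
    using orthogonal_projection[of "?O \<times> ?O" "map ?u (family d)" "?u T"] by (auto simp: split_beta)
  define g where "g = (\<lambda>a b. f (a, b))"
  have gs: "supp d g \<and> (\<forall>p y. unit_qM p y \<longrightarrow> commutes d g (coprod d p y))"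
    using f(1) unfolding g_def
  proof (induction rule: lspan.induct)
    case zero
    show ?case by (simp add: supp_def commutes_def mm_zero)
  next
    case (step u f c)
    then obtain v where v: "v \<in> set (family d)" "u = ?u v" by auto
    have "supp d (\<lambda>a b. c * v a b + f (a, b))"
      using step.IH family_supp[OF v(1)] unfolding supp_def by (metis add.right_neutral mult_zero_right)
    moreover have "commutes d (\<lambda>a b. c * v a b + f (a, b)) (coprod d p y)" if "unit_qM p y" for p y
      using step.IH family_commute[OF v(1) that] that
      by (simp add: commutes_def mm_add_left mm_add_right mm_scale_left mm_scale_right)
    ultimately show ?case by (simp add: v(2))
  qed
  define T' where "T' = (\<lambda>a b. T a b + (- 1) * g a b)"
  have T's: "supp d T'" using T gs unfolding T'_def supp_def by (metis add.right_neutral mult_zero_right)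
  have "commutes d T' (coprod d p y)" if "unit_qM p y" for p y
  proof -
    have 1: "mm d T (coprod d p y) = mm d (coprod d p y) T" "mm d g (coprod d p y) = mm d (coprod d p y) g"
      using commutes_unit_qM[OF T TF that] gs that unfolding commutes_def by auto
    show ?thesis
      unfolding commutes_def T'_def mm_add_left mm_add_right mm_scale_left mm_scale_right 1 ..
  qed
  hence comm: "commutes d T' (average d p q)" if "p \<in> ?O" "q \<in> ?O" for p q
    using commutes_coprod_alg[OF T's _ coprod_alg_average[OF that]] by blast
  obtain e where e: "e \<in> lspan (map ?u (family d))" "\<And>a b. e (a, b) = one d a b" using one_in_lspan_family by blast
  have "T' a b = 0" if "a \<in> ?O" "b \<in> ?O" for a b
  proof (rule orthogonal_commuting_zero[of ?O "family d" T' e])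
    show "cnj (u a b) = u a b" if "u \<in> set (family d)" for u a b by (rule family_real[OF that])
    show "(\<Sum>a\<in>?O. \<Sum>b\<in>?O. T' a b * u a b) = 0" if "u \<in> set (family d)" for u
      using f(2)[OF that] by (simp add: sum.cartesian_product split_beta T'_def g_def family_real[OF that])
    show "(\<Sum>w\<in>?O. T' a w * (\<Sum>u\<leftarrow>family d. u w p * u c q)) = (\<Sum>w\<in>?O. (\<Sum>u\<leftarrow>family d. u a p * u w q) * T' w c)"
      if "p \<in> ?O" "q \<in> ?O" for p q a c
      using fun_cong[OF fun_cong[OF comm[OF that, unfolded commutes_def]], of a c] by (simp add: mm_def average_def)
    show "e (a, b) = (if a = b then 1 else 0)" if "a \<in> ?O" for a b using that by (simp add: e(2) one_def)
  qed (use e that in auto)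
  hence "tmat \<phi> xs ys = f (xs, ys)" if "xs \<in> ?O" "ys \<in> ?O" for xs ys
    using that by (auto simp: T'_def T_def g_def)
  thus ?thesis using f(1) by blast
qed

end

section \<open>Chains and loops of generators\<close>

context queer_pair
begin

type_synonym lab = "imat \<times> bit"

definition ok_label :: "lab \<Rightarrow> bool" where
  "ok_label b \<longleftrightarrow> supp1 (fst b) \<and> homog_mat (snd b) (fst b)"

definition cpar :: "lab list \<Rightarrow> bit" where
  "cpar bs = sum_list (map snd bs)"

lemma cpar_simps [simp]: "cpar [] = 0" "cpar (b # bs) = snd b + cpar bs" "cpar (as @ bs) = cpar as + cpar bs"
  by (simp_all add: cpar_def)

text \<open>An entry of the matrix product \<open>F b\<^sub>1 F b\<^sub>2 \<dots> F\<close>, where the labels \<open>b\<close> enter transposed and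
  with the sign \<open>(-1)\<^sup>k\<close> that also occurs in \<open>fp\<close>. A label is a matrix together with its degree.\<close>

fun chain :: "lab list \<Rightarrow> int \<Rightarrow> int \<Rightarrow> imat free" where
  "chain [] i j = F i j"
| "chain (b # bs) i j = (\<Sum>k\<in>idx K. \<Sum>l\<in>idx K. (sgn_bit (par k) * fst b l k) \<bullet> (F i k * chain bs l j))"

lemma sum_swap_pairs:
  "(\<Sum>a\<in>A. \<Sum>b\<in>B. \<Sum>c\<in>C. \<Sum>d\<in>D. f a b c d) = (\<Sum>c\<in>C. \<Sum>d\<in>D. \<Sum>a\<in>A. \<Sum>b\<in>B. f a b c d)"
proof -
  have "(\<Sum>a\<in>A. \<Sum>b\<in>B. \<Sum>c\<in>C. \<Sum>d\<in>D. f a b c d) = (\<Sum>a\<in>A. \<Sum>c\<in>C. \<Sum>b\<in>B. \<Sum>d\<in>D. f a b c d)"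
    by (intro sum.cong refl sum.swap)
  also have "\<dots> = (\<Sum>c\<in>C. \<Sum>a\<in>A. \<Sum>d\<in>D. \<Sum>b\<in>B. f a b c d)"
    by (subst sum.swap) (intro sum.cong refl sum.swap)
  also have "\<dots> = (\<Sum>c\<in>C. \<Sum>d\<in>D. \<Sum>a\<in>A. \<Sum>b\<in>B. f a b c d)"
    by (intro sum.cong refl sum.swap)
  finally show ?thesis .
qed

lemma chain_append:
  "chain (as @ b # bs) i j = (\<Sum>k\<in>idx K. \<Sum>l\<in>idx K. (sgn_bit (par k) * fst b l k) \<bullet> (chain as i k * chain bs l j))"
proof (induction as arbitrary: i)
  case (Cons a as)
  let ?I = "idx K"
  have "chain ((a # as) @ b # bs) i j = (\<Sum>k\<in>?I. \<Sum>l\<in>?I. \<Sum>k'\<in>?I. \<Sum>l'\<in>?I.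
      (sgn_bit (par k) * fst a l k * (sgn_bit (par k') * fst b l' k')) \<bullet> (F i k * (chain as l k' * chain bs l' j)))"
    by (simp add: Cons sum_distrib_left fv.scale_sum_right)
  also have "\<dots> = (\<Sum>k'\<in>?I. \<Sum>l'\<in>?I. \<Sum>k\<in>?I. \<Sum>l\<in>?I.
      (sgn_bit (par k) * fst a l k * (sgn_bit (par k') * fst b l' k')) \<bullet> (F i k * (chain as l k' * chain bs l' j)))"
    by (rule sum_swap_pairs)
  finally show ?case
    by (simp add: sum_distrib_left sum_distrib_right fv.scale_sum_right mult.assoc mult.left_commute mult.commute)
qed simp

lemma HW_F_mult: "i \<in> idx K \<Longrightarrow> k \<in> idx K \<Longrightarrow> g \<in> HW (Suc n) r \<Longrightarrow> F i k * g \<in> HW (Suc (Suc n)) (par i + par k + r)"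
  using HW_mult[OF F_HW[of i k "Suc 1"], of g n r] by simp

lemma chain_HW:
  "i \<in> idx K \<Longrightarrow> j \<in> idx K \<Longrightarrow> \<forall>b\<in>set bs. ok_label b \<Longrightarrow> chain bs i j \<in> HW (Suc (Suc (length bs))) (par i + par j + cpar bs)"
proof (induction bs arbitrary: i)
  case Nil
  thus ?case by (simp add: F_HW)
next
  case (Cons b bs)
  have "(sgn_bit (par k) * fst b l k) \<bullet> (F i k * chain bs l j) \<in> HW (Suc (Suc (Suc (length bs)))) (par i + par j + (snd b + cpar bs))"
    if "k \<in> idx K" "l \<in> idx K" for k l
  proof (cases "fst b l k = 0")
    case True
    thus ?thesis by (simp add: Filt_0)
  next
    case False
    hence "snd b = par l + par k" using Cons.prems by (auto simp: ok_label_def homog_mat_def)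
    hence e: "par i + par j + (snd b + cpar bs) = par i + par k + (par l + par j + cpar bs)"
      by (simp add: add_ac)
    show ?thesis
      unfolding e by (intro Filt.scl HW_F_mult Cons) (use Cons that in auto)
  qed
  thus ?case by (simp del: sum.cong) (intro Filt_sum; simp)
qed

text \<open>The chain closed up by the label \<open>b\<close>; the sign makes it a trace or a supertrace, according to
  whether the total degree of the labels is even or odd.\<close>

definition loop_elt :: "lab list \<Rightarrow> lab \<Rightarrow> imat free" where
  "loop_elt bs b = (\<Sum>x\<in>idx K. \<Sum>y\<in>idx K. (fst b x y * sgn_bit ((snd b + cpar bs) * par y)) \<bullet> chain bs x y)"

text \<open>A trace is cyclic up to the commutator of the rotated factor with the rest, which is of lower
  degree.\<close>

lemma loop_elt_rotate1:
  assumes ok: "ok_label a" "ok_label b" "\<forall>c\<in>set bs. ok_label c"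
  shows "loop_elt (a # bs) b - sgn_bit (snd b * (snd a + cpar bs)) \<bullet> loop_elt (bs @ [b]) a \<in> Low (Suc (Suc (length bs)))"
proof -
  let ?I = "idx K" and ?C = "snd a + (snd b + cpar bs)" and ?s = "sgn_bit (snd b * (snd a + cpar bs))"
  have L: "loop_elt (a # bs) b = (\<Sum>x\<in>?I. \<Sum>y\<in>?I. \<Sum>k\<in>?I. \<Sum>l\<in>?I.
      (fst b x y * sgn_bit (?C * par y) * (sgn_bit (par k) * fst a l k)) \<bullet> (F x k * chain bs l y))"
    by (simp add: loop_elt_def fv.scale_sum_right add_ac)
  let ?g = "\<lambda>x y k l. (fst a l k * sgn_bit (?C * par k) * (sgn_bit (par y) * fst b x y)) \<bullet> (chain bs l y * F x k)"
  have "loop_elt (bs @ [b]) a = (\<Sum>l\<in>?I. \<Sum>k\<in>?I. \<Sum>y\<in>?I. \<Sum>x\<in>?I. ?g x y k l)"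
    by (simp add: loop_elt_def chain_append fv.scale_sum_right add_ac)
  also have "\<dots> = (\<Sum>y\<in>?I. \<Sum>x\<in>?I. \<Sum>l\<in>?I. \<Sum>k\<in>?I. ?g x y k l)"
    by (rule sum_swap_pairs)
  also have "\<dots> = (\<Sum>x\<in>?I. \<Sum>y\<in>?I. \<Sum>k\<in>?I. \<Sum>l\<in>?I. ?g x y k l)"
    by (subst sum.swap) (intro sum.cong refl sum.swap)
  finally have R: "loop_elt (bs @ [b]) a = (\<Sum>x\<in>?I. \<Sum>y\<in>?I. \<Sum>k\<in>?I. \<Sum>l\<in>?I. ?g x y k l)" .
  have "(fst b x y * sgn_bit (?C * par y) * (sgn_bit (par k) * fst a l k)) \<bullet> (F x k * chain bs l y)
      - ?s \<bullet> ((fst a l k * sgn_bit (?C * par k) * (sgn_bit (par y) * fst b x y)) \<bullet> (chain bs l y * F x k))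
      \<in> Low (Suc (Suc (length bs)))" if "x \<in> ?I" "y \<in> ?I" "k \<in> ?I" "l \<in> ?I" for x y k l
  proof (cases "fst b x y = 0 \<or> fst a l k = 0")
    case True
    thus ?thesis by (auto simp: Filt_0)
  next
    case False
    hence b: "snd b = par x + par y" "snd a = par l + par k" using ok by (auto simp: ok_label_def homog_mat_def)
    let ?t = "sgn_bit ((par x + par k) * (par l + par y + cpar bs))"
    let ?u = "fst b x y * sgn_bit (?C * par y) * (sgn_bit (par k) * fst a l k)"
    have s: "?s * (fst a l k * sgn_bit (?C * par k) * (sgn_bit (par y) * fst b x y)) = ?u * ?t"
      unfolding b by (cases "par x"; cases "par y"; cases "par k"; cases "par l"; cases "cpar bs") simp_all
    have "F x k \<in> HW (Suc 1) (par x + par k)" using that by (simp add: F_HW)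
    from swap_HW[OF this chain_HW[OF that(4,2) ok(3)]]
    have "F x k * chain bs l y - ?t \<bullet> (chain bs l y * F x k) \<in> Low (Suc (Suc (length bs)))" by simp
    from Filt.scl[OF this, of ?u] show ?thesis
      unfolding fv.scale_scale s by (simp only: fv.scale_right_diff_distrib fv.scale_scale)
  qed
  hence "loop_elt (a # bs) b - ?s \<bullet> loop_elt (bs @ [b]) a \<in> Low (Suc (Suc (length bs)))"
    unfolding L R fv.scale_sum_right sum_subtractf[symmetric] by (intro Filt_sum)
  thus ?thesis .
qed

text \<open>Elements of degree at most \<open>n\<close> whose leading term is that of an element generated by the
  \<open>F\<^sub>i\<^sub>j\<close> and \<open>C\<close> of the theorem.\<close>

definition GenLow :: "nat \<Rightarrow> imat free set" where
  "GenLow n = {f. \<exists>g. g \<in> Gen N \<and> g \<in> Low (Suc n) \<and> f - g \<in> Low n}"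

lemma GenLow_I: "f \<in> Gen N \<Longrightarrow> f \<in> Low (Suc n) \<Longrightarrow> f \<in> GenLow n"
  unfolding GenLow_def by (auto intro!: exI[of _ f] simp: Filt_0)

lemma GenLow_Low: "f \<in> Low n \<Longrightarrow> f \<in> GenLow n"
  unfolding GenLow_def by (auto intro!: exI[of _ 0] simp: Filt_0 intro: Gen.null env_null.zero)

lemma GenLow_add: "f \<in> GenLow n \<Longrightarrow> g \<in> GenLow n \<Longrightarrow> f + g \<in> GenLow n"
proof -
  assume "f \<in> GenLow n" "g \<in> GenLow n"
  then obtain f' g' where *: "f' \<in> Gen N" "f' \<in> Low (Suc n)" "f - f' \<in> Low n" "g' \<in> Gen N" "g' \<in> Low (Suc n)" "g - g' \<in> Low n"
    unfolding GenLow_def by blast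
  have "(f + g) - (f' + g') \<in> Low n" using Filt.add[OF *(3,6)] by (simp add: add_diff_add)
  thus ?thesis unfolding GenLow_def using Gen.add[OF *(1,4)] Filt.add[OF *(2,5)] by blast
qed

lemma GenLow_scl: "f \<in> GenLow n \<Longrightarrow> c \<bullet> f \<in> GenLow n"
proof -
  assume "f \<in> GenLow n"
  then obtain f' where *: "f' \<in> Gen N" "f' \<in> Low (Suc n)" "f - f' \<in> Low n" unfolding GenLow_def by blast
  have "c \<bullet> f - c \<bullet> f' \<in> Low n" using Filt.scl[OF *(3), of c] by (simp add: fv.scale_right_diff_distrib)
  thus ?thesis unfolding GenLow_def using Gen.scl[OF *(1)] Filt.scl[OF *(2)] by blast
qed

lemma GenLow_sum: "(\<And>i. i \<in> A \<Longrightarrow> f i \<in> GenLow n) \<Longrightarrow> (\<Sum>i\<in>A. f i) \<in> GenLow n"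
  by (induction A rule: infinite_finite_induct) (auto intro: GenLow_add GenLow_Low Filt_0)

lemma GenLow_diff: "f \<in> GenLow n \<Longrightarrow> g \<in> GenLow n \<Longrightarrow> f - g \<in> GenLow n"
  using GenLow_add[OF _ GenLow_scl, of f n g "-1"] by simp

lemma GenLow_mod: "f - c \<bullet> g \<in> Low n \<Longrightarrow> g \<in> GenLow n \<Longrightarrow> f \<in> GenLow n"
  using GenLow_add[OF GenLow_Low GenLow_scl, of "f - c \<bullet> g" n g c] by simp

lemma GenLow_mult: "f \<in> GenLow n \<Longrightarrow> g \<in> GenLow m \<Longrightarrow> f * g \<in> GenLow (n + m)"
proof -
  assume "f \<in> GenLow n" "g \<in> GenLow m"
  then obtain f' g' where *: "f' \<in> Gen N" "f' \<in> Low (Suc n)" "f - f' \<in> Low n" "g' \<in> Gen N" "g' \<in> Low (Suc m)" "g - g' \<in> Low m"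
    unfolding GenLow_def by blast
  have "g \<in> Low (Suc m)" using Filt.add[OF *(5) Low_mono[OF *(6)]] by simp
  hence "(f - f') * g + f' * (g - g') \<in> Low (n + m)"
    using Filt.add[OF Low_mult_left[OF *(3)] Low_mult_right[OF *(2,6)]] by blast
  hence "f * g - f' * g' \<in> Low (n + m)" by (simp add: algebra_simps)
  moreover have "f' * g' \<in> Low (Suc (n + m))" using Low_mult_right[OF *(2,5)] by simp
  ultimately show ?thesis unfolding GenLow_def using Gen.mult[OF *(1,4)] by blast
qed

lemma Gen_0: "0 \<in> Gen N" by (rule Gen.null) (rule env_null.zero)

definition J_mat :: imat where
  "J_mat i j = (if i = - j \<and> i \<in> idx K then 1 else 0)"

definition id_label :: lab where "id_label = (pm 0, 0)"
definition J_label :: lab where "J_label = (J_mat, 1)"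

definition elem_label :: "int \<Rightarrow> int \<Rightarrow> lab" where "elem_label x y = (E_mat x y, par x + par y)"

lemma ok_label_id_label: "ok_label id_label" and ok_label_J_label: "ok_label J_label" and ok_label_elem_label: "x \<in> idx N \<Longrightarrow> y \<in> idx N \<Longrightarrow> ok_label (elem_label x y)"
  using idM(5) homog_mat_pm[of 0] supp1_pm[of 0]
  by (auto simp: ok_label_def id_label_def J_label_def elem_label_def homog_mat_def supp1_def J_mat_def E_mat_def)

lemma ok_label_cent_basis: "b \<in> set cent_basis \<Longrightarrow> ok_label b"
  by (simp add: ok_label_def cent_basis_homog_mat cent_basis_supp)

lemma sum_id_label: "l \<in> idx K \<Longrightarrow> k \<in> idx K \<Longrightarrow> fst id_label l k = (if l = k then 1 else 0)"
  by (simp add: id_label_def pm_def)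

lemma sum_J_label: "l \<in> idx K \<Longrightarrow> k \<in> idx K \<Longrightarrow> fst J_label l k = (if l = - k then 1 else 0)"
  by (simp add: J_label_def J_mat_def)

lemma sum_id_label_chain: "(\<Sum>k\<in>idx K. \<Sum>l\<in>idx K. (c k * fst id_label l k) \<bullet> f k l) = (\<Sum>k\<in>idx K. c k \<bullet> f k k)"
proof (rule sum.cong[OF refl])
  fix k assume k: "k \<in> idx K"
  have "(\<Sum>l\<in>idx K. (c k * fst id_label l k) \<bullet> f k l) = (\<Sum>l\<in>idx K. if l = k then c k \<bullet> f k k else 0)"
    using k by (intro sum.cong refl) (auto simp: sum_id_label)
  thus "(\<Sum>l\<in>idx K. (c k * fst id_label l k) \<bullet> f k l) = c k \<bullet> f k k" using k by simp
qed

lemma sum_J_label_chain: "(\<Sum>k\<in>idx K. \<Sum>l\<in>idx K. (c k * fst J_label l k) \<bullet> f k l) = (\<Sum>k\<in>idx K. c k \<bullet> f k (- k))"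
proof (rule sum.cong[OF refl])
  fix k assume k: "k \<in> idx K"
  have "(\<Sum>l\<in>idx K. (c k * fst J_label l k) \<bullet> f k l) = (\<Sum>l\<in>idx K. if l = - k then c k \<bullet> f k (- k) else 0)"
    using k by (intro sum.cong refl) (auto simp: sum_J_label)
  thus "(\<Sum>l\<in>idx K. (c k * fst J_label l k) \<bullet> f k l) = c k \<bullet> f k (- k)" using k by simp
qed

lemma sum_elem_label_chain:
  assumes "x \<in> idx N" "y \<in> idx N"
  shows "(\<Sum>k\<in>idx K. \<Sum>l\<in>idx K. (c k * fst (elem_label x y) l k) \<bullet> f k l) = c y \<bullet> f y x"
proof -
  have xy: "x \<in> idx K" "y \<in> idx K" using assms idM(5) by auto
  have "(\<Sum>k\<in>idx K. \<Sum>l\<in>idx K. (c k * fst (elem_label x y) l k) \<bullet> f k l)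
      = (\<Sum>k\<in>idx K. \<Sum>l\<in>idx K. if l = x then (if k = y then c y \<bullet> f y x else 0) else 0)"
    by (intro sum.cong refl) (simp add: elem_label_def E_mat_def)
  also have "\<dots> = c y \<bullet> f y x" using xy by simp
  finally show ?thesis .
qed

lemma fp_uminus: "fp n (- i) (- j) = (- 1) ^ n \<bullet> fp n i j"
proof (induction n arbitrary: i)
  case (Suc n)
  have "fp (Suc n) (- i) (- j) = (\<Sum>k\<in>idx K. sgn_bit (par (- k)) \<bullet> (F (- i) (- k) * fp n (- k) (- j)))"
    using sum_idx_uminus[of "idx K" "\<lambda>k. sgn_bit (par k) \<bullet> (F (- i) k * fp n k (- j))"] by simp
  also have "\<dots> = (\<Sum>k\<in>idx K. (- 1) ^ Suc n \<bullet> (sgn_bit (par k) \<bullet> (F i k * fp n k j)))"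
    by (intro sum.cong refl) (simp add: Suc sgn_bit_add)
  finally show ?case by (simp add: fv.scale_sum_right)
qed simp

text \<open>The entries of \<open>F\<close> satisfy \<open>F\<^sub>-\<^sub>i\<^sub>,\<^sub>-\<^sub>j = F\<^sub>i\<^sub>j\<close>, so an odd involution can be moved along the chain at
  the cost of a sign; an even number of them cancels.\<close>

lemma chain_idjl:
  assumes "set bs \<subseteq> {id_label, J_label}"
  shows "\<exists>s. \<forall>i j. chain bs i j = s \<bullet> fp (length bs) i (if cpar bs = 0 then j else - j)"
  using assms
proof (induction bs)
  case Nil
  show ?case by (intro exI[of _ 1]) simp
next
  case (Cons b bs)
  then obtain s where s: "\<And>i j. chain bs i j = s \<bullet> fp (length bs) i (if cpar bs = 0 then j else - j)" by auto
  have "b = id_label \<or> b = J_label" using Cons.prems by auto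
  thus ?case
  proof
    assume b: "b = id_label"
    have "chain (b # bs) i j = s \<bullet> fp (Suc (length bs)) i (if cpar bs = 0 then j else - j)" for i j
      unfolding b chain.simps sum_id_label_chain by (simp add: s fv.scale_sum_right mult.commute)
    moreover have "cpar (b # bs) = cpar bs" by (simp add: b id_label_def)
    ultimately have "\<forall>i j. chain (b # bs) i j = s \<bullet> fp (length (b # bs)) i (if cpar (b # bs) = 0 then j else - j)"
      by simp
    thus ?thesis ..
  next
    assume b: "b = J_label"
    let ?n = "length bs"
    have f: "fp ?n (- k) j = (- 1) ^ ?n \<bullet> fp ?n k (- j)" for k j using fp_uminus[of ?n k "- j"] by simp
    have "chain (b # bs) i j = (s * (- 1) ^ ?n) \<bullet> fp (Suc ?n) i (- (if cpar bs = 0 then j else - j))" for i j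
      unfolding b chain.simps sum_J_label_chain by (simp add: s f fv.scale_sum_right mult_ac)
    moreover have "(if cpar (b # bs) = 0 then j else - j) = - (if cpar bs = 0 then j else - j)" for j :: int
      by (cases "cpar bs") (simp_all add: b J_label_def)
    ultimately have "\<forall>i j. chain (b # bs) i j = (s * (- 1) ^ ?n) \<bullet> fp (length (b # bs)) i (if cpar (b # bs) = 0 then j else - j)"
      by (simp only: length_Cons) simp
    thus ?thesis ..
  qed
qed

text \<open>With the identity and the odd involution of the whole space instead of those of the block of
  \<open>q\<^sub>M\<close>, chains between the labels \<open>E\<^sub>x\<^sub>y\<close> become entries of powers of \<open>F\<close>.\<close>

definition loop_labels :: "lab set" where
  "loop_labels = {id_label, J_label} \<union> {elem_label x y | x y. x \<in> idx N \<and> y \<in> idx N}"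

lemma ok_label_loop_labels: "b \<in> loop_labels \<Longrightarrow> ok_label b"
  using ok_label_id_label ok_label_J_label ok_label_elem_label by (auto simp: loop_labels_def)

lemma idx_N_uminus: "(- i \<in> idx N) = (i \<in> idx N)" by simp

text \<open>A label \<open>E\<^sub>x\<^sub>y\<close> cuts the chain into two.\<close>

lemma chain_Gen: "set bs \<subseteq> loop_labels \<Longrightarrow> a \<in> idx N \<Longrightarrow> b \<in> idx N \<Longrightarrow> chain bs a b \<in> Gen N"
proof (induction "length bs" arbitrary: bs a b rule: less_induct)
  case less
  show ?case
  proof (cases "set bs \<subseteq> {id_label, J_label}")
    case True
    then obtain s where "chain bs a b = s \<bullet> fp (length bs) a (if cpar bs = 0 then b else - b)"
      using chain_idjl by blast
    thus ?thesis using less.prems by (auto intro!: Gen.scl Gen.fp)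
  next
    case False
    then obtain c where c: "c \<in> set bs" "c \<notin> {id_label, J_label}" by blast
    then obtain x y where xy: "c = elem_label x y" "x \<in> idx N" "y \<in> idx N" using less.prems unfolding loop_labels_def by blast
    obtain us vs where bs: "bs = us @ c # vs" using split_list[OF c(1)] by blast
    have "chain us a y \<in> Gen N" "chain vs x b \<in> Gen N"
      by (rule less.hyps; use less.prems xy bs in auto)+
    thus ?thesis unfolding bs chain_append xy(1) sum_elem_label_chain[OF xy(2,3)] by (intro Gen.scl Gen.mult)
  qed
qed

lemma loop_elt_elem_label:
  assumes "set bs \<subseteq> loop_labels" "x \<in> idx N" "y \<in> idx N"
  shows "loop_elt bs (elem_label x y) \<in> GenLow (Suc (length bs))"
proof -
  have xy: "x \<in> idx K" "y \<in> idx K" using assms idM(5) by auto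
  have "loop_elt bs (elem_label x y) = (\<Sum>k\<in>idx K. \<Sum>l\<in>idx K. (sgn_bit ((snd (elem_label x y) + cpar bs) * par k) * fst (elem_label x y) l k) \<bullet> chain bs l k)"
    unfolding loop_elt_def by (subst sum.swap) (simp add: mult.commute)
  also have "\<dots> = sgn_bit ((snd (elem_label x y) + cpar bs) * par y) \<bullet> chain bs x y" by (rule sum_elem_label_chain[OF assms(2,3)])
  finally have e: "loop_elt bs (elem_label x y) = sgn_bit ((snd (elem_label x y) + cpar bs) * par y) \<bullet> chain bs x y" .
  have "\<forall>b\<in>set bs. ok_label b" using ok_label_loop_labels assms(1) by blast
  hence "chain bs x y \<in> Low (Suc (Suc (length bs)))" by (rule HW_Low[OF chain_HW[OF xy]])
  thus ?thesis unfolding e by (intro GenLow_I Gen.scl Filt.scl chain_Gen assms)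
qed

lemma loop_elt_rotate:
  assumes "\<forall>c\<in>set us. ok_label c" "ok_label a" "\<forall>c\<in>set vs. ok_label c" "ok_label b"
  shows "\<exists>s. loop_elt (us @ a # vs) b - s \<bullet> loop_elt (vs @ b # us) a \<in> Low (Suc (length us + length vs + 1))"
  using assms
proof (induction us arbitrary: vs b)
  case Nil
  show ?case using loop_elt_rotate1[of a b vs] Nil by auto
next
  case (Cons u us)
  have 1: "loop_elt (u # (us @ a # vs)) b - sgn_bit (snd b * (snd u + cpar (us @ a # vs))) \<bullet> loop_elt ((us @ a # vs) @ [b]) u
      \<in> Low (Suc (Suc (length (us @ a # vs))))"
    by (rule loop_elt_rotate1) (use Cons.prems in auto)
  obtain s where 2: "loop_elt (us @ a # (vs @ [b])) u - s \<bullet> loop_elt ((vs @ [b]) @ u # us) a \<in> Low (Suc (length us + length (vs @ [b]) + 1))"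
    using Cons.IH[of "vs @ [b]" u] Cons.prems by auto
  let ?t = "sgn_bit (snd b * (snd u + cpar (us @ a # vs)))"
  have "(loop_elt (u # (us @ a # vs)) b - ?t \<bullet> loop_elt ((us @ a # vs) @ [b]) u) + ?t \<bullet> (loop_elt (us @ a # (vs @ [b])) u - s \<bullet> loop_elt ((vs @ [b]) @ u # us) a)
      \<in> Low (Suc (Suc (length (us @ a # vs))))"
    by (intro Filt.add[OF 1] Filt.scl Low_mono[OF 2]) simp
  hence "loop_elt ((u # us) @ a # vs) b - (?t * s) \<bullet> loop_elt (vs @ b # (u # us)) a \<in> Low (Suc (length (u # us) + length vs + 1))"
    by (simp add: fv.scale_right_diff_distrib)
  thus ?case by blast
qed

definition odd_trace :: "nat \<Rightarrow> imat free" where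
  "odd_trace n = (\<Sum>x\<in>idx K. sgn_bit (par x) \<bullet> fp n x (- x))"

lemma chain_replicate_id_label: "chain (replicate n id_label) i j = fp n i j"
  by (induction n arbitrary: i) (simp_all add: sum_id_label_chain)

lemma chain_replicate_id_label_J_label: "chain (replicate n id_label @ [J_label]) i j = fp (Suc n) i (- j)"
proof (induction n arbitrary: i)
  case 0
  have "F (- k) j = F k (- j)" for k using F_uminus[of k "- j"] by simp
  thus ?case by (simp add: sum_J_label_chain)
qed (simp add: sum_id_label_chain)

text \<open>Rotating the odd involution once around a loop of identities changes its sign, so the trace
  twisted by it equals its own negative modulo lower degree.\<close>

lemma odd_trace_Low: "odd_trace n \<in> Low (Suc n)"
proof (cases n)
  case 0
  have "odd_trace 0 = (\<Sum>x\<in>idx K. sgn_bit (par (- x)) \<bullet> F (- x) (- (- x)))"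
    unfolding odd_trace_def using sum_idx_uminus[of "idx K" "\<lambda>x. sgn_bit (par x) \<bullet> fp 0 x (- x)"] by simp
  also have "\<dots> = (\<Sum>x\<in>idx K. - (sgn_bit (par x) \<bullet> F x (- x)))"
  proof (intro sum.cong refl)
    fix x assume "x \<in> idx K"
    moreover have "F (- x) (- (- x)) = F x (- x)" by (rule F_uminus)
    ultimately show "sgn_bit (par (- x)) \<bullet> F (- x) (- (- x)) = - (sgn_bit (par x) \<bullet> F x (- x))"
      by (simp add: sgn_bit_add)
  qed
  also have "\<dots> = - odd_trace 0" by (simp add: odd_trace_def sum_negf)
  finally have "odd_trace 0 + odd_trace 0 = 0" by (simp only: eq_neg_iff_add_eq_0)
  hence "2 \<bullet> odd_trace 0 = 0"
    using fv.scale_left_distrib[of 1 1 "odd_trace 0"] by simp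
  hence "odd_trace 0 = 0" by simp
  thus ?thesis by (simp add: 0 Filt_0)
next
  case (Suc m)
  \<comment> \<open>\<open>A\<close> and \<open>B\<close> evaluate the two loops that differ by one rotation of the odd involution\<close>
  have A: "loop_elt (id_label # replicate m id_label) J_label = - odd_trace n"
  proof -
    have "loop_elt (id_label # replicate m id_label) J_label = (\<Sum>x\<in>idx K. \<Sum>y\<in>idx K. (sgn_bit (par y) * fst J_label x y) \<bullet> fp n x y)"
    proof -
      have "chain (id_label # replicate m id_label) x y = fp n x y" for x y
        using chain_replicate_id_label[of "Suc m" x y] by (simp add: Suc)
      moreover have "cpar (id_label # replicate m id_label) = 0" by (induction m) (simp_all add: id_label_def)
      ultimately show ?thesis unfolding loop_elt_def by (simp add: J_label_def mult.commute del: chain.simps)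
    qed
    also have "\<dots> = (\<Sum>y\<in>idx K. sgn_bit (par y) \<bullet> fp n (- y) y)"
      by (subst sum.swap) (rule sum_J_label_chain)
    also have "\<dots> = (\<Sum>y\<in>idx K. sgn_bit (par (- y)) \<bullet> fp n y (- y))"
      using sum_idx_uminus[of "idx K" "\<lambda>y. sgn_bit (par y) \<bullet> fp n (- y) y"] by simp
    also have "\<dots> = (\<Sum>y\<in>idx K. - (sgn_bit (par y) \<bullet> fp n y (- y)))"
      by (intro sum.cong refl) (simp add: sgn_bit_add)
    finally show ?thesis by (simp add: odd_trace_def sum_negf)
  qed
  have B: "loop_elt (replicate m id_label @ [J_label]) id_label = odd_trace n"
  proof -
    have "cpar (replicate m id_label) = 0" by (induction m) (simp_all add: id_label_def)
    hence "loop_elt (replicate m id_label @ [J_label]) id_label = (\<Sum>x\<in>idx K. \<Sum>y\<in>idx K. (sgn_bit (par y) * fst id_label x y) \<bullet> fp n x (- y))"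
      unfolding loop_elt_def chain_replicate_id_label_J_label Suc by (simp add: id_label_def J_label_def mult.commute del: fp.simps)
    also have "\<dots> = (\<Sum>y\<in>idx K. sgn_bit (par y) \<bullet> fp n y (- y))"
      by (subst sum.swap) (rule sum_id_label_chain)
    finally show ?thesis by (simp add: odd_trace_def)
  qed
  have c: "cpar (replicate m id_label) = 0" "snd id_label = 0" by (induction m) (simp_all add: id_label_def)
  have "loop_elt (id_label # replicate m id_label) J_label - sgn_bit (snd J_label * (snd id_label + cpar (replicate m id_label))) \<bullet> loop_elt (replicate m id_label @ [J_label]) id_label
      \<in> Low (Suc (Suc (length (replicate m id_label))))"
    by (rule loop_elt_rotate1) (auto simp: ok_label_id_label ok_label_J_label)
  hence "- odd_trace n - odd_trace n \<in> Low (Suc n)" unfolding A B c by (simp add: Suc)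
  hence "(-1/2) \<bullet> (- odd_trace n - odd_trace n) \<in> Low (Suc n)" by (rule Filt.scl)
  moreover have "(-1/2) \<bullet> (- odd_trace n - odd_trace n) = odd_trace n"
    using fv.scale_left_distrib[of "1/2" "1/2" "odd_trace n"] by (simp add: fv.scale_right_diff_distrib)
  ultimately show ?thesis by simp
qed

text \<open>For odd \<open>n\<close> the terms at \<open>x\<close> and \<open>-x\<close> cancel.\<close>

lemma trace_Gen: "(\<Sum>x\<in>idx K. fp n x x) \<in> Gen N"
proof (cases "even n")
  case True
  thus ?thesis by (rule Gen.tr)
next
  case False
  have "(\<Sum>x\<in>idx K. fp n x x) = (\<Sum>x\<in>idx K. fp n (- x) (- x))"
    by (rule sum_idx_uminus[symmetric]) simp
  also have "\<dots> = - (\<Sum>x\<in>idx K. fp n x x)" using False by (simp add: fp_uminus sum_negf)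
  finally have "(\<Sum>x\<in>idx K. fp n x x) + (\<Sum>x\<in>idx K. fp n x x) = 0" by (simp only: eq_neg_iff_add_eq_0)
  hence "2 \<bullet> (\<Sum>x\<in>idx K. fp n x x) = 0"
    using fv.scale_left_distrib[of 1 1 "\<Sum>x\<in>idx K. fp n x x"] by simp
  hence "(\<Sum>x\<in>idx K. fp n x x) = 0" by simp
  thus ?thesis by (simp only: Gen_0)
qed

lemma fp_Low: "i \<in> idx K \<Longrightarrow> j \<in> idx K \<Longrightarrow> fp n i j \<in> Low (Suc (Suc n))"
  using HW_Low[OF chain_HW[of i j "replicate n id_label"]] ok_label_id_label by (simp add: chain_replicate_id_label)

lemma loop_elt_idjl:
  assumes "set bs \<subseteq> {id_label, J_label}" "b \<in> {id_label, J_label}"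
  shows "loop_elt bs b \<in> GenLow (Suc (length bs))"
proof -
  let ?n = "length bs"
  obtain s where s: "\<And>i j. chain bs i j = s \<bullet> fp ?n i (if cpar bs = 0 then j else - j)"
    using chain_idjl[OF assms(1)] by blast
  have tr: "(\<Sum>x\<in>idx K. fp ?n x x) \<in> GenLow (Suc ?n)"
    by (intro GenLow_I trace_Gen Filt_sum fp_Low)
  have ot: "odd_trace ?n \<in> GenLow (Suc ?n)" by (intro GenLow_Low odd_trace_Low)
  have L: "loop_elt bs b = (\<Sum>y\<in>idx K. \<Sum>x\<in>idx K. (sgn_bit ((snd b + cpar bs) * par y) * fst b x y) \<bullet> chain bs x y)"
    unfolding loop_elt_def by (subst sum.swap) (simp add: mult.commute)
  have c: "cpar bs = 0 \<or> cpar bs = 1" by (metis bit.exhaust)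
  show ?thesis
  proof (cases "b = id_label")
    case True
    have "loop_elt bs b = (\<Sum>y\<in>idx K. sgn_bit ((snd id_label + cpar bs) * par y) \<bullet> chain bs y y)"
      unfolding L by (unfold True) (rule sum_id_label_chain)
    also have "\<dots> = (\<Sum>y\<in>idx K. sgn_bit (cpar bs * par y) \<bullet> chain bs y y)"
      by (simp add: id_label_def)
    also have "\<dots> = s \<bullet> (if cpar bs = 0 then (\<Sum>x\<in>idx K. fp ?n x x) else odd_trace ?n)"
      using c by (auto simp: s odd_trace_def fv.scale_sum_right mult.commute)
    finally show ?thesis using tr ot by (auto intro: GenLow_scl)
  next
    case False
    hence b: "b = J_label" using assms by auto
    have "loop_elt bs b = (\<Sum>y\<in>idx K. sgn_bit ((snd J_label + cpar bs) * par y) \<bullet> chain bs (- y) y)"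
      unfolding L by (unfold b) (rule sum_J_label_chain)
    also have "\<dots> = (\<Sum>y\<in>idx K. sgn_bit ((1 + cpar bs) * par y) \<bullet> chain bs (- y) y)"
      by (simp add: J_label_def)
    also have "\<dots> = (\<Sum>y\<in>idx K. sgn_bit ((1 + cpar bs) * par (- y)) \<bullet> chain bs y (- y))"
      using sum_idx_uminus[of "idx K" "\<lambda>y. sgn_bit ((1 + cpar bs) * par y) \<bullet> chain bs (- y) y"] by simp
    also have "\<dots> = (if cpar bs = 0 then (- s) \<bullet> odd_trace ?n else s \<bullet> (\<Sum>x\<in>idx K. fp ?n x x))"
    proof (cases "cpar bs = 0")
      case True
      have "(\<Sum>y\<in>idx K. sgn_bit ((1 + cpar bs) * par (- y)) \<bullet> chain bs y (- y)) = (\<Sum>y\<in>idx K. (- s * sgn_bit (par y)) \<bullet> fp ?n y (- y))"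
        by (intro sum.cong refl) (simp add: s True sgn_bit_add mult.commute)
      thus ?thesis using True by (simp add: odd_trace_def fv.scale_sum_right)
    next
      case False
      hence "cpar bs = 1" using c by auto
      thus ?thesis by (simp add: s fv.scale_sum_right)
    qed
    finally show ?thesis using tr ot by (auto simp del: fv.scale_minus_left intro: GenLow_scl)
  qed
qed

text \<open>If some label is an \<open>E\<^sub>x\<^sub>y\<close>, the loop is rotated until this label closes it, and is then an entry
  of a chain.\<close>

lemma loop_elt_loop_labels:
  assumes "set bs \<subseteq> loop_labels" "b \<in> loop_labels"
  shows "loop_elt bs b \<in> GenLow (Suc (length bs))"
proof (cases "b \<in> {id_label, J_label}")
  case False
  thus ?thesis using assms loop_elt_elem_label unfolding loop_labels_def by blast
next
  case b: True
  show ?thesis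
  proof (cases "set bs \<subseteq> {id_label, J_label}")
    case True
    thus ?thesis by (rule loop_elt_idjl[OF _ b])
  next
    case False
    then obtain c where c: "c \<in> set bs" "c \<notin> {id_label, J_label}" by blast
    then obtain x y where xy: "c = elem_label x y" "x \<in> idx N" "y \<in> idx N" using assms unfolding loop_labels_def by blast
    obtain us vs where bs: "bs = us @ c # vs" using split_list[OF c(1)] by blast
    obtain t where t: "loop_elt (us @ c # vs) b - t \<bullet> loop_elt (vs @ b # us) c \<in> Low (Suc (length us + length vs + 1))"
    proof -
      have "\<forall>d\<in>set bs. ok_label d" using ok_label_loop_labels assms(1) by blast
      hence "\<forall>d\<in>set us. ok_label d" "ok_label c" "\<forall>d\<in>set vs. ok_label d" by (simp_all add: bs)
      from loop_elt_rotate[OF this ok_label_loop_labels[OF assms(2)]] show ?thesis using that by blast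
    qed
    have "loop_elt (vs @ b # us) c \<in> GenLow (Suc (length (vs @ b # us)))"
      unfolding xy(1) by (rule loop_elt_elem_label) (use assms bs xy in auto)
    thus ?thesis using GenLow_mod[OF t] by (simp add: bs add_ac)
  qed
qed

lemma chain_lin:
  assumes "\<And>l k. fst b l k = fst b1 l k - (\<Sum>x\<in>X. fst (b2 x) l k)"
  shows "chain (us @ b # vs) i j = chain (us @ b1 # vs) i j - (\<Sum>x\<in>X. chain (us @ b2 x # vs) i j)"
proof -
  have "(\<Sum>x\<in>X. chain (us @ b2 x # vs) i j)
     = (\<Sum>k\<in>idx K. \<Sum>l\<in>idx K. \<Sum>x\<in>X. (sgn_bit (par k) * fst (b2 x) l k) \<bullet> (chain us i k * chain vs l j))"
    unfolding chain_append by (subst sum.swap, intro sum.cong refl, rule sum.swap)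
  thus ?thesis
    by (simp add: chain_append assms right_diff_distrib fv.scale_left_diff_distrib sum_subtractf
        sum_distrib_left fv.scale_sum_left)
qed

lemma loop_elt_lin_inner:
  assumes "\<And>l k. fst b l k = fst b1 l k - (\<Sum>x\<in>X. fst (b2 x) l k)" "snd b1 = snd b" "\<And>x. x \<in> X \<Longrightarrow> snd (b2 x) = snd b"
  shows "loop_elt (us @ b # vs) c = loop_elt (us @ b1 # vs) c - (\<Sum>x\<in>X. loop_elt (us @ b2 x # vs) c)"
proof -
  let ?f = "\<lambda>x y. fst c x y * sgn_bit ((snd c + (cpar us + (snd b + cpar vs))) * par y)"
  have 1: "loop_elt (us @ b2 x # vs) c = (\<Sum>u\<in>idx K. \<Sum>v\<in>idx K. ?f u v \<bullet> chain (us @ b2 x # vs) u v)" if "x \<in> X" for x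
    using that by (simp add: loop_elt_def assms(3))
  have "(\<Sum>x\<in>X. loop_elt (us @ b2 x # vs) c) = (\<Sum>x\<in>X. \<Sum>u\<in>idx K. \<Sum>v\<in>idx K. ?f u v \<bullet> chain (us @ b2 x # vs) u v)"
    by (rule sum.cong[OF refl 1])
  also have "\<dots> = (\<Sum>u\<in>idx K. \<Sum>v\<in>idx K. \<Sum>x\<in>X. ?f u v \<bullet> chain (us @ b2 x # vs) u v)"
    by (subst sum.swap, intro sum.cong refl, rule sum.swap)
  finally show ?thesis
    by (simp add: loop_elt_def chain_lin[of b b1 b2 X, OF assms(1)] assms(2) fv.scale_right_diff_distrib sum_subtractf fv.scale_sum_right)
qed

lemma loop_elt_lin_outer:
  assumes "\<And>l k. fst b l k = fst b1 l k - (\<Sum>x\<in>X. fst (b2 x) l k)" "snd b1 = snd b" "\<And>x. x \<in> X \<Longrightarrow> snd (b2 x) = snd b"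
  shows "loop_elt bs b = loop_elt bs b1 - (\<Sum>x\<in>X. loop_elt bs (b2 x))"
proof -
  let ?s = "\<lambda>y. sgn_bit ((snd b + cpar bs) * par y)"
  have "(\<Sum>x\<in>X. loop_elt bs (b2 x)) = (\<Sum>x\<in>X. \<Sum>u\<in>idx K. \<Sum>v\<in>idx K. (fst (b2 x) u v * ?s v) \<bullet> chain bs u v)"
    by (rule sum.cong[OF refl]) (simp add: loop_elt_def assms(3))
  also have "\<dots> = (\<Sum>u\<in>idx K. \<Sum>v\<in>idx K. \<Sum>x\<in>X. (fst (b2 x) u v * ?s v) \<bullet> chain bs u v)"
    by (subst sum.swap, intro sum.cong refl, rule sum.swap)
  finally show ?thesis
    by (simp add: loop_elt_def assms(1,2) left_diff_distrib fv.scale_left_diff_distrib sum_subtractf sum_distrib_right fv.scale_sum_left)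
qed

lemma cent_basis_expand:
  assumes "b \<in> set cent_basis" "b \<notin> loop_labels"
  obtains b1 b2 where "\<And>l k. fst b l k = fst b1 l k - (\<Sum>x\<in>idx N. fst (b2 x) l k)" "snd b1 = snd b"
    "\<And>x. x \<in> idx N \<Longrightarrow> snd (b2 x) = snd b" "b1 \<in> loop_labels" "\<And>x. x \<in> idx N \<Longrightarrow> b2 x \<in> loop_labels"
  using assms(1)
proof (cases b rule: cent_basis_cases)
  case (E x y)
  hence "b \<in> loop_labels" by (auto simp: loop_labels_def elem_label_def)
  thus ?thesis using assms(2) by simp
next
  case one
  have B: "elem_label x x \<in> loop_labels" if "x \<in> idx N" for x using that unfolding loop_labels_def by blast
  show ?thesis
  proof (rule that[of id_label "\<lambda>x. elem_label x x"])
    show "\<And>x. x \<in> idx N \<Longrightarrow> elem_label x x \<in> loop_labels" by (rule B)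
  next
    fix l k
    have "(\<Sum>x\<in>idx N. fst (elem_label x x) l k) = (\<Sum>x\<in>idx N. if x = l then (if l = k then 1 else 0) else 0)"
      by (intro sum.cong refl) (auto simp: elem_label_def E_mat_def)
    thus "fst b l k = fst id_label l k - (\<Sum>x\<in>idx N. fst (elem_label x x) l k)"
      using idM(5) by (auto simp: one id_label_def pm_def oneM_def idM_def)
  qed (auto simp: one id_label_def elem_label_def loop_labels_def)
next
  case J
  have B: "elem_label x (- x) \<in> loop_labels" if "x \<in> idx N" for x using that idx_N_uminus unfolding loop_labels_def by blast
  show ?thesis
  proof (rule that[of J_label "\<lambda>x. elem_label x (- x)"])
    show "\<And>x. x \<in> idx N \<Longrightarrow> elem_label x (- x) \<in> loop_labels" by (rule B)
  next
    fix l k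
    have "(\<Sum>x\<in>idx N. fst (elem_label x (- x)) l k) = (\<Sum>x\<in>idx N. if x = l then (if l = - k then 1 else 0) else 0)"
      by (intro sum.cong refl) (auto simp: elem_label_def E_mat_def)
    thus "fst b l k = fst J_label l k - (\<Sum>x\<in>idx N. fst (elem_label x (- x)) l k)"
      using idM(5) by (auto simp: J J_label_def J_mat_def JM_def idM_def)
  qed (auto simp: J J_label_def elem_label_def loop_labels_def)
qed

text \<open>Every label from \<open>cent_basis\<close> is a combination of \<open>loop_labels\<close>, and loops are multilinear in
  their labels. The induction is on the number of labels still to be replaced.\<close>

lemma loop_elt_GenLow:
  assumes "set bs \<subseteq> loop_labels \<union> set cent_basis" "b \<in> loop_labels \<union> set cent_basis"
  shows "loop_elt bs b \<in> GenLow (Suc (length bs))"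
  using assms
proof (induction "length (filter (\<lambda>c. c \<notin> loop_labels) (b # bs))" arbitrary: bs b rule: less_induct)
  case less
  show ?case
  proof (cases "b \<in> loop_labels")
    case b: False
    then obtain b1 b2 where e: "\<And>l k. fst b l k = fst b1 l k - (\<Sum>x\<in>idx N. fst (b2 x) l k)" "snd b1 = snd b"
      "\<And>x. x \<in> idx N \<Longrightarrow> snd (b2 x) = snd b" "b1 \<in> loop_labels" "\<And>x. x \<in> idx N \<Longrightarrow> b2 x \<in> loop_labels"
      using less.prems cent_basis_expand[of b] by blast
    have "loop_elt bs c \<in> GenLow (Suc (length bs))" if "c \<in> loop_labels" for c
      by (rule less.hyps) (use that b less.prems in auto)
    note G = this
    have "loop_elt bs b = loop_elt bs b1 - (\<Sum>x\<in>idx N. loop_elt bs (b2 x))"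
      by (rule loop_elt_lin_outer) (use e in auto)
    thus ?thesis using G[OF e(4)] G[OF e(5)] by (simp only:) (intro GenLow_diff GenLow_sum; simp)
  next
    case b: True
    show ?thesis
    proof (cases "set bs \<subseteq> loop_labels")
      case True
      thus ?thesis by (rule loop_elt_loop_labels[OF _ b])
    next
      case False
      then obtain c where c: "c \<in> set bs" "c \<notin> loop_labels" by blast
      then obtain us vs where bs: "bs = us @ c # vs" using split_list by metis
      obtain b1 b2 where e: "\<And>l k. fst c l k = fst b1 l k - (\<Sum>x\<in>idx N. fst (b2 x) l k)" "snd b1 = snd c"
        "\<And>x. x \<in> idx N \<Longrightarrow> snd (b2 x) = snd c" "b1 \<in> loop_labels" "\<And>x. x \<in> idx N \<Longrightarrow> b2 x \<in> loop_labels"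
        using less.prems cent_basis_expand[of c] c by blast
      have "loop_elt (us @ d # vs) b \<in> GenLow (Suc (length (us @ d # vs)))" if "d \<in> loop_labels" for d
        by (rule less.hyps) (use that b c less.prems bs in auto)
      hence "loop_elt (us @ d # vs) b \<in> GenLow (Suc (length bs))" if "d \<in> loop_labels" for d using that by (simp add: bs)
      note G = this
      have "loop_elt bs b = loop_elt (us @ b1 # vs) b - (\<Sum>x\<in>idx N. loop_elt (us @ b2 x # vs) b)"
        unfolding bs by (rule loop_elt_lin_inner) (use e in auto)
      thus ?thesis using G[OF e(4)] G[OF e(5)] by (simp only:) (intro GenLow_diff GenLow_sum; simp)
    qed
  qed
qed

end

section \<open>Contraction of commuting matrices with generators\<close>

context queer_pair
begin

definition signed_chain :: "lab list \<Rightarrow> int \<Rightarrow> int \<Rightarrow> imat free" where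
  "signed_chain L i j = sgn_bit (cpar L * par j) \<bullet> chain L i j"

text \<open>A product of chain entries, one for each list of labels. With empty lists it is the product of
  generators that appears in \<open>expand\<close>; joining factors only lengthens the lists.\<close>

fun chains :: "lab list list \<Rightarrow> int list \<Rightarrow> int list \<Rightarrow> imat free" where
  "chains (L # Ls) (x # xs) (y # ys) = signed_chain L x y * chains Ls xs ys"
| "chains Ls xs ys = 1"

text \<open>The labels already attached to the first chain carry a degree, which has to be moved past the
  remaining tensor factors of the kernel.\<close>

fun chain_sign :: "lab list list \<Rightarrow> int list \<Rightarrow> int list \<Rightarrow> complex" where
  "chain_sign (L # Ls) (x # xs) (y # ys) = sgn_bit (cpar L * (parl xs + parl ys)) * chain_sign Ls xs ys"
| "chain_sign Ls xs ys = 1"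

text \<open>The kernel \<open>T\<close> on the tensor power contracted with the chains. For chains without labels this is
  \<open>expand\<close> applied to the function with matrix \<open>T\<close>.\<close>

definition contract :: "lab list list \<Rightarrow> lmat \<Rightarrow> imat free" where
  "contract Ls T = (\<Sum>xs\<in>ilists K (length Ls). \<Sum>ys\<in>ilists K (length Ls).
     (pair_sign xs ys * chain_sign Ls xs ys * T xs ys) \<bullet> chains Ls xs ys)"

definition tot :: "lab list list \<Rightarrow> nat" where
  "tot Ls = sum_list (map (\<lambda>L. Suc (length L)) Ls)"

lemma tot_simps [simp]: "tot [] = 0" "tot (L # Ls) = Suc (length L + tot Ls)"
  by (simp_all add: tot_def)

lemma tot_swp [simp]: "tot (swp k Ls) = tot Ls"
  by (induction k Ls rule: swp.induct) auto

text \<open>Kernels that connect the end points of the chains step by step, graded by the number of tensor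
  factors and the degree: closing the first chain to a loop, joining the end of the first chain to
  the beginning of the second, or reordering the chains. The family of the first fundamental theorem
  is obtained by these steps.\<close>

inductive contractible :: "nat \<Rightarrow> bit \<Rightarrow> lmat \<Rightarrow> bool" where
  nil: "contractible 0 0 (one 0)"
| loop: "contractible d \<theta> T \<Longrightarrow> b \<in> set cent_basis \<Longrightarrow> contractible (Suc d) (\<theta> + snd b) (tens (fst b) (parity_right (snd b) T))"
| merge: "contractible (Suc d) \<theta> T \<Longrightarrow> b \<in> set cent_basis \<Longrightarrow> contractible (Suc (Suc d)) (\<theta> + snd b) (left_swp 0 (tens (fst b) (parity_right (snd b) T)))"
| conj: "contractible d \<theta> T \<Longrightarrow> Suc k < d \<Longrightarrow> contractible d \<theta> (conj_swp k T)"

lemma tens_homog: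
  assumes "\<And>xs ys. T xs ys \<noteq> 0 \<Longrightarrow> parl xs + parl ys = \<theta>" "b \<in> set cent_basis" "tens (fst b) (parity_right (snd b) T) xs ys \<noteq> 0"
  shows "parl xs + parl ys = \<theta> + snd b"
proof -
  obtain x xs' y ys' where e: "xs = x # xs'" "ys = y # ys'" using assms(3) by (cases xs; cases ys) auto
  have "fst b x y \<noteq> 0" "T xs' ys' \<noteq> 0" using assms(3) by (auto simp: e parity_right_def)
  hence "par x + par y = snd b" "parl xs' + parl ys' = \<theta>"
    using assms(1) cent_basis_homog_mat[OF assms(2)] by (auto simp: homog_mat_def)
  thus ?thesis by (simp add: e add_ac flip: \<open>par x + par y = snd b\<close> \<open>parl xs' + parl ys' = \<theta>\<close>)
qed

lemma contractible_homog: "contractible d \<theta> T \<Longrightarrow> T xs ys \<noteq> 0 \<Longrightarrow> parl xs + parl ys = \<theta>"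
proof (induction arbitrary: xs ys rule: contractible.induct)
  case nil
  thus ?case by (auto simp: one_def split: if_splits)
next
  case (loop d \<theta> T b)
  show ?case by (rule tens_homog[OF loop.IH loop.hyps(2) loop.prems])
next
  case (merge d \<theta> T b)
  have "tens (fst b) (parity_right (snd b) T) (swp 0 xs) ys \<noteq> 0" using merge.prems by (auto simp: left_swp_def)
  from tens_homog[OF merge.IH merge.hyps(2) this] show ?case by simp
next
  case (conj d \<theta> T k)
  have "T (swp k xs) (swp k ys) \<noteq> 0" using conj.prems by (auto simp: conj_swp_def)
  from conj.IH[OF this] show ?case by simp
qed

lemma contract_Cons:
  "contract (L # Ls) A = (\<Sum>x\<in>idx K. \<Sum>y\<in>idx K. \<Sum>xs\<in>ilists K (length Ls). \<Sum>ys\<in>ilists K (length Ls).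
     (pair_sign (x # xs) (y # ys) * chain_sign (L # Ls) (x # xs) (y # ys) * A (x # xs) (y # ys)) \<bullet> (signed_chain L x y * chains Ls xs ys))"
proof -
  have "contract (L # Ls) A = (\<Sum>x\<in>idx K. \<Sum>xs\<in>ilists K (length Ls). \<Sum>y\<in>idx K. \<Sum>ys\<in>ilists K (length Ls).
     (pair_sign (x # xs) (y # ys) * chain_sign (L # Ls) (x # xs) (y # ys) * A (x # xs) (y # ys)) \<bullet> (signed_chain L x y * chains Ls xs ys))"
    unfolding contract_def list.size(4) add_Suc_right Nat.add_0_right sum_ilists_Suc chains.simps ..
  also have "\<dots> = (\<Sum>x\<in>idx K. \<Sum>y\<in>idx K. \<Sum>xs\<in>ilists K (length Ls). \<Sum>ys\<in>ilists K (length Ls).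
     (pair_sign (x # xs) (y # ys) * chain_sign (L # Ls) (x # xs) (y # ys) * A (x # xs) (y # ys)) \<bullet> (signed_chain L x y * chains Ls xs ys))"
    by (intro sum.cong refl sum.swap)
  finally show ?thesis .
qed

text \<open>The factor of the kernel at the first chain closes it, and the loop splits off.\<close>

lemma contract_loop:
  assumes T: "\<And>xs ys. T xs ys \<noteq> 0 \<Longrightarrow> parl xs + parl ys = \<theta>" and b: "ok_label b"
  shows "contract (L # Ls) (tens (fst b) (parity_right (snd b) T)) = sgn_bit (cpar L * \<theta>) \<bullet> (loop_elt L b * contract Ls T)"
proof -
  have R: "sgn_bit (cpar L * \<theta>) \<bullet> (loop_elt L b * contract Ls T) = (\<Sum>x\<in>idx K. \<Sum>y\<in>idx K. \<Sum>xs\<in>ilists K (length Ls). \<Sum>ys\<in>ilists K (length Ls).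
     (sgn_bit (cpar L * \<theta>) * (fst b x y * sgn_bit ((snd b + cpar L) * par y)) * (pair_sign xs ys * chain_sign Ls xs ys * T xs ys))
       \<bullet> (chain L x y * chains Ls xs ys))"
    by (simp only: loop_elt_def sum_distrib_right fv.scale_sum_right)
      (simp only: contract_def sum_distrib_left fv.scale_sum_right scl_mult_left mult_scl_right fv.scale_scale mult_ac)
  show ?thesis
    unfolding R contract_Cons
  proof (intro sum.cong refl)
    fix x y :: int and xs ys :: "int list"
    show "(pair_sign (x # xs) (y # ys) * chain_sign (L # Ls) (x # xs) (y # ys) * tens (fst b) (parity_right (snd b) T) (x # xs) (y # ys)) \<bullet> (signed_chain L x y * chains Ls xs ys)
      = (sgn_bit (cpar L * \<theta>) * (fst b x y * sgn_bit ((snd b + cpar L) * par y)) * (pair_sign xs ys * chain_sign Ls xs ys * T xs ys))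
       \<bullet> (chain L x y * chains Ls xs ys)"
    proof (cases "fst b x y = 0 \<or> T xs ys = 0")
      case True
      thus ?thesis by (auto simp: parity_right_def)
    next
      case False
      hence s: "snd b = par x + par y" "\<theta> = parl xs + parl ys" using T b by (auto simp: ok_label_def homog_mat_def)
      have "sgn_bit ((par x + par y) * (par y + parl ys)) * sgn_bit (cpar L * (parl xs + parl ys))
          * sgn_bit (snd b * parl ys) * sgn_bit (cpar L * par y)
          = sgn_bit (cpar L * \<theta>) * sgn_bit ((snd b + cpar L) * par y)"
        unfolding s by (cases "par x"; cases "par y"; cases "parl xs"; cases "parl ys"; cases "cpar L") simp_all
      thus ?thesis
        by (simp add: parity_right_def signed_chain_def mult_ac)
    qed
  qed
qed

text \<open>The kernel has the transposition of the first two factors on the left, so its entry \<open>b\<close> joins the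
  column index of the first chain to the row index of the second; what is left is one chain with the
  rows of the first and the columns of the second.\<close>

lemma contract_merge:
  assumes T: "\<And>xs ys. T xs ys \<noteq> 0 \<Longrightarrow> parl xs + parl ys = \<theta>" and b: "ok_label b"
  shows "contract (L1 # L2 # Ls) (left_swp 0 (tens (fst b) (parity_right (snd b) T)))
    = sgn_bit (snd b * (cpar L1 + \<theta>)) \<bullet> contract ((L1 @ b # L2) # Ls) T"
proof -
  let ?I = "idx K" and ?J = "ilists K (length Ls)"
  let ?A = "left_swp 0 (tens (fst b) (parity_right (snd b) T))"
  let ?f = "\<lambda>x1 y1 x2 y2 xs ys. (pair_sign (x1 # x2 # xs) (y1 # y2 # ys) * chain_sign (L1 # L2 # Ls) (x1 # x2 # xs) (y1 # y2 # ys)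
      * ?A (x1 # x2 # xs) (y1 # y2 # ys)) \<bullet> (signed_chain L1 x1 y1 * (signed_chain L2 x2 y2 * chains Ls xs ys))"
  let ?g = "\<lambda>x1 y1 x2 y2 xs ys. (sgn_bit (snd b * (cpar L1 + \<theta>)) * (pair_sign (x1 # xs) (y2 # ys)
      * chain_sign ((L1 @ b # L2) # Ls) (x1 # xs) (y2 # ys) * T (x1 # xs) (y2 # ys))
      * sgn_bit (cpar (L1 @ b # L2) * par y2) * (sgn_bit (par y1) * fst b x2 y1)) \<bullet> (chain L1 x1 y1 * chain L2 x2 y2 * chains Ls xs ys)"
  have "contract (L1 # L2 # Ls) ?A = (\<Sum>x1\<in>?I. \<Sum>y1\<in>?I. \<Sum>x2\<in>?I. \<Sum>xs\<in>?J. \<Sum>y2\<in>?I. \<Sum>ys\<in>?J. ?f x1 y1 x2 y2 xs ys)"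
    unfolding contract_Cons list.size(4) add_Suc_right Nat.add_0_right sum_ilists_Suc chains.simps ..
  also have "\<dots> = (\<Sum>x1\<in>?I. \<Sum>y1\<in>?I. \<Sum>x2\<in>?I. \<Sum>y2\<in>?I. \<Sum>xs\<in>?J. \<Sum>ys\<in>?J. ?f x1 y1 x2 y2 xs ys)"
    by (intro sum.cong refl sum.swap)
  also have "\<dots> = (\<Sum>x1\<in>?I. \<Sum>y1\<in>?I. \<Sum>x2\<in>?I. \<Sum>y2\<in>?I. \<Sum>xs\<in>?J. \<Sum>ys\<in>?J. ?g x1 y1 x2 y2 xs ys)"
  proof (intro sum.cong refl)
    fix x1 x2 y1 y2 :: int and xs ys :: "int list"
    show "?f x1 y1 x2 y2 xs ys = ?g x1 y1 x2 y2 xs ys"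
    proof (cases "fst b x2 y1 = 0 \<or> T (x1 # xs) (y2 # ys) = 0")
      case True
      thus ?thesis by (auto simp: parity_right_def left_swp_def)
    next
      case False
      hence s: "snd b = par x2 + par y1" "\<theta> = par x1 + parl xs + (par y2 + parl ys)"
        using T[of "x1 # xs" "y2 # ys"] b by (auto simp: ok_label_def homog_mat_def)
      have "sgn_bit ((par x1 + par y1) * (par y1 + (par y2 + parl ys))) * sgn_bit ((par x2 + par y2) * (par y2 + parl ys))
          * sgn_bit (cpar L1 * (par x2 + parl xs + (par y2 + parl ys))) * sgn_bit (cpar L2 * (parl xs + parl ys))
          * sgn_bit (par x1 * par x2) * sgn_bit (snd b * (par y2 + parl ys)) * sgn_bit (cpar L1 * par y1) * sgn_bit (cpar L2 * par y2)
        = sgn_bit (snd b * (cpar L1 + \<theta>)) * sgn_bit ((par x1 + par y2) * (par y2 + parl ys))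
          * sgn_bit ((cpar L1 + (snd b + cpar L2)) * (parl xs + parl ys)) * sgn_bit ((cpar L1 + (snd b + cpar L2)) * par y2) * sgn_bit (par y1)"
        unfolding s by (cases "par x1"; cases "par y1"; cases "par x2"; cases "par y2"; cases "parl xs"; cases "parl ys"; cases "cpar L1"; cases "cpar L2") simp_all
      hence e: "sgn_bit ((par x1 + par y1) * (par y1 + (par y2 + parl ys))) * (sgn_bit ((par x2 + par y2) * (par y2 + parl ys))
          * (sgn_bit (cpar L1 * (par x2 + parl xs + (par y2 + parl ys))) * (sgn_bit (cpar L2 * (parl xs + parl ys))
          * (sgn_bit (par x1 * par x2) * (sgn_bit (snd b * (par y2 + parl ys)) * (sgn_bit (cpar L1 * par y1) * (sgn_bit (cpar L2 * par y2) * c)))))))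
        = sgn_bit (snd b * (cpar L1 + \<theta>)) * (sgn_bit ((par x1 + par y2) * (par y2 + parl ys))
          * (sgn_bit ((cpar L1 + (snd b + cpar L2)) * (parl xs + parl ys)) * (sgn_bit ((cpar L1 + (snd b + cpar L2)) * par y2) * (sgn_bit (par y1) * c))))" for c
        by (simp only: mult.assoc[symmetric])
      have "?f x1 y1 x2 y2 xs ys = (sgn_bit ((par x1 + par y1) * (par y1 + (par y2 + parl ys))) * (sgn_bit ((par x2 + par y2) * (par y2 + parl ys))
          * (sgn_bit (cpar L1 * (par x2 + parl xs + (par y2 + parl ys))) * (sgn_bit (cpar L2 * (parl xs + parl ys))
          * (sgn_bit (par x1 * par x2) * (sgn_bit (snd b * (par y2 + parl ys)) * (sgn_bit (cpar L1 * par y1) * (sgn_bit (cpar L2 * par y2)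
          * (fst b x2 y1 * T (x1 # xs) (y2 # ys) * pair_sign xs ys * chain_sign Ls xs ys))))))))) \<bullet> (chain L1 x1 y1 * (chain L2 x2 y2 * chains Ls xs ys))"
        by (simp add: left_swp_def parity_right_def signed_chain_def mult_ac)
      also have "\<dots> = ?g x1 y1 x2 y2 xs ys"
        unfolding e by (simp add: mult_ac)
      finally show ?thesis .
    qed
  qed
  also have "\<dots> = (\<Sum>x1\<in>?I. \<Sum>y1\<in>?I. \<Sum>y2\<in>?I. \<Sum>x2\<in>?I. \<Sum>xs\<in>?J. \<Sum>ys\<in>?J. ?g x1 y1 x2 y2 xs ys)"
    by (intro sum.cong refl sum.swap)
  also have "\<dots> = (\<Sum>x1\<in>?I. \<Sum>y2\<in>?I. \<Sum>y1\<in>?I. \<Sum>x2\<in>?I. \<Sum>xs\<in>?J. \<Sum>ys\<in>?J. ?g x1 y1 x2 y2 xs ys)"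
    by (intro sum.cong refl sum.swap)
  also have "\<dots> = (\<Sum>x1\<in>?I. \<Sum>y2\<in>?I. \<Sum>xs\<in>?J. \<Sum>ys\<in>?J. \<Sum>y1\<in>?I. \<Sum>x2\<in>?I. ?g x1 y1 x2 y2 xs ys)"
    by (intro sum.cong refl sum_swap_pairs)
  also have "\<dots> = sgn_bit (snd b * (cpar L1 + \<theta>)) \<bullet> contract ((L1 @ b # L2) # Ls) T"
    by (simp only: contract_Cons signed_chain_def chain_append fv.scale_sum_right sum_distrib_right fv.scale_scale scl_mult_left mult.assoc)
  finally show ?thesis .
qed

lemma chains_Low:
  "\<forall>L\<in>set Ls. \<forall>b\<in>set L. ok_label b \<Longrightarrow> xs \<in> ilists K (length Ls) \<Longrightarrow> ys \<in> ilists K (length Ls)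
    \<Longrightarrow> chains Ls xs ys \<in> Low (Suc (tot Ls))"
proof (induction Ls arbitrary: xs ys)
  case (Cons L Ls)
  obtain x xs' y ys' where e: "xs = x # xs'" "ys = y # ys'" using Cons.prems by (cases xs; cases ys) (auto simp: ilists_def)
  have "signed_chain L x y \<in> Low (Suc (Suc (length L)))"
    unfolding signed_chain_def by (intro Filt.scl HW_Low[OF chain_HW]) (use Cons.prems e in auto)
  moreover have "chains Ls xs' ys' \<in> Low (Suc (tot Ls))" by (rule Cons.IH) (use Cons.prems e in auto)
  ultimately show ?case using Low_mult_right[of "signed_chain L x y" "Suc (length L)" _ "Suc (tot Ls)"] by (simp add: e)
qed (use Low_1[of 1] in simp)

text \<open>Conjugating the kernel by an adjacent transposition exchanges two chains, at the cost of their
  supercommutator. The sign depends only on the degrees of the labels.\<close>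

lemma chains_swp:
  "Suc k < length Ls \<Longrightarrow> \<forall>L\<in>set Ls. \<forall>b\<in>set L. ok_label b \<Longrightarrow>
    \<exists>s. \<forall>xs\<in>ilists K (length Ls). \<forall>ys\<in>ilists K (length Ls).
      (pair_sign (swp k xs) (swp k ys) * chain_sign Ls (swp k xs) (swp k ys) * (ssg k xs * ssg k ys)) \<bullet> chains Ls (swp k xs) (swp k ys)
      - s \<bullet> ((pair_sign xs ys * chain_sign (swp k Ls) xs ys) \<bullet> chains (swp k Ls) xs ys) \<in> Low (tot Ls)"
proof (induction k arbitrary: Ls)
  case 0
  then obtain L1 L2 Ls' where Ls: "Ls = L1 # L2 # Ls'" by (cases Ls; cases "tl Ls") auto
  show ?case
  proof (intro exI[of _ "sgn_bit (cpar L1 * cpar L2)"] ballI)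
    fix as bs assume as: "as \<in> ilists K (length Ls)" and bs: "bs \<in> ilists K (length Ls)"
    obtain x1 x2 xs where a: "as = x1 # x2 # xs" using as by (cases as; cases "tl as") (auto simp: ilists_def Ls)
    obtain y1 y2 ys where b: "bs = y1 # y2 # ys" using bs by (cases bs; cases "tl bs") (auto simp: ilists_def Ls)
    have m: "x1 \<in> idx K" "x2 \<in> idx K" "xs \<in> ilists K (length Ls')" "y1 \<in> idx K" "y2 \<in> idx K" "ys \<in> ilists K (length Ls')"
      using as bs by (auto simp: a b Ls)
    have o: "\<forall>b\<in>set L1. ok_label b" "\<forall>b\<in>set L2. ok_label b" "\<forall>L\<in>set Ls'. \<forall>b\<in>set L. ok_label b"
      using "0.prems" by (simp_all add: Ls)
    let ?t = "sgn_bit ((par x2 + par y2 + cpar L1) * (par x1 + par y1 + cpar L2))"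
    let ?u = "pair_sign (swp 0 as) (swp 0 bs) * chain_sign Ls (swp 0 as) (swp 0 bs) * (ssg 0 as * ssg 0 bs)
        * sgn_bit (cpar L1 * par y2) * sgn_bit (cpar L2 * par y1)"
    have g: "chain L1 x2 y2 * chain L2 x1 y1 - ?t \<bullet> (chain L2 x1 y1 * chain L1 x2 y2)
        \<in> Low (Suc (length L1) + Suc (length L2))"
      by (rule swap_HW[OF chain_HW[OF m(2,5) o(1)] chain_HW[OF m(1,4) o(2)]])
    have "(chain L1 x2 y2 * chain L2 x1 y1 - ?t \<bullet> (chain L2 x1 y1 * chain L1 x2 y2)) * chains Ls' xs ys \<in> Low (tot Ls)"
      using Low_mult_left[OF g chains_Low[OF o(3) m(3,6)]] by (simp add: Ls add.assoc)
    hence 1: "?u \<bullet> ((chain L1 x2 y2 * chain L2 x1 y1 - ?t \<bullet> (chain L2 x1 y1 * chain L1 x2 y2)) * chains Ls' xs ys) \<in> Low (tot Ls)"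
      by (rule Filt.scl)
    have s: "sgn_bit ((par x2 + par y2) * (par y2 + (par y1 + parl ys))) * sgn_bit ((par x1 + par y1) * (par y1 + parl ys))
        * sgn_bit (cpar L1 * (par x1 + parl xs + (par y1 + parl ys))) * sgn_bit (cpar L2 * (parl xs + parl ys))
        * sgn_bit (par x1 * par x2) * sgn_bit (par y1 * par y2) * sgn_bit (cpar L1 * par y2) * sgn_bit (cpar L2 * par y1) * ?t
      = sgn_bit (cpar L1 * cpar L2) * sgn_bit ((par x1 + par y1) * (par y1 + (par y2 + parl ys))) * sgn_bit ((par x2 + par y2) * (par y2 + parl ys))
        * sgn_bit (cpar L2 * (par x2 + parl xs + (par y2 + parl ys))) * sgn_bit (cpar L1 * (parl xs + parl ys))
        * sgn_bit (cpar L2 * par y1) * sgn_bit (cpar L1 * par y2)"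
      by (cases "par x1"; cases "par y1"; cases "par x2"; cases "par y2"; cases "parl xs"; cases "parl ys"; cases "cpar L1"; cases "cpar L2") simp_all
    have "?u * ?t = (sgn_bit ((par x2 + par y2) * (par y2 + (par y1 + parl ys))) * sgn_bit ((par x1 + par y1) * (par y1 + parl ys))
        * sgn_bit (cpar L1 * (par x1 + parl xs + (par y1 + parl ys))) * sgn_bit (cpar L2 * (parl xs + parl ys))
        * sgn_bit (par x1 * par x2) * sgn_bit (par y1 * par y2) * sgn_bit (cpar L1 * par y2) * sgn_bit (cpar L2 * par y1) * ?t)
        * (pair_sign xs ys * chain_sign Ls' xs ys)"
      by (simp add: a b Ls mult_ac)
    also have "\<dots> = sgn_bit (cpar L1 * cpar L2) * (pair_sign as bs * chain_sign (swp 0 Ls) as bs) * sgn_bit (cpar L2 * par y1) * sgn_bit (cpar L1 * par y2)"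
      unfolding s by (simp add: a b Ls mult_ac)
    finally have ut: "?u * ?t = sgn_bit (cpar L1 * cpar L2) * (pair_sign as bs * chain_sign (swp 0 Ls) as bs) * sgn_bit (cpar L2 * par y1) * sgn_bit (cpar L1 * par y2)" .
    have A: "(pair_sign (swp 0 as) (swp 0 bs) * chain_sign Ls (swp 0 as) (swp 0 bs) * (ssg 0 as * ssg 0 bs)) \<bullet> chains Ls (swp 0 as) (swp 0 bs)
        = ?u \<bullet> (chain L1 x2 y2 * chain L2 x1 y1 * chains Ls' xs ys)"
      by (simp add: a b Ls signed_chain_def mult_ac mult.assoc[of "chain L1 x2 y2"])
    have B: "sgn_bit (cpar L1 * cpar L2) \<bullet> ((pair_sign as bs * chain_sign (swp 0 Ls) as bs) \<bullet> chains (swp 0 Ls) as bs)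
        = (?u * ?t) \<bullet> (chain L2 x1 y1 * chain L1 x2 y2 * chains Ls' xs ys)"
      unfolding ut by (simp add: a b Ls signed_chain_def mult_ac mult.assoc[of "chain L2 x1 y1"])
    show "(pair_sign (swp 0 as) (swp 0 bs) * chain_sign Ls (swp 0 as) (swp 0 bs) * (ssg 0 as * ssg 0 bs)) \<bullet> chains Ls (swp 0 as) (swp 0 bs)
        - sgn_bit (cpar L1 * cpar L2) \<bullet> ((pair_sign as bs * chain_sign (swp 0 Ls) as bs) \<bullet> chains (swp 0 Ls) as bs) \<in> Low (tot Ls)"
      using 1 unfolding A B by (simp only: left_diff_distrib fv.scale_right_diff_distrib scl_mult_left fv.scale_scale)
  qed
next
  case (Suc k)
  then obtain L Ls' where Ls: "Ls = L # Ls'" by (cases Ls) auto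
  have o: "\<forall>b\<in>set L. ok_label b" "\<forall>L\<in>set Ls'. \<forall>b\<in>set L. ok_label b" using Suc.prems by (simp_all add: Ls)
  obtain s where s: "\<And>xs ys. xs \<in> ilists K (length Ls') \<Longrightarrow> ys \<in> ilists K (length Ls') \<Longrightarrow>
      (pair_sign (swp k xs) (swp k ys) * chain_sign Ls' (swp k xs) (swp k ys) * (ssg k xs * ssg k ys)) \<bullet> chains Ls' (swp k xs) (swp k ys)
      - s \<bullet> ((pair_sign xs ys * chain_sign (swp k Ls') xs ys) \<bullet> chains (swp k Ls') xs ys) \<in> Low (tot Ls')"
    using Suc.IH[of Ls'] Suc.prems o(2) unfolding Ls by force
  show ?case
  proof (intro exI[of _ s] ballI)
    fix as bs assume as: "as \<in> ilists K (length Ls)" and bs: "bs \<in> ilists K (length Ls)"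
    obtain x xs where a: "as = x # xs" using as by (cases as) (auto simp: ilists_def Ls)
    obtain y ys where b: "bs = y # ys" using bs by (cases bs) (auto simp: ilists_def Ls)
    have m: "x \<in> idx K" "xs \<in> ilists K (length Ls')" "y \<in> idx K" "ys \<in> ilists K (length Ls')"
      using as bs by (auto simp: a b Ls)
    let ?D = "(pair_sign (swp k xs) (swp k ys) * chain_sign Ls' (swp k xs) (swp k ys) * (ssg k xs * ssg k ys)) \<bullet> chains Ls' (swp k xs) (swp k ys)
      - s \<bullet> ((pair_sign xs ys * chain_sign (swp k Ls') xs ys) \<bullet> chains (swp k Ls') xs ys)"
    let ?u = "sgn_bit ((par x + par y) * (par y + parl ys)) * sgn_bit (cpar L * (parl xs + parl ys))"
    have "signed_chain L x y \<in> Low (Suc (Suc (length L)))"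
      unfolding signed_chain_def by (intro Filt.scl HW_Low[OF chain_HW[OF m(1,3) o(1)]])
    from Low_mult_right[OF this s[OF m(2,4)]] have "signed_chain L x y * ?D \<in> Low (tot Ls)" by (simp add: Ls)
    hence "?u \<bullet> (signed_chain L x y * ?D) \<in> Low (tot Ls)" by (rule Filt.scl)
    moreover have "?u \<bullet> (signed_chain L x y * ?D) = (pair_sign (swp (Suc k) as) (swp (Suc k) bs) * chain_sign Ls (swp (Suc k) as) (swp (Suc k) bs) * (ssg (Suc k) as * ssg (Suc k) bs)) \<bullet> chains Ls (swp (Suc k) as) (swp (Suc k) bs)
      - s \<bullet> ((pair_sign as bs * chain_sign (swp (Suc k) Ls) as bs) \<bullet> chains (swp (Suc k) Ls) as bs)"
      by (simp add: a b Ls right_diff_distrib fv.scale_right_diff_distrib mult_ac)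
    ultimately show "(pair_sign (swp (Suc k) as) (swp (Suc k) bs) * chain_sign Ls (swp (Suc k) as) (swp (Suc k) bs) * (ssg (Suc k) as * ssg (Suc k) bs)) \<bullet> chains Ls (swp (Suc k) as) (swp (Suc k) bs)
      - s \<bullet> ((pair_sign as bs * chain_sign (swp (Suc k) Ls) as bs) \<bullet> chains (swp (Suc k) Ls) as bs) \<in> Low (tot Ls)" by (simp only:)
  qed
qed

lemma sum_swp_swp:
  "(\<Sum>xs\<in>ilists K d. \<Sum>ys\<in>ilists K d. f (swp k xs) (swp k ys)) = (\<Sum>xs\<in>ilists K d. \<Sum>ys\<in>ilists K d. f xs ys)"
proof -
  have "(\<Sum>ys\<in>ilists K d. f a (swp k ys)) = (\<Sum>ys\<in>ilists K d. f a ys)" for a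
    by (rule sum_swp)
  thus ?thesis by (simp only: sum_swp[where f = "\<lambda>xs. \<Sum>ys\<in>ilists K d. f xs ys"])
qed

lemma contract_conj:
  assumes "Suc k < length Ls" "\<forall>L\<in>set Ls. \<forall>b\<in>set L. ok_label b"
  shows "\<exists>s. contract Ls (conj_swp k T) - s \<bullet> contract (swp k Ls) T \<in> Low (tot Ls)"
proof -
  let ?J = "ilists K (length Ls)"
  let ?f = "\<lambda>xs ys. (pair_sign (swp k xs) (swp k ys) * chain_sign Ls (swp k xs) (swp k ys) * (ssg k xs * ssg k ys)) \<bullet> chains Ls (swp k xs) (swp k ys)"
  let ?g = "\<lambda>xs ys. (pair_sign xs ys * chain_sign (swp k Ls) xs ys) \<bullet> chains (swp k Ls) xs ys"
  obtain s where s: "\<And>xs ys. xs \<in> ?J \<Longrightarrow> ys \<in> ?J \<Longrightarrow> ?f xs ys - s \<bullet> ?g xs ys \<in> Low (tot Ls)"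
    using chains_swp[OF assms] by blast
  have "contract Ls (conj_swp k T) = (\<Sum>xs\<in>?J. \<Sum>ys\<in>?J. (pair_sign (swp k xs) (swp k ys) * chain_sign Ls (swp k xs) (swp k ys) * conj_swp k T (swp k xs) (swp k ys)) \<bullet> chains Ls (swp k xs) (swp k ys))"
    unfolding contract_def by (rule sum_swp_swp[symmetric])
  also have "\<dots> = (\<Sum>xs\<in>?J. \<Sum>ys\<in>?J. T xs ys \<bullet> ?f xs ys)"
    by (intro sum.cong refl) (simp add: conj_swp_def mult_ac)
  finally have 1: "contract Ls (conj_swp k T) = (\<Sum>xs\<in>?J. \<Sum>ys\<in>?J. T xs ys \<bullet> ?f xs ys)" .
  have "s \<bullet> contract (swp k Ls) T = (\<Sum>xs\<in>?J. \<Sum>ys\<in>?J. T xs ys \<bullet> (s \<bullet> ?g xs ys))"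
    unfolding contract_def fv.scale_sum_right by (intro sum.cong refl) (simp_all add: mult_ac)
  hence "contract Ls (conj_swp k T) - s \<bullet> contract (swp k Ls) T = (\<Sum>xs\<in>?J. \<Sum>ys\<in>?J. T xs ys \<bullet> (?f xs ys - s \<bullet> ?g xs ys))"
    unfolding 1 by (simp only: fv.scale_right_diff_distrib sum_subtractf)
  also have "\<dots> \<in> Low (tot Ls)" by (intro Filt_sum Filt.scl s)
  finally show ?thesis ..
qed

definition labels :: "lab set" where "labels = loop_labels \<union> set cent_basis"

lemma ok_label_labels: "b \<in> labels \<Longrightarrow> ok_label b"
  unfolding labels_def using ok_label_loop_labels ok_label_cent_basis by blast

text \<open>Each step of \<open>contractible\<close> is undone by the corresponding lemma; at the end only loops remain.\<close>

lemma contract_GenLow: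
  "contractible d \<theta> T \<Longrightarrow> length Ls = d \<Longrightarrow> \<forall>L\<in>set Ls. set L \<subseteq> labels \<Longrightarrow> contract Ls T \<in> GenLow (tot Ls)"
proof (induction arbitrary: Ls rule: contractible.induct)
  case nil
  have "contract Ls (one 0) = 1" using nil by (simp add: contract_def one_def)
  moreover have "1 \<in> GenLow 0" by (intro GenLow_I Gen.one Low_1) simp
  ultimately show ?case using nil by simp
next
  case (loop d \<theta> T b)
  obtain L Ls' where Ls: "Ls = L # Ls'" using loop.prems by (cases Ls) auto
  have l: "set L \<subseteq> labels" "b \<in> labels" "\<forall>L\<in>set Ls'. set L \<subseteq> labels"
    using loop.prems loop.hyps by (simp_all add: Ls labels_def)
  have e: "contract Ls (tens (fst b) (parity_right (snd b) T)) = sgn_bit (cpar L * \<theta>) \<bullet> (loop_elt L b * contract Ls' T)"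
    unfolding Ls by (rule contract_loop[OF contractible_homog[OF loop.hyps(1)] ok_label_labels[OF l(2)]])
  have "loop_elt L b * contract Ls' T \<in> GenLow (Suc (length L) + tot Ls')"
    by (intro GenLow_mult loop_elt_GenLow loop.IH) (use l loop.prems in \<open>simp_all add: labels_def Ls\<close>)
  thus ?case unfolding e by (intro GenLow_scl) (simp add: Ls)
next
  case (merge d \<theta> T b)
  obtain L1 L2 Ls' where Ls: "Ls = L1 # L2 # Ls'" using merge.prems by (cases Ls; cases "tl Ls") auto
  have l: "set L1 \<subseteq> labels" "set L2 \<subseteq> labels" "b \<in> labels" "\<forall>L\<in>set Ls'. set L \<subseteq> labels"
    using merge.prems merge.hyps by (simp_all add: Ls labels_def)
  have e: "contract Ls (left_swp 0 (tens (fst b) (parity_right (snd b) T))) = sgn_bit (snd b * (cpar L1 + \<theta>)) \<bullet> contract ((L1 @ b # L2) # Ls') T"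
    unfolding Ls by (rule contract_merge[OF contractible_homog[OF merge.hyps(1)] ok_label_labels[OF l(3)]])
  have "contract ((L1 @ b # L2) # Ls') T \<in> GenLow (tot ((L1 @ b # L2) # Ls'))"
    by (rule merge.IH) (use l merge.prems in \<open>simp_all add: Ls\<close>)
  thus ?case unfolding e by (intro GenLow_scl) (simp add: Ls add_ac)
next
  case (conj d \<theta> T k)
  have "\<forall>L\<in>set Ls. \<forall>b\<in>set L. ok_label b" using conj.prems ok_label_labels by blast
  then obtain s where s: "contract Ls (conj_swp k T) - s \<bullet> contract (swp k Ls) T \<in> Low (tot Ls)"
    using contract_conj[of k Ls T] conj.prems conj.hyps by auto
  have "contract (swp k Ls) T \<in> GenLow (tot (swp k Ls))"
    by (rule conj.IH) (use conj.prems in simp_all)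
  thus ?case using GenLow_mod[OF s] by simp
qed

text \<open>For \<open>m = 0\<close> there is no transposition and the step closes a loop, for \<open>m = 1\<close> it is the merging
  step; larger \<open>m\<close> are reached by conjugation, which
  acts on the remaining factors of the kernel and preserves contractibility.\<close>

lemma contractible_left_transp:
  assumes "b \<in> set cent_basis"
  shows "contractible d \<theta> T \<Longrightarrow> m \<le> d \<Longrightarrow> contractible (Suc d) (\<theta> + snd b) (left_transp m (tens (fst b) (parity_right (snd b) T)))"
proof (induction m arbitrary: T)
  case 0
  thus ?case using contractible.loop[OF _ assms] by simp
next
  case (Suc m)
  show ?case
  proof (cases m)
    case 0
    then obtain e where "d = Suc e" using Suc.prems by (cases d) auto
    thus ?thesis using contractible.merge[of e \<theta> T b] Suc.prems assms 0 by simp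
  next
    case (Suc l)
    have r: "conj_swp l (parity_right (snd b) T) = parity_right (snd b) (conj_swp l T)" if "True" for l
      by (intro ext) (simp add: conj_swp_def parity_right_def mult_ac)
    have "contractible d \<theta> (conj_swp l T)" using Suc.prems Suc by (intro contractible.conj) auto
    hence "contractible (Suc d) (\<theta> + snd b) (left_transp m (tens (fst b) (parity_right (snd b) (conj_swp l T))))"
      by (rule Suc.IH) (use Suc.prems in simp)
    hence "contractible (Suc d) (\<theta> + snd b) (conj_swp (Suc l) (left_transp m (tens (fst b) (parity_right (snd b) (conj_swp l T)))))"
      using Suc.prems Suc by (intro contractible.conj) auto
    thus ?thesis by (simp add: Suc conj_swp_tens r)
  qed
qed

lemma family_contractible: "u \<in> set (family d) \<Longrightarrow> \<exists>\<theta>. contractible d \<theta> u"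
proof (induction d arbitrary: u)
  case 0
  thus ?case using contractible.nil by auto
next
  case (Suc d)
  then obtain m b v where u: "u = left_transp m (tens (fst b) (parity_right (snd b) v))" "b \<in> set cent_basis" "v \<in> set (family d)" "m < Suc d"
    by (auto simp del: upt_Suc)
  thus ?case using Suc.IH[OF u(3)] contractible_left_transp[OF u(2)] by (metis less_Suc_eq_le)
qed

lemma pair_sign_square: "pair_sign xs ys * pair_sign xs ys = 1"
  by (induction xs ys rule: pair_sign.induct) (simp_all add: mult_ac)

lemma chains_replicate: "length xs = n \<Longrightarrow> length ys = n \<Longrightarrow> chains (replicate n []) xs ys = Fw (zip xs ys) \<and> chain_sign (replicate n []) xs ys = 1"
proof (induction n arbitrary: xs ys)
  case (Suc n)
  thus ?case by (cases xs; cases ys) (auto simp: signed_chain_def)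
qed simp

text \<open>An invariant function is a combination of the family on words of length \<open>n\<close>, and the signs
  \<open>pair_sign\<close> of the two conversions cancel.\<close>

lemma expand_GenLow:
  assumes "\<And>a b w. a \<in> idM \<Longrightarrow> b \<in> idM \<Longrightarrow> act (F_mat a b) \<phi> w = ract (par a + par b) (F_mat a b) \<phi> w"
  shows "expand n \<phi> \<in> GenLow n"
proof -
  let ?R = "replicate n ([] :: lab list)"
  have R: "tot ?R = n" by (induction n) auto
  obtain f where f: "f \<in> lspan (map (\<lambda>u (a, b). u a b) (family n))"
    "\<And>xs ys. xs \<in> ilists K n \<Longrightarrow> ys \<in> ilists K n \<Longrightarrow> tmat \<phi> xs ys = f (xs, ys)"
    using first_fundamental_theorem[OF assms, of n] by blast
  have "expand n \<phi> = contract ?R (\<lambda>xs ys. f (xs, ys))"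
    unfolding expand_def contract_def length_replicate
  proof (intro sum.cong refl)
    fix xs ys assume *: "xs \<in> ilists K n" "ys \<in> ilists K n"
    have "pair_sign xs ys * f (xs, ys) = \<phi> (zip xs ys)"
      using pair_sign_square[of xs ys] by (simp add: f(2)[OF *, symmetric] tmat_def flip: mult.assoc)
    thus "\<phi> (zip xs ys) \<bullet> Fw (zip xs ys) = (pair_sign xs ys * chain_sign ?R xs ys * f (xs, ys)) \<bullet> chains ?R xs ys"
      using chains_replicate[of xs n ys] * by (simp add: ilists_def)
  qed
  also have "\<dots> \<in> GenLow n"
    using f(1)
  proof (induction rule: lspan.induct)
    case zero
    show ?case by (simp add: contract_def GenLow_Low Filt_0)
  next
    case (step u f c)
    then obtain v where v: "v \<in> set (family n)" "u = (\<lambda>(a, b). v a b)" by auto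
    obtain \<theta> where "contractible n \<theta> v" using family_contractible[OF v(1)] by blast
    hence "contract ?R v \<in> GenLow (tot ?R)" by (rule contract_GenLow) auto
    moreover have "contract ?R (\<lambda>xs ys. c * u (xs, ys) + f (xs, ys)) = c \<bullet> contract ?R v + contract ?R (\<lambda>xs ys. f (xs, ys))"
      unfolding contract_def fv.scale_sum_right sum.distrib[symmetric] v(2)
      by (intro sum.cong refl) (simp add: distrib_left[where 'a = complex] fv.scale_left_distrib mult_ac)
    ultimately show ?case using step.IH by (simp add: R GenLow_add GenLow_scl)
  qed
  finally show ?thesis .
qed

lemma Low_0: "f \<in> Low 0 \<Longrightarrow> f \<in> nl"
  by (induction rule: Filt.induct) (auto intro: env_null.intros env_null_scl)

text \<open>By \<open>expand_symbol\<close> the element \<open>2\<^sup>n n! f\<close> and the expansion of its symbol have the same leading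
  term, and the latter is that of some generated \<open>g\<close>.\<close>

lemma cent_Low_Gen: "f \<in> Low n \<Longrightarrow> f \<in> cent idM \<Longrightarrow> f \<in> Gen N"
proof (induction n arbitrary: f)
  case 0
  thus ?case using Low_0 Gen.null by blast
next
  case (Suc n)
  let ?c = "2 ^ n * fact n :: complex"
  have "expand n (symbol f) \<in> GenLow n"
    by (rule expand_GenLow) (use symbol_cent[OF Suc.prems(2) idM(3)] in simp)
  then obtain g where g: "g \<in> Gen N" "expand n (symbol f) - g \<in> Low n" unfolding GenLow_def by blast
  have "(expand n (symbol f) - g) - (expand n (symbol f) - ?c \<bullet> f) \<in> Low n"
    by (rule Filt_diff[OF g(2) expand_symbol[OF Suc.prems(1)]])
  hence "?c \<bullet> f + (- 1) \<bullet> g \<in> Low n" by simp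
  moreover have "?c \<bullet> f + (- 1) \<bullet> g \<in> cent idM"
    using Suc.prems(2) Gen_cent[OF g(1) NK] unfolding idM_def by (intro cent_add cent_scl)
  ultimately have "?c \<bullet> f + (- 1) \<bullet> g \<in> Gen N" by (rule Suc.IH)
  from Gen.scl[OF Gen.add[OF this g(1)], of "inverse ?c"]
  have "(inverse ?c * ?c) \<bullet> f \<in> Gen N" by simp
  moreover have "inverse ?c * ?c = 1" by (rule left_inverse) simp
  ultimately show ?case by simp
qed

lemma cent_eq_Gen: "cent idM = Gen N"
  using Low_exhaustive cent_Low_Gen Gen_cent[OF _ NK] unfolding idM_def by blast

end

theorem theorem1p2:
  fixes N M :: nat
  assumes "M \<ge> 1"
  shows "generated_subalgebra (Uq (N + M))
           ({C_elt (N + M) n | n. odd n}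
            \<union> {F_pow (N + M) n i j | n i j. n \<ge> 1 \<and> i \<in> idx N \<and> j \<in> idx N})
         = A_cent N M"
proof -
  interpret queer_pair "N + M" N by unfold_locales simp
  show ?thesis
    using generated_eq[of N] A_cent_eq[of N M] cent_eq_Gen by (simp add: idM_def)
qed

end
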